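(* Let $A\subseteq B\subseteq\{0,1\}$, fix one of the (saturated, $n$-trivial) comical model structures on $\mathsf{cSet}_A^+$, and let $W\xrightarrow{j}X\xrightarrow{f}Y\xrightarrow{g}Z$ be maps in $\mathsf{cSet}_A^+$, with $j$ a monomorphism and $g$ a fibration. Suppose that the map $fj$ and the object $Z$ admit weak connection structures $\Gamma_{fj}:i^*i_!W\to Y$ and $\Gamma_Z:i^*i_!Z\to Z$ (with respect to $\Box_B$) such that $$g\circ\Gamma_{fj}=\Gamma_Z\circ i^*i_!(gfj).$$ Then $f$ admits a weak connection structure $\Gamma_f:i^*i_!X\to Y$ such that $\Gamma_f\circ i^*i_!j=\Gamma_{fj}$ and $$g\circ\Gamma_f=\Gamma_Z\circ i^*i_!(gf).$$
   Context: **Cubical sets.** For $A\subseteq\{0,1\}$, $\Box_A$ is the subcategory of the category of posets with objects $[1]^n$ ($n\ge 0$, $[1]=\{0<1\}$) and morphisms generated under composition by: faces $\partial_{i,\varepsilon}:[1]^{n-1}\to[1]^n$ ($1\le i\le n$, $\varepsilon\in\{0,1\}$; insert $\varepsilon$ as $i$-th coordinate); degeneracies $\sigma_i:[1]^n\to[1]^{n-1}$ ($1\le i\le n$; delete the $i$-th coordinate); and, for each $\varepsilon\in A$, connections $\gamma_{i,\varepsilon}:[1]^n\to[1]^{n-1}$ ($1\le i\le n-1$; replace $x_i,x_{i+1}$ by $\max\{x_i,x_{i+1}\}$ if $\varepsilon=0$, by $\min\{x_i,x_{i+1}\}$ if $\varepsilon=1$). $\mathsf{cSet}_A$ is the category of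 presheaves of sets on $\Box_A$, $\Box^n_A$ the representable at $[1]^n$; elements of $X_n=X([1]^n)$ are $n$-cubes and structure maps act on the right. A cube is degenerate if it is in the image of a degeneracy or a connection of $\Box_A$. **Marked cubical sets.** An object of $\mathsf{cSet}_A^+$ is a pair $(X,eX)$ with $X\in\mathsf{cSet}_A$ and $eX\subseteq\bigcup_{n\ge1}X_n$ a set of "marked" cubes containing all degenerate cubes; morphisms are cubical maps preserving marked cubes. $\Box^n_A$ also denotes the marked cubical set with only degenerate cubes marked; $\widetilde\Box^n_A$ ($n\ge1$) has in addition $\mathrm{id}_{[1]^n}$ marked. A map is regular if a cube is marked iff its image is marked, and entire if its underlying cubical map is an isomorphism; a regular subcomplex inclusion is a regular monomorphism. $\tau_nX$ is obtained from $X$ by marking all cubes of dimension $>n$. The geometric product $\otimes$ on $\mathsf{cSet}_A$ preserves colimits in each variable and extends $\Box^m_A\otimes\Box^n_A=\Box^{m+n}_A$; its $n$-cubes are formal products $x\otimes y$, $x\in X_k$, $y\in Y_\ell$, $k+\ell=n$, modulo $(x\sigma_{k+1})\otimes y=x\otimes(y\sigma_1)$. The lax Gray tensor product on $\mathsf{cSet}_A^+$ has this underlying cubical set, with $x\otimes y$ marked if $x$ or $y$ is marked. **Comical generators.** Every monomorphism $\delta:[1]^m\to[1]^n$ of $\Box_A$ is uniquely a composite $\partial_{c_1,\varepsilon_1}\cdots\partial_{c_r,\varepsilon_r}$ with $c_1>\dots>c_r$. It is a critical face with respect to $\partial_{i,\varepsilon}$ if this composite contains none of: (1) $\partial_{i,\varepsilon}$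 or $\partial_{i,1-\varepsilon}$; (2) for some $j>i$, $\partial_{j,\varepsilon}$ together with $\partial_{k,1-\varepsilon}$ for all $i<k<j$; (3) for some $j<i$, $\partial_{j,\varepsilon}$ together with $\partial_{k,1-\varepsilon}$ for all $j<k<i$. The comical cube $\Box^n_{A,i,\varepsilon}$ ($n\ge1$) is $\Box^n_A$ with all critical faces with respect to $\partial_{i,\varepsilon}$ marked; the comical open box $\sqcap^n_{A,i,\varepsilon}$ is its regular subcomplex whose non-degenerate cubes are all faces except $\mathrm{id}_{[1]^n}$ and $\partial_{i,\varepsilon}$; the inclusion is a comical open box inclusion. For $n\ge2$, $(\Box^n_{A,i,\varepsilon})'$ is obtained from $\Box^n_{A,i,\varepsilon}$ by marking all $(n-1)$-dimensional faces except $\partial_{i,\varepsilon}$; the entire map $(\Box^n_{A,i,\varepsilon})'\to\tau_{n-2}\Box^n_{A,i,\varepsilon}$ is a comical marking extension. $L_A$ is generated by two marked $2$-cubes $s,t$ with $s\partial_{1,1}=t\partial_{1,0}$ and with the edges $s\partial_{1,0},s\partial_{2,1},t\partial_{2,0},t\partial_{1,1}$ marked (no other non-degenerate cubes marked). Rezk maps are the maps $(\partial\Box^m_A\hookrightarrow\Box^m_A)\,\hat\otimes\,(L_A\to\tau_0L_A)\,\hat\otimes\,(\partial\Box^n_A\hookrightarrow\Box^n_A)$, $m,n\ge0$ ($\hat\otimes$ the pushout product for the lax Gray tensor product). The $n$-marker is the entire map $\Box^n_A\to\widetilde\Box^n_A$. A comical set is a marked cubical set with the right lifting property against comical open box inclusions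 and comical marking extensions; it is saturated if it also has it against all Rezk maps, and $n$-trivial if all its cubes of dimension $>n$ are marked. **Comical model structures** (known to exist on each $\mathsf{cSet}_A^+$). Cofibrations are the monomorphisms, and the fibrant objects are, respectively: comical sets; saturated comical sets; $n$-trivial comical sets; $n$-trivial saturated comical sets ($n\ge0$). (A model structure is determined by its cofibrations and fibrant objects.) **Weak connection structures.** For $A\subseteq B$, the inclusion $i:\Box_A\hookrightarrow\Box_B$ induces $i^*:\mathsf{cSet}_B^+\to\mathsf{cSet}_A^+$, which restricts structure maps, keeping the same cubes and the same marked cubes; $i_!$ is its left adjoint and $\eta:\mathrm{id}\Rightarrow i^*i_!$ the unit. A weak connection structure on a map $f:X\to Y$ in $\mathsf{cSet}_A^+$ (with respect to $\Box_B$) is a map $\Gamma_f:i^*i_!X\to Y$ with $\Gamma_f\circ\eta_X=f$; a weak connection structure on an object $Z$ is one on $\mathrm{id}_Z$. *)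

theory Defs
  imports Main "HOL-Library.FuncSet"
begin

section \<open>The categories of cubes\<close>

text \<open>
  The poset $[1]^n$ is the set of Boolean lists of length $n$; the elements $0 < 1$ of $[1]$ are
  False and True.  A morphism $[1]^m \to [1]^n$ is an extensional function on lists of
  length $m$, so that equality of morphisms is equality in HOL.  Coordinates are numbered from 1.
\<close>

type_synonym bmap = "bool list \<Rightarrow> bool list"

definition cube :: "nat \<Rightarrow> bool list set" where
  "cube n = {x. length x = n}"

definition bid :: "nat \<Rightarrow> bmap" where
  "bid n = (\<lambda>x\<in>cube n. x)"

text \<open>The face \<open>face n i e\<close> goes from $[1]^{n-1}$ to $[1]^n$; \<open>degen n i\<close> and \<open>conn n i e\<close> go
  from $[1]^n$ to $[1]^{n-1}$.\<close>

definition face :: "nat \<Rightarrow> nat \<Rightarrow> bool \<Rightarrow> bmap" where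
  "face n i e = (\<lambda>x\<in>cube (n - 1). take (i - 1) x @ e # drop (i - 1) x)"

definition degen :: "nat \<Rightarrow> nat \<Rightarrow> bmap" where
  "degen n i = (\<lambda>x\<in>cube n. take (i - 1) x @ drop i x)"

definition conn :: "nat \<Rightarrow> nat \<Rightarrow> bool \<Rightarrow> bmap" where
  "conn n i e = (\<lambda>x\<in>cube n. take (i - 1) x @
     (if e then min (x ! (i - 1)) (x ! i) else max (x ! (i - 1)) (x ! i)) # drop (i + 1) x)"

inductive is_box :: "bool set \<Rightarrow> nat \<Rightarrow> nat \<Rightarrow> bmap \<Rightarrow> bool" for A where
  box_id: "is_box A n n (bid n)"
| box_face: "1 \<le> i \<Longrightarrow> i \<le> n \<Longrightarrow> is_box A (n - 1) n (face n i e)"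
| box_degen: "1 \<le> i \<Longrightarrow> i \<le> n \<Longrightarrow> is_box A n (n - 1) (degen n i)"
| box_conn: "e \<in> A \<Longrightarrow> 1 \<le> i \<Longrightarrow> i < n \<Longrightarrow> is_box A n (n - 1) (conn n i e)"
| box_comp: "is_box A m n \<phi> \<Longrightarrow> is_box A k m \<psi> \<Longrightarrow> is_box A k n (compose (cube k) \<phi> \<psi>)"

definition Box :: "bool set \<Rightarrow> nat \<Rightarrow> nat \<Rightarrow> bmap set" where
  "Box A m n = {\<phi>. is_box A m n \<phi>}"


section \<open>Marked cubical sets\<close>

text \<open>The set of $n$-cubes is \<open>cells X n\<close>, the right action of $\varphi \colon [1]^m \to [1]^n$ on
  $x \in X_n$ is \<open>act X m n \<phi> x\<close>, and \<open>marked X n\<close> is the set of marked $n$-cubes.  The values of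
  \<open>act X\<close> outside the intended arguments are irrelevant.\<close>

record 'a mcset =
  cells :: "nat \<Rightarrow> 'a set"
  act :: "nat \<Rightarrow> nat \<Rightarrow> bmap \<Rightarrow> 'a \<Rightarrow> 'a"
  marked :: "nat \<Rightarrow> 'a set"

definition degenerate :: "bool set \<Rightarrow> 'a mcset \<Rightarrow> nat \<Rightarrow> 'a set" where
  "degenerate A X n =
     {act X n (n - 1) (degen n i) y | i y. 1 \<le> i \<and> i \<le> n \<and> y \<in> cells X (n - 1)} \<union>
     {act X n (n - 1) (conn n i e) y | i e y. e \<in> A \<and> 1 \<le> i \<and> i < n \<and> y \<in> cells X (n - 1)}"

locale marked_cubical_set =
  fixes A :: "bool set" and X :: "'a mcset"
  assumes act_closed: "\<phi> \<in> Box A m n \<Longrightarrow> x \<in> cells X n \<Longrightarrow> act X m n \<phi> x \<in> cells X m"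
    and act_id: "x \<in> cells X n \<Longrightarrow> act X n n (bid n) x = x"
    and act_comp: "\<phi> \<in> Box A m n \<Longrightarrow> \<psi> \<in> Box A k m \<Longrightarrow> x \<in> cells X n \<Longrightarrow>
      act X k n (compose (cube k) \<phi> \<psi>) x = act X k m \<psi> (act X m n \<phi> x)"
    and marked_cells: "marked X n \<subseteq> cells X n"
    and marked_0: "marked X 0 = {}"
    and marked_degenerate: "degenerate A X n \<subseteq> marked X n"

type_synonym ('a, 'b) mmap = "nat \<Rightarrow> 'a \<Rightarrow> 'b"

text \<open>Maps are extensional as well, so that equality of maps is equality in HOL.\<close>

definition hom :: "bool set \<Rightarrow> 'a mcset \<Rightarrow> 'b mcset \<Rightarrow> ('a, 'b) mmap set" where
  "hom A X Y = {f. (\<forall>n. f n \<in> cells X n \<rightarrow>\<^sub>E cells Y n) \<and>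
     (\<forall>m n \<phi> x. \<phi> \<in> Box A m n \<longrightarrow> x \<in> cells X n \<longrightarrow>
        f m (act X m n \<phi> x) = act Y m n \<phi> (f n x)) \<and>
     (\<forall>n. f n ` marked X n \<subseteq> marked Y n)}"

definition mid :: "'a mcset \<Rightarrow> ('a, 'a) mmap" where
  "mid X n = (\<lambda>x\<in>cells X n. x)"

text \<open>\<open>mcomp X g f\<close> is the composite $g \circ f$ of maps with $X$ the source of $f$.\<close>

definition mcomp :: "'a mcset \<Rightarrow> ('b, 'c) mmap \<Rightarrow> ('a, 'b) mmap \<Rightarrow> ('a, 'c) mmap" where
  "mcomp X g f n = compose (cells X n) (g n) (f n)"

text \<open>The map $p \colon P \to Q$ has the right lifting property against $u \colon U \to V$.\<close>

definition rlp :: "bool set \<Rightarrow> 'a mcset \<Rightarrow> 'b mcset \<Rightarrow> ('a, 'b) mmap \<Rightarrow>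
    'c mcset \<Rightarrow> 'd mcset \<Rightarrow> ('c, 'd) mmap \<Rightarrow> bool" where
  "rlp A U V u P Q p \<longleftrightarrow> (\<forall>a\<in>hom A U P. \<forall>b\<in>hom A V Q. mcomp U p a = mcomp U b u \<longrightarrow>
     (\<exists>h\<in>hom A V P. mcomp U h u = a \<and> mcomp V p h = b))"

definition point :: "unit mcset" where
  "point = \<lparr>cells = (\<lambda>n. UNIV), act = (\<lambda>m n \<phi> x. ()), marked = (\<lambda>n. if n = 0 then {} else UNIV)\<rparr>"

definition rlp_obj :: "bool set \<Rightarrow> 'a mcset \<Rightarrow> 'b mcset \<Rightarrow> ('a, 'b) mmap \<Rightarrow> 'c mcset \<Rightarrow> bool" where
  "rlp_obj A U V u X \<longleftrightarrow> rlp A U V u X point (\<lambda>n. \<lambda>x\<in>cells X n. ())"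

definition mark :: "'a mcset \<Rightarrow> (nat \<Rightarrow> 'a set) \<Rightarrow> 'a mcset" where
  "mark X S = X\<lparr>marked := (\<lambda>n. marked X n \<union> S n)\<rparr>"

definition tau :: "nat \<Rightarrow> 'a mcset \<Rightarrow> 'a mcset" where
  "tau n X = mark X (\<lambda>k. if k > n then cells X k else {})"

text \<open>The regular subcomplex generated by a family of cubes; its inclusion into $X$ is the
  identity map of the subcomplex.\<close>

definition subcomplex :: "bool set \<Rightarrow> 'a mcset \<Rightarrow> (nat \<Rightarrow> 'a set) \<Rightarrow> 'a mcset" where
  "subcomplex A X S =
    (let C = (\<lambda>k. {act X k m \<phi> s | m \<phi> s. s \<in> S m \<and> \<phi> \<in> Box A k m})
     in \<lparr>cells = C, act = act X, marked = (\<lambda>k. marked X k \<inter> C k)\<rparr>)"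


section \<open>Representables and comical generators\<close>

definition boxset :: "bool set \<Rightarrow> nat \<Rightarrow> bmap mcset" where
  "boxset A n =
    (let X = \<lparr>cells = (\<lambda>k. Box A k n), act = (\<lambda>l k \<psi> \<phi>. compose (cube l) \<phi> \<psi>), marked = (\<lambda>k. {})\<rparr>
     in mark X (degenerate A X))"

definition boxset_map :: "bool set \<Rightarrow> nat \<Rightarrow> bmap \<Rightarrow> (bmap, bmap) mmap" where
  "boxset_map A m \<phi> k = (\<lambda>\<psi>\<in>Box A k m. compose (cube k) \<phi> \<psi>)"

text \<open>A list $[(c_1,\varepsilon_1), \dots, (c_r,\varepsilon_r)]$ with $c_1 > \dots > c_r$ stands for the
  face $\partial_{c_1,\varepsilon_1} \cdots \partial_{c_r,\varepsilon_r} \colon [1]^{n-r} \to [1]^n$.\<close>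

definition face_word :: "nat \<Rightarrow> (nat \<times> bool) list \<Rightarrow> bool" where
  "face_word n cs \<longleftrightarrow> sorted_wrt (>) (map fst cs) \<and> (\<forall>(c, e)\<in>set cs. 1 \<le> c \<and> c \<le> n)"

fun word_face :: "nat \<Rightarrow> (nat \<times> bool) list \<Rightarrow> bmap" where
  "word_face n [] = bid n"
| "word_face n ((c, e) # cs) =
     compose (cube (n - Suc (length cs))) (face n c e) (word_face (n - 1) cs)"

definition critical :: "nat \<Rightarrow> bool \<Rightarrow> (nat \<times> bool) list \<Rightarrow> bool" where
  "critical i e cs \<longleftrightarrow>
     (i, e) \<notin> set cs \<and> (i, \<not> e) \<notin> set cs \<and>
     \<not> (\<exists>j>i. (j, e) \<in> set cs \<and> (\<forall>k. i < k \<and> k < j \<longrightarrow> (k, \<not> e) \<in> set cs)) \<and>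
     \<not> (\<exists>j<i. (j, e) \<in> set cs \<and> (\<forall>k. j < k \<and> k < i \<longrightarrow> (k, \<not> e) \<in> set cs))"

definition faces_where :: "nat \<Rightarrow> ((nat \<times> bool) list \<Rightarrow> bool) \<Rightarrow> nat \<Rightarrow> bmap set" where
  "faces_where n P m = {word_face n cs | cs. face_word n cs \<and> m + length cs = n \<and> P cs}"

definition boundary :: "bool set \<Rightarrow> nat \<Rightarrow> bmap mcset" where
  "boundary A n = subcomplex A (boxset A n) (faces_where n (\<lambda>cs. cs \<noteq> []))"

definition comical_cube :: "bool set \<Rightarrow> nat \<Rightarrow> nat \<Rightarrow> bool \<Rightarrow> bmap mcset" where
  "comical_cube A n i e = mark (boxset A n) (faces_where n (critical i e))"

definition open_box :: "bool set \<Rightarrow> nat \<Rightarrow> nat \<Rightarrow> bool \<Rightarrow> bmap mcset" where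
  "open_box A n i e =
     subcomplex A (comical_cube A n i e) (faces_where n (\<lambda>cs. cs \<noteq> [] \<and> cs \<noteq> [(i, e)]))"

definition comical_cube' :: "bool set \<Rightarrow> nat \<Rightarrow> nat \<Rightarrow> bool \<Rightarrow> bmap mcset" where
  "comical_cube' A n i e = mark (comical_cube A n i e)
     (faces_where n (\<lambda>cs. length cs = 1 \<and> cs \<noteq> [(i, e)]))"

definition comical :: "bool set \<Rightarrow> 'a mcset \<Rightarrow> bool" where
  "comical A X \<longleftrightarrow>
     (\<forall>n i e. 1 \<le> i \<and> i \<le> n \<longrightarrow>
        rlp_obj A (open_box A n i e) (comical_cube A n i e) (mid (open_box A n i e)) X) \<and>
     (\<forall>n i e. 2 \<le> n \<and> 1 \<le> i \<and> i \<le> n \<longrightarrow>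
        rlp_obj A (comical_cube' A n i e) (tau (n - 2) (comical_cube A n i e))
          (mid (comical_cube' A n i e)) X)"

definition trivial_above :: "nat \<Rightarrow> 'a mcset \<Rightarrow> bool" where
  "trivial_above n X \<longleftrightarrow> (\<forall>k>n. marked X k = cells X k)"


section \<open>Pushouts and the lax Gray tensor product\<close>

definition eqclass :: "('a \<Rightarrow> 'a \<Rightarrow> bool) \<Rightarrow> 'a \<Rightarrow> 'a set" where
  "eqclass r x = {y. equivclp r x y}"

definition po_rel :: "'s mcset \<Rightarrow> ('s, 'p) mmap \<Rightarrow> ('s, 'q) mmap \<Rightarrow>
    nat \<Rightarrow> 'p + 'q \<Rightarrow> 'p + 'q \<Rightarrow> bool" where
  "po_rel S f g n u v \<longleftrightarrow> (\<exists>s\<in>cells S n. u = Inl (f n s) \<and> v = Inr (g n s))"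

text \<open>The pushout of $P \leftarrow S \to Q$, formed on equivalence classes of $P_n + Q_n$.  On cubes,
  structure maps and maps out of the pushout are defined on representatives; \<open>the_elem\<close> extracts
  the common value.\<close>

definition pushout :: "'s mcset \<Rightarrow> 'p mcset \<Rightarrow> 'q mcset \<Rightarrow> ('s, 'p) mmap \<Rightarrow> ('s, 'q) mmap \<Rightarrow>
    ('p + 'q) set mcset" where
  "pushout S P Q f g = \<lparr>
     cells = (\<lambda>n. eqclass (po_rel S f g n) ` (cells P n <+> cells Q n)),
     act = (\<lambda>m n \<phi> c. the_elem ((\<lambda>u. eqclass (po_rel S f g m)
              (map_sum (act P m n \<phi>) (act Q m n \<phi>) u)) ` c)),
     marked = (\<lambda>n. eqclass (po_rel S f g n) ` (marked P n <+> marked Q n))\<rparr>"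

definition cotuple :: "('p + 'q) set mcset \<Rightarrow> ('p, 'r) mmap \<Rightarrow> ('q, 'r) mmap \<Rightarrow>
    (('p + 'q) set, 'r) mmap" where
  "cotuple PQ u v n = (\<lambda>c\<in>cells PQ n. the_elem (case_sum (u n) (v n) ` c))"

text \<open>The formal product $x \otimes y$ with $x \in X_k$, $y \in Y_l$ is the class of \<open>(k, x, l, y)\<close>.\<close>

definition tensor_rel :: "'a mcset \<Rightarrow> 'b mcset \<Rightarrow> nat \<Rightarrow>
    nat \<times> 'a \<times> nat \<times> 'b \<Rightarrow> nat \<times> 'a \<times> nat \<times> 'b \<Rightarrow> bool" where
  "tensor_rel X Y n u v \<longleftrightarrow> (\<exists>k l x y. k + l + 1 = n \<and> x \<in> cells X k \<and> y \<in> cells Y l \<and>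
     u = (k + 1, act X (k + 1) k (degen (k + 1) (k + 1)) x, l, y) \<and>
     v = (k, x, l + 1, act Y (l + 1) l (degen (l + 1) 1) y))"

definition tensor_elem :: "'a mcset \<Rightarrow> 'b mcset \<Rightarrow> nat \<Rightarrow> 'a \<Rightarrow> nat \<Rightarrow> 'b \<Rightarrow>
    (nat \<times> 'a \<times> nat \<times> 'b) set" where
  "tensor_elem X Y k x l y = eqclass (tensor_rel X Y (k + l)) (k, x, l, y)"

definition juxtapose :: "nat \<Rightarrow> nat \<Rightarrow> bmap \<Rightarrow> bmap \<Rightarrow> bmap" where
  "juxtapose a b \<phi> \<psi> = (\<lambda>x\<in>cube (a + b). \<phi> (take a x) @ \<psi> (drop a x))"

text \<open>Every morphism $\theta \colon [1]^m \to [1]^{k+l}$ of the cube category is of the form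
  $\varphi \otimes \psi$ with $\varphi \colon [1]^a \to [1]^k$, $\psi \colon [1]^b \to [1]^l$ and $a + b = m$, and the
  structure maps of $X \otimes Y$ are $(x \otimes y)(\varphi \otimes \psi) = x\varphi \otimes y\psi$; the class does
  not depend on the choices.\<close>

definition tensor :: "bool set \<Rightarrow> 'a mcset \<Rightarrow> 'b mcset \<Rightarrow> (nat \<times> 'a \<times> nat \<times> 'b) set mcset" where
  "tensor A X Y = \<lparr>
     cells = (\<lambda>n. {tensor_elem X Y k x l y | k x l y.
        k + l = n \<and> x \<in> cells X k \<and> y \<in> cells Y l}),
     act = (\<lambda>m n \<theta> c. the_elem {tensor_elem X Y a (act X a k \<phi> x) b (act Y b l \<psi> y) |
        a b \<phi> \<psi> k x l y. (k, x, l, y) \<in> c \<and> a + b = m \<and>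
          \<phi> \<in> Box A a k \<and> \<psi> \<in> Box A b l \<and> \<theta> = juxtapose a b \<phi> \<psi>}),
     marked = (\<lambda>n. {tensor_elem X Y k x l y | k x l y.
        k + l = n \<and> x \<in> cells X k \<and> y \<in> cells Y l \<and> (x \<in> marked X k \<or> y \<in> marked Y l)})\<rparr>"

definition tensor_map :: "bool set \<Rightarrow> 'a mcset \<Rightarrow> 'b mcset \<Rightarrow> 'c mcset \<Rightarrow> 'd mcset \<Rightarrow>
    ('a, 'c) mmap \<Rightarrow> ('b, 'd) mmap \<Rightarrow>
    ((nat \<times> 'a \<times> nat \<times> 'b) set, (nat \<times> 'c \<times> nat \<times> 'd) set) mmap" where
  "tensor_map A X Y X' Y' f g n = (\<lambda>c\<in>cells (tensor A X Y) n.
     the_elem ((\<lambda>(k, x, l, y). tensor_elem X' Y' k (f k x) l (g l y)) ` c))"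

text \<open>A map packaged with its source and target.\<close>

type_synonym ('a, 'b) arrow = "'a mcset \<times> ('a, 'b) mmap \<times> 'b mcset"

text \<open>For $f \colon X \to Y$ and $g \colon X' \to Y'$, the map
  $Y \otimes X' \cup_{X \otimes X'} X \otimes Y' \to Y \otimes Y'$.\<close>

definition pushout_product :: "bool set \<Rightarrow> ('a, 'b) arrow \<Rightarrow> ('c, 'd) arrow \<Rightarrow>
    (((nat \<times> 'b \<times> nat \<times> 'c) set + (nat \<times> 'a \<times> nat \<times> 'd) set) set,
     (nat \<times> 'b \<times> nat \<times> 'd) set) arrow" where
  "pushout_product A = (\<lambda>(X, f, Y) (X', g, Y').
     let P = pushout (tensor A X X') (tensor A Y X') (tensor A X Y')
           (tensor_map A X X' Y X' f (mid X')) (tensor_map A X X' X Y' (mid X) g)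
     in (P,
         cotuple P (tensor_map A Y X' Y Y' (mid Y) g) (tensor_map A X Y' Y Y' f (mid Y')),
         tensor A Y Y'))"


section \<open>Rezk maps, saturation and fibrant objects\<close>

text \<open>The generators $s$ and $t$ of $L_A$ are the identities of the left and the right copy of
  $\Box^2_A$.\<close>

definition L_po :: "bool set \<Rightarrow> (bmap + bmap) set mcset" where
  "L_po A = pushout (boxset A 1) (boxset A 2) (boxset A 2)
     (boxset_map A 1 (face 2 1 True)) (boxset_map A 1 (face 2 1 False))"

definition L_class :: "bool set \<Rightarrow> nat \<Rightarrow> bmap + bmap \<Rightarrow> (bmap + bmap) set" where
  "L_class A n = eqclass (po_rel (boxset A 1)
     (boxset_map A 1 (face 2 1 True)) (boxset_map A 1 (face 2 1 False)) n)"

definition rezk_L :: "bool set \<Rightarrow> (bmap + bmap) set mcset" where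
  "rezk_L A = mark (L_po A) (\<lambda>n.
     if n = 2 then L_class A 2 ` {Inl (bid 2), Inr (bid 2)}
     else if n = 1 then L_class A 1 ` {Inl (face 2 1 False), Inl (face 2 2 True),
                                       Inr (face 2 2 False), Inr (face 2 1 True)}
     else {})"

definition boundary_inclusion :: "bool set \<Rightarrow> nat \<Rightarrow> (bmap, bmap) arrow" where
  "boundary_inclusion A n = (boundary A n, mid (boundary A n), boxset A n)"

definition L_arrow :: "bool set \<Rightarrow> ((bmap + bmap) set, (bmap + bmap) set) arrow" where
  "L_arrow A = (rezk_L A, mid (rezk_L A), tau 0 (rezk_L A))"

definition saturated :: "bool set \<Rightarrow> 'a mcset \<Rightarrow> bool" where
  "saturated A X \<longleftrightarrow> (\<forall>m n.
     case pushout_product A (pushout_product A (boundary_inclusion A m) (L_arrow A))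
            (boundary_inclusion A n)
     of (U, u, V) \<Rightarrow> rlp_obj A U V u X)"

text \<open>The fibrant objects of the four families of model structures: the flag selects the saturated
  versions, and the option selects the $n$-trivial versions.\<close>

definition comical_fibrant :: "bool set \<Rightarrow> bool \<Rightarrow> nat option \<Rightarrow> 'a mcset \<Rightarrow> bool" where
  "comical_fibrant A sat triv X \<longleftrightarrow> comical A X \<and> (sat \<longrightarrow> saturated A X) \<and>
     (case triv of None \<Rightarrow> True | Some n \<Rightarrow> trivial_above n X)"


section \<open>Model structures\<close>

text \<open>The category of marked cubical sets is considered on a type \<open>'u\<close> of cubes, which plays the role
  of the universe of sets: its objects are all marked cubical sets whose cubes are elements
  of \<open>'u\<close>.  Classes of maps are predicates on triples (source, target, map).\<close>

type_synonym 'u map_class = "'u mcset \<Rightarrow> 'u mcset \<Rightarrow> ('u, 'u) mmap \<Rightarrow> bool"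

definition monic :: "bool set \<Rightarrow> 'u mcset \<Rightarrow> 'u mcset \<Rightarrow> ('u, 'u) mmap \<Rightarrow> bool" where
  "monic A X Y f \<longleftrightarrow> f \<in> hom A X Y \<and>
     (\<forall>V::'u mcset. marked_cubical_set A V \<longrightarrow>
        (\<forall>a\<in>hom A V X. \<forall>b\<in>hom A V X. mcomp V f a = mcomp V f b \<longrightarrow> a = b))"

definition terminal :: "bool set \<Rightarrow> 'u mcset \<Rightarrow> bool" where
  "terminal A T \<longleftrightarrow> marked_cubical_set A T \<and>
     (\<forall>X::'u mcset. marked_cubical_set A X \<longrightarrow> (\<exists>!f. f \<in> hom A X T))"

definition retract :: "bool set \<Rightarrow> 'u mcset \<Rightarrow> 'u mcset \<Rightarrow> ('u, 'u) mmap \<Rightarrow>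
    'u mcset \<Rightarrow> 'u mcset \<Rightarrow> ('u, 'u) mmap \<Rightarrow> bool" where
  "retract A X Y f X' Y' f' \<longleftrightarrow>
     (\<exists>s\<in>hom A X X'. \<exists>r\<in>hom A X' X. \<exists>s'\<in>hom A Y Y'. \<exists>r'\<in>hom A Y' Y.
        mcomp X r s = mid X \<and> mcomp Y r' s' = mid Y \<and>
        mcomp X f' s = mcomp X s' f \<and> mcomp X' f r = mcomp X' r' f')"

locale model_structure =
  fixes A :: "bool set" and WE Cof Fib :: "'u map_class"
  assumes WE_hom: "WE X Y f \<Longrightarrow> marked_cubical_set A X \<and> marked_cubical_set A Y \<and> f \<in> hom A X Y"
    and Cof_hom: "Cof X Y f \<Longrightarrow> marked_cubical_set A X \<and> marked_cubical_set A Y \<and> f \<in> hom A X Y"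
    and Fib_hom: "Fib X Y f \<Longrightarrow> marked_cubical_set A X \<and> marked_cubical_set A Y \<and> f \<in> hom A X Y"
    and two_of_three:
      "\<lbrakk>marked_cubical_set A X; marked_cubical_set A Y; marked_cubical_set A Z;
        f \<in> hom A X Y; g \<in> hom A Y Z\<rbrakk> \<Longrightarrow>
        (WE X Y f \<and> WE Y Z g \<longrightarrow> WE X Z (mcomp X g f)) \<and>
        (WE X Y f \<and> WE X Z (mcomp X g f) \<longrightarrow> WE Y Z g) \<and>
        (WE Y Z g \<and> WE X Z (mcomp X g f) \<longrightarrow> WE X Y f)"
    and retracts:
      "\<lbrakk>marked_cubical_set A X; marked_cubical_set A Y; f \<in> hom A X Y; retract A X Y f X' Y' f'\<rbrakk> \<Longrightarrow>
        (WE X' Y' f' \<longrightarrow> WE X Y f) \<and> (Cof X' Y' f' \<longrightarrow> Cof X Y f) \<and> (Fib X' Y' f' \<longrightarrow> Fib X Y f)"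
    and lift_Fib: "Cof U V u \<Longrightarrow> WE U V u \<Longrightarrow> Fib P Q p \<Longrightarrow> rlp A U V u P Q p"
    and lift_trivial_Fib: "Cof U V u \<Longrightarrow> Fib P Q p \<Longrightarrow> WE P Q p \<Longrightarrow> rlp A U V u P Q p"
    and factor_Fib:
      "marked_cubical_set A X \<Longrightarrow> marked_cubical_set A Y \<Longrightarrow> f \<in> hom A X Y \<Longrightarrow>
        \<exists>E i p. Cof X E i \<and> WE X E i \<and> Fib E Y p \<and> mcomp X p i = f"
    and factor_trivial_Fib:
      "marked_cubical_set A X \<Longrightarrow> marked_cubical_set A Y \<Longrightarrow> f \<in> hom A X Y \<Longrightarrow>
        \<exists>E i p. Cof X E i \<and> Fib E Y p \<and> WE E Y p \<and> mcomp X p i = f"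

definition fibrant :: "bool set \<Rightarrow> 'u map_class \<Rightarrow> 'u mcset \<Rightarrow> bool" where
  "fibrant A Fib X \<longleftrightarrow> (\<exists>T t. terminal A T \<and> Fib X T t)"

locale comical_model_structure = model_structure A WE Cof Fib
  for A :: "bool set" and sat :: bool and triv :: "nat option" and WE Cof Fib :: "'u map_class" +
  assumes Cof_iff_monic:
      "marked_cubical_set A X \<Longrightarrow> marked_cubical_set A Y \<Longrightarrow> Cof X Y f \<longleftrightarrow> monic A X Y f"
    and fibrant_iff:
      "marked_cubical_set A X \<Longrightarrow> fibrant A Fib X \<longleftrightarrow> comical_fibrant A sat triv X"


section \<open>Change of cube category and weak connection structures\<close>

definition istar :: "bool set \<Rightarrow> 'a mcset \<Rightarrow> 'a mcset" where
  "istar A X = X\<lparr>act := (\<lambda>m n \<phi>. if \<phi> \<in> Box A m n then act X m n \<phi> else undefined)\<rparr>"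

text \<open>The left adjoint $i_!$ is the left Kan extension of cubical sets: an $n$-cube of $i_! X$ is a
  class of pairs $(x, \varphi)$ with $x \in X_m$ and $\varphi \colon [1]^n \to [1]^m$ in the larger cube category,
  modulo $(x, \psi\varphi) \sim (x\psi, \varphi)$ for $\psi$ in the smaller one.  The marked cubes are those
  which every map out of $i_! X$ adjoint to a marked map has to preserve: the images of marked
  cubes of $X$ and the degenerate cubes.\<close>

definition lan_rel :: "bool set \<Rightarrow> bool set \<Rightarrow> 'a mcset \<Rightarrow> nat \<Rightarrow>
    nat \<times> 'a \<times> bmap \<Rightarrow> nat \<times> 'a \<times> bmap \<Rightarrow> bool" where
  "lan_rel A B X n u v \<longleftrightarrow> (\<exists>m k \<psi> \<phi> x. x \<in> cells X m \<and> \<psi> \<in> Box A k m \<and> \<phi> \<in> Box B n k \<and>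
     u = (m, x, compose (cube n) \<psi> \<phi>) \<and> v = (k, act X k m \<psi> x, \<phi>))"

definition lan_elem :: "bool set \<Rightarrow> bool set \<Rightarrow> 'a mcset \<Rightarrow> nat \<Rightarrow> nat \<times> 'a \<times> bmap \<Rightarrow>
    (nat \<times> 'a \<times> bmap) set" where
  "lan_elem A B X n = eqclass (lan_rel A B X n)"

definition ishriek :: "bool set \<Rightarrow> bool set \<Rightarrow> 'a mcset \<Rightarrow> (nat \<times> 'a \<times> bmap) set mcset" where
  "ishriek A B X =
    (let U = \<lparr>
       cells = (\<lambda>n. {lan_elem A B X n (m, x, \<phi>) | m x \<phi>. x \<in> cells X m \<and> \<phi> \<in> Box B n m}),
       act = (\<lambda>k n \<theta> c. the_elem ((\<lambda>(m, x, \<phi>). lan_elem A B X k (m, x, compose (cube k) \<phi> \<theta>)) ` c)),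
       marked = (\<lambda>n. {lan_elem A B X n (n, x, bid n) | x. x \<in> marked X n})\<rparr>
     in mark U (degenerate B U))"

definition ishriek_map :: "bool set \<Rightarrow> bool set \<Rightarrow> 'a mcset \<Rightarrow> 'b mcset \<Rightarrow> ('a, 'b) mmap \<Rightarrow>
    ((nat \<times> 'a \<times> bmap) set, (nat \<times> 'b \<times> bmap) set) mmap" where
  "ishriek_map A B X Y f n = (\<lambda>c\<in>cells (ishriek A B X) n.
     the_elem ((\<lambda>(m, x, \<phi>). lan_elem A B Y n (m, f m x, \<phi>)) ` c))"

definition unit_map :: "bool set \<Rightarrow> bool set \<Rightarrow> 'a mcset \<Rightarrow> ('a, (nat \<times> 'a \<times> bmap) set) mmap" where
  "unit_map A B X n = (\<lambda>x\<in>cells X n. lan_elem A B X n (n, x, bid n))"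

text \<open>The functor $i^* i_!$; on maps it is given by \<open>ishriek_map\<close>, since $i^*$ keeps maps unchanged.\<close>

abbreviation ii :: "bool set \<Rightarrow> bool set \<Rightarrow> 'a mcset \<Rightarrow> (nat \<times> 'a \<times> bmap) set mcset" where
  "ii A B X \<equiv> istar A (ishriek A B X)"

definition weak_connection_structure :: "bool set \<Rightarrow> bool set \<Rightarrow> 'a mcset \<Rightarrow> 'b mcset \<Rightarrow>
    ('a, 'b) mmap \<Rightarrow> ((nat \<times> 'a \<times> bmap) set, 'b) mmap \<Rightarrow> bool" where
  "weak_connection_structure A B X Y f \<Gamma> \<longleftrightarrow>
     \<Gamma> \<in> hom A (ii A B X) Y \<and> mcomp X \<Gamma> (unit_map A B X) = f"


section \<open>The adjunction\<close>

text \<open>The explicit \<open>ishriek\<close> is the left adjoint of \<open>istar\<close> with unit \<open>unit_map\<close>, and \<open>ishriek_map\<close> is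
  its effect on maps: \<open>ishriek_universal\<close> and \<open>ishriek_map_hom_natural\<close>.\<close>

lemma eqclass_respects:
  assumes "\<And>u v. r u v \<Longrightarrow> F u = F v" and "equivclp r x y"
  shows "F y = F x"
  using assms(2)
proof (induction rule: equivclp_induct)
  case base show ?case by simp
next
  case (step y z) then show ?case using assms(1) by metis
qed

lemma the_elem_eqclass:
  assumes "\<And>u v. r u v \<Longrightarrow> F u = F v"
  shows "the_elem (F ` eqclass r x) = F x"
proof -
  have "F ` eqclass r x = {F x}"
  proof (intro equalityI subsetI)
    fix z assume "z \<in> F ` eqclass r x"
    then obtain y where "z = F y" "equivclp r x y" by (auto simp: eqclass_def)
    moreover have "F y = F x" using assms \<open>equivclp r x y\<close> by (rule eqclass_respects)
    ultimately show "z \<in> {F x}" by simp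
  next
    fix z assume "z \<in> {F x}"
    then show "z \<in> F ` eqclass r x" by (auto simp: eqclass_def)
  qed
  then show ?thesis by simp
qed

lemma eqclass_eqI: "equivclp r x y \<Longrightarrow> eqclass r x = eqclass r y"
  unfolding eqclass_def
  by (intro Collect_cong iffI) (erule (1) equivclp_trans[OF equivclp_sym], erule (1) equivclp_trans)

lemma rel_eqclass: "r x y \<Longrightarrow> eqclass r x = eqclass r y"
  by (intro eqclass_eqI r_into_equivclp)

lemma is_box_ext: "is_box A m n \<phi> \<Longrightarrow> \<phi> \<in> cube m \<rightarrow>\<^sub>E cube n"
proof (induction rule: is_box.induct)
  case (box_comp m n \<phi> k \<psi>)
  then show ?case by (auto simp: PiE_iff compose_def extensional_def Pi_def)
qed (auto simp: PiE_iff extensional_def cube_def bid_def face_def degen_def conn_def min_def)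

lemma Box_ext: "\<phi> \<in> Box A m n \<Longrightarrow> \<phi> \<in> cube m \<rightarrow>\<^sub>E cube n"
  by (simp add: Box_def is_box_ext)

lemma is_box_mono: "is_box A m n \<phi> \<Longrightarrow> A \<subseteq> B \<Longrightarrow> is_box B m n \<phi>"
proof (induction rule: is_box.induct)
  case (box_comp m n \<phi> k \<psi>) then show ?case by (blast intro: is_box.box_comp)
qed (blast intro: is_box.intros(1-4))+

lemma Box_mono: "A \<subseteq> B \<Longrightarrow> \<phi> \<in> Box A m n \<Longrightarrow> \<phi> \<in> Box B m n"
  by (simp add: Box_def is_box_mono)

lemma Box_id: "bid n \<in> Box A n n" by (simp add: Box_def box_id)
lemma Box_comp: "\<phi> \<in> Box A m n \<Longrightarrow> \<psi> \<in> Box A k m \<Longrightarrow> compose (cube k) \<phi> \<psi> \<in> Box A k n"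
  by (auto simp: Box_def intro: box_comp)

lemma compose_bid_right: "\<phi> \<in> Box A m n \<Longrightarrow> compose (cube m) \<phi> (bid m) = \<phi>"
  using Box_ext[of \<phi> A m n] by (auto simp: compose_def bid_def PiE_iff extensional_def fun_eq_iff)
lemma compose_bid_left: "\<phi> \<in> Box A m n \<Longrightarrow> compose (cube m) (bid n) \<phi> = \<phi>"
  using Box_ext[of \<phi> A m n] by (auto simp: compose_def bid_def PiE_iff extensional_def fun_eq_iff)
lemma compose_assoc_Box: "\<theta> \<in> Box A k m \<Longrightarrow>
   compose (cube k) (compose (cube m) \<chi> \<phi>) \<theta> = compose (cube k) \<chi> (compose (cube k) \<phi> \<theta>)"
  using Box_ext[of \<theta> A k m] by (auto simp: compose_def PiE_iff)

lemma Box_degen: "1 \<le> i \<Longrightarrow> i \<le> n \<Longrightarrow> degen n i \<in> Box A n (n - 1)"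
  unfolding Box_def by (blast intro: box_degen)
lemma Box_conn: "e \<in> A \<Longrightarrow> 1 \<le> i \<Longrightarrow> i < n \<Longrightarrow> conn n i e \<in> Box A n (n - 1)"
  unfolding Box_def by (blast intro: box_conn)

lemma mcomp_hom:
  assumes X: "marked_cubical_set A X" and f: "f \<in> hom A X Y" and g: "g \<in> hom A Y Z"
  shows "mcomp X g f \<in> hom A X Z"
proof -
  interpret X: marked_cubical_set A X by (rule X)
  have fc: "f n x \<in> cells Y n" if "x \<in> cells X n" for n x using f that by (auto simp: hom_def)
  have gc: "g n x \<in> cells Z n" if "x \<in> cells Y n" for n x using g that by (auto simp: hom_def)
  have c: "mcomp X g f n x = g n (f n x)" if "x \<in> cells X n" for n x
    using that by (simp add: mcomp_def compose_def)
  have "mcomp X g f n \<in> cells X n \<rightarrow>\<^sub>E cells Z n" for n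
    by (rule PiE_I) (simp_all add: c fc gc, simp add: mcomp_def compose_def)
  moreover have "mcomp X g f m (act X m n \<phi> x) = act Z m n \<phi> (mcomp X g f n x)"
    if "\<phi> \<in> Box A m n" "x \<in> cells X n" for m n \<phi> x
    using f g that by (simp add: c fc X.act_closed hom_def)
  moreover have "mcomp X g f n x \<in> marked Z n" if x: "x \<in> marked X n" for n x
  proof -
    have "x \<in> cells X n" using x X.marked_cells by blast
    moreover have "f n ` marked X n \<subseteq> marked Y n" "g n ` marked Y n \<subseteq> marked Z n"
      using f g by (simp_all add: hom_def)
    ultimately show ?thesis using x c by auto
  qed
  ultimately show ?thesis unfolding hom_def by blast
qed

context
  fixes A B :: "bool set" and X :: "'a mcset"
  assumes AB: "A \<subseteq> B" and X: "marked_cubical_set A X"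
begin

interpretation X: marked_cubical_set A X by (rule X)

lemma lan_act: 
  assumes "\<theta> \<in> Box B k n"
  shows "act (ishriek A B X) k n \<theta> (lan_elem A B X n (m, x, \<phi>)) =
    lan_elem A B X k (m, x, compose (cube k) \<phi> \<theta>)"
proof -
  let ?F = "\<lambda>(m, x, \<phi>). lan_elem A B X k (m, x, compose (cube k) \<phi> \<theta>)"
  have "?F u = ?F v" if r: "lan_rel A B X n u v" for u v
  proof -
    from r obtain m l \<psi> \<phi> x where *: "x \<in> cells X m" "\<psi> \<in> Box A l m" "\<phi> \<in> Box B n l"
      "u = (m, x, compose (cube n) \<psi> \<phi>)" "v = (l, act X l m \<psi> x, \<phi>)"
      unfolding lan_rel_def by blast
    have "lan_rel A B X k (m, x, compose (cube k) \<psi> (compose (cube k) \<phi> \<theta>)) 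
       (l, act X l m \<psi> x, compose (cube k) \<phi> \<theta>)"
      unfolding lan_rel_def using * assms Box_comp by blast
    then show ?thesis
      using * by (simp add: lan_elem_def rel_eqclass compose_assoc_Box[OF *(3)] compose_assoc_Box[OF assms] assms)
  qed
  then have "the_elem (?F ` eqclass (lan_rel A B X n) (m, x, \<phi>)) = ?F (m, x, \<phi>)"
    by (rule the_elem_eqclass)
  then show ?thesis by (simp add: ishriek_def mark_def lan_elem_def Let_def)
qed

lemma lan_cells: "cells (ishriek A B X) n = 
   {lan_elem A B X n (m, x, \<phi>) | m x \<phi>. x \<in> cells X m \<and> \<phi> \<in> Box B n m}"
  by (simp add: ishriek_def mark_def Let_def)

lemma lan_degenerate: "degenerate B (ishriek A B X) n \<subseteq> marked (ishriek A B X) n"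
  by (auto simp: ishriek_def mark_def Let_def degenerate_def)

lemma lan_marked: "marked (ishriek A B X) n =
   {lan_elem A B X n (n, x, bid n) | x. x \<in> marked X n} \<union> degenerate B (ishriek A B X) n"
  by (simp add: ishriek_def mark_def Let_def degenerate_def)

lemma lan_rel_elem:
  "x \<in> cells X m \<Longrightarrow> \<psi> \<in> Box A k m \<Longrightarrow> \<phi> \<in> Box B n k \<Longrightarrow>
   lan_elem A B X n (m, x, compose (cube n) \<psi> \<phi>) = lan_elem A B X n (k, act X k m \<psi> x, \<phi>)"
  unfolding lan_elem_def by (rule rel_eqclass) (auto simp: lan_rel_def)

lemma ishriek_marked_cubical_set: "marked_cubical_set B (ishriek A B X)"
proof
  show closed: "act (ishriek A B X) m n \<phi> x \<in> cells (ishriek A B X) m"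
    if "\<phi> \<in> Box B m n" "x \<in> cells (ishriek A B X) n" for \<phi> m n x
    using that by (auto simp: lan_cells lan_act) (blast intro: Box_comp)
  show "act (ishriek A B X) n n (bid n) x = x" if "x \<in> cells (ishriek A B X) n" for x n
    using that by (auto simp: lan_cells lan_act[OF Box_id] compose_bid_right)
  show "act (ishriek A B X) k n (compose (cube k) \<phi> \<psi>) x =
      act (ishriek A B X) k m \<psi> (act (ishriek A B X) m n \<phi> x)"
    if "\<phi> \<in> Box B m n" "\<psi> \<in> Box B k m" "x \<in> cells (ishriek A B X) n" for \<phi> \<psi> k m n x
    using that by (auto simp: lan_cells lan_act Box_comp compose_assoc_Box)
  show "marked (ishriek A B X) n \<subseteq> cells (ishriek A B X) n" for n
  proof -
    have "degenerate B (ishriek A B X) n \<subseteq> cells (ishriek A B X) n"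
      using closed by (auto simp: degenerate_def intro!: closed Box_degen[simplified] Box_conn[simplified])
    moreover have "lan_elem A B X n (n, x, bid n) \<in> cells (ishriek A B X) n" if "x \<in> marked X n" for x
      unfolding lan_cells using that X.marked_cells Box_id by blast
    ultimately show ?thesis by (auto simp: lan_marked)
  qed
  show "marked (ishriek A B X) 0 = {}"
    by (auto simp: lan_marked X.marked_0 degenerate_def)
  show "degenerate B (ishriek A B X) n \<subseteq> marked (ishriek A B X) n" for n
    by (rule lan_degenerate)
qed

lemma unit_hom: "unit_map A B X \<in> hom A X (ii A B X)"
proof -
  have "lan_elem A B X m (m, act X m n \<phi> x, bid m) = lan_elem A B X m (n, x, compose (cube m) (bid n) \<phi>)"
    if "\<phi> \<in> Box A m n" "x \<in> cells X n" for m n \<phi> x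
    using lan_rel_elem[of x n \<phi> m "bid m" m] that Box_id
    by (simp add: compose_bid_left compose_bid_right)
  moreover have "lan_elem A B X n (n, x, bid n) \<in> cells (ishriek A B X) n" if "x \<in> cells X n" for x n
      unfolding lan_cells using that Box_id by blast
  moreover have "lan_elem A B X n (n, x, bid n) \<in> marked (ishriek A B X) n" if "x \<in> marked X n" for x n
      unfolding lan_marked using that by blast
  ultimately show ?thesis
    using X.act_closed X.marked_cells[THEN subsetD]
    by (auto simp: hom_def unit_map_def istar_def lan_act Box_mono[OF AB])
qed

lemma ishriek_universal:
  assumes Y: "marked_cubical_set B Y" and f: "f \<in> hom A X (istar A Y)"
  shows "\<exists>!h. h \<in> hom B (ishriek A B X) Y \<and> mcomp X h (unit_map A B X) = f"
proof -
  interpret Y: marked_cubical_set B Y by (rule Y)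
  have f_cell: "f n x \<in> cells Y n" if "x \<in> cells X n" for n x
    using f that by (auto simp: hom_def istar_def)
  have f_nat: "f m (act X m n \<phi> x) = act Y m n \<phi> (f n x)" if "\<phi> \<in> Box A m n" "x \<in> cells X n" for m n \<phi> x
    using f that by (auto simp: hom_def istar_def)
  have f_marked: "f n x \<in> marked Y n" if "x \<in> marked X n" for n x
  proof -
    have "f n ` marked X n \<subseteq> marked Y n" using f by (simp add: hom_def istar_def)
    then show ?thesis using that by blast
  qed
  define G where "G n = (\<lambda>(m, x, \<phi>). act Y n m \<phi> (f m x))" for n
  define h where "h n = (\<lambda>c\<in>cells (ishriek A B X) n. the_elem (G n ` c))" for n
  have G_rel: "G n u = G n v" if "lan_rel A B X n u v" for n u v
    using that unfolding lan_rel_def G_def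
    by (auto simp: f_nat f_cell Y.act_comp Box_mono[OF AB])
  have h_elem: "h n (lan_elem A B X n (m, x, \<phi>)) = act Y n m \<phi> (f m x)"
    if "x \<in> cells X m" "\<phi> \<in> Box B n m" for n m x \<phi>
  proof -
    have "lan_elem A B X n (m, x, \<phi>) \<in> cells (ishriek A B X) n" using that lan_cells by blast
    then show ?thesis
      using the_elem_eqclass[of "lan_rel A B X n" "G n" "(m, x, \<phi>)"] G_rel
      by (simp add: h_def lan_elem_def G_def)
  qed
  have h_nat: "h m (act (ishriek A B X) m n \<theta> c) = act Y m n \<theta> (h n c)"
    if "\<theta> \<in> Box B m n" "c \<in> cells (ishriek A B X) n" for m n \<theta> c
    using that by (auto simp: lan_cells lan_act h_elem Box_comp Y.act_comp f_cell)
  have h_cell: "h n \<in> cells (ishriek A B X) n \<rightarrow>\<^sub>E cells Y n" for n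
  proof (rule PiE_I)
    show "h n c \<in> cells Y n" if "c \<in> cells (ishriek A B X) n" for c
      using that unfolding lan_cells by (auto simp: h_elem intro!: Y.act_closed f_cell)
    show "h n c = undefined" if "c \<notin> cells (ishriek A B X) n" for c
      using that by (simp add: h_def)
  qed
  have h_unit: "h n (lan_elem A B X n (n, x, bid n)) = f n x" if "x \<in> cells X n" for n x
    using that by (simp add: h_elem Box_id Y.act_id f_cell)
  have "h n c \<in> marked Y n" if "c \<in> marked (ishriek A B X) n" for n c
    using that unfolding lan_marked
  proof
    assume "c \<in> {lan_elem A B X n (n, x, bid n) |x. x \<in> marked X n}"
    then show ?thesis using X.marked_cells h_unit f_marked by fastforce
  next
    assume "c \<in> degenerate B (ishriek A B X) n"
    then have "h n c \<in> degenerate B Y n"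
    proof -
      have c: "h (n - 1) y \<in> cells Y (n - 1)" if "y \<in> cells (ishriek A B X) (n - 1)" for y
        using h_cell[of "n - 1"] that by (rule PiE_mem)
      from \<open>c \<in> degenerate B (ishriek A B X) n\<close> consider
        (d) i y where "c = act (ishriek A B X) n (n - 1) (degen n i) y" "1 \<le> i" "i \<le> n"
          "y \<in> cells (ishriek A B X) (n - 1)"
      | (g) i e y where "c = act (ishriek A B X) n (n - 1) (conn n i e) y" "e \<in> B" "1 \<le> i" "i < n"
          "y \<in> cells (ishriek A B X) (n - 1)"
        unfolding degenerate_def by blast
      then show ?thesis
      proof cases
        case d
        then have "h n c = act Y n (n - 1) (degen n i) (h (n - 1) y)"
          using h_nat[OF Box_degen] by blast
        with d c show ?thesis unfolding degenerate_def by blast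
      next
        case g
        then have "h n c = act Y n (n - 1) (conn n i e) (h (n - 1) y)"
          using h_nat[OF Box_conn] by blast
        with g c show ?thesis unfolding degenerate_def by blast
      qed
    qed
    then show ?thesis using Y.marked_degenerate by blast
  qed
  then have "h \<in> hom B (ishriek A B X) Y" 
    using h_cell h_nat by (auto simp: hom_def)
  moreover have "mcomp X h (unit_map A B X) = f"
  proof (intro ext)
    fix n x
    have "x \<notin> cells X n \<Longrightarrow> f n x = undefined"
      using f by (auto simp: hom_def PiE_iff extensional_def)
    then show "mcomp X h (unit_map A B X) n x = f n x"
      by (cases "x \<in> cells X n") (simp_all add: mcomp_def unit_map_def compose_def h_unit)
  qed
  moreover have "h' = h" if h': "h' \<in> hom B (ishriek A B X) Y" "mcomp X h' (unit_map A B X) = f" for h'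
  proof -
    have u: "h' n (lan_elem A B X n (n, x, bid n)) = f n x" if "x \<in> cells X n" for n x
      using that fun_cong[OF fun_cong[OF h'(2)], of n x] by (simp add: mcomp_def compose_def unit_map_def)
    have "h' n (lan_elem A B X n (m, x, \<phi>)) = h n (lan_elem A B X n (m, x, \<phi>))"
      if "x \<in> cells X m" "\<phi> \<in> Box B n m" for n m x \<phi>
    proof -
      have "lan_elem A B X n (m, x, \<phi>) = act (ishriek A B X) n m \<phi> (lan_elem A B X m (m, x, bid m))"
        using that by (simp add: lan_act compose_bid_left)
      moreover have "lan_elem A B X m (m, x, bid m) \<in> cells (ishriek A B X) m"
        unfolding lan_cells using that Box_id by blast
      moreover have "h' n (act (ishriek A B X) n m \<phi> c) = act Y n m \<phi> (h' m c)"
        if "c \<in> cells (ishriek A B X) m" for c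
        using h'(1) that \<open>\<phi> \<in> Box B n m\<close> by (simp add: hom_def)
      ultimately have "h' n (lan_elem A B X n (m, x, \<phi>)) = act Y n m \<phi> (f m x)"
        using u that by metis
      then show ?thesis using that by (simp add: h_elem)
    qed
    then have "\<forall>c\<in>cells (ishriek A B X) n. h' n c = h n c" for n
      by (auto simp: lan_cells)
    moreover have "h' n \<in> extensional (cells (ishriek A B X) n)" for n
      using h'(1) by (auto simp: hom_def PiE_iff)
    moreover have "h n \<in> extensional (cells (ishriek A B X) n)" for n
      by (simp add: h_def)
    ultimately have "h' n = h n" for n
      by (intro extensionalityI[of _ "cells (ishriek A B X) n"]) blast+
    then show ?thesis by (rule ext)
  qed
  ultimately show ?thesis by blast
qed

end

context
  fixes A B :: "bool set" and X :: "'a mcset"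
  assumes AB: "A \<subseteq> B" and X: "marked_cubical_set A X"
begin

interpretation X: marked_cubical_set A X by (rule X)

lemma ishriek_map_hom_natural:
  assumes Y: "marked_cubical_set A Y" and f: "f \<in> hom A X Y"
  shows "ishriek_map A B X Y f \<in> hom B (ishriek A B X) (ishriek A B Y)"
    and "mcomp X (ishriek_map A B X Y f) (unit_map A B X) = mcomp X (unit_map A B Y) f"
proof -
  have f_cell: "f n x \<in> cells Y n" if "x \<in> cells X n" for n x
    using f that by (auto simp: hom_def)
  have f_nat: "f m (act X m n \<phi> x) = act Y m n \<phi> (f n x)"
    if "\<phi> \<in> Box A m n" "x \<in> cells X n" for m n \<phi> x
    using f that by (auto simp: hom_def)
  have uf: "mcomp X (unit_map A B Y) f \<in> hom A X (ii A B Y)"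
    by (rule mcomp_hom[OF X f unit_hom[OF AB Y]])
  obtain h where h: "h \<in> hom B (ishriek A B X) (ishriek A B Y)"
      "mcomp X h (unit_map A B X) = mcomp X (unit_map A B Y) f"
    using ishriek_universal[OF AB X ishriek_marked_cubical_set[OF AB Y] uf] by blast
  have h_unit: "h n (lan_elem A B X n (n, x, bid n)) = lan_elem A B Y n (n, f n x, bid n)"
    if "x \<in> cells X n" for n x
    using that fun_cong[OF fun_cong[OF h(2)], of n x] f_cell
    by (simp add: mcomp_def compose_def unit_map_def)
  have "ishriek_map A B X Y f n c = h n c" for n c
  proof (cases "c \<in> cells (ishriek A B X) n")
    case False
    moreover have "h n c = undefined"
      using h(1) False by (auto simp: hom_def PiE_iff extensional_def)
    ultimately show ?thesis by (simp add: ishriek_map_def)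
  next
    case True
    then obtain m x \<phi> where c: "c = lan_elem A B X n (m, x, \<phi>)"
      and x: "x \<in> cells X m" and \<phi>: "\<phi> \<in> Box B n m"
      unfolding lan_cells[OF AB X] by blast
    let ?F = "\<lambda>(m, x, \<phi>). lan_elem A B Y n (m, f m x, \<phi>)"
    have "?F u = ?F v" if r: "lan_rel A B X n u v" for u v
    proof -
      from r obtain m l \<psi> \<phi> x where *: "x \<in> cells X m" "\<psi> \<in> Box A l m" "\<phi> \<in> Box B n l"
        "u = (m, x, compose (cube n) \<psi> \<phi>)" "v = (l, act X l m \<psi> x, \<phi>)"
        unfolding lan_rel_def by blast
      then show ?thesis
        using lan_rel_elem[OF AB Y f_cell[OF *(1)] *(2,3)] by (simp add: f_nat)
    qed
    then have "the_elem (?F ` eqclass (lan_rel A B X n) (m, x, \<phi>)) = ?F (m, x, \<phi>)"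
      by (rule the_elem_eqclass)
    then have 1: "ishriek_map A B X Y f n c = lan_elem A B Y n (m, f m x, \<phi>)"
      using True by (simp add: ishriek_map_def c lan_elem_def)
    have e: "lan_elem A B X m (m, x, bid m) \<in> cells (ishriek A B X) m"
      unfolding lan_cells[OF AB X] using x Box_id by blast
    have "c = act (ishriek A B X) n m \<phi> (lan_elem A B X m (m, x, bid m))"
      using \<phi> by (simp add: c lan_act[OF AB X] compose_bid_left)
    then have "h n c = act (ishriek A B Y) n m \<phi> (h m (lan_elem A B X m (m, x, bid m)))"
      using h(1) \<phi> e by (simp add: hom_def)
    also have "\<dots> = lan_elem A B Y n (m, f m x, \<phi>)"
      using \<phi> x by (simp add: h_unit lan_act[OF AB Y] compose_bid_left)
    finally show ?thesis using 1 by simp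
  qed
  then have "ishriek_map A B X Y f = h" by (intro ext)
  with h show "ishriek_map A B X Y f \<in> hom B (ishriek A B X) (ishriek A B Y)"
    and "mcomp X (ishriek_map A B X Y f) (unit_map A B X) = mcomp X (unit_map A B Y) f"
    by simp_all
qed

end

end

theory Submission
  imports Defs
begin

text \<open>
  Comical generators are trivial cofibrations: a marking extension is entire, so it lifts against
  every map out of a comical set, and an open box lifts against a fibration \<open>p\<close> of fibrant objects
  by lifting against the source first and correcting the result along a path in the target; a
  map lifting against all fibrations of fibrant objects is a weak equivalence.  Hence a
  fibration $Y \to Z$ lifts against open boxes and marking extensions.

  This suffices to extend $\Gamma_{fj}$ cube by cube over \<open>X\<close>.  For one $n$-cube the task is to lift a
  map $i^*\Box^n_B \to Z$ that is already lifted on $\Box^n_A$ and on the faces.  If \<open>\<theta>\<close> in $\Box_B$ has target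
  $[1]^n$, its composites with the connections are cubes containing $\theta$ as a face, and all their
  other faces have been treated before or lie in the boundary; the critical faces are
  degenerate, hence marked, so the open box can be filled.
\<close>

section \<open>Morphisms of the cube category\<close>

text \<open>A fibration over a general base is accessible only through the model structure axioms,
  while the explicit description of fibrant objects concerns lifting over the point; hence the
  generators must first be shown to be trivial cofibrations. They have cubes of type
  \<open>bmap\<close>, whereas the model structure lives on \<open>'u\<close>: their finitely many
  cubes in each dimension are copied into the infinite type \<open>'u\<close>.

  A morphism of \<open>Box B k n\<close> may use connections in all coordinates, so its lift is
  built one output coordinate at a time. Joining one output to a new coordinate leaves a single
  unknown face: the absorbing value of the new coordinate lands in the boundary, the neutral value
  returns the original morphism. On products with a factor from \<open>Box A\<close> naturality
  dictates the values; respecting this takes an auxiliary filler \<open>G\<close> before the actual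
  filler \<open>F\<close>.

  Degenerate cubes of a representable are those that fail to be injective on Boolean points, so the
  degeneracy of critical faces reduces to exhibiting two points with the same image.\<close>

abbreviation cmp :: "nat \<Rightarrow> bmap \<Rightarrow> bmap \<Rightarrow> bmap" where
  "cmp k \<phi> \<psi> \<equiv> compose (cube k) \<phi> \<psi>"

lemma cube_iff [simp]: "x \<in> cube n \<longleftrightarrow> length x = n"
  by (simp add: cube_def)

lemma Box_length: "\<phi> \<in> Box A m n \<Longrightarrow> length x = m \<Longrightarrow> length (\<phi> x) = n"
  using Box_ext[of \<phi> A m n] by (auto simp: PiE_iff)

lemma cmp_apply: "length x = k \<Longrightarrow> cmp k \<phi> \<psi> x = \<phi> (\<psi> x)"
  by (simp add: compose_def)

lemma bid_apply: "length x = n \<Longrightarrow> bid n x = x"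
  by (simp add: bid_def)

text \<open>The two memberships may refer to different sets of connections, so that a morphism of
  the smaller cube category can be compared with one only known to lie in the larger.\<close>

lemma Box_eqI:
  assumes "\<phi> \<in> Box A m n" "\<psi> \<in> Box B m n'" "\<And>x. length x = m \<Longrightarrow> \<phi> x = \<psi> x"
  shows "\<phi> = \<psi>"
  using assms Box_ext[of \<phi> A m n] Box_ext[of \<psi> B m n']
  by (intro extensionalityI[of _ "cube m"]) (auto simp: PiE_iff)

lemma Box_face: "1 \<le> i \<Longrightarrow> i \<le> n \<Longrightarrow> face n i e \<in> Box A (n - 1) n"
  unfolding Box_def by (blast intro: box_face)

lemma Box_face_Suc: "1 \<le> i \<Longrightarrow> i \<le> Suc n \<Longrightarrow> face (Suc n) i e \<in> Box A n (Suc n)"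
  using Box_face[of i "Suc n"] by simp
lemma Box_degen_Suc: "1 \<le> i \<Longrightarrow> i \<le> Suc n \<Longrightarrow> degen (Suc n) i \<in> Box A (Suc n) n"
  using Box_degen[of i "Suc n"] by simp
lemma Box_conn_Suc: "e \<in> A \<Longrightarrow> 1 \<le> i \<Longrightarrow> i < Suc n \<Longrightarrow> conn (Suc n) i e \<in> Box A (Suc n) n"
  using Box_conn[of e A i "Suc n"] by simp

lemma length_face: "length x = n \<Longrightarrow> i \<le> n \<Longrightarrow> length (face (Suc n) (Suc i) e x) = Suc n"
  by (auto simp: face_def)
lemma length_degen: "length x = Suc n \<Longrightarrow> i \<le> n \<Longrightarrow> length (degen (Suc n) (Suc i) x) = n"
  by (auto simp: degen_def)
lemma length_conn: "length x = Suc n \<Longrightarrow> i < n \<Longrightarrow> length (conn (Suc n) (Suc i) e x) = n"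
  by (auto simp: conn_def)

lemma nth_face:
  "length x = n \<Longrightarrow> i \<le> n \<Longrightarrow> k \<le> n \<Longrightarrow>
   face (Suc n) (Suc i) e x ! k = (if k < i then x ! k else if k = i then e else x ! (k - 1))"
  by (auto simp: face_def nth_append nth_Cons' min_def)
lemma nth_degen:
  "length x = Suc n \<Longrightarrow> i \<le> n \<Longrightarrow> k < n \<Longrightarrow>
   degen (Suc n) (Suc i) x ! k = (if k < i then x ! k else x ! Suc k)"
  by (auto simp: degen_def nth_append min_def)
lemma nth_conn:
  "length x = Suc n \<Longrightarrow> i < n \<Longrightarrow> k < n \<Longrightarrow>
   conn (Suc n) (Suc i) e x ! k = (if k < i then x ! k
     else if k = i then (if e then x ! i \<and> x ! Suc i else x ! i \<or> x ! Suc i)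
     else x ! Suc k)"
  by (auto simp: conn_def nth_append nth_Cons' min_def max_def)

lemmas cube_simps = length_face length_degen length_conn nth_face nth_degen nth_conn cmp_apply bid_apply

section \<open>The cubical identities, with coordinates counted from zero\<close>

lemma degen_face: "i \<le> n \<Longrightarrow> cmp n (degen (Suc n) (Suc i)) (face (Suc n) (Suc i) e) = bid n"
  by (rule Box_eqI[OF Box_comp[OF Box_degen_Suc Box_face_Suc] Box_id])
    (simp_all add: list_eq_iff_nth_eq cube_simps, (intro allI impI conjI; simp)?)

lemma degen_face_less:
  "i \<le> j \<Longrightarrow> j \<le> n \<Longrightarrow>
   cmp (Suc n) (degen (Suc (Suc n)) (Suc i)) (face (Suc (Suc n)) (Suc (Suc j)) e) =
   cmp (Suc n) (face (Suc n) (Suc j) e) (degen (Suc n) (Suc i))"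
  by (rule Box_eqI[OF Box_comp[OF Box_degen_Suc Box_face_Suc] Box_comp[OF Box_face_Suc Box_degen_Suc]])
    (simp_all add: list_eq_iff_nth_eq cube_simps, (intro allI impI conjI; simp)?)

lemma degen_face_greater:
  "j \<le> i \<Longrightarrow> i \<le> n \<Longrightarrow>
   cmp (Suc n) (degen (Suc (Suc n)) (Suc (Suc i))) (face (Suc (Suc n)) (Suc j) e) =
   cmp (Suc n) (face (Suc n) (Suc j) e) (degen (Suc n) (Suc i))"
  by (rule Box_eqI[OF Box_comp[OF Box_degen_Suc Box_face_Suc] Box_comp[OF Box_face_Suc Box_degen_Suc]])
    (simp_all add: list_eq_iff_nth_eq cube_simps, (intro allI impI conjI; simp)?)

text \<open>The value \<open>e\<close> is arbitrary here, so the membership needed for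
  extensionality is taken in the cube category \<open>Box UNIV\<close> with both connections. The
  same holds for the later identities with connections.\<close>

lemma conn_face_less:
  assumes "i < j" "j \<le> n"
  shows "cmp (Suc n) (conn (Suc (Suc n)) (Suc i) e) (face (Suc (Suc n)) (Suc (Suc j)) d) =
    cmp (Suc n) (face (Suc n) (Suc j) d) (conn (Suc n) (Suc i) e)"
  by (rule Box_eqI[OF Box_comp[OF Box_conn_Suc[of e UNIV] Box_face_Suc]
        Box_comp[OF Box_face_Suc Box_conn_Suc[of e UNIV]]])
    (use assms in \<open>simp_all add: list_eq_iff_nth_eq cube_simps, (intro allI impI conjI; simp)?\<close>)

lemma conn_face_greater:
  assumes "j \<le> i" "i < n"
  shows "cmp (Suc n) (conn (Suc (Suc n)) (Suc (Suc i)) e) (face (Suc (Suc n)) (Suc j) d) =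
    cmp (Suc n) (face (Suc n) (Suc j) d) (conn (Suc n) (Suc i) e)"
  by (rule Box_eqI[OF Box_comp[OF Box_conn_Suc[of e UNIV] Box_face_Suc]
        Box_comp[OF Box_face_Suc Box_conn_Suc[of e UNIV]]])
    (use assms in \<open>simp_all add: list_eq_iff_nth_eq cube_simps, (intro allI impI conjI; simp)?\<close>)

lemma conn_face_neutral:
  assumes "i < n"
  shows "cmp n (conn (Suc n) (Suc i) e) (face (Suc n) (Suc i) e) = bid n"
  by (rule Box_eqI[OF Box_comp[OF Box_conn_Suc[of e UNIV] Box_face_Suc] Box_id])
    (use assms in \<open>simp_all add: list_eq_iff_nth_eq cube_simps, (intro allI impI conjI; simp)?\<close>)

lemma conn_face_neutral_Suc:
  assumes "i < n"
  shows "cmp n (conn (Suc n) (Suc i) e) (face (Suc n) (Suc (Suc i)) e) = bid n"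
  by (rule Box_eqI[OF Box_comp[OF Box_conn_Suc[of e UNIV] Box_face_Suc] Box_id])
    (use assms in \<open>simp_all add: list_eq_iff_nth_eq cube_simps, (intro allI impI conjI; simp)?\<close>)

text \<open>At the absorbing value a connection forgets its other argument, which is why a
  degeneracy appears on the right.\<close>

lemma conn_face_absorbing:
  assumes "i \<le> n"
  shows "cmp (Suc n) (conn (Suc (Suc n)) (Suc i) e) (face (Suc (Suc n)) (Suc i) (\<not> e)) =
    cmp (Suc n) (face (Suc n) (Suc i) (\<not> e)) (degen (Suc n) (Suc i))"
  by (rule Box_eqI[OF Box_comp[OF Box_conn_Suc[of e UNIV] Box_face_Suc]
        Box_comp[OF Box_face_Suc Box_degen_Suc]])
    (use assms in \<open>simp_all add: list_eq_iff_nth_eq cube_simps, (intro allI impI conjI; simp)?\<close>)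

lemma conn_face_absorbing_Suc:
  assumes "i \<le> n"
  shows "cmp (Suc n) (conn (Suc (Suc n)) (Suc i) e) (face (Suc (Suc n)) (Suc (Suc i)) (\<not> e)) =
    cmp (Suc n) (face (Suc n) (Suc i) (\<not> e)) (degen (Suc n) (Suc i))"
  by (rule Box_eqI[OF Box_comp[OF Box_conn_Suc[of e UNIV] Box_face_Suc]
        Box_comp[OF Box_face_Suc Box_degen_Suc]])
    (use assms in \<open>simp_all add: list_eq_iff_nth_eq cube_simps, (intro allI impI conjI; simp)?\<close>)

lemma face_face:
  assumes "j \<le> l" "l \<le> n"
  shows "cmp n (face (Suc (Suc n)) (Suc (Suc l)) d) (face (Suc n) (Suc j) e) =
    cmp n (face (Suc (Suc n)) (Suc j) e) (face (Suc n) (Suc l) d)"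
  by (rule Box_eqI[OF Box_comp[OF Box_face_Suc Box_face_Suc] Box_comp[OF Box_face_Suc Box_face_Suc]])
    (use assms in \<open>simp_all add: list_eq_iff_nth_eq cube_simps, (intro allI impI conjI; simp)?\<close>)

lemma degen_degen:
  assumes "i \<le> j" "j \<le> n"
  shows "cmp (Suc (Suc n)) (degen (Suc n) (Suc i)) (degen (Suc (Suc n)) (Suc (Suc j))) =
    cmp (Suc (Suc n)) (degen (Suc n) (Suc j)) (degen (Suc (Suc n)) (Suc i))"
  by (rule Box_eqI[OF Box_comp[OF Box_degen_Suc Box_degen_Suc] Box_comp[OF Box_degen_Suc Box_degen_Suc]])
    (use assms in \<open>simp_all add: list_eq_iff_nth_eq cube_simps, (intro allI impI conjI; simp)?\<close>)

lemma degen_conn_less: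
  assumes "i \<le> j" "j < n"
  shows "cmp (Suc (Suc n)) (degen (Suc n) (Suc i)) (conn (Suc (Suc n)) (Suc (Suc j)) e) =
    cmp (Suc (Suc n)) (conn (Suc n) (Suc j) e) (degen (Suc (Suc n)) (Suc i))"
  by (rule Box_eqI[OF Box_comp[OF Box_degen_Suc Box_conn_Suc[of e UNIV]]
        Box_comp[OF Box_conn_Suc[of e UNIV] Box_degen_Suc]])
    (use assms in \<open>simp_all add: list_eq_iff_nth_eq cube_simps, (intro allI impI conjI; simp)?\<close>)

lemma degen_conn_greater:
  assumes "j < i" "i \<le> n"
  shows "cmp (Suc (Suc n)) (degen (Suc n) (Suc i)) (conn (Suc (Suc n)) (Suc j) e) =
    cmp (Suc (Suc n)) (conn (Suc n) (Suc j) e) (degen (Suc (Suc n)) (Suc (Suc i)))"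
  by (rule Box_eqI[OF Box_comp[OF Box_degen_Suc Box_conn_Suc[of e UNIV]]
        Box_comp[OF Box_conn_Suc[of e UNIV] Box_degen_Suc]])
    (use assms in \<open>simp_all add: list_eq_iff_nth_eq cube_simps, (intro allI impI conjI; simp)?\<close>)

lemma degen_conn_same:
  assumes "j \<le> n"
  shows "cmp (Suc (Suc n)) (degen (Suc n) (Suc j)) (conn (Suc (Suc n)) (Suc j) e) =
    cmp (Suc (Suc n)) (degen (Suc n) (Suc j)) (degen (Suc (Suc n)) (Suc j))"
  by (rule Box_eqI[OF Box_comp[OF Box_degen_Suc Box_conn_Suc[of e UNIV]]
        Box_comp[OF Box_degen_Suc Box_degen_Suc]])
    (use assms in \<open>simp_all add: list_eq_iff_nth_eq cube_simps, (intro allI impI conjI; simp)?\<close>)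

lemma conn_conn_less:
  assumes "i < j" "j < n"
  shows "cmp (Suc (Suc n)) (conn (Suc n) (Suc i) e) (conn (Suc (Suc n)) (Suc (Suc j)) d) =
    cmp (Suc (Suc n)) (conn (Suc n) (Suc j) d) (conn (Suc (Suc n)) (Suc i) e)"
  by (rule Box_eqI[OF Box_comp[OF Box_conn_Suc[of e UNIV] Box_conn_Suc[of d UNIV]]
        Box_comp[OF Box_conn_Suc[of d UNIV] Box_conn_Suc[of e UNIV]]])
    (use assms in \<open>simp_all add: list_eq_iff_nth_eq cube_simps, (intro allI impI conjI; simp)?\<close>)

text \<open>Associativity of \<open>min\<close> or \<open>max\<close>: both sides join the same
  three adjacent coordinates.\<close>

lemma conn_conn_same:
  assumes "i < n"
  shows "cmp (Suc (Suc n)) (conn (Suc n) (Suc i) e) (conn (Suc (Suc n)) (Suc (Suc i)) e) =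
    cmp (Suc (Suc n)) (conn (Suc n) (Suc i) e) (conn (Suc (Suc n)) (Suc i) e)"
  by (rule Box_eqI[OF Box_comp[OF Box_conn_Suc[of e UNIV] Box_conn_Suc[of e UNIV]]
        Box_comp[OF Box_conn_Suc[of e UNIV] Box_conn_Suc[of e UNIV]]])
    (use assms in \<open>simp_all add: list_eq_iff_nth_eq cube_simps, (intro allI impI conjI; simp)?\<close>)

section \<open>Juxtaposition of morphisms and splitting along a cut of the target\<close>

lemma cube_addE:
  assumes "length x = a + b"
  obtains u v where "x = u @ v" "length u = a" "length v = b"
  using assms that[of "take a x" "drop a x"] by simp

lemma juxtapose_apply:
  "length u = a \<Longrightarrow> length v = b \<Longrightarrow> juxtapose a b \<phi> \<psi> (u @ v) = \<phi> u @ \<psi> v"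
  by (simp add: juxtapose_def)

lemma face_append: "length u = n \<Longrightarrow> length v = q \<Longrightarrow> i \<le> n \<Longrightarrow>
  face (Suc (n + q)) (Suc i) e (u @ v) = face (Suc n) (Suc i) e u @ v"
  by (simp add: face_def)
lemma face_append_right: "length u = p \<Longrightarrow> length v = n \<Longrightarrow>
  face (Suc (p + n)) (Suc (p + i)) e (u @ v) = u @ face (Suc n) (Suc i) e v"
  by (simp add: face_def)
lemma degen_append: "length u = Suc n \<Longrightarrow> length v = q \<Longrightarrow> i \<le> n \<Longrightarrow>
  degen (Suc (n + q)) (Suc i) (u @ v) = degen (Suc n) (Suc i) u @ v"
  by (simp add: degen_def)
lemma degen_append_right: "length u = p \<Longrightarrow> length v = Suc n \<Longrightarrow>
  degen (Suc (p + n)) (Suc (p + i)) (u @ v) = u @ degen (Suc n) (Suc i) v"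
  by (simp add: degen_def)
lemma conn_append: "length u = Suc n \<Longrightarrow> length v = q \<Longrightarrow> i < n \<Longrightarrow>
  conn (Suc (n + q)) (Suc i) e (u @ v) = conn (Suc n) (Suc i) e u @ v"
  by (simp add: conn_def nth_append)
lemma conn_append_right: "length u = p \<Longrightarrow> length v = Suc n \<Longrightarrow>
  conn (Suc (p + n)) (Suc (p + i)) e (u @ v) = u @ conn (Suc n) (Suc i) e v"
  by (auto simp: conn_def nth_append)

lemmas append_simps = face_append face_append_right degen_append degen_append_right
  conn_append conn_append_right

text \<open>The rule \<open>box_comp\<close> composes arbitrary morphisms; associativity rearranges
  any composite so that one generator at a time is applied on the left. The source then stays fixed
  during the induction, which suits statements about the target.\<close>

lemma is_box_left_induct [consumes 1, case_names id face degen conn]: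
  assumes "is_box A m n \<phi>"
    and "\<And>m. P m m (bid m)"
    and "\<And>k i n e \<psi>. is_box A k n \<psi> \<Longrightarrow> P k n \<psi> \<Longrightarrow> i \<le> n \<Longrightarrow>
           P k (Suc n) (cmp k (face (Suc n) (Suc i) e) \<psi>)"
    and "\<And>k i n \<psi>. is_box A k (Suc n) \<psi> \<Longrightarrow> P k (Suc n) \<psi> \<Longrightarrow> i \<le> n \<Longrightarrow>
           P k n (cmp k (degen (Suc n) (Suc i)) \<psi>)"
    and "\<And>k i n e \<psi>. is_box A k (Suc n) \<psi> \<Longrightarrow> P k (Suc n) \<psi> \<Longrightarrow> e \<in> A \<Longrightarrow> i < n \<Longrightarrow>
           P k n (cmp k (conn (Suc n) (Suc i) e) \<psi>)"
  shows "P m n \<phi>"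
proof -
  have "P k n (cmp k \<phi> \<psi>)" if "is_box A k m \<psi>" "P k m \<psi>" for k \<psi>
    using assms(1) that
  proof (induction arbitrary: k \<psi> rule: is_box.induct)
    case (box_id n)
    then show ?case using compose_bid_left[of \<psi> A k n] by (simp add: Box_def)
  next
    case (box_face i n e)
    then obtain i' n' where "i = Suc i'" "n = Suc n'" by (cases i; cases n) auto
    then show ?case using box_face assms(3) by simp
  next
    case (box_degen i n)
    then obtain i' n' where "i = Suc i'" "n = Suc n'" by (cases i; cases n) auto
    then show ?case using box_degen assms(4) by simp
  next
    case (box_conn e i n)
    then obtain i' n' where "i = Suc i'" "n = Suc n'" by (cases i; cases n) auto
    then show ?case using box_conn assms(5) by simp
  next
    case (box_comp m n \<phi> l \<psi>')
    have "cmp k (cmp l \<phi> \<psi>') \<psi> = cmp k \<phi> (cmp k \<psi>' \<psi>)"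
      using compose_assoc_Box[of \<psi> A k l] box_comp.prems by (simp add: Box_def)
    moreover have "is_box A k m (cmp k \<psi>' \<psi>)"
      using box_comp.hyps box_comp.prems is_box.box_comp by blast
    ultimately show ?case using box_comp by simp
  qed
  from this[of m "bid m"] have "P m n (cmp m \<phi> (bid m))"
    using assms(2) is_box.box_id by blast
  then show ?thesis using compose_bid_right[of \<phi> A m n] assms(1) by (simp add: Box_def)
qed

lemma juxtapose_extensional: "juxtapose a b \<phi> \<psi> \<in> extensional (cube (a + b))"
  by (simp add: juxtapose_def)

lemma juxtapose_eqI:
  assumes "\<theta> \<in> Box A (a + b) n"
    and "\<And>u v. length u = a \<Longrightarrow> length v = b \<Longrightarrow> \<theta> (u @ v) = \<phi> u @ \<psi> v"
  shows "juxtapose a b \<phi> \<psi> = \<theta>"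
proof (rule extensionalityI[of _ "cube (a + b)"])
  show "\<theta> \<in> extensional (cube (a + b))" using Box_ext[OF assms(1)] by (auto simp: PiE_iff)
  show "juxtapose a b \<phi> \<psi> x = \<theta> x" if "x \<in> cube (a + b)" for x
  proof -
    from that have "length x = a + b" by simp
    then obtain u v where "x = u @ v" "length u = a" "length v = b" by (rule cube_addE)
    then show ?thesis using assms(2) by (simp add: juxtapose_apply)
  qed
qed (rule juxtapose_extensional)

lemma juxtapose_bid_bid: "juxtapose a b (bid a) (bid b) = bid (a + b)"
  by (rule juxtapose_eqI[OF Box_id]) (simp add: bid_apply)

lemma Box_juxtapose_bid: "\<phi> \<in> Box A m n \<Longrightarrow> juxtapose m q \<phi> (bid q) \<in> Box A (m + q) (n + q)"
  unfolding Box_def mem_Collect_eq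
proof (induction rule: is_box_left_induct)
  case (id m) then show ?case by (simp add: juxtapose_bid_bid is_box.box_id)
next
  case (face k i n e \<psi>)
  have "cmp (k + q) (face (Suc (n + q)) (Suc i) e) (juxtapose k q \<psi> (bid q)) \<in> Box A (k + q) (Suc (n + q))"
    using face by (intro Box_comp[OF Box_face_Suc]) (auto simp: Box_def)
  moreover have "juxtapose k q (cmp k (face (Suc n) (Suc i) e) \<psi>) (bid q) =
      cmp (k + q) (face (Suc (n + q)) (Suc i) e) (juxtapose k q \<psi> (bid q))"
    using face Box_length[of \<psi> A k n]
    by (intro juxtapose_eqI[OF calculation]) (simp add: cmp_apply juxtapose_apply bid_apply append_simps Box_def)
  ultimately show ?case by (simp add: Box_def)
next
  case (degen k i n \<psi>)
  have "cmp (k + q) (degen (Suc (n + q)) (Suc i)) (juxtapose k q \<psi> (bid q)) \<in> Box A (k + q) (n + q)"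
    using degen by (intro Box_comp[OF Box_degen_Suc]) (auto simp: Box_def)
  moreover have "juxtapose k q (cmp k (degen (Suc n) (Suc i)) \<psi>) (bid q) =
      cmp (k + q) (degen (Suc (n + q)) (Suc i)) (juxtapose k q \<psi> (bid q))"
    using degen Box_length[of \<psi> A k "Suc n"]
    by (intro juxtapose_eqI[OF calculation]) (simp add: cmp_apply juxtapose_apply bid_apply append_simps Box_def)
  ultimately show ?case by (simp add: Box_def)
next
  case (conn k i n e \<psi>)
  have "cmp (k + q) (conn (Suc (n + q)) (Suc i) e) (juxtapose k q \<psi> (bid q)) \<in> Box A (k + q) (n + q)"
    using conn by (intro Box_comp[OF Box_conn_Suc]) (auto simp: Box_def)
  moreover have "juxtapose k q (cmp k (conn (Suc n) (Suc i) e) \<psi>) (bid q) =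
      cmp (k + q) (conn (Suc (n + q)) (Suc i) e) (juxtapose k q \<psi> (bid q))"
    using conn Box_length[of \<psi> A k "Suc n"]
    by (intro juxtapose_eqI[OF calculation]) (simp add: cmp_apply juxtapose_apply bid_apply append_simps Box_def)
  ultimately show ?case by (simp add: Box_def)
qed

lemma Box_bid_juxtapose: "\<phi> \<in> Box A m n \<Longrightarrow> juxtapose p m (bid p) \<phi> \<in> Box A (p + m) (p + n)"
  unfolding Box_def mem_Collect_eq
proof (induction rule: is_box_left_induct)
  case (id m) then show ?case by (simp add: juxtapose_bid_bid is_box.box_id)
next
  case (face k i n e \<psi>)
  have "cmp (p + k) (face (Suc (p + n)) (Suc (p + i)) e) (juxtapose p k (bid p) \<psi>) \<in> Box A (p + k) (Suc (p + n))"
    using face by (intro Box_comp[OF Box_face_Suc]) (auto simp: Box_def)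
  moreover have "juxtapose p k (bid p) (cmp k (face (Suc n) (Suc i) e) \<psi>) =
      cmp (p + k) (face (Suc (p + n)) (Suc (p + i)) e) (juxtapose p k (bid p) \<psi>)"
    using face Box_length[of \<psi> A k n]
    by (intro juxtapose_eqI[OF calculation]) (simp add: cmp_apply juxtapose_apply bid_apply append_simps Box_def)
  ultimately show ?case by (simp add: Box_def)
next
  case (degen k i n \<psi>)
  have "cmp (p + k) (degen (Suc (p + n)) (Suc (p + i))) (juxtapose p k (bid p) \<psi>) \<in> Box A (p + k) (p + n)"
    using degen by (intro Box_comp[OF Box_degen_Suc]) (auto simp: Box_def)
  moreover have "juxtapose p k (bid p) (cmp k (degen (Suc n) (Suc i)) \<psi>) =
      cmp (p + k) (degen (Suc (p + n)) (Suc (p + i))) (juxtapose p k (bid p) \<psi>)"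
    using degen Box_length[of \<psi> A k "Suc n"]
    by (intro juxtapose_eqI[OF calculation]) (simp add: cmp_apply juxtapose_apply bid_apply append_simps Box_def)
  ultimately show ?case by (simp add: Box_def)
next
  case (conn k i n e \<psi>)
  have "cmp (p + k) (conn (Suc (p + n)) (Suc (p + i)) e) (juxtapose p k (bid p) \<psi>) \<in> Box A (p + k) (p + n)"
    using conn by (intro Box_comp[OF Box_conn_Suc]) (auto simp: Box_def)
  moreover have "juxtapose p k (bid p) (cmp k (conn (Suc n) (Suc i) e) \<psi>) =
      cmp (p + k) (conn (Suc (p + n)) (Suc (p + i)) e) (juxtapose p k (bid p) \<psi>)"
    using conn Box_length[of \<psi> A k "Suc n"]
    by (intro juxtapose_eqI[OF calculation]) (simp add: cmp_apply juxtapose_apply bid_apply append_simps Box_def)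
  ultimately show ?case by (simp add: Box_def)
qed

lemma juxtapose_cmp:
  assumes "\<phi>' \<in> Box A a' a" "\<psi>' \<in> Box B b' b"
  shows "cmp (a' + b') (juxtapose a b \<phi> \<psi>) (juxtapose a' b' \<phi>' \<psi>') =
    juxtapose a' b' (cmp a' \<phi> \<phi>') (cmp b' \<psi> \<psi>')"
proof (rule extensionalityI[of _ "cube (a' + b')"])
  fix x assume "x \<in> cube (a' + b')"
  then have "length x = a' + b'" by simp
  then obtain u v where "x = u @ v" "length u = a'" "length v = b'" by (rule cube_addE)
  then show "cmp (a' + b') (juxtapose a b \<phi> \<psi>) (juxtapose a' b' \<phi>' \<psi>') x =
      juxtapose a' b' (cmp a' \<phi> \<phi>') (cmp b' \<psi> \<psi>') x"
    using Box_length[OF assms(1), of u] Box_length[OF assms(2), of v]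
    by (simp add: juxtapose_apply cmp_apply)
qed (auto simp: juxtapose_extensional)

lemma Box_juxtapose:
  assumes "\<phi> \<in> Box A a p" "\<psi> \<in> Box A b q"
  shows "juxtapose a b \<phi> \<psi> \<in> Box A (a + b) (p + q)"
proof -
  have "cmp (a + b) (juxtapose a q \<phi> (bid q)) (juxtapose a b (bid a) \<psi>) = juxtapose a b \<phi> \<psi>"
    using assms by (simp add: juxtapose_cmp[OF Box_id assms(2)] compose_bid_left compose_bid_right)
  then show ?thesis
    using Box_comp[OF Box_juxtapose_bid[OF assms(1)] Box_bid_juxtapose[OF assms(2)]] by metis
qed

lemma cmp_assoc:
  fixes \<chi> \<phi> \<theta> :: bmap
  shows "\<theta> \<in> Box A k m \<Longrightarrow> cmp k (cmp m \<chi> \<phi>) \<theta> = cmp k \<chi> (cmp k \<phi> \<theta>)"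
  by (rule compose_assoc_Box)

text \<open>Each generator changes outputs on one side of the cut only. For a degeneracy or a
  connection the induction hypothesis is used with the cut of a target that has one more coordinate,
  on the side where the generator acts. The splitting is not unique: an input that is deleted next
  to the cut can be counted with either factor.\<close>

lemma Box_splitE:
  assumes "\<theta> \<in> Box A m (p + q)"
  obtains a b \<phi> \<psi> where "m = a + b" "\<phi> \<in> Box A a p" "\<psi> \<in> Box A b q" "\<theta> = juxtapose a b \<phi> \<psi>"
proof -
  have "\<forall>p q. n = p + q \<longrightarrow> (\<exists>a b \<phi> \<psi>. m = a + b \<and> \<phi> \<in> Box A a p \<and> \<psi> \<in> Box A b q \<and> \<theta> = juxtapose a b \<phi> \<psi>)"
    if "is_box A m n \<theta>" for n
    using that
  proof (induction rule: is_box_left_induct)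
    case (id m)
    then show ?case using Box_id juxtapose_bid_bid by metis
  next
    case (face k i n e \<theta>)
    show ?case
    proof (intro allI impI)
      fix p q assume pq: "Suc n = p + q"
      show "\<exists>a b \<phi> \<psi>. k = a + b \<and> \<phi> \<in> Box A a p \<and> \<psi> \<in> Box A b q \<and>
          cmp k (face (Suc n) (Suc i) e) \<theta> = juxtapose a b \<phi> \<psi>"
      proof (cases "i < p")
        case True
        then obtain p' where p: "p = Suc p'" "i \<le> p'" by (cases p) auto
        with pq face.IH[rule_format, of p' q] obtain a b \<phi> \<psi> where *: "k = a + b" "\<phi> \<in> Box A a p'" "\<psi> \<in> Box A b q"
          "\<theta> = juxtapose a b \<phi> \<psi>" by auto
        have "juxtapose a b (cmp a (face (Suc p') (Suc i) e) \<phi>) \<psi> = cmp k (face (Suc n) (Suc i) e) \<theta>"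
          using * p pq face.hyps Box_length[OF *(2)] Box_length[OF *(3)] Box_comp[OF Box_face_Suc, of "Suc i" n \<theta> A k e]
          by (intro juxtapose_eqI[of _ A _ _ "Suc n"]) (auto simp: cmp_apply juxtapose_apply append_simps Box_def)
        moreover have "cmp a (face (Suc p') (Suc i) e) \<phi> \<in> Box A a p"
          using p Box_comp[OF Box_face_Suc *(2), of "Suc i" e] by simp
        ultimately show ?thesis using * by metis
      next
        case False
        then obtain i' q' where i: "i = p + i'" "q = Suc q'" "n = p + q'" "i' \<le> q'" using pq face.hyps
          by (cases q) (auto simp: not_less le_iff_add)
        with face.IH[rule_format, of p q'] obtain a b \<phi> \<psi> where *: "k = a + b" "\<phi> \<in> Box A a p" "\<psi> \<in> Box A b q'"
          "\<theta> = juxtapose a b \<phi> \<psi>" by auto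
        have "juxtapose a b \<phi> (cmp b (face (Suc q') (Suc i') e) \<psi>) = cmp k (face (Suc n) (Suc i) e) \<theta>"
          using * i pq face.hyps Box_length[OF *(2)] Box_length[OF *(3)] Box_comp[OF Box_face_Suc, of "Suc i" n \<theta> A k e]
          by (intro juxtapose_eqI[of _ A _ _ "Suc n"]) (auto simp: cmp_apply juxtapose_apply append_simps Box_def)
        moreover have "cmp b (face (Suc q') (Suc i') e) \<psi> \<in> Box A b q"
          using i Box_comp[OF Box_face_Suc *(3), of "Suc i'" e] by simp
        ultimately show ?thesis using * by metis
      qed
    qed
  next
    case (degen k i n \<theta>)
    show ?case
    proof (intro allI impI)
      fix p q assume pq: "n = p + q"
      show "\<exists>a b \<phi> \<psi>. k = a + b \<and> \<phi> \<in> Box A a p \<and> \<psi> \<in> Box A b q \<and>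
          cmp k (degen (Suc n) (Suc i)) \<theta> = juxtapose a b \<phi> \<psi>"
      proof (cases "i < p")
        case True
        from degen.IH[rule_format, of "Suc p" q] pq obtain a b \<phi> \<psi> where *: "k = a + b" "\<phi> \<in> Box A a (Suc p)" "\<psi> \<in> Box A b q"
          "\<theta> = juxtapose a b \<phi> \<psi>" by auto
        have "juxtapose a b (cmp a (degen (Suc p) (Suc i)) \<phi>) \<psi> = cmp k (degen (Suc n) (Suc i)) \<theta>"
          using * True pq degen.hyps Box_length[OF *(2)] Box_length[OF *(3)] Box_comp[OF Box_degen_Suc, of "Suc i" n \<theta> A k]
          by (intro juxtapose_eqI[of _ A _ _ n]) (auto simp: cmp_apply juxtapose_apply append_simps Box_def)
        moreover have "cmp a (degen (Suc p) (Suc i)) \<phi> \<in> Box A a p"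
          using True Box_comp[OF Box_degen_Suc *(2), of "Suc i"] by simp
        ultimately show ?thesis using * by metis
      next
        case False
        then obtain i' where i: "i = p + i'" "i' \<le> q" using pq degen.hyps
          by (auto simp: not_less le_iff_add)
        from degen.IH[rule_format, of p "Suc q"] pq obtain a b \<phi> \<psi> where *: "k = a + b" "\<phi> \<in> Box A a p" "\<psi> \<in> Box A b (Suc q)"
          "\<theta> = juxtapose a b \<phi> \<psi>" by auto
        have "juxtapose a b \<phi> (cmp b (degen (Suc q) (Suc i')) \<psi>) = cmp k (degen (Suc n) (Suc i)) \<theta>"
          using * i pq degen.hyps Box_length[OF *(2)] Box_length[OF *(3)] Box_comp[OF Box_degen_Suc, of "Suc i" n \<theta> A k]
          by (intro juxtapose_eqI[of _ A _ _ n]) (auto simp: cmp_apply juxtapose_apply append_simps Box_def)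
        moreover have "cmp b (degen (Suc q) (Suc i')) \<psi> \<in> Box A b q"
          using i Box_comp[OF Box_degen_Suc *(3), of "Suc i'"] by simp
        ultimately show ?thesis using * by metis
      qed
    qed
  next
    case (conn k i n e \<theta>)
    show ?case
    proof (intro allI impI)
      fix p q assume pq: "n = p + q"
      show "\<exists>a b \<phi> \<psi>. k = a + b \<and> \<phi> \<in> Box A a p \<and> \<psi> \<in> Box A b q \<and>
          cmp k (conn (Suc n) (Suc i) e) \<theta> = juxtapose a b \<phi> \<psi>"
      proof (cases "i < p")
        case True
        from conn.IH[rule_format, of "Suc p" q] pq obtain a b \<phi> \<psi> where *: "k = a + b" "\<phi> \<in> Box A a (Suc p)" "\<psi> \<in> Box A b q"
          "\<theta> = juxtapose a b \<phi> \<psi>" by auto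
        have "juxtapose a b (cmp a (conn (Suc p) (Suc i) e) \<phi>) \<psi> = cmp k (conn (Suc n) (Suc i) e) \<theta>"
          using * True pq conn.hyps Box_length[OF *(2)] Box_length[OF *(3)] Box_comp[OF Box_conn_Suc, of e A "Suc i" n \<theta> k]
          by (intro juxtapose_eqI[of _ A _ _ n]) (auto simp: cmp_apply juxtapose_apply append_simps Box_def)
        moreover have "cmp a (conn (Suc p) (Suc i) e) \<phi> \<in> Box A a p"
          using True conn.hyps Box_comp[OF Box_conn_Suc *(2), of e "Suc i"] by simp
        ultimately show ?thesis using * by metis
      next
        case False
        then obtain i' where i: "i = p + i'" "i' < q" using pq conn.hyps
          by (auto simp: not_less le_iff_add)
        from conn.IH[rule_format, of p "Suc q"] pq obtain a b \<phi> \<psi> where *: "k = a + b" "\<phi> \<in> Box A a p" "\<psi> \<in> Box A b (Suc q)"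
          "\<theta> = juxtapose a b \<phi> \<psi>" by auto
        have "juxtapose a b \<phi> (cmp b (conn (Suc q) (Suc i') e) \<psi>) = cmp k (conn (Suc n) (Suc i) e) \<theta>"
          using * i pq conn.hyps Box_length[OF *(2)] Box_length[OF *(3)] Box_comp[OF Box_conn_Suc, of e A "Suc i" n \<theta> k]
          by (intro juxtapose_eqI[of _ A _ _ n]) (auto simp: cmp_apply juxtapose_apply append_simps Box_def)
        moreover have "cmp b (conn (Suc q) (Suc i') e) \<psi> \<in> Box A b q"
          using i conn.hyps Box_comp[OF Box_conn_Suc *(3), of e "Suc i'"] by simp
        ultimately show ?thesis using * by metis
      qed
    qed
  qed
  moreover have "is_box A m (p + q) \<theta>" using assms by (simp add: Box_def)
  ultimately show ?thesis using that by blast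
qed

section \<open>Factorization of morphisms, injectivity and the boundary\<close>

inductive facemap :: "nat \<Rightarrow> nat \<Rightarrow> bmap \<Rightarrow> bool" where
  id: "facemap n n (bid n)"
| face: "facemap m n \<psi> \<Longrightarrow> i \<le> n \<Longrightarrow> facemap m (Suc n) (cmp m (face (Suc n) (Suc i) e) \<psi>)"

definition generator :: "bool set \<Rightarrow> nat \<Rightarrow> bmap \<Rightarrow> bool" where
  "generator A m \<sigma> \<longleftrightarrow> (\<exists>i\<le>m. \<sigma> = degen (Suc m) (Suc i)) \<or> (\<exists>i<m. \<exists>e\<in>A. \<sigma> = conn (Suc m) (Suc i) e)"

definition in_facet :: "nat \<Rightarrow> nat \<Rightarrow> bool \<Rightarrow> bmap \<Rightarrow> bool" where
  "in_facet m j e \<theta> \<longleftrightarrow> (\<forall>x. length x = m \<longrightarrow> \<theta> x ! j = e)"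

text \<open>Having a constant output coordinate means factoring through a facet, so these are the
  cubes of the boundary of the n-cube.\<close>

definition bdry :: "nat \<Rightarrow> nat \<Rightarrow> bmap \<Rightarrow> bool" where
  "bdry m n \<theta> \<longleftrightarrow> (\<exists>j<n. \<exists>e. in_facet m j e \<theta>)"

lemma generator_degen: "i \<le> m \<Longrightarrow> generator A m (degen (Suc m) (Suc i))"
  and generator_conn: "i < m \<Longrightarrow> e \<in> A \<Longrightarrow> generator A m (conn (Suc m) (Suc i) e)"
  by (auto simp: generator_def)

lemma generator_Box: "generator A m \<sigma> \<Longrightarrow> \<sigma> \<in> Box A (Suc m) m"
  by (auto simp: generator_def intro: Box_degen_Suc Box_conn_Suc)

lemma facemap_Box: "facemap m n \<phi> \<Longrightarrow> \<phi> \<in> Box A m n"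
  by (induction rule: facemap.induct) (auto intro: Box_id Box_comp[OF Box_face_Suc])

text \<open>The generator is pushed to the right through the faces by the cubical identities. Either
  it meets a face that cancels it, and a composite of faces remains, or it emerges as a generator
  applied first.\<close>

lemma generator_facemap:
  assumes "facemap m n \<psi>" "generator A n' \<sigma>" "n = Suc n'"
  shows "facemap m n' (cmp m \<sigma> \<psi>) \<or>
    (\<exists>m' \<tau> \<beta>. m = Suc m' \<and> generator A m' \<tau> \<and> \<beta> \<in> Box A m' n' \<and> cmp m \<sigma> \<psi> = cmp m \<beta> \<tau>)"
  using assms
proof (induction arbitrary: n' \<sigma> rule: facemap.induct)
  case (id n)
  then have "\<sigma> \<in> Box A n n'" using generator_Box by simp
  then have "cmp n \<sigma> (bid n) = cmp n (bid n') \<sigma>"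
    by (simp add: compose_bid_left compose_bid_right)
  then show ?case using id Box_id by blast
next
  case (face m n \<psi> j d)
  have nn: "n' = n" using face.prems by simp
  have \<psi>: "\<psi> \<in> Box A m n" using face.hyps(1) by (rule facemap_Box)
  have assoc: "cmp m \<sigma> (cmp m (face (Suc n) (Suc j) d) \<psi>) = cmp m (cmp n \<sigma> (face (Suc n) (Suc j) d)) \<psi>"
    by (simp add: cmp_assoc[OF \<psi>])
  \<comment> \<open>All identities without cancellation have this shape: the generator passes the
    outermost face, possibly turning into another generator, and meets the remaining faces.\<close>
  have step: ?case if eq: "cmp n \<sigma> (face (Suc n) (Suc j) d) = cmp n (face n (Suc j') d') \<tau>"
    "generator A k \<tau>" "n = Suc k" "j' \<le> k" for j' d' \<tau> k
  proof -
    have 1: "cmp m \<sigma> (cmp m (face (Suc n) (Suc j) d) \<psi>) = cmp m (face n (Suc j') d') (cmp m \<tau> \<psi>)"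
      by (simp add: assoc eq(1) cmp_assoc[OF \<psi>])
    from face.IH[OF eq(2,3)] show ?thesis
    proof
      assume "facemap m k (cmp m \<tau> \<psi>)"
      from facemap.face[OF this eq(4), of d'] have "facemap m n (cmp m (face n (Suc j') d') (cmp m \<tau> \<psi>))"
        by (simp add: eq(3))
      then show ?thesis using 1 nn by metis
    next
      assume "\<exists>m' \<tau>' \<beta>. m = Suc m' \<and> generator A m' \<tau>' \<and> \<beta> \<in> Box A m' k \<and> cmp m \<tau> \<psi> = cmp m \<beta> \<tau>'"
      then obtain m' \<tau>' \<beta> where *: "m = Suc m'" "generator A m' \<tau>'" "\<beta> \<in> Box A m' k" "cmp m \<tau> \<psi> = cmp m \<beta> \<tau>'"
        by blast
      have "cmp m (face n (Suc j') d') (cmp m \<beta> \<tau>') = cmp m (cmp m' (face n (Suc j') d') \<beta>) \<tau>'"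
        unfolding *(1) by (rule cmp_assoc[OF generator_Box[OF *(2)], symmetric])
      moreover have "cmp m' (face n (Suc j') d') \<beta> \<in> Box A m' n"
        using * eq Box_comp[OF Box_face_Suc[of "Suc j'" k]] by simp
      ultimately show ?thesis using 1 * nn by metis
    qed
  qed
  have idc: ?case if "cmp n \<sigma> (face (Suc n) (Suc j) d) = bid n"
    using assoc that face.hyps nn compose_bid_left[OF \<psi>] by simp
  from \<open>generator A n' \<sigma>\<close> consider
    (deg) i where "i \<le> n" "\<sigma> = degen (Suc n) (Suc i)" | (con) i e where "i < n" "e \<in> A" "\<sigma> = conn (Suc n) (Suc i) e"
    unfolding generator_def nn by blast
  then show ?case
  proof cases
    case deg
    consider "i = j" | "i < j" | "j < i" by linarith
    then show ?thesis
    proof cases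
      case 1 then show ?thesis using idc degen_face deg by simp
    next
      case 2
      then obtain k j' where "n = Suc k" "j = Suc j'" using deg face.hyps(2) by (cases j; cases n) auto
      then show ?thesis using 2 deg face.hyps(2) by (intro step[of j' d "degen (Suc k) (Suc i)"]) (auto simp: degen_face_less generator_degen generator_conn)
    next
      case 3
      then obtain k i' where "n = Suc k" "i = Suc i'" using deg face.hyps(2) by (cases i; cases n) auto
      then show ?thesis using 3 deg face.hyps(2) by (intro step[of j d "degen (Suc k) (Suc i')"]) (auto simp: degen_face_greater generator_degen generator_conn)
    qed
  next
    case con
    then obtain k where k: "n = Suc k" by (cases n) auto
    consider "d = e" "j = i \<or> j = Suc i" | "d = (\<not> e)" "j = i \<or> j = Suc i" | "j < i" | "Suc i < j" by linarith
    then show ?thesis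
    proof cases
      case 1 then show ?thesis using idc con conn_face_neutral conn_face_neutral_Suc by blast
    next
      case 2
      have "cmp n \<sigma> (face (Suc n) (Suc j) d) = cmp n (face n (Suc i) d) (degen n (Suc i))"
        unfolding 2(1) con(3) k
        using 2(2) con(1) k conn_face_absorbing[of i k e] conn_face_absorbing_Suc[of i k e] by auto
      then show ?thesis using con k
        by (intro step[of i d "degen (Suc k) (Suc i)"]) (auto simp: generator_degen)
    next
      case 3
      then obtain i' where "i = Suc i'" by (cases i) auto
      then show ?thesis using 3 con k face.hyps(2)
        by (intro step[of j d "conn (Suc k) (Suc i') e"]) (auto simp: conn_face_greater generator_degen generator_conn)
    next
      case 4
      then obtain j' where "j = Suc j'" by (cases j) auto
      then show ?thesis using 4 con k face.hyps(2)
        by (intro step[of j' d "conn (Suc k) (Suc i) e"]) (auto simp: conn_face_less generator_degen generator_conn)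
    qed
  qed
qed

text \<open>Half of a Reedy factorization: as long as a morphism is not a composite of faces, a
  degeneracy or a connection can be split off on the right.\<close>

lemma Box_factor:
  assumes "\<phi> \<in> Box A m n"
  shows "facemap m n \<phi> \<or>
    (\<exists>m' \<sigma> \<phi>'. m = Suc m' \<and> generator A m' \<sigma> \<and> \<phi>' \<in> Box A m' n \<and> \<phi> = cmp m \<phi>' \<sigma>)"
    (is "?F m n \<phi>")
proof -
  have gen: "?F k n (cmp k \<tau> \<psi>)" if "is_box A k (Suc n) \<psi>" "?F k (Suc n) \<psi>" "generator A n \<tau>" for k n \<tau> \<psi>
    using that(2)
  proof
    assume "facemap k (Suc n) \<psi>"
    then show ?thesis using generator_facemap[OF _ that(3)] by blast
  next
    assume "\<exists>m' \<sigma> \<phi>'. k = Suc m' \<and> generator A m' \<sigma> \<and> \<phi>' \<in> Box A m' (Suc n) \<and> \<psi> = cmp k \<phi>' \<sigma>"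
    then obtain m' \<sigma> \<phi>' where *: "k = Suc m'" "generator A m' \<sigma>" "\<phi>' \<in> Box A m' (Suc n)" "\<psi> = cmp k \<phi>' \<sigma>" by blast
    have "cmp k \<tau> \<psi> = cmp k (cmp m' \<tau> \<phi>') \<sigma>"
      using * by (simp add: cmp_assoc[OF generator_Box[OF *(2)]])
    then show ?thesis using * Box_comp[OF generator_Box[OF that(3)] *(3)] by blast
  qed
  have "?F m n \<phi>" if "is_box A m n \<phi>" for m n \<phi>
    using that
  proof (induction rule: is_box_left_induct)
    case (id m) then show ?case using facemap.id by blast
  next
    case (face k i n e \<psi>)
    from face.IH show ?case
    proof
      assume "facemap k n \<psi>" then show ?thesis using facemap.face face by blast
    next
      assume "\<exists>m' \<sigma> \<phi>'. k = Suc m' \<and> generator A m' \<sigma> \<and> \<phi>' \<in> Box A m' n \<and> \<psi> = cmp k \<phi>' \<sigma>"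
      then obtain m' \<sigma> \<phi>' where *: "k = Suc m'" "generator A m' \<sigma>" "\<phi>' \<in> Box A m' n" "\<psi> = cmp k \<phi>' \<sigma>" by blast
      have "cmp k (face (Suc n) (Suc i) e) \<psi> = cmp k (cmp m' (face (Suc n) (Suc i) e) \<phi>') \<sigma>"
        using * by (simp add: cmp_assoc[OF generator_Box[OF *(2)]])
      moreover have "cmp m' (face (Suc n) (Suc i) e) \<phi>' \<in> Box A m' (Suc n)"
        using * face by (intro Box_comp[OF Box_face_Suc]) auto
      ultimately show ?thesis using * by blast
    qed
  next
    case (degen k i n \<psi>) then show ?case by (intro gen) (auto simp: generator_def)
  next
    case (conn k i n e \<psi>) then show ?case by (intro gen) (auto simp: generator_def)
  qed
  then show ?thesis using assms by (simp add: Box_def)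
qed

lemma facemap_inj: "facemap m n \<phi> \<Longrightarrow> inj_on \<phi> (cube m)"
proof (induction rule: facemap.induct)
  case (id n) then show ?case by (simp add: inj_on_def bid_def)
next
  case (face m n \<psi> i e)
  have "\<psi> x = \<psi> y" if "face (Suc n) (Suc i) e (\<psi> x) = face (Suc n) (Suc i) e (\<psi> y)" "length x = m" "length y = m" for x y
  proof -
    have l: "length (\<psi> x) = n" "length (\<psi> y) = n"
      using that face.hyps Box_length[OF facemap_Box] by auto
    then have "degen (Suc n) (Suc i) (face (Suc n) (Suc i) e z) = z" if "length z = n" for z
      using fun_cong[OF degen_face[OF face.hyps(2), of e], of z] that by (simp add: cmp_apply bid_apply)
    then show ?thesis using l that by metis
  qed
  then show ?case using face.IH by (auto simp: inj_on_def cmp_apply)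
qed

lemma facemap_le: "facemap m n \<phi> \<Longrightarrow> m \<le> n \<and> (m = n \<longrightarrow> \<phi> = bid n)"
  by (induction rule: facemap.induct) auto

lemma in_facet_cmp: "\<psi> \<in> Box A k m \<Longrightarrow> in_facet m j e \<phi> \<Longrightarrow> in_facet k j e (cmp k \<phi> \<psi>)"
  using Box_length[of \<psi> A k m] by (auto simp: in_facet_def cmp_apply)

lemma bdry_cmp: "\<psi> \<in> Box A k m \<Longrightarrow> bdry m n \<phi> \<Longrightarrow> bdry k n (cmp k \<phi> \<psi>)"
  unfolding bdry_def using in_facet_cmp by blast

lemma in_facet_face: "\<psi> \<in> Box A m n \<Longrightarrow> i \<le> n \<Longrightarrow> in_facet m i e (cmp m (face (Suc n) (Suc i) e) \<psi>)"
  using Box_length[of \<psi> A m n] by (auto simp: in_facet_def cmp_apply nth_face)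

lemma facemap_bdry: "facemap m n \<phi> \<Longrightarrow> m \<noteq> n \<Longrightarrow> bdry m n \<phi>"
proof (induction rule: facemap.induct)
  case (face m n \<psi> i e)
  then show ?case unfolding bdry_def using in_facet_face[OF facemap_Box] by (metis less_Suc_eq_le)
qed simp

text \<open>Reinserting the constant value after deleting its coordinate changes nothing. The factor
  through the facet is given by an explicit degeneracy, so values on facets can later be defined
  without choosing factorizations.\<close>

lemma facet_factor:
  assumes "\<theta> \<in> Box A m (Suc n)" "j \<le> n" "in_facet m j e \<theta>"
  shows "\<theta> = cmp m (face (Suc n) (Suc j) e) (cmp m (degen (Suc n) (Suc j)) \<theta>)"
proof (rule Box_eqI[OF assms(1)])
  show "cmp m (face (Suc n) (Suc j) e) (cmp m (degen (Suc n) (Suc j)) \<theta>) \<in> Box A m (Suc n)"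
    using assms by (intro Box_comp[OF Box_face_Suc] Box_comp[OF Box_degen_Suc]) auto
  fix x :: "bool list" assume x: "length x = m"
  have "length (\<theta> x) = Suc n" "\<theta> x ! j = e" using x assms Box_length by (auto simp: in_facet_def)
  then show "\<theta> x = cmp m (face (Suc n) (Suc j) e) (cmp m (degen (Suc n) (Suc j)) \<theta>) x"
    using x assms(2)
    by (simp add: list_eq_iff_nth_eq cube_simps) (intro allI impI conjI; simp)
qed

lemma generator_not_inj:
  assumes "generator A m \<sigma>"
  shows "\<not> inj_on \<sigma> (cube (Suc m))"
proof -
  obtain i e where i: "i \<le> m" and \<sigma>: "\<sigma> = degen (Suc m) (Suc i) \<or> (\<sigma> = conn (Suc m) (Suc i) e \<and> i < m)"
    using assms that unfolding generator_def by (metis less_imp_le)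
  \<comment> \<open>Every coordinate has the absorbing value, so a connection does not notice when
    the i-th one becomes neutral; a degeneracy does not see the i-th coordinate at all.\<close>
  define x where "x = replicate (Suc m) (\<not> e)"
  have lx: "length x = Suc m" and nx: "x ! k = (\<not> e)" if "k \<le> m" for k
    using that by (simp_all add: x_def del: replicate_Suc)
  have "\<sigma> x = \<sigma> (x[i := e])"
    using \<sigma>
  proof
    assume "\<sigma> = degen (Suc m) (Suc i)"
    then show ?thesis using lx[OF i] by (simp add: degen_def)
  next
    assume "\<sigma> = conn (Suc m) (Suc i) e \<and> i < m"
    then have \<sigma>: "\<sigma> = conn (Suc m) (Suc i) e" "i < m" by auto
    have "conn (Suc m) (Suc i) e x ! k = conn (Suc m) (Suc i) e (x[i := e]) ! k" if "k < m" for k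
      using that \<sigma>(2) lx[OF i] nx by (cases e) (simp_all add: nth_conn nth_list_update)
    then show ?thesis using \<sigma> lx[OF i] by (simp add: list_eq_iff_nth_eq length_conn)
  qed
  moreover have "x \<noteq> x[i := e]" using i by (metis x_def length_replicate less_Suc_eq_le nth_list_update_eq nth_replicate)
  ultimately show ?thesis unfolding inj_on_def by (metis cube_iff length_list_update length_replicate x_def)
qed

lemma not_injE:
  assumes "\<phi> \<in> Box A m n" "\<not> inj_on \<phi> (cube m)"
  obtains m' \<sigma> \<phi>' where "m = Suc m'" "generator A m' \<sigma>" "\<phi>' \<in> Box A m' n" "\<phi> = cmp m \<phi>' \<sigma>"
  using Box_factor[OF assms(1)] assms(2) facemap_inj that by blast

text \<open>Injectivity excludes a generator in the factorization, leaving a composite of faces, and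
  only the empty composite avoids the boundary.\<close>

lemma inj_not_bdry:
  assumes "\<phi> \<in> Box A m n" "inj_on \<phi> (cube m)" "\<not> bdry m n \<phi>"
  shows "m = n" "\<phi> = bid n"
proof -
  have "facemap m n \<phi>"
  proof (rule ccontr)
    assume "\<not> facemap m n \<phi>"
    then obtain m' \<sigma> \<phi>' where *: "m = Suc m'" "generator A m' \<sigma>" "\<phi> = cmp m \<phi>' \<sigma>"
      using Box_factor[OF assms(1)] by blast
    then show False using generator_not_inj[OF *(2)] assms(2)
      by (auto simp: inj_on_def cmp_apply)
  qed
  then show "m = n" "\<phi> = bid n" using facemap_bdry assms(3) facemap_le by blast+
qed

lemma not_inj_cmp:
  assumes "\<psi> \<in> Box A k m" "\<not> inj_on \<psi> (cube k)"
  shows "\<not> inj_on (cmp k \<phi> \<psi>) (cube k)"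
proof -
  obtain x y where "length x = k" "length y = k" "x \<noteq> y" "\<psi> x = \<psi> y"
    using assms(2) by (auto simp: inj_on_def)
  then show ?thesis unfolding inj_on_def by (intro notI) (simp add: cmp_apply)
qed

lemma not_inj_degenerate:
  assumes "\<phi> \<in> Box A m n" "\<not> inj_on \<phi> (cube m)"
  shows "\<phi> \<in> degenerate A (boxset A n) m"
proof -
  obtain m' \<sigma> \<phi>' where *: "m = Suc m'" "generator A m' \<sigma>" "\<phi>' \<in> Box A m' n" "\<phi> = cmp m \<phi>' \<sigma>"
    using not_injE[OF assms] .
  from *(2) show ?thesis unfolding generator_def
  proof (elim disjE exE conjE bexE)
    fix i assume "i \<le> m'" "\<sigma> = degen (Suc m') (Suc i)"
    then have "\<exists>i y. \<phi> = cmp m y (degen m i) \<and> 1 \<le> i \<and> i \<le> m \<and> y \<in> Box A (m - 1) n"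
      using * by (intro exI[of _ "Suc i"] exI[of _ \<phi>']) auto
    then show ?thesis by (simp add: degenerate_def boxset_def mark_def Let_def)
  next
    fix i e assume "i < m'" "e \<in> A" "\<sigma> = conn (Suc m') (Suc i) e"
    then have "\<exists>i e y. \<phi> = cmp m y (conn m i e) \<and> e \<in> A \<and> 1 \<le> i \<and> i < m \<and> y \<in> Box A (m - 1) n"
      using * by (intro exI[of _ "Suc i"] exI[of _ e] exI[of _ \<phi>']) auto
    then show ?thesis by (simp add: degenerate_def boxset_def mark_def Let_def)
  qed
qed

section \<open>Extension of natural families along subcomplexes\<close>

text \<open>The unmarked version of \<open>marked_cubical_set\<close>. The auxiliary objects
  \<open>shift\<close> and \<open>conn_lifts\<close> carry no marked cubes, so they cannot in
  general satisfy the clause that degenerate cubes are marked.\<close>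

locale cubical_set =
  fixes A :: "bool set" and X :: "'a mcset"
  assumes act_closed: "\<phi> \<in> Box A m n \<Longrightarrow> x \<in> cells X n \<Longrightarrow> act X m n \<phi> x \<in> cells X m"
    and act_id: "x \<in> cells X n \<Longrightarrow> act X n n (bid n) x = x"
    and act_comp: "\<phi> \<in> Box A m n \<Longrightarrow> \<psi> \<in> Box A k m \<Longrightarrow> x \<in> cells X n \<Longrightarrow>
      act X k n (cmp k \<phi> \<psi>) x = act X k m \<psi> (act X m n \<phi> x)"

lemma (in marked_cubical_set) cubical: "cubical_set A X"
  by unfold_locales (auto intro: act_closed act_id act_comp)

text \<open>Splitting off generators only lowers the source dimension, and an injective remainder
  outside the boundary would be an identity, which the dimensions forbid.\<close>

lemma bdry_if_less:
  assumes "\<phi> \<in> Box A m n" "m < n"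
  shows "bdry m n \<phi>"
  using assms
proof (induction m arbitrary: \<phi> rule: less_induct)
  case (less m)
  show ?case
  proof (cases "inj_on \<phi> (cube m)")
    case True
    then show ?thesis using inj_not_bdry[OF less.prems(1)] less.prems(2) by blast
  next
    case False
    then obtain m' \<sigma> \<phi>' where *: "m = Suc m'" "generator A m' \<sigma>" "\<phi>' \<in> Box A m' n" "\<phi> = cmp m \<phi>' \<sigma>"
      using not_injE[OF less.prems(1)] by metis
    then have "bdry m' n \<phi>'" using less by simp
    then show ?thesis using bdry_cmp[OF generator_Box[OF *(2)]] * by simp
  qed
qed

lemma generator_section:
  assumes "generator A m \<sigma>"
  obtains s where "s \<in> Box A m (Suc m)" "cmp m \<sigma> s = bid m"
  using assms unfolding generator_def
proof (elim disjE exE conjE bexE)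
  fix i assume "i \<le> m" "\<sigma> = degen (Suc m) (Suc i)"
  then show thesis by (intro that[of "face (Suc m) (Suc i) True"]) (auto simp: degen_face intro: Box_face_Suc)
next
  fix i e assume "i < m" "e \<in> A" "\<sigma> = conn (Suc m) (Suc i) e"
  then show thesis by (intro that[of "face (Suc m) (Suc i) e"]) (auto simp: conn_face_neutral intro: Box_face_Suc)
qed

text \<open>A commuting square of degenerate operators in which a section of \<open>\<sigma>\<close> is compatible with the
  opposite side is an absolute pushout.\<close>

definition joinable :: "bool set \<Rightarrow> nat \<Rightarrow> bmap \<Rightarrow> bmap \<Rightarrow> bool" where
  "joinable A n \<sigma> \<tau> \<longleftrightarrow> (\<exists>k s s' \<tau>' \<sigma>'. n = Suc k \<and> s \<in> Box A n (Suc n) \<and> cmp n \<sigma> s = bid n \<and>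
     s' \<in> Box A k n \<and> \<tau>' \<in> Box A n k \<and> \<sigma>' \<in> Box A n k \<and>
     cmp n \<tau> s = cmp n s' \<tau>' \<and> cmp (Suc n) \<tau>' \<sigma> = cmp (Suc n) \<sigma>' \<tau>)"

text \<open>A case distinction over the cubical identities. What is left over are connections of
  opposite kind that share a coordinate: there \<open>min\<close> and \<open>max\<close> do not
  associate as equal kinds do in \<open>conn_conn_same\<close>.\<close>

lemma joinable_generators:
  assumes "generator A n \<sigma>" "generator A n \<tau>" "\<sigma> \<noteq> \<tau>"
  shows "joinable A n \<sigma> \<tau> \<or> joinable A n \<tau> \<sigma> \<or>
    (\<exists>i e. Suc i < n \<and> e \<in> A \<and> (\<not> e) \<in> A \<and>
       {\<sigma>, \<tau>} = {conn (Suc n) (Suc i) e, conn (Suc n) (Suc (Suc i)) (\<not> e)})"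
proof (cases n)
  case 0
  then show ?thesis using assms by (auto simp: generator_def)
next
  case (Suc k)
  have dd: "joinable A n (degen (Suc n) (Suc i)) (degen (Suc n) (Suc (Suc j)))" if "i \<le> j" "j \<le> k" for i j
    unfolding joinable_def using that Suc
    by (intro exI[of _ k] exI[of _ "face (Suc n) (Suc i) True"] exI[of _ "face n (Suc i) True"]
        exI[of _ "degen n (Suc j)"] exI[of _ "degen n (Suc i)"])
      (auto simp: degen_face degen_face_greater degen_degen intro!: Box_face_Suc Box_degen_Suc)
  have dc: "joinable A n (degen (Suc n) (Suc i)) (conn (Suc n) (Suc (Suc j)) e)" if "i \<le> j" "j < k" "e \<in> A" for i j e
    unfolding joinable_def using that Suc
    by (intro exI[of _ k] exI[of _ "face (Suc n) (Suc i) True"] exI[of _ "face n (Suc i) True"]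
        exI[of _ "conn n (Suc j) e"] exI[of _ "degen n (Suc i)"])
      (auto simp: degen_face conn_face_greater degen_conn_less intro!: Box_face_Suc Box_degen_Suc Box_conn_Suc)
  have cd: "joinable A n (degen (Suc n) (Suc (Suc i))) (conn (Suc n) (Suc j) e)" if "j < i" "i \<le> k" "e \<in> A" for i j e
    unfolding joinable_def using that Suc
    by (intro exI[of _ k] exI[of _ "face (Suc n) (Suc (Suc i)) True"] exI[of _ "face n (Suc i) True"]
        exI[of _ "conn n (Suc j) e"] exI[of _ "degen n (Suc i)"])
      (auto simp: degen_face conn_face_less degen_conn_greater intro!: Box_face_Suc Box_degen_Suc Box_conn_Suc)
  have dc0: "joinable A n (degen (Suc n) (Suc j)) (conn (Suc n) (Suc j) e)" if "j \<le> k" for j e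
    unfolding joinable_def using that Suc
    by (intro exI[of _ k] exI[of _ "face (Suc n) (Suc j) (\<not> e)"] exI[of _ "face n (Suc j) (\<not> e)"]
        exI[of _ "degen n (Suc j)"] exI[of _ "degen n (Suc j)"])
      (auto simp: degen_face conn_face_absorbing[of _ _ e, simplified] degen_conn_same intro!: Box_face_Suc Box_degen_Suc Box_conn_Suc)
  have dc1: "joinable A n (degen (Suc n) (Suc (Suc j))) (conn (Suc n) (Suc j) e)" if "j \<le> k" for j e
    unfolding joinable_def using that Suc
    by (intro exI[of _ k] exI[of _ "face (Suc n) (Suc (Suc j)) (\<not> e)"] exI[of _ "face n (Suc j) (\<not> e)"]
        exI[of _ "degen n (Suc j)"] exI[of _ "degen n (Suc j)"])
      (auto simp: degen_face conn_face_absorbing_Suc degen_conn_same degen_degen intro!: Box_face_Suc Box_degen_Suc Box_conn_Suc)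
  have cc: "joinable A n (conn (Suc n) (Suc i) e) (conn (Suc n) (Suc (Suc j)) d)" if "i < j" "j < k" "e \<in> A" "d \<in> A" for i j e d
    unfolding joinable_def using that Suc
    by (intro exI[of _ k] exI[of _ "face (Suc n) (Suc i) e"] exI[of _ "face n (Suc i) e"]
        exI[of _ "conn n (Suc j) d"] exI[of _ "conn n (Suc i) e"])
      (auto simp: conn_face_neutral conn_face_greater conn_conn_less intro!: Box_face_Suc Box_degen_Suc Box_conn_Suc)
  have cc1: "joinable A n (conn (Suc n) (Suc i) e) (conn (Suc n) (Suc (Suc i)) e)" if "i < k" "e \<in> A" for i e
    unfolding joinable_def using that Suc
    by (intro exI[of _ k] exI[of _ "face (Suc n) (Suc i) e"] exI[of _ "face n (Suc i) e"]
        exI[of _ "conn n (Suc i) e"] exI[of _ "conn n (Suc i) e"])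
      (auto simp: conn_face_neutral conn_face_greater conn_conn_same intro!: Box_face_Suc Box_degen_Suc Box_conn_Suc)
  have cc0: "joinable A n (conn (Suc n) (Suc i) e) (conn (Suc n) (Suc i) d)" if "i \<le> k" "d = (\<not> e)" for i e d
  proof -
    have "cmp n (conn (Suc n) (Suc i) d) (face (Suc n) (Suc i) e) = cmp n (face n (Suc i) e) (degen n (Suc i))"
      using conn_face_absorbing[of i k d] that Suc by simp
    moreover have "cmp n (conn (Suc n) (Suc i) e) (face (Suc n) (Suc i) e) = bid n"
      using that Suc by (simp add: conn_face_neutral)
    ultimately show ?thesis
      unfolding joinable_def using that Suc
      by (intro exI[of _ k] exI[of _ "face (Suc n) (Suc i) e"] exI[of _ "face n (Suc i) e"]
          exI[of _ "degen n (Suc i)"] exI[of _ "degen n (Suc i)"])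
        (auto simp: degen_conn_same intro!: Box_face_Suc Box_degen_Suc)
  qed
  have DD: "joinable A n (degen (Suc n) (Suc i)) (degen (Suc n) (Suc j))" if "i < j" "j \<le> n" for i j
    proof -
    obtain j' where "j = Suc j'" using \<open>i < j\<close> by (cases j) auto
    then show ?thesis using that Suc dd[of i j'] by simp
  qed
  have DC: "joinable A n (degen (Suc n) (Suc i)) (conn (Suc n) (Suc j) e)" if "i \<le> n" "j < n" "e \<in> A" for i j e
  proof -
    consider "i = j" | "i = Suc j" | "i < j" | "Suc j < i" by linarith
    then show ?thesis
    proof cases
      case 1 then show ?thesis using dc0[of j e] that Suc by simp
    next
      case 2 then show ?thesis using dc1[of j e] that Suc by simp
    next
      case 3
      then obtain j' where "j = Suc j'" by (cases j) auto
      then show ?thesis using 3 dc[of i j' e] that Suc by simp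
    next
      case 4
      then obtain i' where "i = Suc i'" by (cases i) auto
      then show ?thesis using 4 cd[of j i' e] that Suc by simp
    qed
  qed
  have CC: "joinable A n (conn (Suc n) (Suc i) e) (conn (Suc n) (Suc j) d) \<or>
      j = Suc i \<and> d = (\<not> e) \<or> i = j \<and> d = e" if ij: "i \<le> j" "j < n" "e \<in> A" "d \<in> A" for i j e d
  proof -
    have d: "d = e \<or> d = (\<not> e)" by blast
    consider "i = j" | "j = Suc i" | "Suc i < j" using ij(1) by linarith
    then show ?thesis
    proof cases
      case 1 then show ?thesis using d cc0[of i d e] ij(2) Suc by auto
    next
      case 2
      then show ?thesis using d cc1[of i e] ij(2,3) Suc by auto
    next
      case 3
      then obtain j' where "j = Suc j'" by (cases j) auto
      then show ?thesis using 3 cc[of i j' e d] ij Suc by simp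
    qed
  qed
  from assms(1) show ?thesis unfolding generator_def
  proof (elim disjE exE conjE bexE)
    fix i assume i: "i \<le> n" "\<sigma> = degen (Suc n) (Suc i)"
    from assms(2) show ?thesis unfolding generator_def
    proof (elim disjE exE conjE bexE)
      fix j assume j: "j \<le> n" "\<tau> = degen (Suc n) (Suc j)"
      then show ?thesis using i assms(3) DD[of i j] DD[of j i] by (metis linorder_neqE_nat)
    next
      fix j e assume j: "j < n" "e \<in> A" "\<tau> = conn (Suc n) (Suc j) e"
      then show ?thesis using i DC by blast
    qed
  next
    fix i e assume i: "i < n" "e \<in> A" "\<sigma> = conn (Suc n) (Suc i) e"
    from assms(2) show ?thesis unfolding generator_def
    proof (elim disjE exE conjE bexE)
      fix j assume j: "j \<le> n" "\<tau> = degen (Suc n) (Suc j)"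
      then show ?thesis using i DC by blast
    next
      fix j d assume j: "j < n" "d \<in> A" "\<tau> = conn (Suc n) (Suc j) d"
      show ?thesis
      proof (cases "i \<le> j")
        case True
        then consider "joinable A n \<sigma> \<tau>" | "j = Suc i" "d = (\<not> e)" | "i = j" "d = e"
          using CC[of i j e d] i j by blast
        then show ?thesis using i j assms(3) by cases blast+
      next
        case False
        with CC[of j i d e] i j have "joinable A n \<tau> \<sigma> \<or> i = Suc j \<and> e = (\<not> d)"
          by fastforce
        then show ?thesis
        proof (elim disjE conjE)
          assume ij: "i = Suc j" "e = (\<not> d)"
          then have "{\<sigma>, \<tau>} = {conn (Suc n) (Suc j) d, conn (Suc n) (Suc (Suc j)) (\<not> d)}"
            unfolding i(3) j(3) by blast
          then show ?thesis using i(1,2) j(1,2) ij by blast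
        qed blast
      qed
    qed
  qed
qed

text \<open>One cube can be degenerate in two ways, and a map defined below must give both
  presentations the same value. For joinable generators both presentations come from one cube of
  lower dimension, where naturality is already known.\<close>

lemma generator_agree:
  assumes X: "cubical_set A X" and P: "cubical_set A P"
    and h: "\<And>a x. a \<le> n \<Longrightarrow> x \<in> cells X a \<Longrightarrow> h a x \<in> cells P a"
    and nat: "\<And>a b \<phi> x. a \<le> n \<Longrightarrow> b \<le> n \<Longrightarrow> \<phi> \<in> Box A a b \<Longrightarrow> x \<in> cells X b \<Longrightarrow>
      h a (act X a b \<phi> x) = act P a b \<phi> (h b x)"
    and st: "generator A n \<sigma>" "generator A n \<tau>"
    and yz: "y \<in> cells X n" "z \<in> cells X n" "act X (Suc n) n \<sigma> y = act X (Suc n) n \<tau> z"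
  shows "act P (Suc n) n \<sigma> (h n y) = act P (Suc n) n \<tau> (h n z)"
proof -
  interpret X: cubical_set A X by (rule X)
  interpret P: cubical_set A P by (rule P)
  have cancel: "y = z" if g: "generator A n \<sigma>" and yz: "y \<in> cells X n" "z \<in> cells X n"
      "act X (Suc n) n \<sigma> y = act X (Suc n) n \<sigma> z" for \<sigma> y z
  proof -
    obtain s where s: "s \<in> Box A n (Suc n)" "cmp n \<sigma> s = bid n" using generator_section[OF g] .
    have "act X n (Suc n) s (act X (Suc n) n \<sigma> x) = x" if "x \<in> cells X n" for x
      using X.act_comp[OF generator_Box[OF g] s(1) that] s(2) X.act_id[OF that] by simp
    then show ?thesis using yz by metis
  qed
  have join: "act P (Suc n) n \<sigma> (h n y) = act P (Suc n) n \<tau> (h n z)"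
    if st: "generator A n \<sigma>" "generator A n \<tau>" "joinable A n \<sigma> \<tau>"
      and yz: "y \<in> cells X n" "z \<in> cells X n" "act X (Suc n) n \<sigma> y = act X (Suc n) n \<tau> z" for \<sigma> \<tau> y z
  proof -
    obtain k s s' \<tau>' \<sigma>' where n: "n = Suc k" and s: "s \<in> Box A n (Suc n)" "cmp n \<sigma> s = bid n"
      and s': "s' \<in> Box A k n" and t': "\<tau>' \<in> Box A n k" and o': "\<sigma>' \<in> Box A n k"
      and eq1: "cmp n \<tau> s = cmp n s' \<tau>'" and eq2: "cmp (Suc n) \<tau>' \<sigma> = cmp (Suc n) \<sigma>' \<tau>"
      using st(3) unfolding joinable_def by blast
    note gB = generator_Box[OF st(1)] generator_Box[OF st(2)]
    define w where "w = act X k n s' z"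
    have w: "w \<in> cells X k" unfolding w_def by (rule X.act_closed[OF s' yz(2)])
    have "y = act X n (Suc n) s (act X (Suc n) n \<sigma> y)"
      using X.act_comp[OF gB(1) s(1) yz(1)] s(2) X.act_id[OF yz(1)] by simp
    also have "\<dots> = act X n n (cmp n s' \<tau>') z"
      using X.act_comp[OF gB(2) s(1) yz(2)] yz(3) eq1 by simp
    finally have y: "y = act X n k \<tau>' w"
      using X.act_comp[OF s' t' yz(2)] by (simp add: w_def)
    have "act X (Suc n) n \<tau> z = act X (Suc n) k (cmp (Suc n) \<tau>' \<sigma>) w"
      using X.act_comp[OF t' gB(1) w] y yz(3) by simp
    also have "\<dots> = act X (Suc n) n \<tau> (act X n k \<sigma>' w)"
      using X.act_comp[OF o' gB(2) w] eq2 by simp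
    finally have z: "z = act X n k \<sigma>' w"
      using cancel[OF st(2) yz(2)] X.act_closed[OF o' w] by blast
    have hw: "h k w \<in> cells P k" using h w n by simp
    have "act P (Suc n) n \<sigma> (h n y) = act P (Suc n) k (cmp (Suc n) \<tau>' \<sigma>) (h k w)"
      using P.act_comp[OF t' gB(1) hw] nat[of n k \<tau>' w] t' w n y by simp
    also have "\<dots> = act P (Suc n) n \<tau> (h n z)"
      using P.act_comp[OF o' gB(2) hw] nat[of n k \<sigma>' w] o' w n z eq2 by simp
    finally show ?thesis .
  qed
  \<comment> \<open>Opposite connections sharing a coordinate are compared through a third generator
    \<rho>, which deletes the last of the three coordinates involved. Here \<open>y\<close> is
    itself degenerate, so the given cube is also obtained along \<rho>, and \<rho> is joinable with
    each of the two connections.\<close>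
  have special: "act P (Suc n) n \<sigma> (h n y) = act P (Suc n) n \<tau> (h n z)"
    if sp: "Suc i < n" "e \<in> A" "(\<not> e) \<in> A" and \<sigma>: "\<sigma> = conn (Suc n) (Suc i) e" and \<tau>: "\<tau> = conn (Suc n) (Suc (Suc i)) (\<not> e)"
      and yz: "y \<in> cells X n" "z \<in> cells X n" "act X (Suc n) n \<sigma> y = act X (Suc n) n \<tau> z" for i e \<sigma> \<tau> y z
  proof -
    obtain k where n: "n = Suc k" using sp by (cases n) auto
    define \<rho> where "\<rho> = degen (Suc n) (Suc (Suc (Suc i)))"
    have g: "generator A n \<sigma>" "generator A n \<tau>" "generator A n \<rho>"
      using sp by (auto simp: \<rho>_def \<sigma> \<tau> intro!: generator_degen generator_conn)
    let ?s = "face (Suc n) (Suc (Suc i)) e"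
    have s: "?s \<in> Box A n (Suc n)" "cmp n \<sigma> ?s = bid n"
      using sp by (auto simp: \<sigma> conn_face_neutral_Suc intro!: Box_face_Suc)
    have ts: "cmp n \<tau> ?s = cmp n (face n (Suc (Suc i)) e) (degen n (Suc (Suc i)))"
      using conn_face_absorbing[of "Suc i" k "\<not> e"] that n by simp
    have b: "face n (Suc (Suc i)) e \<in> Box A k n" "degen n (Suc (Suc i)) \<in> Box A n k" "conn n (Suc i) e \<in> Box A n k"
      using sp n by (auto intro!: Box_face_Suc Box_degen_Suc Box_conn_Suc)
    define w where "w = act X k n (face n (Suc (Suc i)) e) z"
    have w: "w \<in> cells X k" unfolding w_def by (rule X.act_closed[OF b(1) yz(2)])
    have "y = act X n (Suc n) ?s (act X (Suc n) n \<sigma> y)"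
      using X.act_comp[OF generator_Box[OF g(1)] s(1) yz(1)] s(2) X.act_id[OF yz(1)] by simp
    also have "\<dots> = act X n k (degen n (Suc (Suc i))) w"
      using X.act_comp[OF generator_Box[OF g(2)] s(1) yz(2)] X.act_comp[OF b(1,2) yz(2)] yz(3) ts by (simp add: w_def)
    finally have y: "y = act X n k (degen n (Suc (Suc i))) w" .
    have "act X (Suc n) n \<sigma> y = act X (Suc n) k (cmp (Suc n) (degen n (Suc (Suc i))) \<sigma>) w"
      using X.act_comp[OF b(2) generator_Box[OF g(1)] w] y by simp
    also have "cmp (Suc n) (degen n (Suc (Suc i))) \<sigma> = cmp (Suc n) (conn n (Suc i) e) \<rho>"
      using sp n by (simp add: \<rho>_def \<sigma> degen_conn_greater)
    also have "act X (Suc n) k \<dots> w = act X (Suc n) n \<rho> (act X n k (conn n (Suc i) e) w)"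
      by (rule X.act_comp[OF b(3) generator_Box[OF g(3)] w])
    finally have u: "act X (Suc n) n \<sigma> y = act X (Suc n) n \<rho> (act X n k (conn n (Suc i) e) w)" .
    have uc: "act X n k (conn n (Suc i) e) w \<in> cells X n" by (rule X.act_closed[OF b(3) w])
    have "joinable A n \<rho> \<sigma>"
      unfolding joinable_def using sp n
      by (intro exI[of _ k] exI[of _ "face (Suc n) (Suc (Suc (Suc i))) True"] exI[of _ "face n (Suc (Suc i)) True"]
          exI[of _ "conn n (Suc i) e"] exI[of _ "degen n (Suc (Suc i))"])
        (auto simp: \<rho>_def \<sigma> degen_face conn_face_less degen_conn_greater intro!: Box_face_Suc Box_degen_Suc Box_conn_Suc)
    moreover have "joinable A n \<rho> \<tau>"
      unfolding joinable_def using sp n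
      by (intro exI[of _ k] exI[of _ "face (Suc n) (Suc (Suc (Suc i))) e"] exI[of _ "face n (Suc (Suc i)) e"]
          exI[of _ "degen n (Suc (Suc i))"] exI[of _ "degen n (Suc (Suc i))"])
        (use conn_face_absorbing_Suc[of "Suc i" k "\<not> e"] in \<open>auto simp: \<rho>_def \<tau> degen_face degen_conn_same degen_degen intro!: Box_face_Suc Box_degen_Suc\<close>)
    ultimately show ?thesis
      using join[OF g(3,1) _ uc yz(1)] join[OF g(3,2) _ uc yz(2)] u yz(3) by metis
  qed
  show ?thesis
  proof (cases "\<sigma> = \<tau>")
    case True
    then show ?thesis using cancel[OF st(1) yz(1,2)] yz(3) by simp
  next
    case False
    from joinable_generators[OF st False]
    consider "joinable A n \<sigma> \<tau>" | "joinable A n \<tau> \<sigma>"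
      | i e where "Suc i < n" "e \<in> A" "(\<not> e) \<in> A"
          "\<sigma> = conn (Suc n) (Suc i) e" "\<tau> = conn (Suc n) (Suc (Suc i)) (\<not> e)"
      | i e where "Suc i < n" "e \<in> A" "(\<not> e) \<in> A"
          "\<tau> = conn (Suc n) (Suc i) e" "\<sigma> = conn (Suc n) (Suc (Suc i)) (\<not> e)"
      by (auto simp: doubleton_eq_iff)
    then show ?thesis
    proof cases
      case 1 then show ?thesis using join st yz by blast
    next
      case 2 then show ?thesis using join[OF st(2,1) _ yz(2,1) yz(3)[symmetric]] by simp
    next
      case 3 then show ?thesis using special yz by blast
    next
      case 4 then show ?thesis using special[OF _ _ _ _ _ yz(2,1) yz(3)[symmetric]] by metis
    qed
  qed
qed

text \<open>Relative skeletal induction, shared by the lifting of paths, by both fillers of the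
  connection lift and by the final extension over \<open>X\<close>. The relation \<open>R\<close>
  says that a value lies over given data; \<open>d\<close> is a compatible family of candidates for
  the facets. Faces alone suffice in \<open>fill_Suc\<close>, since degenerate cubes are handled by
  \<open>generator_agree\<close>.\<close>

locale extension_problem = X: cubical_set A X + P: cubical_set A P
  for A :: "bool set" and X :: "'a mcset" and P :: "'b mcset" +
  fixes W :: "nat \<Rightarrow> 'a set" and h0 :: "('a, 'b) mmap" and R :: "nat \<Rightarrow> 'a \<Rightarrow> 'b \<Rightarrow> bool"
  assumes W_cells: "W n \<subseteq> cells X n"
    and W_act: "\<phi> \<in> Box A m n \<Longrightarrow> x \<in> W n \<Longrightarrow> act X m n \<phi> x \<in> W m"
    and h0_cells: "x \<in> W n \<Longrightarrow> h0 n x \<in> cells P n"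
    and h0_act: "\<phi> \<in> Box A m n \<Longrightarrow> x \<in> W n \<Longrightarrow> h0 m (act X m n \<phi> x) = act P m n \<phi> (h0 n x)"
    and h0_R: "x \<in> W n \<Longrightarrow> R n x (h0 n x)"
    and R_act: "\<phi> \<in> Box A m n \<Longrightarrow> x \<in> cells X n \<Longrightarrow> z \<in> cells P n \<Longrightarrow> R n x z \<Longrightarrow>
      R m (act X m n \<phi> x) (act P m n \<phi> z)"
    and fill_0: "x \<in> cells X 0 - W 0 \<Longrightarrow> \<exists>z\<in>cells P 0. R 0 x z"
    and fill_Suc: "x \<in> cells X (Suc m) - W (Suc m) \<Longrightarrow>
      (\<And>j e. j \<le> m \<Longrightarrow> d j e \<in> cells P m \<and> R m (act X m (Suc m) (face (Suc m) (Suc j) e) x) (d j e)) \<Longrightarrow>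
      (\<And>k j l e e'. m = Suc k \<Longrightarrow> j \<le> l \<Longrightarrow> l \<le> k \<Longrightarrow>
        act P k m (face m (Suc j) e) (d (Suc l) e') = act P k m (face m (Suc l) e') (d j e)) \<Longrightarrow>
      \<exists>z\<in>cells P (Suc m). R (Suc m) x z \<and>
        (\<forall>j\<le>m. \<forall>e. act P m (Suc m) (face (Suc m) (Suc j) e) z = d j e)"
begin

definition partial :: "nat \<Rightarrow> ('a, 'b) mmap \<Rightarrow> bool" where
  "partial n h \<longleftrightarrow>
     (\<forall>a<n. \<forall>x\<in>cells X a. h a x \<in> cells P a \<and> R a x (h a x)) \<and>
     (\<forall>a<n. \<forall>x\<in>W a. h a x = h0 a x) \<and>
     (\<forall>a<n. \<forall>b<n. \<forall>\<phi>\<in>Box A a b. \<forall>x\<in>cells X b. h a (act X a b \<phi> x) = act P a b \<phi> (h b x))"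

lemma partial_step:
  assumes h: "partial n h"
  shows "\<exists>h'. partial (Suc n) h' \<and> (\<forall>a<n. h' a = h a)"
proof -
  have hc: "h a x \<in> cells P a" and hR: "R a x (h a x)" if "a < n" "x \<in> cells X a" for a x
    using h that unfolding partial_def by blast+
  have hW: "h a x = h0 a x" if "a < n" "x \<in> W a" for a x
    using h that unfolding partial_def by blast
  have hn: "h a (act X a b \<phi> x) = act P a b \<phi> (h b x)" if "a < n" "b < n" "\<phi> \<in> Box A a b" "x \<in> cells X b" for a b \<phi> x
    using h that unfolding partial_def by blast
  \<comment> \<open>All constraints on the value at \<open>x\<close> at once. The last two clauses
    are naturality for generators and for facets; \<open>Box_factor\<close> and
    \<open>bdry_if_less\<close> extend it to all morphisms.\<close>
  define good where "good x z \<longleftrightarrow> z \<in> cells P n \<and> R n x z \<and> (x \<in> W n \<longrightarrow> z = h0 n x) \<and>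
     (\<forall>m \<sigma> y. n = Suc m \<longrightarrow> generator A m \<sigma> \<longrightarrow> y \<in> cells X m \<longrightarrow> x = act X n m \<sigma> y \<longrightarrow> z = act P n m \<sigma> (h m y)) \<and>
     (\<forall>m j e. n = Suc m \<longrightarrow> j \<le> m \<longrightarrow> act P m n (face n (Suc j) e) z = h m (act X m n (face n (Suc j) e) x))" for x z
  have ex: "\<exists>z. good x z" if x: "x \<in> cells X n" for x
  proof -
    consider (W) "x \<in> W n" | (deg) m \<sigma> y where "x \<notin> W n" "n = Suc m" "generator A m \<sigma>" "y \<in> cells X m" "x = act X n m \<sigma> y"
      | (nd) "x \<notin> W n" "\<nexists>m \<sigma> y. n = Suc m \<and> generator A m \<sigma> \<and> y \<in> cells X m \<and> x = act X n m \<sigma> y"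
      by blast
    then show ?thesis
    proof cases
      case W
      have "good x (h0 n x)"
        unfolding good_def
      proof (intro conjI allI impI)
        fix m \<sigma> y assume m: "n = Suc m" and g: "generator A m \<sigma>" and y: "y \<in> cells X m" "x = act X n m \<sigma> y"
        \<comment> \<open>A cube of \<open>W\<close> may be degenerate. The section recovers
          \<open>y\<close> from it, so \<open>y\<close> lies in \<open>W\<close> as well and its
          value is prescribed too.\<close>
        obtain s where s: "s \<in> Box A m n" "cmp m \<sigma> s = bid m" using generator_section[OF g] m by auto
        have "y = act X m n s x"
          using X.act_comp[OF generator_Box[OF g] _ y(1), of s m] s y m X.act_id[OF y(1)] by simp
        then have "y \<in> W m" using W_act[OF s(1) W] by simp
        then show "h0 n x = act P n m \<sigma> (h m y)"
          using h0_act[OF generator_Box[OF g]] hW[of m y] m y by simp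
      next
        fix m j e assume "n = Suc m" "j \<le> m"
        then have f: "face n (Suc j) e \<in> Box A m n" by (simp add: Box_face_Suc)
        then show "act P m n (face n (Suc j) e) (h0 n x) = h m (act X m n (face n (Suc j) e) x)"
          using h0_act[OF f W] hW[of m] W_act[OF f W] \<open>n = Suc m\<close> by simp
      qed (use W h0_cells h0_R in auto)
      then show ?thesis ..
    next
      case deg
      note g = deg(3) and gB = generator_Box[OF deg(3)]
      have "good x (act P n m \<sigma> (h m y))"
        unfolding good_def
      proof (intro conjI allI impI)
        show "act P n m \<sigma> (h m y) \<in> cells P n" using P.act_closed[OF gB] hc deg by simp
        show "R n x (act P n m \<sigma> (h m y))" using R_act[OF gB deg(4)] hc hR deg by simp
        show "act P n m \<sigma> (h m y) = act P n m' \<sigma>' (h m' y')"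
          if "n = Suc m'" "generator A m' \<sigma>'" "y' \<in> cells X m'" "x = act X n m' \<sigma>' y'" for m' \<sigma>' y'
          using generator_agree[OF X.cubical_set_axioms P.cubical_set_axioms, of m h \<sigma> \<sigma>' y y'] hc hn deg that by auto
        show "act P m' n (face n (Suc j) e) (act P n m \<sigma> (h m y)) = h m' (act X m' n (face n (Suc j) e) x)"
          if "n = Suc m'" "j \<le> m'" for m' j e
        proof -
          have f: "face (Suc m) (Suc j) e \<in> Box A m (Suc m)" using that deg by (auto intro: Box_face_Suc)
          have "cmp m \<sigma> (face (Suc m) (Suc j) e) \<in> Box A m m" by (rule Box_comp[OF gB f])
          then have "h m (act X m m (cmp m \<sigma> (face (Suc m) (Suc j) e)) y) =
              act P m m (cmp m \<sigma> (face (Suc m) (Suc j) e)) (h m y)"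
            using hn[of m m] deg by blast
          then show ?thesis
            using P.act_comp[OF gB f, of "h m y"] X.act_comp[OF gB f deg(4)] hc[of m y] deg that by simp
        qed
      qed (use deg in auto)
      then show ?thesis ..
    next
      case nd
      show ?thesis
      proof (cases n)
        case 0
        then show ?thesis using fill_0[of x] nd x unfolding good_def by auto
      next
        case (Suc m)
        define d where "d j e = h m (act X m n (face n (Suc j) e) x)" for j e
        have f: "act X m n (face n (Suc j) e) x \<in> cells X m" if "j \<le> m" for j e
          using X.act_closed[OF Box_face_Suc] that x Suc by simp
        have "\<exists>z\<in>cells P (Suc m). R (Suc m) x z \<and>
            (\<forall>j\<le>m. \<forall>e. act P m (Suc m) (face (Suc m) (Suc j) e) z = d j e)"
        proof (rule fill_Suc)
          show "x \<in> cells X (Suc m) - W (Suc m)" using nd x Suc by simp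
          show "d j e \<in> cells P m \<and> R m (act X m (Suc m) (face (Suc m) (Suc j) e) x) (d j e)" if "j \<le> m" for j e
            using f[OF that, of e] hc hR Suc by (simp add: d_def)
          show "act P k m (face m (Suc j) e) (d (Suc l) e') = act P k m (face m (Suc l) e') (d j e)"
            if k: "m = Suc k" and jl: "j \<le> l" "l \<le> k" for k j l e e'
          proof -
            have b: "face m (Suc j) e \<in> Box A k m" "face m (Suc l) e' \<in> Box A k m"
              "face n (Suc (Suc l)) e' \<in> Box A m n" "face n (Suc j) e \<in> Box A m n"
              using k jl Suc by (auto intro!: Box_face_Suc)
            have "act P k m (face m (Suc j) e) (d (Suc l) e') = h k (act X k n (cmp k (face n (Suc (Suc l)) e') (face m (Suc j) e)) x)"
              unfolding d_def using X.act_comp[OF b(3,1) x] hn[of k m, OF _ _ b(1)] f[of "Suc l" e'] k jl Suc by simp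
            also have "\<dots> = h k (act X k n (cmp k (face n (Suc j) e) (face m (Suc l) e')) x)"
              using k jl Suc by (simp add: face_face)
            also have "\<dots> = act P k m (face m (Suc l) e') (d j e)"
              unfolding d_def using X.act_comp[OF b(4,2) x] hn[of k m, OF _ _ b(2)] f[of j e] k jl Suc by simp
            finally show ?thesis .
          qed
        qed
        then obtain z where "z \<in> cells P n" "R n x z" "\<And>j e. j \<le> m \<Longrightarrow> act P m n (face n (Suc j) e) z = d j e"
          using Suc by auto
        then have "good x z" using nd Suc unfolding good_def d_def by blast
        then show ?thesis ..
      qed
    qed
  qed
  define k where "k x = (SOME z. good x z)" for x
  have k: "good x (k x)" if "x \<in> cells X n" for x
    unfolding k_def using ex[OF that] by (rule someI_ex)
  define h' where "h' = h(n := k)"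
  have h'n: "h' n = k" and h'l: "a < n \<Longrightarrow> h' a = h a" for a by (auto simp: h'_def)
  have kc: "k x \<in> cells P n" if "x \<in> cells X n" for x using k[OF that] by (simp add: good_def)
  have kg: "k (act X n m \<sigma> y) = act P n m \<sigma> (h m y)" if "n = Suc m" "generator A m \<sigma>" "y \<in> cells X m" for m \<sigma> y
    using k[of "act X n m \<sigma> y"] X.act_closed[OF generator_Box] that unfolding good_def by blast
  have kf: "h m (act X m n (face n (Suc j) e) x) = act P m n (face n (Suc j) e) (k x)" if "n = Suc m" "j \<le> m" "x \<in> cells X n" for m j e x
    using k[OF that(3)] that unfolding good_def by auto
  \<comment> \<open>A morphism from a lower dimension lies in a facet, so the clause of
    \<open>good\<close> about facets is enough.\<close>
  have nat1: "h a (act X a n \<phi> x) = act P a n \<phi> (k x)" if a: "a < n" and \<phi>: "\<phi> \<in> Box A a n" and x: "x \<in> cells X n" for a \<phi> x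
  proof -
    obtain m where m: "n = Suc m" using a by (cases n) auto
    obtain j e where j: "j \<le> m" "in_facet a j e \<phi>" using bdry_if_less[OF \<phi> a] m unfolding bdry_def by (metis less_Suc_eq_le)
    define \<psi> where "\<psi> = cmp a (degen n (Suc j)) \<phi>"
    have \<psi>: "\<psi> \<in> Box A a m" unfolding \<psi>_def using \<phi> m j by (intro Box_comp[OF _ \<phi>]) (auto intro!: Box_degen_Suc)
    have f: "face n (Suc j) e \<in> Box A m n" using m j by (auto intro!: Box_face_Suc)
    have eq: "\<phi> = cmp a (face n (Suc j) e) \<psi>" unfolding \<psi>_def using facet_factor[of \<phi> A a m j e] \<phi> j m by simp
    have "act X a n \<phi> x = act X a m \<psi> (act X m n (face n (Suc j) e) x)"
      unfolding eq by (rule X.act_comp[OF f \<psi> x])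
    then have "h a (act X a n \<phi> x) = act P a m \<psi> (act P m n (face n (Suc j) e) (k x))"
      using hn[OF a _ \<psi>] X.act_closed[OF f x] kf[OF m j(1) x] m by simp
    then show ?thesis unfolding eq using P.act_comp[OF f \<psi> kc[OF x]] by simp
  qed
  have nat: "h' a (act X a b \<phi> x) = act P a b \<phi> (h' b x)"
    if ab: "a \<le> n" "b \<le> n" and \<phi>: "\<phi> \<in> Box A a b" and x: "x \<in> cells X b" for a b \<phi> x
  proof (cases "a = n")
    case False
    then show ?thesis
    proof (cases "b = n")
      case True
      then show ?thesis using False nat1[of a \<phi> x] ab \<phi> x h'n h'l by simp
    next
      case F: False
      then show ?thesis using False hn[of a b \<phi> x] ab \<phi> x h'l by simp
    qed
  next
    case True
    from Box_factor[OF \<phi>] show ?thesis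
    proof
      assume "facemap a b \<phi>"
      then have "b = n" "\<phi> = bid n" using facemap_le[of a b \<phi>] ab True by auto
      then show ?thesis using X.act_id P.act_id x True h'n kc by auto
    next
      assume "\<exists>m \<sigma> \<psi>. a = Suc m \<and> generator A m \<sigma> \<and> \<psi> \<in> Box A m b \<and> \<phi> = cmp a \<psi> \<sigma>"
      then obtain m \<sigma> \<psi> where *: "n = Suc m" "generator A m \<sigma>" "\<psi> \<in> Box A m b" "\<phi> = cmp n \<psi> \<sigma>"
        using True by auto
      note gB = generator_Box[OF *(2)]
      have c: "h' b x \<in> cells P b" using ab(2) x kc hc h'n h'l by (cases "b = n") auto
      have "h m (act X m b \<psi> x) = act P m b \<psi> (h' b x)"
        using ab(2) x hn[of m b \<psi> x] nat1[of m \<psi> x] * h'n h'l by (cases "b = n") auto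
      then have "h' n (act X n b \<phi> x) = act P n m \<sigma> (act P m b \<psi> (h' b x))"
        using X.act_comp[OF *(3) gB x] kg[OF *(1,2) X.act_closed[OF *(3) x]] * h'n by simp
      then show ?thesis using P.act_comp[OF *(3) gB c] * True by simp
    qed
  qed
  have "partial (Suc n) h'"
    unfolding partial_def
  proof (intro conjI allI impI ballI)
    fix a x assume a: "a < Suc n" "x \<in> cells X a"
    show "h' a x \<in> cells P a" using a kc hc h'n h'l by (cases "a = n") auto
    show "R a x (h' a x)" using a k hR h'n h'l by (cases "a = n") (auto simp: good_def)
  next
    fix a x assume a: "a < Suc n" "x \<in> W a"
    then have "x \<in> cells X a" using W_cells by blast
    then show "h' a x = h0 a x" using a k[of x] hW h'n h'l by (cases "a = n") (auto simp: good_def)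
  qed (use nat in auto)
  then show ?thesis using h'l by blast
qed

theorem extension:
  obtains h where "\<And>n x. x \<in> cells X n \<Longrightarrow> h n x \<in> cells P n" "\<And>n x. x \<in> cells X n \<Longrightarrow> R n x (h n x)"
    "\<And>n x. x \<in> W n \<Longrightarrow> h n x = h0 n x"
    "\<And>m n \<phi> x. \<phi> \<in> Box A m n \<Longrightarrow> x \<in> cells X n \<Longrightarrow> h m (act X m n \<phi> x) = act P m n \<phi> (h n x)"
proof -
  \<comment> \<open>Each step leaves the lower dimensions unchanged, hence the diagonal values
    \<open>F (Suc a) a\<close> fit together.\<close>
  have "\<exists>F. \<forall>n. partial n (F n) \<and> (\<forall>a<n. F (Suc n) a = F n a)"
  proof (rule dependent_nat_choice)
    show "\<exists>h. partial 0 h" by (simp add: partial_def)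
  qed (use partial_step in blast)
  then obtain F where F: "\<And>n. partial n (F n)" "\<And>n a. a < n \<Longrightarrow> F (Suc n) a = F n a" by blast
  define h where "h a = F (Suc a) a" for a
  have hF: "F n a = h a" if "a < n" for n a
    using that
  proof (induction n)
    case (Suc n)
    then show ?case using F(2)[of a n] by (cases "a = n") (auto simp: h_def)
  qed simp
  show ?thesis
  proof (rule that[of h])
    fix n x assume x: "x \<in> cells X n"
    show "h n x \<in> cells P n" "R n x (h n x)" using F(1)[of "Suc n"] x unfolding partial_def h_def by auto
  next
    fix n x assume "x \<in> W n"
    then show "h n x = h0 n x" using F(1)[of "Suc n"] unfolding partial_def h_def by auto
  next
    fix m n \<phi> x assume "\<phi> \<in> Box A m n" "x \<in> cells X n"
    moreover have "partial (Suc (m + n)) (F (Suc (m + n)))" by (rule F(1))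
    moreover have "m < Suc (m + n)" "n < Suc (m + n)" by simp_all
    ultimately have "F (Suc (m + n)) m (act X m n \<phi> x) = act P m n \<phi> (F (Suc (m + n)) n x)"
      unfolding partial_def by blast
    then show "h m (act X m n \<phi> x) = act P m n \<phi> (h n x)" by (simp add: hF)
  qed
qed

end

section \<open>Lifting against comical generators, cube by cube\<close>

lemma face_word_Cons:
  assumes "face_word n ((c, e) # cs)"
  obtains m i where "n = Suc m" "c = Suc i" "i \<le> m" "face_word m cs" "\<And>c' e'. (c', e') \<in> set cs \<Longrightarrow> c' \<le> i"
proof -
  obtain m i where mi: "n = Suc m" "c = Suc i" using assms by (cases n; cases c) (auto simp: face_word_def)
  have "c' \<le> i" if "(c', e') \<in> set cs" for c' e'
    using assms that mi by (force simp: face_word_def)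
  moreover from this have "face_word m cs"
    using assms mi by (fastforce simp: face_word_def)
  ultimately show thesis using that[of m i] assms mi by (auto simp: face_word_def)
qed

lemma word_face_facemap: "face_word n cs \<Longrightarrow> length cs \<le> n \<and> facemap (n - length cs) n (word_face n cs)"
proof (induction cs arbitrary: n)
  case Nil then show ?case by (simp add: facemap.id)
next
  case (Cons a cs)
  obtain c e where a: "a = (c, e)" by (cases a)
  obtain m i where *: "n = Suc m" "c = Suc i" "i \<le> m" "face_word m cs"
    using Cons.prems face_word_Cons unfolding a by blast
  show ?case using Cons.IH[OF *(4)] * facemap.face[of "m - length cs" m "word_face m cs" i e] a by auto
qed

lemma word_face_Box: "face_word n cs \<Longrightarrow> word_face n cs \<in> Box A (n - length cs) n"
  using word_face_facemap facemap_Box by blast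

lemma word_face_in_facet:
  "face_word n cs \<Longrightarrow> (Suc j, e) \<in> set cs \<Longrightarrow> in_facet (n - length cs) j e (word_face n cs)"
proof (induction cs arbitrary: n)
  case (Cons a cs)
  obtain c d where a: "a = (c, d)" by (cases a)
  obtain m i where *: "n = Suc m" "c = Suc i" "i \<le> m" "face_word m cs"
      and le: "\<And>c' e'. (c', e') \<in> set cs \<Longrightarrow> c' \<le> i"
    using Cons.prems face_word_Cons unfolding a by metis
  note B = word_face_Box[OF *(4), of UNIV]
  have eq: "word_face n (a # cs) = cmp (m - length cs) (face (Suc m) (Suc i) d) (word_face m cs)"
    using * a by simp
  show ?case
  proof (cases "(Suc j, e) = a")
    case True
    then show ?thesis using in_facet_face[OF B *(3), of d] * a eq by simp
  next
    case False
    then have j: "(Suc j, e) \<in> set cs" using Cons.prems by auto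
    then have "j < i" using le by fastforce
    then show ?thesis using Cons.IH[OF *(4) j] Box_length[OF B] * eq
      by (auto simp: in_facet_def cmp_apply nth_face)
  qed
qed simp

text \<open>With \<open>word_face_in_facet\<close> this identifies the image of a face with the
  subcube cut out by its letters; injectivity on a face can then be refuted by two points of the
  subcube.\<close>

lemma word_face_surj:
  "face_word n cs \<Longrightarrow> length y = n \<Longrightarrow> (\<And>j e. (Suc j, e) \<in> set cs \<Longrightarrow> y ! j = e) \<Longrightarrow>
   \<exists>x. length x = n - length cs \<and> word_face n cs x = y"
proof (induction cs arbitrary: n y)
  case Nil then show ?case by (auto simp: bid_apply)
next
  case (Cons a cs)
  obtain c d where a: "a = (c, d)" by (cases a)
  obtain m i where *: "n = Suc m" "c = Suc i" "i \<le> m" "face_word m cs"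
      and le: "\<And>c' e'. (c', e') \<in> set cs \<Longrightarrow> c' \<le> i"
    using Cons.prems(1) face_word_Cons unfolding a by metis
  define y' where "y' = degen (Suc m) (Suc i) y"
  have y': "length y' = m" using Cons.prems * by (simp add: y'_def length_degen)
  have "y' ! j = e" if "(Suc j, e) \<in> set cs" for j e
  proof -
    have "j < i" using le[OF that] by simp
    then show ?thesis using Cons.prems(2) Cons.prems(3)[of j e] that * by (simp add: y'_def nth_degen)
  qed
  with Cons.IH[OF *(4) y'] obtain x where x: "length x = m - length cs" "word_face m cs x = y'" by blast
  have "y ! i = d" using Cons.prems(3)[of i d] a * by simp
  then have "face (Suc m) (Suc i) d y' = y" using Cons.prems(2) *
    by (simp add: y'_def list_eq_iff_nth_eq cube_simps) (intro allI impI conjI; simp)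
  then show ?case using x * a by (intro exI[of _ x]) (simp add: cmp_apply)
qed

lemma word_face_Suc:
  "face_word n cs \<Longrightarrow> word_face (Suc n) cs = juxtapose (n - length cs) 1 (word_face n cs) (bid 1)"
proof (induction cs arbitrary: n)
  case Nil then show ?case by (simp add: juxtapose_bid_bid[of n 1, simplified])
next
  case (Cons a cs)
  obtain c d where a: "a = (c, d)" by (cases a)
  obtain m i where *: "n = Suc m" "c = Suc i" "i \<le> m" "face_word m cs"
    using Cons.prems(1) face_word_Cons unfolding a by metis
  note B = word_face_Box[OF *(4), of UNIV]
  have l: "length cs \<le> m" using word_face_facemap[OF *(4)] by blast
  have fc: "cmp (m - length cs) (face (Suc m) (Suc i) d) (word_face m cs) \<in> Box UNIV (m - length cs) (Suc m)"
    using * by (intro Box_comp[OF Box_face_Suc B]) auto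
  have "juxtapose (m - length cs) 1 (word_face m cs) (bid 1) \<in> Box UNIV (m - length cs + 1) (m + 1)"
    by (rule Box_juxtapose_bid[OF B])
  then have J: "cmp (m - length cs + 1) (face (Suc (Suc m)) (Suc i) d) (juxtapose (m - length cs) 1 (word_face m cs) (bid 1))
      \<in> Box UNIV (m - length cs + 1) (Suc (Suc m))"
    using * Box_comp[OF Box_face_Suc[of "Suc i" "Suc m" d UNIV]] by simp
  have "juxtapose (m - length cs) 1 (cmp (m - length cs) (face (Suc m) (Suc i) d) (word_face m cs)) (bid 1)
     = cmp (m - length cs + 1) (face (Suc (Suc m)) (Suc i) d) (juxtapose (m - length cs) 1 (word_face m cs) (bid 1))"
  proof (rule juxtapose_eqI[OF J])
    fix u v :: "bool list" assume "length u = m - length cs" "length v = 1"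
    then show "cmp (m - length cs + 1) (face (Suc (Suc m)) (Suc i) d) (juxtapose (m - length cs) 1 (word_face m cs) (bid 1)) (u @ v) =
         cmp (m - length cs) (face (Suc m) (Suc i) d) (word_face m cs) u @ bid 1 v"
      using face_append[of "word_face m cs u" m v 1 i d] Box_length[OF B] *
      by (simp add: cmp_apply juxtapose_apply[of _ _ _ "Suc 0", simplified] bid_apply)
  qed
  then show ?case using Cons.IH[OF *(4)] * a l by (simp add: Suc_diff_le)
qed

lemma critical_Nil [simp]: "critical i e []"
  by (simp add: critical_def)

lemma critical_mono: "critical i e cs \<Longrightarrow> set cs' \<subseteq> set cs \<Longrightarrow> critical i e cs'"
  unfolding critical_def by blast

lemma face_word_full:
  assumes "face_word n cs" "length cs = n" "1 \<le> i" "i \<le> n"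
  shows "i \<in> fst ` set cs"
proof -
  have sorted: "sorted_wrt (>) (map fst cs)" and sub: "set (map fst cs) \<subseteq> {1..n}"
    using assms(1) by (auto simp: face_word_def)
  have d: "distinct xs" if "sorted_wrt (>) xs" for xs :: "nat list"
    using that by (induction xs) auto
  have "card (set (map fst cs)) = n" using distinct_card[OF d[OF sorted]] assms(2) by simp
  then have "set (map fst cs) = {1..n}" using card_subset_eq[OF _ sub] by simp
  then show ?thesis using assms(3,4) by auto
qed

text \<open>A vertex fixes every coordinate, in particular the i-th, which a critical face leaves
  free. Thus marking the critical faces marks no vertex, as \<open>marked_0\<close> demands.\<close>

lemma faces_where_critical_0: "1 \<le> i \<Longrightarrow> i \<le> n \<Longrightarrow> faces_where n (critical i e) 0 = {}"
proof -
  assume i: "1 \<le> i" "i \<le> n"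
  have False if cs: "face_word n cs" "length cs = n" "critical i e cs" for cs
  proof -
    obtain d where "(i, d) \<in> set cs" using face_word_full[OF cs(1,2) i] by auto
    then show False using cs(3) unfolding critical_def by (cases "d = e") auto
  qed
  then show ?thesis by (auto simp: faces_where_def)
qed

lemma faces_whereE:
  assumes "w \<in> faces_where n P k"
  obtains cs where "w = word_face n cs" "face_word n cs" "k + length cs = n" "P cs" "k = n - length cs"
    "w \<in> Box A k n"
proof -
  obtain cs where cs: "w = word_face n cs" "face_word n cs" "k + length cs = n" "P cs"
    using assms by (auto simp: faces_where_def)
  then have "k = n - length cs" by simp
  then show thesis using that[OF cs] word_face_Box[OF cs(2), of A] cs(1) by simp
qed

section \<open>Markings of representables and gluing along facets\<close>

lemma boxset_simps [simp]:
  "cells (boxset A n) k = Box A k n"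
  "act (boxset A n) l k \<psi> \<phi> = cmp l \<phi> \<psi>"
  by (simp_all add: boxset_def mark_def Let_def)

lemma mark_simps [simp]:
  "cells (mark X S) = cells X" "act (mark X S) = act X" "marked (mark X S) n = marked X n \<union> S n"
  "degenerate A (mark X S) = degenerate A X"
  by (simp_all add: mark_def degenerate_def fun_eq_iff)

lemma degenerateE:
  assumes "x \<in> degenerate A X n"
  obtains m \<sigma> y where "n = Suc m" "generator A m \<sigma>" "y \<in> cells X m" "x = act X n m \<sigma> y"
proof -
  from assms consider i y where "1 \<le> i" "i \<le> n" "y \<in> cells X (n - 1)" "x = act X n (n - 1) (degen n i) y"
    | i e y where "e \<in> A" "1 \<le> i" "i < n" "y \<in> cells X (n - 1)" "x = act X n (n - 1) (conn n i e) y"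
    unfolding degenerate_def by blast
  then show thesis
  proof cases
    case 1
    then obtain m j where "n = Suc m" "i = Suc j" by (cases n; cases i) auto
    then show thesis using 1 that[of m "degen n i" y] by (simp add: generator_degen)
  next
    case 2
    then obtain m j where "n = Suc m" "i = Suc j" by (cases n; cases i) auto
    then show thesis using 2 that[of m "conn n i e" y] by (simp add: generator_conn)
  qed
qed

lemma degenerateI:
  assumes "generator A m \<sigma>" "y \<in> cells X m"
  shows "act X (Suc m) m \<sigma> y \<in> degenerate A X (Suc m)"
  using assms(1) unfolding generator_def
proof (elim disjE exE conjE bexE)
  fix i assume "i \<le> m" "\<sigma> = degen (Suc m) (Suc i)"
  then have "\<exists>i' y'. act X (Suc m) m \<sigma> y = act X (Suc m) m (degen (Suc m) i') y' \<and> Suc 0 \<le> i' \<and> i' \<le> Suc m \<and> y' \<in> cells X m"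
    using assms(2) by (intro exI[of _ "Suc i"] exI[of _ y]) auto
  then show ?thesis by (simp add: degenerate_def)
next
  fix i e assume "i < m" "e \<in> A" "\<sigma> = conn (Suc m) (Suc i) e"
  then have "\<exists>i' e' y'. act X (Suc m) m \<sigma> y = act X (Suc m) m (conn (Suc m) i' e') y' \<and> e' \<in> A \<and> Suc 0 \<le> i' \<and> i' < Suc m \<and> y' \<in> cells X m"
    using assms(2) by (intro exI[of _ "Suc i"] exI[of _ e] exI[of _ y]) auto
  then show ?thesis by (simp add: degenerate_def)
qed

text \<open>Apart from membership in the cube category, degeneracy becomes a condition on points
  that does not mention which connections are available. All later marking arguments rest on this
  test.\<close>

lemma degenerate_boxset: "degenerate A (boxset A n) m = {\<phi> \<in> Box A m n. \<not> inj_on \<phi> (cube m)}"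
proof (intro equalityI subsetI)
  fix \<phi> assume "\<phi> \<in> degenerate A (boxset A n) m"
  then obtain k \<sigma> \<psi> where "m = Suc k" "generator A k \<sigma>" "\<psi> \<in> Box A k n" "\<phi> = cmp m \<psi> \<sigma>"
    by (rule degenerateE) auto
  then show "\<phi> \<in> {\<phi> \<in> Box A m n. \<not> inj_on \<phi> (cube m)}"
    using Box_comp[OF _ generator_Box] not_inj_cmp[OF generator_Box generator_not_inj] by auto
qed (use not_inj_degenerate in auto)

lemma marked_boxset: "marked (boxset A n) m = {\<phi> \<in> Box A m n. \<not> inj_on \<phi> (cube m)}"
  unfolding degenerate_boxset[symmetric] by (simp add: boxset_def Let_def degenerate_def mark_def)

lemma inj_on_cube_0: "inj_on \<phi> (cube 0)"
  by (auto simp: inj_on_def)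

lemma marked_cubical_set_boxset: "marked_cubical_set A (boxset A n)"
proof
  show "degenerate A (boxset A n) k \<subseteq> marked (boxset A n) k" for k
    by (simp add: marked_boxset degenerate_boxset)
  show "act (boxset A n) m k \<phi> x \<in> cells (boxset A n) m" if "\<phi> \<in> Box A m k" "x \<in> cells (boxset A n) k" for \<phi> m k x
    using that Box_comp by simp
  show "act (boxset A n) l k (cmp l \<phi> \<psi>) x = act (boxset A n) l m \<psi> (act (boxset A n) m k \<phi> x)"
    if "\<phi> \<in> Box A m k" "\<psi> \<in> Box A l m" "x \<in> cells (boxset A n) k" for \<phi> \<psi> l m k x
    by (simp add: cmp_assoc[OF that(2)])
qed (auto simp: marked_boxset inj_on_cube_0 compose_bid_right)

lemma (in marked_cubical_set) generator_marked:
  "generator A m \<sigma> \<Longrightarrow> y \<in> cells X m \<Longrightarrow> act X (Suc m) m \<sigma> y \<in> marked X (Suc m)"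
  by (rule subsetD[OF marked_degenerate degenerateI])

lemma (in marked_cubical_set) not_inj_marked:
  assumes "\<phi> \<in> Box A m n" "\<not> inj_on \<phi> (cube m)" "y \<in> cells X n"
  shows "act X m n \<phi> y \<in> marked X m"
proof -
  obtain k \<sigma> \<psi> where *: "m = Suc k" "generator A k \<sigma>" "\<psi> \<in> Box A k n" "\<phi> = cmp m \<psi> \<sigma>"
    using not_injE[OF assms(1,2)] .
  show ?thesis using act_comp[OF *(3) generator_Box[OF *(2)] assms(3)] generator_marked[OF *(2) act_closed[OF *(3) assms(3)]] * by simp
qed

text \<open>Gluing of functions given on the facets selected by \<open>F\<close>: the value is read
  off in any selected facet that contains the cube. Two facets in different directions meet where
  both coordinates are constant, and there the hypothesis applies; opposite facets are disjoint. The
  set \<open>B\<close> is left open because the lemma serves open boxes over the smaller category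
  and boundaries over the larger one.\<close>

lemma facet_family_map:
  fixes K :: "nat \<Rightarrow> bool \<Rightarrow> nat \<Rightarrow> bmap \<Rightarrow> 'y"
  assumes "\<And>n j l e e' k \<psi>. m = Suc n \<Longrightarrow> j \<le> l \<Longrightarrow> l \<le> n \<Longrightarrow> F j e \<Longrightarrow> F (Suc l) e' \<Longrightarrow> \<psi> \<in> Box B k n \<Longrightarrow>
    K (Suc l) e' k (cmp k (face m (Suc j) e) \<psi>) = K j e k (cmp k (face m (Suc l) e') \<psi>)"
  obtains b where "\<And>k \<theta> j e. \<theta> \<in> Box B k (Suc m) \<Longrightarrow> j \<le> m \<Longrightarrow> F j e \<Longrightarrow> in_facet k j e \<theta> \<Longrightarrow>
    b k \<theta> = K j e k (cmp k (degen (Suc m) (Suc j)) \<theta>)"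
proof -
  have lt: "K j e k (cmp k (degen (Suc m) (Suc j)) \<theta>) = K l e' k (cmp k (degen (Suc m) (Suc l)) \<theta>)"
    if \<theta>: "\<theta> \<in> Box B k (Suc m)" and F: "F j e" "F l e'" and jl: "j < l" "l \<le> m"
      and fac: "in_facet k j e \<theta>" "in_facet k l e' \<theta>" for j e l e' k \<theta>
  proof -
    obtain l' n where l': "l = Suc l'" "m = Suc n" using jl by (cases l; cases m) auto
    have t1: "cmp k (degen (Suc m) (Suc j)) \<theta> \<in> Box B k m" "cmp k (degen (Suc m) (Suc l)) \<theta> \<in> Box B k m"
      using \<theta> jl by (auto intro!: Box_comp[OF Box_degen_Suc])
    define \<psi> where "\<psi> = cmp k (degen m (Suc l')) (cmp k (degen (Suc m) (Suc j)) \<theta>)"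
    have \<psi>: "\<psi> \<in> Box B k n"
      unfolding \<psi>_def l'(2) by (rule Box_comp[OF Box_degen_Suc]) (use t1 jl l' in auto)
    have \<psi>2: "\<psi> = cmp k (degen m (Suc j)) (cmp k (degen (Suc m) (Suc l)) \<theta>)"
      unfolding \<psi>_def cmp_assoc[OF \<theta>, symmetric] using degen_degen[of j l' n] jl l' by simp
    have "in_facet k l' e' (cmp k (degen (Suc m) (Suc j)) \<theta>)"
      using fac(2) Box_length[OF \<theta>] jl l' by (auto simp: in_facet_def cmp_apply nth_degen)
    then have 1: "cmp k (degen (Suc m) (Suc j)) \<theta> = cmp k (face m (Suc l') e') \<psi>"
      unfolding \<psi>_def using facet_factor[of _ B k n l' e'] t1 jl l' by simp
    have "in_facet k j e (cmp k (degen (Suc m) (Suc l)) \<theta>)"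
      using fac(1) Box_length[OF \<theta>] jl l' by (auto simp: in_facet_def cmp_apply nth_degen)
    then have 2: "cmp k (degen (Suc m) (Suc l)) \<theta> = cmp k (face m (Suc j) e) \<psi>"
      unfolding \<psi>2 using facet_factor[of _ B k n j e] t1 jl l' by simp
    show ?thesis using assms[OF l'(2), of j l' e e' \<psi> k] \<psi> F jl l' 1 2 by simp
  qed
  have eq: "K j e k (cmp k (degen (Suc m) (Suc j)) \<theta>) = K l e' k (cmp k (degen (Suc m) (Suc l)) \<theta>)"
    if \<theta>: "\<theta> \<in> Box B k (Suc m)" and F: "F j e" "F l e'" and jl: "j \<le> m" "l \<le> m"
      and fac: "in_facet k j e \<theta>" "in_facet k l e' \<theta>" for j e l e' k \<theta>
  proof -
    consider "j < l" | "l < j" | "j = l" by linarith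
    then show ?thesis
    proof cases
      case 1 then show ?thesis using lt that by blast
    next
      case 2 then show ?thesis using lt[OF \<theta> F(2,1)] that by metis
    next
      case 3
      then have "e = e'" using fac unfolding in_facet_def by (metis Ex_list_of_length)
      then show ?thesis using 3 by simp
    qed
  qed
  define b where "b k \<theta> = (let p = SOME p. fst p \<le> m \<and> F (fst p) (snd p) \<and> in_facet k (fst p) (snd p) \<theta>
     in K (fst p) (snd p) k (cmp k (degen (Suc m) (Suc (fst p))) \<theta>))" for k \<theta>
  show ?thesis
  proof (rule that[of b])
    fix k \<theta> j e assume *: "\<theta> \<in> Box B k (Suc m)" "j \<le> m" "F j e" "in_facet k j e \<theta>"
    let ?Q = "\<lambda>p. fst p \<le> m \<and> F (fst p) (snd p) \<and> in_facet k (fst p) (snd p) \<theta>"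
    have "?Q (j, e)" using * by simp
    then have "?Q (SOME p. ?Q p)" by (rule someI)
    then show "b k \<theta> = K j e k (cmp k (degen (Suc m) (Suc j)) \<theta>)"
      unfolding b_def Let_def using eq[OF *(1)] * by blast
  qed
qed

lemma faces_where_Box: "w \<in> faces_where n P k \<Longrightarrow> w \<in> Box A k n"
  by (rule faces_whereE)

lemma facemap_codim_1: "facemap m n \<phi> \<Longrightarrow> n = Suc m \<Longrightarrow> \<exists>j d. j \<le> m \<and> \<phi> = face (Suc m) (Suc j) d"
proof (induction rule: facemap.induct)
  case (face m n \<psi> j d)
  then have "n = m" "\<psi> = bid m" using facemap_le[OF face.hyps(1)] by auto
  then show ?case using face.hyps(2) compose_bid_right[OF Box_face_Suc[of "Suc j" m d UNIV]] by auto
qed simp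

text \<open>The relative form of \<open>comical\<close>. Besides being a map, this is the only
  property of a fibration that the extension of weak connection structures relies on.\<close>

definition comical_fibration :: "bool set \<Rightarrow> 'a mcset \<Rightarrow> 'b mcset \<Rightarrow> ('a, 'b) mmap \<Rightarrow> bool" where
  "comical_fibration A Y Z g \<longleftrightarrow>
     (\<forall>n i e. 1 \<le> i \<and> i \<le> n \<longrightarrow>
        rlp A (open_box A n i e) (comical_cube A n i e) (mid (open_box A n i e)) Y Z g) \<and>
     (\<forall>n i e. 2 \<le> n \<and> 1 \<le> i \<and> i \<le> n \<longrightarrow>
        rlp A (comical_cube' A n i e) (tau (n - 2) (comical_cube A n i e))
          (mid (comical_cube' A n i e)) Y Z g)"

lemma homI:
  assumes "\<And>n x. x \<in> cells X n \<Longrightarrow> f n x \<in> cells Y n" "\<And>n x. x \<notin> cells X n \<Longrightarrow> f n x = undefined"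
    "\<And>m n \<phi> x. \<phi> \<in> Box A m n \<Longrightarrow> x \<in> cells X n \<Longrightarrow> f m (act X m n \<phi> x) = act Y m n \<phi> (f n x)"
    "\<And>n x. x \<in> marked X n \<Longrightarrow> f n x \<in> marked Y n"
  shows "f \<in> hom A X Y"
  using assms by (auto simp: hom_def)

lemma hom_cells: "f \<in> hom A X Y \<Longrightarrow> x \<in> cells X n \<Longrightarrow> f n x \<in> cells Y n"
  and hom_undefined: "f \<in> hom A X Y \<Longrightarrow> x \<notin> cells X n \<Longrightarrow> f n x = undefined"
  and hom_act: "f \<in> hom A X Y \<Longrightarrow> \<phi> \<in> Box A m n \<Longrightarrow> x \<in> cells X n \<Longrightarrow>
     f m (act X m n \<phi> x) = act Y m n \<phi> (f n x)"
  by (auto simp: hom_def PiE_iff extensional_def)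

lemma hom_marked: "f \<in> hom A X Y \<Longrightarrow> x \<in> marked X n \<Longrightarrow> f n x \<in> marked Y n"
  unfolding hom_def by blast

lemma hom_eqI:
  assumes "f \<in> hom A X Y" "f' \<in> hom A X Y'" "\<And>n x. x \<in> cells X n \<Longrightarrow> f n x = f' n x"
  shows "f = f'"
proof (intro ext)
  fix n x show "f n x = f' n x"
    using assms hom_undefined[of f A X Y x n] hom_undefined[of f' A X Y' x n] by (cases "x \<in> cells X n") auto
qed

lemma mcomp_apply: "x \<in> cells X n \<Longrightarrow> mcomp X g f n x = g n (f n x)"
  by (simp add: mcomp_def compose_def)

lemma mid_apply: "x \<in> cells X n \<Longrightarrow> mid X n x = x"
  by (simp add: mid_def)

lemma mcomp_eqI:
  assumes "\<And>n x. x \<in> cells X n \<Longrightarrow> g n (f n x) = g' n (f' n x)"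
  shows "mcomp X g f = mcomp X g' f'"
  using assms by (auto simp: mcomp_def compose_def fun_eq_iff)

lemma mcomp_eqD: "mcomp X g f = mcomp X g' f' \<Longrightarrow> x \<in> cells X n \<Longrightarrow> g n (f n x) = g' n (f' n x)"
  by (metis mcomp_apply)

section \<open>Lifting properties in terms of single cubes and their facets\<close>

definition yoneda :: "bool set \<Rightarrow> nat \<Rightarrow> 'a mcset \<Rightarrow> 'a \<Rightarrow> (bmap, 'a) mmap" where
  "yoneda A n Y y k = (\<lambda>\<phi>\<in>Box A k n. act Y k n \<phi> y)"

lemma yoneda_hom:
  assumes Y: "marked_cubical_set A Y" and y: "y \<in> cells Y n"
    and V: "\<And>k. cells V k = Box A k n" "act V = act (boxset A n)"
    and m: "\<And>k \<phi>. \<phi> \<in> marked V k \<Longrightarrow> \<phi> \<in> Box A k n \<and> act Y k n \<phi> y \<in> marked Y k"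
  shows "yoneda A n Y y \<in> hom A V Y"
proof (rule homI)
  interpret marked_cubical_set A Y by (rule Y)
  show "yoneda A n Y y k \<phi> \<in> cells Y k" if "\<phi> \<in> cells V k" for k \<phi>
    using that act_closed[OF _ y] by (simp add: V yoneda_def)
  show "yoneda A n Y y l (act V l k \<psi> \<phi>) = act Y l k \<psi> (yoneda A n Y y k \<phi>)"
    if "\<psi> \<in> Box A l k" "\<phi> \<in> cells V k" for l k \<psi> \<phi>
    using that act_comp[OF _ that(1) y, of \<phi>] Box_comp[OF _ that(1)] by (simp add: V yoneda_def)
qed (use m V in \<open>auto simp: yoneda_def\<close>)

lemma comical_cube_simps:
  "cells (comical_cube A n i e) k = Box A k n"
  "act (comical_cube A n i e) = act (boxset A n)"
  "marked (comical_cube A n i e) k = {\<phi> \<in> Box A k n. \<not> inj_on \<phi> (cube k)} \<union> faces_where n (critical i e) k"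
  by (simp_all add: comical_cube_def marked_boxset)

text \<open>A nonempty word other than the missing letter contains a letter different from it: if it
  begins with the missing letter, the next one has a smaller index. Conversely a constant coordinate
  gives a facet of the box through which the cube factors.\<close>

lemma cells_open_box:
  assumes i: "i \<le> m"
  shows "cells (open_box A (Suc m) (Suc i) e) k =
    {\<phi> \<in> Box A k (Suc m). \<exists>j d. j \<le> m \<and> (j, d) \<noteq> (i, e) \<and> in_facet k j d \<phi>}" (is "?L = ?R")
proof (intro equalityI subsetI)
  fix \<phi> assume "\<phi> \<in> ?L"
  then obtain l \<psi> w where w: "w \<in> faces_where (Suc m) (\<lambda>cs. cs \<noteq> [] \<and> cs \<noteq> [(Suc i, e)]) l"
    and \<psi>: "\<psi> \<in> Box A k l" and \<phi>: "\<phi> = cmp k w \<psi>"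
    by (auto simp: open_box_def subcomplex_def Let_def comical_cube_simps)
  obtain cs where cs: "w = word_face (Suc m) cs" "face_word (Suc m) cs" "cs \<noteq> []" "cs \<noteq> [(Suc i, e)]"
      "l = Suc m - length cs" "w \<in> Box A l (Suc m)"
    using faces_whereE[OF w] by blast
  have "\<exists>j d. (Suc j, d) \<in> set cs \<and> j \<le> m \<and> (j, d) \<noteq> (i, e)"
  proof -
    have ge: "\<exists>j. c = Suc j \<and> j \<le> m" if "(c, d) \<in> set cs" for c d
      using cs(2) that unfolding face_word_def by (cases c) auto
    obtain c d cs' where c: "cs = (c, d) # cs'" using cs(3) by (cases cs) auto
    show ?thesis
    proof (cases "(c, d) = (Suc i, e)")
      case False
      then show ?thesis using ge[of c d] c by auto
    next
      case True
      then obtain c' d' cs'' where c': "cs' = (c', d') # cs''" using cs(4) c by (cases cs') auto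
      then have "c' < c" using cs(2) c by (auto simp: face_word_def)
      then show ?thesis using ge[of c' d'] True c c' by auto
    qed
  qed
  then obtain j d where j: "(Suc j, d) \<in> set cs" "j \<le> m" "(j, d) \<noteq> (i, e)" by blast
  have "in_facet k j d \<phi>"
    unfolding \<phi> using word_face_in_facet[OF cs(2) j(1)] in_facet_cmp[OF \<psi>] cs by simp
  then show "\<phi> \<in> ?R" using j Box_comp[OF cs(6) \<psi>] \<phi> by blast
next
  fix \<phi> assume "\<phi> \<in> ?R"
  then obtain j d where j: "\<phi> \<in> Box A k (Suc m)" "j \<le> m" "(j, d) \<noteq> (i, e)" "in_facet k j d \<phi>" by blast
  have w: "face (Suc m) (Suc j) d \<in> faces_where (Suc m) (\<lambda>cs. cs \<noteq> [] \<and> cs \<noteq> [(Suc i, e)]) m"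
    using j compose_bid_right[OF Box_face_Suc[of "Suc j" m d UNIV]]
    by (auto simp: faces_where_def face_word_def intro!: exI[of _ "[(Suc j, d)]"])
  have "cmp k (degen (Suc m) (Suc j)) \<phi> \<in> Box A k m" using j by (auto intro!: Box_comp[OF Box_degen_Suc])
  then show "\<phi> \<in> ?L"
    using facet_factor[OF j(1,2,4)] w
    by (auto simp: open_box_def subcomplex_def Let_def comical_cube_simps)
qed

lemma open_box_simps:
  "act (open_box A n i e) = act (boxset A n)"
  "marked (open_box A n i e) k = marked (comical_cube A n i e) k \<inter> cells (open_box A n i e) k"
  by (simp_all add: open_box_def subcomplex_def Let_def comical_cube_simps)

text \<open>The family \<open>D\<close> gives the facets of the box and \<open>z\<close> the cube
  below. In \<open>critY\<close> the marking of a proper critical face is tested inside one of the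
  given facets containing it. The empty word is critical too, so the conclusion includes that the
  filler itself is marked.\<close>

lemma fill_open_box:
  assumes naive: "comical_fibration A Y Z g"
    and Y: "marked_cubical_set A Y" and Z: "marked_cubical_set A Z" and g: "g \<in> hom A Y Z"
    and i: "i \<le> m" and z: "z \<in> cells Z (Suc m)"
    and D: "\<And>j d. j \<le> m \<Longrightarrow> (j, d) \<noteq> (i, e) \<Longrightarrow> D j d \<in> cells Y m \<and>
      g m (D j d) = act Z m (Suc m) (face (Suc m) (Suc j) d) z"
    and compat: "\<And>n j l d d'. m = Suc n \<Longrightarrow> j \<le> l \<Longrightarrow> l \<le> n \<Longrightarrow> (j, d) \<noteq> (i, e) \<Longrightarrow> (Suc l, d') \<noteq> (i, e) \<Longrightarrow>
      act Y n m (face m (Suc j) d) (D (Suc l) d') = act Y n m (face m (Suc l) d') (D j d)"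
    and critZ: "\<And>k w. w \<in> faces_where (Suc m) (critical (Suc i) e) k \<Longrightarrow> act Z k (Suc m) w z \<in> marked Z k"
    and critY: "\<And>cs. face_word (Suc m) cs \<Longrightarrow> critical (Suc i) e cs \<Longrightarrow> cs \<noteq> [] \<Longrightarrow>
      \<exists>j d. (Suc j, d) \<in> set cs \<and> j \<le> m \<and>
        act Y (Suc m - length cs) m (cmp (Suc m - length cs) (degen (Suc m) (Suc j)) (word_face (Suc m) cs)) (D j d)
          \<in> marked Y (Suc m - length cs)"
  shows "\<exists>y\<in>cells Y (Suc m). g (Suc m) y = z \<and>
    (\<forall>j d. j \<le> m \<longrightarrow> (j, d) \<noteq> (i, e) \<longrightarrow> act Y m (Suc m) (face (Suc m) (Suc j) d) y = D j d) \<and>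
    (\<forall>k w. w \<in> faces_where (Suc m) (critical (Suc i) e) k \<longrightarrow> act Y k (Suc m) w y \<in> marked Y k)"
proof -
  interpret Y: marked_cubical_set A Y by (rule Y)
  interpret Z: marked_cubical_set A Z by (rule Z)
  let ?U = "open_box A (Suc m) (Suc i) e" and ?V = "comical_cube A (Suc m) (Suc i) e"
  obtain b where b: "\<And>k \<theta> j d. \<theta> \<in> Box A k (Suc m) \<Longrightarrow> j \<le> m \<Longrightarrow> (j, d) \<noteq> (i, e) \<Longrightarrow> in_facet k j d \<theta> \<Longrightarrow>
    b k \<theta> = act Y k m (cmp k (degen (Suc m) (Suc j)) \<theta>) (D j d)"
  proof (rule facet_family_map[of m "\<lambda>j d. (j, d) \<noteq> (i, e)" A "\<lambda>j d k \<psi>. act Y k m \<psi> (D j d)"])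
    fix n j l d d' k \<psi>
    assume *: "m = Suc n" "j \<le> l" "l \<le> n" "(j, d) \<noteq> (i, e)" "(Suc l, d') \<noteq> (i, e)" "\<psi> \<in> Box A k n"
    then have F: "face m (Suc j) d \<in> Box A n m" "face m (Suc l) d' \<in> Box A n m"
      by (auto intro!: Box_face_Suc)
    show "act Y k m (cmp k (face m (Suc j) d) \<psi>) (D (Suc l) d') = act Y k m (cmp k (face m (Suc l) d') \<psi>) (D j d)"
      using Y.act_comp[OF F(1) *(6)] Y.act_comp[OF F(2) *(6)] D[of "Suc l" d'] D[of j d] compat[OF *(1-5)] * by simp
  qed blast
  define a where "a k = (\<lambda>\<theta>\<in>cells ?U k. b k \<theta>)" for k
  have a_eq: "a k \<theta> = act Y k m (cmp k (degen (Suc m) (Suc j)) \<theta>) (D j d)"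
    if "\<theta> \<in> Box A k (Suc m)" "j \<le> m" "(j, d) \<noteq> (i, e)" "in_facet k j d \<theta>" for k \<theta> j d
  proof -
    have "\<theta> \<in> cells ?U k" unfolding cells_open_box[OF i] using that by blast
    then show ?thesis using b[OF that] by (simp add: a_def)
  qed
  have UE: thesis if "\<theta> \<in> cells ?U k" "\<And>j d. \<theta> \<in> Box A k (Suc m) \<Longrightarrow> j \<le> m \<Longrightarrow> (j, d) \<noteq> (i, e) \<Longrightarrow> in_facet k j d \<theta> \<Longrightarrow> thesis"
    for k \<theta> thesis
    using that unfolding cells_open_box[OF i] by blast
  have dB: "cmp k (degen (Suc m) (Suc j)) \<theta> \<in> Box A k m" if "\<theta> \<in> Box A k (Suc m)" "j \<le> m" for k j \<theta>
    using that by (auto intro!: Box_comp[OF Box_degen_Suc])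
  have ca: "a k \<theta> \<in> cells Y k" if "\<theta> \<in> cells ?U k" for k \<theta>
    using that by (rule UE) (simp add: a_eq Y.act_closed[OF dB] D)
  have na: "a l (cmp l \<theta> \<psi>) = act Y l k \<psi> (a k \<theta>)" if \<theta>: "\<theta> \<in> cells ?U k" and \<psi>: "\<psi> \<in> Box A l k" for k l \<theta> \<psi>
    using \<theta>
  proof (rule UE)
    fix j d assume *: "\<theta> \<in> Box A k (Suc m)" "j \<le> m" "(j, d) \<noteq> (i, e)" "in_facet k j d \<theta>"
    have "a l (cmp l \<theta> \<psi>) = act Y l m (cmp l (degen (Suc m) (Suc j)) (cmp l \<theta> \<psi>)) (D j d)"
      by (rule a_eq[OF Box_comp[OF *(1) \<psi>] *(2,3) in_facet_cmp[OF \<psi> *(4)]])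
    also have "\<dots> = act Y l m (cmp l (cmp k (degen (Suc m) (Suc j)) \<theta>) \<psi>) (D j d)"
      by (simp add: cmp_assoc[OF \<psi>])
    also have "\<dots> = act Y l k \<psi> (a k \<theta>)"
      using Y.act_comp[OF dB[OF *(1,2)] \<psi>] D[OF *(2,3)] a_eq[OF *] by simp
    finally show ?thesis .
  qed
  have ga: "g k (a k \<theta>) = act Z k (Suc m) \<theta> z" if "\<theta> \<in> cells ?U k" for k \<theta>
    using that
  proof (rule UE)
    fix j d assume *: "\<theta> \<in> Box A k (Suc m)" "j \<le> m" "(j, d) \<noteq> (i, e)" "in_facet k j d \<theta>"
    have "g k (a k \<theta>) = act Z k m (cmp k (degen (Suc m) (Suc j)) \<theta>) (act Z m (Suc m) (face (Suc m) (Suc j) d) z)"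
      using a_eq[OF *] hom_act[OF g dB[OF *(1,2)]] D[OF *(2,3)] by simp
    also have "\<dots> = act Z k (Suc m) \<theta> z"
      using Z.act_comp[OF Box_face_Suc dB[OF *(1,2)] z, of "Suc j" d] facet_factor[OF *(1,2,4)] *(2) by simp
    finally show ?thesis .
  qed
  have "a \<in> hom A ?U Y"
  proof (rule homI)
    fix k \<theta> assume \<theta>: "\<theta> \<in> marked ?U k"
    then have u: "\<theta> \<in> cells ?U k" by (simp add: open_box_simps)
    have \<theta>B: "\<theta> \<in> Box A k (Suc m)" using u by (rule UE)
    from \<theta> consider "\<not> inj_on \<theta> (cube k)" | "\<theta> \<in> faces_where (Suc m) (critical (Suc i) e) k"
      by (auto simp: open_box_simps comical_cube_simps)
    then show "a k \<theta> \<in> marked Y k"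
    proof cases
      case 1
      then obtain k' \<sigma> \<psi> where *: "k = Suc k'" "generator A k' \<sigma>" "\<psi> \<in> Box A k' (Suc m)" "\<theta> = cmp k \<psi> \<sigma>"
        using not_injE[OF \<theta>B] by metis
      \<comment> \<open>The section shows that the cube \<psi> underlying the degenerate cube
        \<theta> lies in the open box too, so the value at \<theta> is a degenerate cube of
        \<open>Y\<close> and hence marked.\<close>
      obtain s where s: "s \<in> Box A k' k" "cmp k' \<sigma> s = bid k'" using generator_section[OF *(2)] * by metis
      have eq: "cmp k' \<theta> s = \<psi>"
        using * s cmp_assoc[OF s(1), of \<psi> \<sigma>] by (simp add: compose_bid_right)
      have "\<psi> \<in> cells ?U k'"
        using u
      proof (rule UE)
        fix j d assume "j \<le> m" "(j, d) \<noteq> (i, e)" "in_facet k j d \<theta>"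
        then show ?thesis
          unfolding cells_open_box[OF i] using *(3) in_facet_cmp[OF s(1)] eq by blast
      qed
      then show ?thesis using na[OF _ generator_Box[OF *(2)]] Y.generator_marked[OF *(2) ca] * by simp
    next
      case 2
      then obtain cs where cs: "\<theta> = word_face (Suc m) cs" "face_word (Suc m) cs" "critical (Suc i) e cs"
          "k = Suc m - length cs" "k + length cs = Suc m"
        by (rule faces_whereE) blast
      have "cs \<noteq> []"
      proof
        assume "cs = []"
        then have "\<theta> = bid (Suc m)" "k = Suc m" using cs by auto
        moreover have "\<not> in_facet (Suc m) j d (bid (Suc m))" if "j \<le> m" for j d
          unfolding in_facet_def using that by (auto simp: bid_apply intro!: exI[of _ "replicate (Suc m) (\<not> d)"] simp del: replicate_Suc)
        ultimately show False using u by (auto elim!: UE)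
      qed
      then obtain j d where j: "(Suc j, d) \<in> set cs" "j \<le> m"
          "act Y k m (cmp k (degen (Suc m) (Suc j)) \<theta>) (D j d) \<in> marked Y k"
        using critY[OF cs(2,3)] cs by auto
      have "(j, d) \<noteq> (i, e)" using j(1) cs(3) unfolding critical_def by (cases d; cases e) auto
      then show ?thesis using a_eq[OF \<theta>B j(2)] word_face_in_facet[OF cs(2) j(1)] cs j(3) by simp
    qed
  qed (use ca na in \<open>auto simp: open_box_simps a_def\<close>)
  moreover have "yoneda A (Suc m) Z z \<in> hom A ?V Z"
  proof (rule yoneda_hom[OF Z z])
    fix k \<phi> assume "\<phi> \<in> marked ?V k"
    then show "\<phi> \<in> Box A k (Suc m) \<and> act Z k (Suc m) \<phi> z \<in> marked Z k"
      using Z.not_inj_marked[OF _ _ z] critZ faces_where_Box by (auto simp: comical_cube_simps)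
  qed (simp_all add: comical_cube_simps)
  moreover have "mcomp ?U g a = mcomp ?U (yoneda A (Suc m) Z z) (mid ?U)"
    using ga by (intro mcomp_eqI) (auto simp: mid_apply yoneda_def elim!: UE)
  moreover have "rlp A ?U ?V (mid ?U) Y Z g" using naive i by (auto simp: comical_fibration_def)
  ultimately obtain h where h: "h \<in> hom A ?V Y" "mcomp ?U h (mid ?U) = a" "mcomp ?V g h = yoneda A (Suc m) Z z"
    unfolding rlp_def by blast
  define y where "y = h (Suc m) (bid (Suc m))"
  have bV: "bid (Suc m) \<in> cells ?V (Suc m)" by (simp add: comical_cube_simps Box_id)
  have hy: "h k \<phi> = act Y k (Suc m) \<phi> y" if "\<phi> \<in> Box A k (Suc m)" for k \<phi>
    using hom_act[OF h(1) that bV] that unfolding y_def by (simp add: comical_cube_simps compose_bid_left)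
  show ?thesis
  proof (intro bexI conjI allI impI)
    show y: "y \<in> cells Y (Suc m)" unfolding y_def by (rule hom_cells[OF h(1) bV])
    show "g (Suc m) y = z"
      using fun_cong[OF fun_cong[OF h(3)], of "Suc m" "bid (Suc m)"] Z.act_id[OF z]
      by (simp add: mcomp_apply[OF bV] y_def yoneda_def Box_id)
    show "act Y m (Suc m) (face (Suc m) (Suc j) d) y = D j d" if j: "j \<le> m" "(j, d) \<noteq> (i, e)" for j d
    proof -
      have fB: "face (Suc m) (Suc j) d \<in> Box A m (Suc m)" using j by (auto intro!: Box_face_Suc)
      have f: "in_facet m j d (face (Suc m) (Suc j) d)"
        using j by (auto simp: in_facet_def nth_face)
      then have u: "face (Suc m) (Suc j) d \<in> cells ?U m" unfolding cells_open_box[OF i] using j fB by blast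
      have "act Y m (Suc m) (face (Suc m) (Suc j) d) y = a m (face (Suc m) (Suc j) d)"
        using hy[OF fB] h(2) mcomp_apply[OF u, of h "mid ?U"] mid_apply[OF u] by metis
      also have "\<dots> = D j d"
        using a_eq[OF fB j f] degen_face[OF j(1)] Y.act_id D[OF j] by simp
      finally show ?thesis .
    qed
    show "act Y k (Suc m) w y \<in> marked Y k" if w: "w \<in> faces_where (Suc m) (critical (Suc i) e) k" for k w
      using hom_marked[OF h(1), of w k] hy[of w k] w faces_where_Box[OF w] by (auto simp: comical_cube_simps)
  qed
qed

text \<open>The marking extension for the cube represented by \<open>y\<close>. Above dimension
  \<open>n\<close> an injective cube of the representable is the identity or a facet; the identity
  is marked because the empty word is critical, and the only facet that needs an assumption
  downstairs is the missing one, which is \<open>Zf\<close>.\<close>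

lemma mark_missing_face:
  assumes naive: "comical_fibration A Y Z g"
    and Y: "marked_cubical_set A Y" and Z: "marked_cubical_set A Z" and g: "g \<in> hom A Y Z"
    and i: "i \<le> Suc n" and y: "y \<in> cells Y (Suc (Suc n))"
    and crit: "\<And>k w. w \<in> faces_where (Suc (Suc n)) (critical (Suc i) e) k \<Longrightarrow> act Y k (Suc (Suc n)) w y \<in> marked Y k"
    and other: "\<And>j d. j \<le> Suc n \<Longrightarrow> (j, d) \<noteq> (i, e) \<Longrightarrow> act Y (Suc n) (Suc (Suc n)) (face (Suc (Suc n)) (Suc j) d) y \<in> marked Y (Suc n)"
    and Zf: "act Z (Suc n) (Suc (Suc n)) (face (Suc (Suc n)) (Suc i) e) (g (Suc (Suc n)) y) \<in> marked Z (Suc n)"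
  shows "act Y (Suc n) (Suc (Suc n)) (face (Suc (Suc n)) (Suc i) e) y \<in> marked Y (Suc n)"
proof -
  interpret Y: marked_cubical_set A Y by (rule Y)
  interpret Z: marked_cubical_set A Z by (rule Z)
  let ?N = "Suc (Suc n)"
  let ?U = "comical_cube' A ?N (Suc i) e" and ?V = "tau (?N - 2) (comical_cube A ?N (Suc i) e)"
  have U: "cells ?U k = Box A k ?N" "act ?U = act (boxset A ?N)" for k
    by (simp_all add: comical_cube'_def comical_cube_simps)
  have V: "cells ?V k = Box A k ?N" "act ?V = act (boxset A ?N)" for k
    by (simp_all add: tau_def comical_cube_simps)
  have gy: "g ?N y \<in> cells Z ?N" by (rule hom_cells[OF g y])
  have gact: "g k (act Y k ?N \<phi> y) = act Z k ?N \<phi> (g ?N y)" if "\<phi> \<in> Box A k ?N" for k \<phi>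
    by (rule hom_act[OF g that y])
  have f1: "w = face ?N (Suc j) d \<and> k = Suc n" if "w = word_face ?N [(Suc j, d)]" "k + length [(Suc j, d)] = ?N" "j \<le> Suc n" for w j d k
    using that compose_bid_right[OF Box_face_Suc[of "Suc j" "Suc n" d UNIV]] by simp
  have 1: "yoneda A ?N Y y \<in> hom A ?U Y"
  proof (rule yoneda_hom[OF Y y])
    fix k \<phi> assume "\<phi> \<in> marked ?U k"
    then consider "\<phi> \<in> Box A k ?N" "\<not> inj_on \<phi> (cube k)" | "\<phi> \<in> faces_where ?N (critical (Suc i) e) k"
      | "\<phi> \<in> faces_where ?N (\<lambda>cs. length cs = 1 \<and> cs \<noteq> [(Suc i, e)]) k"
      by (auto simp: comical_cube'_def comical_cube_simps)
    then show "\<phi> \<in> Box A k ?N \<and> act Y k ?N \<phi> y \<in> marked Y k"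
    proof cases
      case 1 then show ?thesis using Y.not_inj_marked[OF _ _ y] by blast
    next
      case 2 then show ?thesis using crit faces_where_Box by blast
    next
      case 3
      then obtain cs where cs: "\<phi> = word_face ?N cs" "face_word ?N cs" "k + length cs = ?N" "length cs = 1" "cs \<noteq> [(Suc i, e)]" "\<phi> \<in> Box A k ?N"
        by (rule faces_whereE[where A = A]) blast
      obtain c d where cd: "cs = [(c, d)]" using cs(4) by (auto simp: length_Suc_conv)
      then obtain j where j: "c = Suc j" "j \<le> Suc n" using cs(2) by (cases c) (auto simp: face_word_def)
      have "\<phi> = face ?N (Suc j) d" "k = Suc n" using f1[OF _ _ j(2)] cs(1,3) cd j(1) by blast+
      moreover have "(j, d) \<noteq> (i, e)" using cs(5) cd j by blast
      ultimately show ?thesis using other[OF j(2)] cs(6) by blast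
    qed
  qed (simp_all add: U)
  have bidm: "y \<in> marked Y ?N" 
  proof -
    have "bid ?N \<in> faces_where ?N (critical (Suc i) e) ?N"
      by (auto simp: faces_where_def face_word_def intro!: exI[of _ "[]"])
    from crit[OF this] show ?thesis using Y.act_id[OF y] by simp
  qed
  have 2: "yoneda A ?N Z (g ?N y) \<in> hom A ?V Z"
  proof (rule yoneda_hom[OF Z gy])
    fix k \<phi> assume \<phi>: "\<phi> \<in> marked ?V k"
    then have B: "\<phi> \<in> Box A k ?N" using faces_where_Box
      by (auto simp: tau_def comical_cube_simps split: if_splits)
    have "act Z k ?N \<phi> (g ?N y) \<in> marked Z k"
    proof (cases "inj_on \<phi> (cube k)")
      case False
      then show ?thesis using Z.not_inj_marked[OF B _ gy] by blast
    next
      case True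
      then have fm: "facemap k ?N \<phi>"
        using Box_factor[OF B] not_inj_cmp[OF generator_Box generator_not_inj] by metis
      from \<phi> True consider "\<phi> \<in> faces_where ?N (critical (Suc i) e) k" | "k > n"
        by (auto simp: tau_def comical_cube_simps split: if_splits)
      then show ?thesis
      proof cases
        case 1 then show ?thesis using crit[OF 1] gact[OF B] hom_marked[OF g] by metis
      next
        case 2
        have "k \<le> ?N" using facemap_le[OF fm] by simp
        then consider "k = ?N" | "k = Suc n" using 2 by linarith
        then show ?thesis
        proof cases
          case 1
          then have "\<phi> = bid ?N" using facemap_le[OF fm] by simp
          then show ?thesis using 1 hom_marked[OF g bidm] Z.act_id[OF gy] by simp
        next
          case k: 2
          obtain j d where j: "\<phi> = face ?N (Suc j) d" "j \<le> Suc n"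
            using facemap_codim_1[OF fm] k by blast
          show ?thesis
          proof (cases "(j, d) = (i, e)")
            case True then show ?thesis using Zf j k by simp
          next
            case False
            then show ?thesis using hom_marked[OF g other[OF j(2) False]] gact[OF B] j k by simp
          qed
        qed
      qed
    qed
    then show "\<phi> \<in> Box A k ?N \<and> act Z k ?N \<phi> (g ?N y) \<in> marked Z k" using B by blast
  qed (rule V)+
  have "mcomp ?U g (yoneda A ?N Y y) = mcomp ?U (yoneda A ?N Z (g ?N y)) (mid ?U)"
    by (intro mcomp_eqI) (auto simp: mid_apply yoneda_def U gact)
  moreover have "rlp A ?U ?V (mid ?U) Y Z g"
    by (rule naive[unfolded comical_fibration_def, THEN conjunct2, rule_format]) (use i in simp)
  ultimately obtain h where h: "h \<in> hom A ?V Y" "mcomp ?U h (mid ?U) = yoneda A ?N Y y"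
    using 1 2 unfolding rlp_def by blast
  have fB: "face ?N (Suc i) e \<in> Box A (Suc n) ?N" using i by (auto intro!: Box_face_Suc)
  then have "h (Suc n) (face ?N (Suc i) e) = act Y (Suc n) ?N (face ?N (Suc i) e) y"
    using fun_cong[OF fun_cong[OF h(2)], of "Suc n" "face ?N (Suc i) e"]
    by (simp add: mcomp_apply mid_apply U yoneda_def)
  moreover have "face ?N (Suc i) e \<in> marked ?V (Suc n)" using fB by (simp add: tau_def comical_cube_simps)
  ultimately show ?thesis using hom_marked[OF h(1)] by metis
qed

lemma marked_cubical_set_point: "marked_cubical_set A point"
  by unfold_locales (auto simp: point_def degenerate_def)

lemma hom_point: "marked_cubical_set A X \<Longrightarrow> (\<lambda>n. \<lambda>x\<in>cells X n. ()) \<in> hom A X point"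
proof -
  assume X: "marked_cubical_set A X"
  interpret marked_cubical_set A X by (rule X)
  show ?thesis
  proof (rule homI)
    show "(\<lambda>x\<in>cells X n. ()) x \<in> marked point n" if "x \<in> marked X n" for n x
      using that marked_0 by (cases n) (auto simp: point_def)
  qed (auto simp: point_def)
qed

lemma comical_iff: "comical A X \<longleftrightarrow> comical_fibration A X point (\<lambda>n. \<lambda>x\<in>cells X n. ())"
  unfolding comical_def comical_fibration_def rlp_obj_def by simp

lemma comical_fill:
  assumes "comical A Y" and Y: "marked_cubical_set A Y" and i: "i \<le> m"
    and D: "\<And>j d. j \<le> m \<Longrightarrow> (j, d) \<noteq> (i, e) \<Longrightarrow> D j d \<in> cells Y m"
    and compat: "\<And>n j l d d'. m = Suc n \<Longrightarrow> j \<le> l \<Longrightarrow> l \<le> n \<Longrightarrow> (j, d) \<noteq> (i, e) \<Longrightarrow> (Suc l, d') \<noteq> (i, e) \<Longrightarrow>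
      act Y n m (face m (Suc j) d) (D (Suc l) d') = act Y n m (face m (Suc l) d') (D j d)"
    and critY: "\<And>cs. face_word (Suc m) cs \<Longrightarrow> critical (Suc i) e cs \<Longrightarrow> cs \<noteq> [] \<Longrightarrow>
      \<exists>j d. (Suc j, d) \<in> set cs \<and> j \<le> m \<and>
        act Y (Suc m - length cs) m (cmp (Suc m - length cs) (degen (Suc m) (Suc j)) (word_face (Suc m) cs)) (D j d)
          \<in> marked Y (Suc m - length cs)"
  shows "\<exists>y\<in>cells Y (Suc m).
    (\<forall>j d. j \<le> m \<longrightarrow> (j, d) \<noteq> (i, e) \<longrightarrow> act Y m (Suc m) (face (Suc m) (Suc j) d) y = D j d) \<and>
    (\<forall>k w. w \<in> faces_where (Suc m) (critical (Suc i) e) k \<longrightarrow> act Y k (Suc m) w y \<in> marked Y k)"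
proof -
  have "act point k (Suc m) w () \<in> marked point k" if "w \<in> faces_where (Suc m) (critical (Suc i) e) k" for k w
    using that i faces_where_critical_0[of "Suc i" "Suc m" e] by (cases "k = 0") (auto simp: point_def)
  then show ?thesis
    using fill_open_box[OF _ Y marked_cubical_set_point hom_point[OF Y] i, of "()" e D] assms
    by (auto simp: comical_iff point_def)
qed

lemma comical_mark:
  assumes "comical A Y" and Y: "marked_cubical_set A Y"
    and i: "i \<le> Suc n" and y: "y \<in> cells Y (Suc (Suc n))"
    and crit: "\<And>k w. w \<in> faces_where (Suc (Suc n)) (critical (Suc i) e) k \<Longrightarrow> act Y k (Suc (Suc n)) w y \<in> marked Y k"
    and other: "\<And>j d. j \<le> Suc n \<Longrightarrow> (j, d) \<noteq> (i, e) \<Longrightarrow> act Y (Suc n) (Suc (Suc n)) (face (Suc (Suc n)) (Suc j) d) y \<in> marked Y (Suc n)"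
  shows "act Y (Suc n) (Suc (Suc n)) (face (Suc (Suc n)) (Suc i) e) y \<in> marked Y (Suc n)"
  using mark_missing_face[OF _ Y marked_cubical_set_point hom_point[OF Y] i y crit other] assms(1)
  by (auto simp: comical_iff point_def)

section \<open>Path objects\<close>

text \<open>Tensoring with the interval on the right, the last coordinate being the path
  parameter.\<close>

definition sus :: "nat \<Rightarrow> bmap \<Rightarrow> bmap" where
  "sus m \<phi> = juxtapose m 1 \<phi> (bid 1)"

lemma Box_sus: "\<phi> \<in> Box A m n \<Longrightarrow> sus m \<phi> \<in> Box A (Suc m) (Suc n)"
  using Box_juxtapose_bid[of \<phi> A m n 1] by (simp add: sus_def)

lemma sus_cmp: "\<psi> \<in> Box A k m \<Longrightarrow> cmp (Suc k) (sus m \<phi>) (sus k \<psi>) = sus k (cmp k \<phi> \<psi>)"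
  using juxtapose_cmp[OF _ Box_id, of \<psi> A k m 1 \<phi> "bid 1"] by (simp add: sus_def compose_bid_left[OF Box_id])

lemma sus_bid: "sus n (bid n) = bid (Suc n)"
  using juxtapose_bid_bid[of n 1] by (simp add: sus_def)

lemma sus_apply: "length u = m \<Longrightarrow> sus m \<phi> (u @ [t]) = \<phi> u @ [t]"
  by (simp add: sus_def juxtapose_apply bid_apply)

lemma lastE:
  assumes "length x = Suc m"
  obtains u t where "x = u @ [t]" "length u = m"
  using assms by (metis length_Suc_conv_rev)

lemma face_last: "length u = n \<Longrightarrow> face (Suc n) (Suc n) e u = u @ [e]"
  by (simp add: face_def)

lemma degen_last: "length u = n \<Longrightarrow> degen (Suc n) (Suc n) (u @ [t]) = u"
  by (simp add: degen_def)

lemma sus_face_last: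
  assumes "\<phi> \<in> Box A m n"
  shows "cmp m (sus m \<phi>) (face (Suc m) (Suc m) e) = cmp m (face (Suc n) (Suc n) e) \<phi>"
proof (rule Box_eqI[of _ A m "Suc n" _ A "Suc n"])
  show "cmp m (sus m \<phi>) (face (Suc m) (Suc m) e) \<in> Box A m (Suc n)"
    by (rule Box_comp[OF Box_sus[OF assms] Box_face_Suc]) auto
  show "cmp m (face (Suc n) (Suc n) e) \<phi> \<in> Box A m (Suc n)"
    by (rule Box_comp[OF Box_face_Suc assms]) auto
qed (simp add: cmp_apply face_last sus_apply Box_length[OF assms])

lemma degen_last_sus:
  assumes "\<phi> \<in> Box A m n"
  shows "cmp (Suc m) (degen (Suc n) (Suc n)) (sus m \<phi>) = cmp (Suc m) \<phi> (degen (Suc m) (Suc m))"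
proof (rule Box_eqI[of _ A "Suc m" n _ A n])
  show "cmp (Suc m) (degen (Suc n) (Suc n)) (sus m \<phi>) \<in> Box A (Suc m) n"
    by (rule Box_comp[OF Box_degen_Suc Box_sus[OF assms]]) auto
  show "cmp (Suc m) \<phi> (degen (Suc m) (Suc m)) \<in> Box A (Suc m) n"
    by (rule Box_comp[OF assms Box_degen_Suc]) auto
  fix x :: "bool list" assume "length x = Suc m"
  then obtain u t where "x = u @ [t]" "length u = m" by (rule lastE)
  then show "cmp (Suc m) (degen (Suc n) (Suc n)) (sus m \<phi>) x = cmp (Suc m) \<phi> (degen (Suc m) (Suc m)) x"
    by (simp add: cmp_apply sus_apply degen_last Box_length[OF assms])
qed

lemma sus_face: "j \<le> n \<Longrightarrow> sus n (face (Suc n) (Suc j) e) = face (Suc (Suc n)) (Suc j) e"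
  using face_append[of _ n _ 1 j e] unfolding sus_def
  by (intro juxtapose_eqI[of _ UNIV _ _ "Suc (Suc n)"]) (auto simp: bid_apply intro: Box_face_Suc)

lemma sus_degen: "j \<le> n \<Longrightarrow> sus (Suc n) (degen (Suc n) (Suc j)) = degen (Suc (Suc n)) (Suc j)"
  using degen_append[of _ n _ 1 j] unfolding sus_def
  by (intro juxtapose_eqI[of _ UNIV _ _ "Suc n"]) (auto simp: bid_apply intro: Box_degen_Suc)

lemma sus_not_inj:
  assumes "\<phi> \<in> Box A m n" "\<not> inj_on \<phi> (cube m)"
  shows "\<not> inj_on (sus m \<phi>) (cube (Suc m))"
proof -
  obtain x y where "length x = m" "length y = m" "x \<noteq> y" "\<phi> x = \<phi> y"
    using assms(2) by (auto simp: inj_on_def)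
  then have "x @ [True] \<in> cube (Suc m)" "y @ [True] \<in> cube (Suc m)" "x @ [True] \<noteq> y @ [True]"
    "sus m \<phi> (x @ [True]) = sus m \<phi> (y @ [True])"
    by (auto simp: sus_apply)
  then show ?thesis unfolding inj_on_def by blast
qed

text \<open>The cotensor with the interval whose edge is marked: an $n$-cube is a map
  $\Box^n \otimes \widetilde\Box^1 \to Z$, that is, an $(n+1)$-cube of $Z$.\<close>

definition path :: "bool set \<Rightarrow> 'a mcset \<Rightarrow> 'a mcset" where
  "path A Z = \<lparr>
     cells = (\<lambda>n. {z \<in> cells Z (Suc n). \<forall>k. \<forall>\<phi>\<in>Box A k n. act Z (Suc k) (Suc n) (sus k \<phi>) z \<in> marked Z (Suc k)}),
     act = (\<lambda>m n \<phi>. act Z (Suc m) (Suc n) (sus m \<phi>)),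
     marked = (\<lambda>n. {z \<in> cells Z (Suc n). n \<noteq> 0 \<and>
       (\<forall>k. \<forall>\<phi>\<in>Box A k n. act Z (Suc k) (Suc n) (sus k \<phi>) z \<in> marked Z (Suc k)) \<and>
       (\<forall>e. act Z n (Suc n) (face (Suc n) (Suc n) e) z \<in> marked Z n)})\<rparr>"

definition ev :: "bool set \<Rightarrow> 'a mcset \<Rightarrow> bool \<Rightarrow> ('a, 'a) mmap" where
  "ev A Z e n = (\<lambda>z\<in>cells (path A Z) n. act Z n (Suc n) (face (Suc n) (Suc n) e) z)"

definition cst :: "'a mcset \<Rightarrow> ('a, 'a) mmap" where
  "cst Z n = (\<lambda>z\<in>cells Z n. act Z (Suc n) n (degen (Suc n) (Suc n)) z)"

lemma path_act: "act (path A Z) m n \<phi> z = act Z (Suc m) (Suc n) (sus m \<phi>) z"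
  by (simp add: path_def)

lemma path_cells: "z \<in> cells (path A Z) n \<longleftrightarrow> z \<in> cells Z (Suc n) \<and>
    (\<forall>k. \<forall>\<phi>\<in>Box A k n. act Z (Suc k) (Suc n) (sus k \<phi>) z \<in> marked Z (Suc k))"
  by (simp add: path_def)

text \<open>Membership among the cubes already marks all products with the marked interval. What a
  marked path adds is that both of its ends are marked.\<close>

lemma path_marked: "z \<in> marked (path A Z) n \<longleftrightarrow> z \<in> cells (path A Z) n \<and> n \<noteq> 0 \<and>
    (\<forall>e. act Z n (Suc n) (face (Suc n) (Suc n) e) z \<in> marked Z n)"
  by (auto simp: path_def)

context marked_cubical_set
begin

lemma act_sus_face_last:
  assumes "\<phi> \<in> Box A m n" "z \<in> cells X (Suc n)"
  shows "act X m (Suc m) (face (Suc m) (Suc m) e) (act X (Suc m) (Suc n) (sus m \<phi>) z) =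
    act X m n \<phi> (act X n (Suc n) (face (Suc n) (Suc n) e) z)"
proof -
  have f: "face (Suc k) (Suc k) e \<in> Box A k (Suc k)" for k by (rule Box_face_Suc) auto
  show ?thesis
    using act_comp[OF Box_sus[OF assms(1)] f assms(2)] act_comp[OF f assms] sus_face_last[OF assms(1), of e] by simp
qed

lemma marked_cubical_set_path: "marked_cubical_set A (path A X)"
proof
  show "act (path A X) m n \<phi> z \<in> cells (path A X) m" if \<phi>: "\<phi> \<in> Box A m n" and z: "z \<in> cells (path A X) n" for m n \<phi> z
  proof -
    have z': "z \<in> cells X (Suc n)" using z by (simp add: path_cells)
    have "act X (Suc k) (Suc m) (sus k \<psi>) (act X (Suc m) (Suc n) (sus m \<phi>) z) \<in> marked X (Suc k)" if \<psi>: "\<psi> \<in> Box A k m" for k \<psi>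
    proof -
      have "act X (Suc k) (Suc n) (sus k (cmp k \<phi> \<psi>)) z \<in> marked X (Suc k)"
        using Box_comp[OF \<phi> \<psi>] z by (simp add: path_cells)
      then show ?thesis using act_comp[OF Box_sus[OF \<phi>] Box_sus[OF \<psi>] z'] sus_cmp[OF \<psi>, of \<phi>] by simp
    qed
    then show ?thesis using act_closed[OF Box_sus[OF \<phi>] z'] by (simp add: path_cells path_act)
  qed
  note closed = this
  show "act (path A X) n n (bid n) z = z" if "z \<in> cells (path A X) n" for n z
    using that act_id by (simp add: path_cells path_act sus_bid)
  show comp: "act (path A X) k n (cmp k \<phi> \<psi>) z = act (path A X) k m \<psi> (act (path A X) m n \<phi> z)"
    if "\<phi> \<in> Box A m n" "\<psi> \<in> Box A k m" "z \<in> cells (path A X) n" for \<phi> \<psi> k m n z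
    using that act_comp[OF Box_sus[OF that(1)] Box_sus[OF that(2)], of z] sus_cmp[OF that(2), of \<phi>]
    by (simp add: path_cells path_act)
  show "marked (path A X) n \<subseteq> cells (path A X) n" "marked (path A X) 0 = {}" for n
    by (auto simp: path_marked)
  show "degenerate A (path A X) n \<subseteq> marked (path A X) n" for n
  proof
    fix z assume "z \<in> degenerate A (path A X) n"
    then obtain m \<sigma> y where *: "n = Suc m" "generator A m \<sigma>" "y \<in> cells (path A X) m" "z = act (path A X) n m \<sigma> y"
      by (rule degenerateE)
    note B = generator_Box[OF *(2)]
    have y: "y \<in> cells X (Suc m)" using *(3) by (simp add: path_cells)
    have "act X n (Suc n) (face (Suc n) (Suc n) e) z \<in> marked X n" for e
      using act_sus_face_last[OF B y, of e] generator_marked[OF *(2) act_closed[OF Box_face_Suc y]] *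
      by (simp add: path_act)
    then show "z \<in> marked (path A X) n" using closed[OF B *(3)] * by (simp add: path_marked)
  qed
qed

lemma ev_hom: "ev A X e \<in> hom A (path A X) X"
proof (rule homI)
  interpret path: marked_cubical_set A "path A X" by (rule marked_cubical_set_path)
  have f: "face (Suc k) (Suc k) e \<in> Box A k (Suc k)" for k by (rule Box_face_Suc) auto
  show "ev A X e n z \<in> cells X n" if "z \<in> cells (path A X) n" for n z
    using that act_closed[OF f] by (simp add: ev_def path_cells)
  show "ev A X e m (act (path A X) m n \<phi> z) = act X m n \<phi> (ev A X e n z)"
    if "\<phi> \<in> Box A m n" "z \<in> cells (path A X) n" for m n \<phi> z
    using that act_sus_face_last[OF that(1)] path.act_closed[OF that] by (simp add: ev_def path_act path_cells)
qed (auto simp: ev_def path_marked)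

lemma cst_hom: "cst X \<in> hom A X (path A X)"
proof (rule homI)
  have d: "degen (Suc k) (Suc k) \<in> Box A (Suc k) k" for k by (rule Box_degen_Suc) auto
  have g: "generator A k (degen (Suc k) (Suc k))" for k by (rule generator_degen) simp
  have eq: "act X (Suc m) (Suc n) (sus m \<phi>) (cst X n z) = act X (Suc m) m (degen (Suc m) (Suc m)) (act X m n \<phi> z)"
    if "\<phi> \<in> Box A m n" "z \<in> cells X n" for m n \<phi> z
    using that act_comp[OF d Box_sus[OF that(1)] that(2)] act_comp[OF that(1) d that(2)] degen_last_sus[OF that(1)]
    by (simp add: cst_def)
  show c: "cst X n z \<in> cells (path A X) n" if "z \<in> cells X n" for n z
    unfolding path_cells using eq[OF _ that] generator_marked[OF g act_closed[OF _ that]] act_closed[OF d that] that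
    by (simp add: cst_def)
  show "cst X m (act X m n \<phi> z) = act (path A X) m n \<phi> (cst X n z)" if "\<phi> \<in> Box A m n" "z \<in> cells X n" for m n \<phi> z
    using that eq act_closed by (simp add: path_act cst_def)
  show "cst X n z \<in> marked (path A X) n" if "z \<in> marked X n" for n z
  proof -
    have z: "z \<in> cells X n" using that marked_cells by blast
    have "n \<noteq> 0" using that marked_0 by (metis empty_iff)
    moreover have "act X n (Suc n) (face (Suc n) (Suc n) e) (cst X n z) = z" for e
      using act_comp[OF d Box_face_Suc z, of "Suc n" e] degen_face[of n n e] act_id[OF z] z by (simp add: cst_def)
    ultimately show ?thesis using that c[OF z] by (simp add: path_marked)
  qed
qed (simp add: cst_def)

lemma ev_cst: "mcomp X (ev A X e) (cst X) = mid X"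
proof (intro ext)
  fix n z
  have "ev A X e n (cst X n z) = z" if z: "z \<in> cells X n"
  proof -
    have d: "degen (Suc n) (Suc n) \<in> Box A (Suc n) n" by (rule Box_degen_Suc) auto
    show ?thesis
      using act_comp[OF d Box_face_Suc z, of "Suc n" e] degen_face[of n n e] act_id[OF z] hom_cells[OF cst_hom z] z
      by (simp add: ev_def) (simp add: cst_def)
  qed
  then show "mcomp X (ev A X e) (cst X) n z = mid X n z"
    by (simp add: mcomp_def mid_def compose_def)
qed

text \<open>The condition defining a path quantifies over all faces, but only the top cube is new: a
  non-injective operator gives a degenerate cube, and one in the boundary factors through a side
  facet.\<close>

lemma path_cellI:
  assumes z: "z \<in> marked X (Suc n)"
    and f: "\<And>m j d. n = Suc m \<Longrightarrow> j \<le> m \<Longrightarrow> act X n (Suc n) (face (Suc n) (Suc j) d) z \<in> cells (path A X) m"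
  shows "z \<in> cells (path A X) n"
proof -
  have z': "z \<in> cells X (Suc n)" using z marked_cells by blast
  have "act X (Suc k) (Suc n) (sus k \<phi>) z \<in> marked X (Suc k)" if \<phi>: "\<phi> \<in> Box A k n" for k \<phi>
  proof (cases "inj_on \<phi> (cube k)")
    case False
    then show ?thesis using not_inj_marked[OF Box_sus[OF \<phi>] sus_not_inj[OF \<phi>] z'] by blast
  next
    case True
    show ?thesis
    proof (cases "bdry k n \<phi>")
      case False
      then show ?thesis using inj_not_bdry[OF \<phi> True] z act_id[OF z'] by (simp add: sus_bid)
    next
      case True
      then obtain m j d where m: "n = Suc m" "j \<le> m" "in_facet k j d \<phi>"
        by (metis bdry_def gr0_conv_Suc less_Suc_eq_le less_nat_zero_code neq0_conv)
      define \<psi> where "\<psi> = cmp k (degen n (Suc j)) \<phi>"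
      have \<psi>: "\<psi> \<in> Box A k m" unfolding \<psi>_def m(1) by (rule Box_comp[OF Box_degen_Suc]) (use m \<phi> in auto)
      have fB: "face n (Suc j) d \<in> Box A m n" "face (Suc n) (Suc j) d \<in> Box A n (Suc n)"
        using m by (auto intro!: Box_face_Suc)
      have "\<phi> = cmp k (face n (Suc j) d) \<psi>" unfolding \<psi>_def using facet_factor[of \<phi> A k m j d] m \<phi> by simp
      then have "sus k \<phi> = cmp (Suc k) (face (Suc n) (Suc j) d) (sus k \<psi>)"
        using sus_cmp[OF \<psi>, of "face n (Suc j) d"] sus_face[OF m(2), of d] m(1) by simp
      then show ?thesis
        using act_comp[OF fB(2), of "sus k \<psi>" "Suc k" z] Box_sus[OF \<psi>] z' f[OF m(1,2), of d] \<psi> m(1) by (auto simp: path_cells)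
    qed
  qed
  then show ?thesis using z' by (simp add: path_cells)
qed

lemma path_act_face:
  "j \<le> m \<Longrightarrow> act (path A X) m (Suc m) (face (Suc m) (Suc j) d) z = act X (Suc m) (Suc (Suc m)) (face (Suc (Suc m)) (Suc j) d) z"
  by (simp add: path_act sus_face)

end

section \<open>Evaluation at the end \<open>False\<close> is a trivial fibration\<close>

lemma critical_last:
  assumes "face_word (Suc n) cs" "critical (Suc n) e cs"
  shows "face_word n cs" "word_face (Suc n) cs = sus (n - length cs) (word_face n cs)"
proof -
  have "c \<noteq> Suc n" if "(c, d) \<in> set cs" for c d
    using that assms(2) unfolding critical_def by (cases "d = e") auto
  then show w: "face_word n cs"
    using assms(1) unfolding face_word_def by (force simp: le_Suc_eq)
  show "word_face (Suc n) cs = sus (n - length cs) (word_face n cs)" unfolding sus_def by (rule word_face_Suc[OF w])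
qed

text \<open>This is the marking extension whose missing facet is the end \<open>True\<close>. Words
  critical for the last direction do not mention the last coordinate, so critical faces are
  suspensions, marked since \<open>z\<close> is a path. The other facets are suspensions or the end
  \<open>False\<close>.\<close>

lemma path_mark_end:
  assumes Z: "marked_cubical_set A Z" and com: "comical A Z" and z: "z \<in> cells (path A Z) (Suc m)"
    and end0: "act Z (Suc m) (Suc (Suc m)) (face (Suc (Suc m)) (Suc (Suc m)) False) z \<in> marked Z (Suc m)"
  shows "act Z (Suc m) (Suc (Suc m)) (face (Suc (Suc m)) (Suc (Suc m)) True) z \<in> marked Z (Suc m)"
proof (rule comical_mark[OF com Z])
  show "z \<in> cells Z (Suc (Suc m))" using z by (simp add: path_cells)
  fix k w assume "w \<in> faces_where (Suc (Suc m)) (critical (Suc (Suc m)) True) k"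
  then obtain cs where cs: "w = word_face (Suc (Suc m)) cs" "face_word (Suc (Suc m)) cs" "critical (Suc (Suc m)) True cs"
      "k = Suc (Suc m) - length cs"
    by (rule faces_whereE) blast
  note l = critical_last[OF cs(2,3)]
  have "length cs \<le> Suc m" using word_face_facemap[OF l(1)] by simp
  then have "k = Suc (Suc m - length cs)" using cs(4) by simp
  then show "act Z k (Suc (Suc m)) w z \<in> marked Z k"
    using z word_face_Box[OF l(1), of A] cs(1) l(2) by (simp add: path_cells)
next
  fix j d assume j: "j \<le> Suc m" "(j, d) \<noteq> (Suc m, True)"
  show "act Z (Suc m) (Suc (Suc m)) (face (Suc (Suc m)) (Suc j) d) z \<in> marked Z (Suc m)"
  proof (cases "j \<le> m")
    case True
    then have "face (Suc m) (Suc j) d \<in> Box A m (Suc m)" by (auto intro: Box_face_Suc)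
    then show ?thesis using z sus_face[OF True, of d] by (fastforce simp: path_cells)
  next
    case False
    then have "j = Suc m" "d = False" using j by auto
    then show ?thesis using end0 by simp
  qed
qed simp

text \<open>The box consists of the given paths as side facets and of \<open>x\<close> as the end
  \<open>False\<close>; the end \<open>True\<close> is missing. Its proper critical faces are
  suspended faces of the side paths and therefore marked.\<close>

lemma path_fill:
  assumes Z: "marked_cubical_set A Z" and com: "comical A Z" and x: "x \<in> cells Z (Suc m)"
    and d: "\<And>j e. j \<le> m \<Longrightarrow> d j e \<in> cells (path A Z) m \<and>
      act Z m (Suc m) (face (Suc m) (Suc m) False) (d j e) = act Z m (Suc m) (face (Suc m) (Suc j) e) x"
    and compat: "\<And>k j l e e'. m = Suc k \<Longrightarrow> j \<le> l \<Longrightarrow> l \<le> k \<Longrightarrow>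
      act (path A Z) k m (face m (Suc j) e) (d (Suc l) e') = act (path A Z) k m (face m (Suc l) e') (d j e)"
  shows "\<exists>z\<in>cells (path A Z) (Suc m). act Z (Suc m) (Suc (Suc m)) (face (Suc (Suc m)) (Suc (Suc m)) False) z = x \<and>
    (\<forall>j\<le>m. \<forall>e. act (path A Z) m (Suc m) (face (Suc m) (Suc j) e) z = d j e)"
proof -
  interpret Z: marked_cubical_set A Z by (rule Z)
  define D where "D j e = (if j \<le> m then d j e else x)" for j e
  have "\<exists>y\<in>cells Z (Suc (Suc m)).
    (\<forall>j e. j \<le> Suc m \<longrightarrow> (j, e) \<noteq> (Suc m, True) \<longrightarrow> act Z (Suc m) (Suc (Suc m)) (face (Suc (Suc m)) (Suc j) e) y = D j e) \<and>
    (\<forall>k w. w \<in> faces_where (Suc (Suc m)) (critical (Suc (Suc m)) True) k \<longrightarrow> act Z k (Suc (Suc m)) w y \<in> marked Z k)"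
  proof (rule comical_fill[OF com Z])
    fix j e assume "j \<le> Suc m" "(j, e) \<noteq> (Suc m, True)"
    then show "D j e \<in> cells Z (Suc m)" using d[of j e] x by (auto simp: D_def path_cells)
  next
    fix n j l e e' assume *: "Suc m = Suc n" "j \<le> l" "l \<le> n" "(j, e) \<noteq> (Suc m, True)" "(Suc l, e') \<noteq> (Suc m, True)"
    show "act Z n (Suc m) (face (Suc m) (Suc j) e) (D (Suc l) e') = act Z n (Suc m) (face (Suc m) (Suc l) e') (D j e)"
    proof (cases "l = m")
      case True
      then show ?thesis using * d[of j e] by (simp add: D_def)
    next
      case False
      then obtain k where k: "m = Suc k" using * by (cases m) auto
      then have "j \<le> k" "l \<le> k" using * False by auto
      then show ?thesis
        using * compat[OF k *(2), of e e'] k Z.path_act_face[of j k e "d (Suc l) e'"] Z.path_act_face[of l k e' "d j e"]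
        by (simp add: D_def)
    qed
  next
    fix cs assume cs: "face_word (Suc (Suc m)) cs" "critical (Suc (Suc m)) True cs" "cs \<noteq> []"
    note l = critical_last[OF cs(1,2)]
    have len: "length cs \<le> Suc m" using word_face_facemap[OF l(1)] by simp
    obtain c e cs' where c: "cs = (c, e) # cs'" using cs(3) by (cases cs) auto
    obtain j where j: "c = Suc j" "j \<le> m" using l(1) c by (cases c) (auto simp: face_word_def)
    have B: "word_face (Suc m) cs \<in> Box A (Suc m - length cs) (Suc m)" by (rule word_face_Box[OF l(1)])
    have B': "cmp (Suc m - length cs) (degen (Suc m) (Suc j)) (word_face (Suc m) cs) \<in> Box A (Suc m - length cs) m"
      using j by (intro Box_comp[OF Box_degen_Suc B]) auto
    have "cmp (Suc (Suc m - length cs)) (degen (Suc (Suc m)) (Suc j)) (word_face (Suc (Suc m)) cs) =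
        sus (Suc m - length cs) (cmp (Suc m - length cs) (degen (Suc m) (Suc j)) (word_face (Suc m) cs))"
      using sus_cmp[OF B, of "degen (Suc m) (Suc j)"] l(2) sus_degen[OF j(2)] by simp
    moreover have "d j e \<in> cells (path A Z) m" using d j by blast
    ultimately have "act Z (Suc (Suc m) - length cs) (Suc m) (cmp (Suc (Suc m) - length cs) (degen (Suc (Suc m)) (Suc j)) (word_face (Suc (Suc m)) cs)) (D j e)
          \<in> marked Z (Suc (Suc m) - length cs)"
      using B' j len by (simp add: D_def path_cells Suc_diff_le)
    then show "\<exists>j d. (Suc j, d) \<in> set cs \<and> j \<le> Suc m \<and>
        act Z (Suc (Suc m) - length cs) (Suc m) (cmp (Suc (Suc m) - length cs) (degen (Suc (Suc m)) (Suc j)) (word_face (Suc (Suc m)) cs)) (D j d)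
          \<in> marked Z (Suc (Suc m) - length cs)"
      using c j by (intro exI[of _ j] exI[of _ e]) auto
  qed simp
  then obtain y where y: "y \<in> cells Z (Suc (Suc m))"
    "\<And>j e. j \<le> Suc m \<Longrightarrow> (j, e) \<noteq> (Suc m, True) \<Longrightarrow> act Z (Suc m) (Suc (Suc m)) (face (Suc (Suc m)) (Suc j) e) y = D j e"
    "\<And>k w. w \<in> faces_where (Suc (Suc m)) (critical (Suc (Suc m)) True) k \<Longrightarrow> act Z k (Suc (Suc m)) w y \<in> marked Z k"
    by blast
  have "bid (Suc (Suc m)) \<in> faces_where (Suc (Suc m)) (critical (Suc (Suc m)) True) (Suc (Suc m))"
    by (auto simp: faces_where_def face_word_def intro!: exI[of _ "[]"])
  from y(3)[OF this] have ym: "y \<in> marked Z (Suc (Suc m))" using Z.act_id[OF y(1)] by simp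
  have yd: "act Z (Suc m) (Suc (Suc m)) (face (Suc (Suc m)) (Suc j) e) y = d j e" if "j \<le> m" for j e
    using y(2)[of j e] that by (simp add: D_def)
  have "y \<in> cells (path A Z) (Suc m)"
    using yd d by (intro Z.path_cellI[OF ym]) auto
  moreover have "act Z (Suc m) (Suc (Suc m)) (face (Suc (Suc m)) (Suc (Suc m)) False) y = x"
    using y(2)[of "Suc m" False] by (simp add: D_def)
  ultimately show ?thesis using yd by (auto simp: Z.path_act_face)
qed

lemma path_fill_0:
  assumes Z: "marked_cubical_set A Z" and com: "comical A Z" and x: "x \<in> cells Z 0"
  shows "\<exists>z\<in>cells (path A Z) 0. act Z 0 1 (face 1 1 False) z = x"
proof -
  interpret Z: marked_cubical_set A Z by (rule Z)
  have "\<exists>y\<in>cells Z (Suc 0).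
    (\<forall>j e. j \<le> 0 \<longrightarrow> (j, e) \<noteq> (0, True) \<longrightarrow> act Z 0 (Suc 0) (face (Suc 0) (Suc j) e) y = x) \<and>
    (\<forall>k w. w \<in> faces_where (Suc 0) (critical (Suc 0) True) k \<longrightarrow> act Z k (Suc 0) w y \<in> marked Z k)"
  proof (rule comical_fill[OF com Z])
    fix cs assume cs: "face_word (Suc 0) cs" "critical (Suc 0) True cs" "cs \<noteq> []"
    have "face_word 0 cs" by (rule critical_last[OF cs(1,2)])
    then have "cs = []" using word_face_facemap by fastforce
    then show "\<exists>j d. (Suc j, d) \<in> set cs \<and> j \<le> 0 \<and>
        act Z (Suc 0 - length cs) 0 (cmp (Suc 0 - length cs) (degen (Suc 0) (Suc j)) (word_face (Suc 0) cs)) x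
          \<in> marked Z (Suc 0 - length cs)" using cs(3) by simp
  qed (use x in auto)
  then obtain y where y: "y \<in> cells Z (Suc 0)"
    "\<forall>j e. j \<le> 0 \<longrightarrow> (j, e) \<noteq> (0, True) \<longrightarrow> act Z 0 (Suc 0) (face (Suc 0) (Suc j) e) y = x"
    "\<And>k w. w \<in> faces_where (Suc 0) (critical (Suc 0) True) k \<Longrightarrow> act Z k (Suc 0) w y \<in> marked Z k"
    by blast
  have "bid (Suc 0) \<in> faces_where (Suc 0) (critical (Suc 0) True) (Suc 0)"
    by (auto simp: faces_where_def face_word_def intro!: exI[of _ "[]"])
  from y(3)[OF this] have ym: "y \<in> marked Z (Suc 0)" using Z.act_id[OF y(1)] by simp
  then have "y \<in> cells (path A Z) 0" by (rule Z.path_cellI) auto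
  moreover have "act Z 0 (Suc 0) (face (Suc 0) (Suc 0) False) y = x"
    using y(2)[rule_format, of 0 False] by simp
  ultimately show ?thesis by auto
qed

text \<open>Skeletal extension with \<open>path_fill\<close> as the filling step. Marked cubes have
  marked lifts: the end \<open>False\<close> is marked by \<open>b\<close>, and
  \<open>path_mark_end\<close> carries the marking to the other end.\<close>

lemma path_ev_rlp:
  assumes Z: "marked_cubical_set A Z" and com: "comical A Z"
    and C: "marked_cubical_set A C" and D: "marked_cubical_set A D"
    and j: "j \<in> hom A C D" and inj: "\<And>n. inj_on (j n) (cells C n)"
  shows "rlp A C D j (path A Z) Z (ev A Z False)"
  unfolding rlp_def
proof (intro ballI impI)
  interpret Z: marked_cubical_set A Z by (rule Z)
  interpret C: marked_cubical_set A C by (rule C)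
  interpret D: marked_cubical_set A D by (rule D)
  interpret path: marked_cubical_set A "path A Z" by (rule Z.marked_cubical_set_path)
  fix a b assume a: "a \<in> hom A C (path A Z)" and b: "b \<in> hom A D Z"
    and sq: "mcomp C (ev A Z False) a = mcomp C b j"
  define h0 where "h0 n y = a n (inv_into (cells C n) (j n) y)" for n y
  have h0: "h0 n (j n x) = a n x" if "x \<in> cells C n" for n x
    using inv_into_f_f[OF inj that] by (simp add: h0_def)
  define R where "R n x z \<longleftrightarrow> act Z n (Suc n) (face (Suc n) (Suc n) False) z = b n x" for n x z
  have evR: "R n x z \<longleftrightarrow> ev A Z False n z = b n x" if "z \<in> cells (path A Z) n" for n x z
    using that by (simp add: R_def ev_def)
  interpret E: extension_problem A D "path A Z" "\<lambda>n. j n ` cells C n" h0 R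
  proof (unfold_locales, goal_cases)
    case (1 \<phi> m n x) then show ?case by (rule D.act_closed)
  next
    case (2 x n) then show ?case by (rule D.act_id)
  next
    case (3 \<phi> m n \<psi> k x) then show ?case by (rule D.act_comp)
  next
    case (4 \<phi> m n x) then show ?case by (rule path.act_closed)
  next
    case (5 x n) then show ?case by (rule path.act_id)
  next
    case (6 \<phi> m n \<psi> k x) then show ?case by (rule path.act_comp)
  next
    case (7 n) then show ?case using hom_cells[OF j] by auto
  next
    case (8 \<phi> m n x)
    then show ?case using hom_act[OF j 8(1), symmetric] C.act_closed[OF 8(1)] by auto
  next
    case (9 x n) then show ?case using h0 hom_cells[OF a] by auto
  next
    case (10 \<phi> m n x)
    then show ?case using h0 hom_act[OF j 10(1), symmetric] hom_act[OF a 10(1)] C.act_closed[OF 10(1)] by auto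
  next
    case (11 x n)
    then show ?case using h0 evR hom_cells[OF a] mcomp_eqD[OF sq] by auto
  next
    case (12 \<phi> m n x z)
    then show ?case
      using evR path.act_closed[OF 12(1,3)] hom_act[OF Z.ev_hom 12(1,3)] hom_act[OF b 12(1,2)] by simp
  next
    case (13 x)
    then show ?case using path_fill_0[OF Z com hom_cells[OF b, of x 0]] by (simp add: R_def)
  next
    case (14 x m d)
    have x: "x \<in> cells D (Suc m)" using 14(1) by simp
    have "\<exists>z\<in>cells (path A Z) (Suc m). act Z (Suc m) (Suc (Suc m)) (face (Suc (Suc m)) (Suc (Suc m)) False) z = b (Suc m) x \<and>
        (\<forall>j\<le>m. \<forall>e. act (path A Z) m (Suc m) (face (Suc m) (Suc j) e) z = d j e)"
    proof (rule path_fill[OF Z com hom_cells[OF b x]])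
      show "d j e \<in> cells (path A Z) m \<and>
          act Z m (Suc m) (face (Suc m) (Suc m) False) (d j e) = act Z m (Suc m) (face (Suc m) (Suc j) e) (b (Suc m) x)"
        if "j \<le> m" for j e
        using 14(2)[OF that, of e] hom_act[OF b Box_face_Suc x, of "Suc j" e] that by (simp add: R_def)
    qed (use 14(3) in auto)
    then show ?case by (auto simp: R_def)
  qed
  obtain h where h: "\<And>n x. x \<in> cells D n \<Longrightarrow> h n x \<in> cells (path A Z) n" "\<And>n x. x \<in> cells D n \<Longrightarrow> R n x (h n x)"
    "\<And>n x. x \<in> j n ` cells C n \<Longrightarrow> h n x = h0 n x"
    "\<And>m n \<phi> x. \<phi> \<in> Box A m n \<Longrightarrow> x \<in> cells D n \<Longrightarrow> h m (act D m n \<phi> x) = act (path A Z) m n \<phi> (h n x)"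
    by (rule E.extension) (rule that)
  define H where "H n = (\<lambda>x\<in>cells D n. h n x)" for n
  have H: "H \<in> hom A D (path A Z)"
  proof (rule homI)
    show "H n x \<in> marked (path A Z) n" if x: "x \<in> marked D n" for n x
    proof -
      have xc: "x \<in> cells D n" using x D.marked_cells by blast
      have "n \<noteq> 0" using x D.marked_0 by (metis empty_iff)
      then obtain m where m: "n = Suc m" by (cases n) auto
      have F: "act Z n (Suc n) (face (Suc n) (Suc n) False) (h n x) \<in> marked Z n"
        using h(2)[OF xc] hom_marked[OF b x] by (simp add: R_def)
      then have "act Z n (Suc n) (face (Suc n) (Suc n) e) (h n x) \<in> marked Z n" for e
        using path_mark_end[OF Z com, of "h n x" m] h(1)[OF xc] m by (cases e) auto
      then show ?thesis using h(1)[OF xc] xc m by (simp add: H_def path_marked)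
    qed
  qed (use h D.act_closed in \<open>auto simp: H_def\<close>)
  moreover have "mcomp C H j = a"
    by (rule hom_eqI[OF mcomp_hom[OF C j H] a]) (use h h0 hom_cells[OF j] in \<open>auto simp: mcomp_apply H_def\<close>)
  moreover have "mcomp D (ev A Z False) H = b"
    by (rule hom_eqI[OF mcomp_hom[OF D H Z.ev_hom] b]) (use h evR in \<open>auto simp: mcomp_apply H_def\<close>)
  ultimately show "\<exists>h\<in>hom A D (path A Z). mcomp C h j = a \<and> mcomp D (ev A Z False) h = b" by blast
qed

text \<open>The homotopy is the filler of an open box of dimension one higher, whose missing face is the
  product of the missing face with the interval.\<close>

lemma open_box_homotopy:
  assumes Z: "marked_cubical_set A Z" and com: "comical A Z" and i: "i \<le> m"
    and a: "a \<in> hom A (comical_cube A (Suc m) (Suc i) e) Z" and b: "b \<in> hom A (comical_cube A (Suc m) (Suc i) e) Z"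
    and ab: "\<And>k \<phi>. \<phi> \<in> cells (open_box A (Suc m) (Suc i) e) k \<Longrightarrow> a k \<phi> = b k \<phi>"
  shows "\<exists>K\<in>hom A (comical_cube A (Suc m) (Suc i) e) (path A Z).
    (\<forall>k. \<forall>\<phi>\<in>Box A k (Suc m). ev A Z False k (K k \<phi>) = a k \<phi> \<and> ev A Z True k (K k \<phi>) = b k \<phi>) \<and>
    (\<forall>k. \<forall>\<phi>\<in>cells (open_box A (Suc m) (Suc i) e) k. K k \<phi> = cst Z k (a k \<phi>))"
proof -
  interpret Z: marked_cubical_set A Z by (rule Z)
  interpret path: marked_cubical_set A "path A Z" by (rule Z.marked_cubical_set_path)
  define N where "N = Suc m"
  let ?V = "comical_cube A N (Suc i) e" and ?U = "open_box A N (Suc i) e"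
  note a = a[folded N_def] and b = b[folded N_def] and ab = ab[folded N_def]
  have V: "cells ?V k = Box A k N" "act ?V = act (boxset A N)" for k
    by (simp_all add: comical_cube_simps)
  have aact: "a l (cmp l \<phi> \<psi>) = act Z l k \<psi> (a k \<phi>)" and bact: "b l (cmp l \<phi> \<psi>) = act Z l k \<psi> (b k \<phi>)"
    if "\<phi> \<in> Box A k N" "\<psi> \<in> Box A l k" for k l \<phi> \<psi>
    using hom_act[OF a that(2), of \<phi>] hom_act[OF b that(2), of \<phi>] that by (simp_all add: V)
  have acl: "a k \<phi> \<in> cells Z k" "b k \<phi> \<in> cells Z k" if "\<phi> \<in> Box A k N" for k \<phi>
    using hom_cells[OF a] hom_cells[OF b] that by (simp_all add: V)
  have fB: "face N (Suc j) d \<in> Box A m N" if "j \<le> m" for j d using that by (auto simp: N_def intro!: Box_face_Suc)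
  have Uf: "face N (Suc j) d \<in> cells ?U m" if "j \<le> m" "(j, d) \<noteq> (i, e)" for j d
  proof -
    have "in_facet m j d (face N (Suc j) d)" using that by (auto simp: N_def in_facet_def nth_face)
    then show ?thesis using cells_open_box[OF i, of A e m] fB that by (auto simp: N_def)
  qed
  define c where "c j d = a m (face N (Suc j) d)" for j d
  have c: "c j d \<in> cells Z m" if "j \<le> m" for j d using acl fB[OF that] by (simp add: c_def)
  have cc: "cst Z m (c j d) \<in> cells (path A Z) m" if "j \<le> m" for j d using hom_cells[OF Z.cst_hom c[OF that]] .
  have ccZ: "cst Z m (c j d) = act Z N m (degen N N) (c j d)" if "j \<le> m" for j d
    using c[OF that] by (simp add: cst_def N_def)
  \<comment> \<open>In the directions of the cube the facets of the box are constant paths on the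
    common values of \<open>a\<close> and \<open>b\<close>; in the interval direction they are the
    top cubes of \<open>a\<close> and \<open>b\<close>.\<close>
  define D where "D j d = (if j \<le> m then cst Z m (c j d) else (if d then b else a) N (bid N))" for j d
  have "\<exists>y\<in>cells Z (Suc N).
    (\<forall>j d. j \<le> N \<longrightarrow> (j, d) \<noteq> (i, e) \<longrightarrow> act Z N (Suc N) (face (Suc N) (Suc j) d) y = D j d) \<and>
    (\<forall>k w. w \<in> faces_where (Suc N) (critical (Suc i) e) k \<longrightarrow> act Z k (Suc N) w y \<in> marked Z k)"
  proof (rule comical_fill[OF com Z])
    show "i \<le> N" using i by (simp add: N_def)
    show "D j d \<in> cells Z N" if "j \<le> N" for j d
      using cc[of j d] acl[OF Box_id] by (auto simp: D_def path_cells N_def)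
  next
    fix n j l d d' assume *: "N = Suc n" "j \<le> l" "l \<le> n" "(j, d) \<noteq> (i, e)" "(Suc l, d') \<noteq> (i, e)"
    have n: "n = m" using * by (simp add: N_def)
    have jm: "j \<le> m" using * n by simp
    show "act Z n N (face N (Suc j) d) (D (Suc l) d') = act Z n N (face N (Suc l) d') (D j d)"
    proof (cases "l = m")
      case True
      have "act Z m N (face N (Suc j) d) (D (Suc m) d') = c j d"
        using aact[OF Box_id fB[OF jm, of d]] bact[OF Box_id fB[OF jm, of d]] ab[OF Uf[OF jm *(4)]]
        by (auto simp: D_def c_def compose_bid_left[OF fB[OF jm]])
      moreover have "ev A Z d' m (cst Z m (c j d)) = c j d"
        using fun_cong[OF fun_cong[OF Z.ev_cst], of d' m "c j d"] c[OF jm] by (simp add: mcomp_apply mid_apply)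
      ultimately show ?thesis using True n jm cc[OF jm] by (simp add: D_def ev_def N_def)
    next
      case False
      then obtain k where k: "m = Suc k" "l \<le> k" using * n by (cases m) auto
      have lm: "Suc l \<le> m" using k by simp
      have kB: "face m (Suc j) d \<in> Box A k m" "face m (Suc l) d' \<in> Box A k m" using k *(2) by (auto intro!: Box_face_Suc)
      have F: "act (path A Z) k m (face m (Suc j) d) (cst Z m (c (Suc l) d')) =
            cst Z k (act Z k m (face m (Suc j) d) (c (Suc l) d'))"
          "act (path A Z) k m (face m (Suc l) d') (cst Z m (c j d)) =
            cst Z k (act Z k m (face m (Suc l) d') (c j d))"
        using hom_act[OF Z.cst_hom kB(1) c[OF lm]] hom_act[OF Z.cst_hom kB(2) c[OF jm]] by simp_all
      have "act Z k m (face m (Suc j) d) (c (Suc l) d') = act Z k m (face m (Suc l) d') (c j d)"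
        using aact[OF fB[OF lm] kB(1), of d'] aact[OF fB[OF jm] kB(2), of d] face_face[OF *(2) k(2), of d' d] k
        by (simp add: c_def N_def)
      then show ?thesis
        using F Z.path_act_face[of j k d] Z.path_act_face[of l k d'] *(2) k n lm jm by (simp add: D_def N_def)
    qed
  next
    fix cs assume cs: "face_word (Suc N) cs" "critical (Suc i) e cs" "cs \<noteq> []"
    obtain c0 d0 cs' where c0: "cs = (c0, d0) # cs'" using cs(3) by (cases cs) auto
    obtain j0 where j0: "c0 = Suc j0" "j0 \<le> N" "face_word N cs'" "\<And>c' e'. (c', e') \<in> set cs' \<Longrightarrow> c' \<le> j0"
      using face_word_Cons[OF cs(1)[unfolded c0]] by (metis Suc_inject)
    show "\<exists>j d. (Suc j, d) \<in> set cs \<and> j \<le> N \<and>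
        act Z (Suc N - length cs) N (cmp (Suc N - length cs) (degen (Suc N) (Suc j)) (word_face (Suc N) cs)) (D j d)
          \<in> marked Z (Suc N - length cs)"
    \<comment> \<open>If the word fixes the interval coordinate, the remaining letters form a
      critical face of the original comical cube, marked by \<open>a\<close> and by
      \<open>b\<close>. Otherwise the face is a suspension inside a constant path.\<close>
    proof (cases "j0 = N")
      case True
      let ?w = "word_face N cs'" and ?k = "N - length cs'"
      have B: "?w \<in> Box A ?k N" by (rule word_face_Box[OF j0(3)])
      have len: "length cs' \<le> N" using word_face_facemap[OF j0(3)] by simp
      have "cmp ?k (degen (Suc N) (Suc N)) (word_face (Suc N) cs) = ?w"
        using cmp_assoc[OF B, of "degen (Suc N) (Suc N)" "face (Suc N) (Suc N) d0"] degen_face[of N N d0] c0 j0(1) True compose_bid_left[OF B]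
        by simp
      moreover have "critical (Suc i) e cs'" by (rule critical_mono[OF cs(2)]) (auto simp: c0)
      then have "?w \<in> marked ?V ?k"
        using j0(3) len by (auto simp: comical_cube_simps faces_where_def)
      from hom_marked[OF a this] hom_marked[OF b this]
      have "act Z ?k N ?w ((if d0 then b else a) N (bid N)) \<in> marked Z ?k"
        using aact[OF Box_id B] bact[OF Box_id B] by (auto simp: compose_bid_left[OF B])
      ultimately show ?thesis using c0 j0(1) True by (intro exI[of _ N] exI[of _ d0]) (auto simp: D_def N_def)
    next
      case False
      then have jm: "j0 \<le> m" using j0 by (simp add: N_def)
      have w: "face_word N cs" using cs(1) c0 j0 False by (fastforce simp: face_word_def)
      let ?w = "word_face N cs" and ?k = "N - length cs"
      have B: "?w \<in> Box A ?k N" by (rule word_face_Box[OF w])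
      have len: "length cs \<le> N" using word_face_facemap[OF w] by simp
      have k: "Suc N - length cs = Suc ?k" using len by simp
      have vB: "cmp ?k (degen N (Suc j0)) ?w \<in> Box A ?k m" using jm by (auto simp: N_def intro!: Box_comp[OF Box_degen_Suc B[unfolded N_def]])
      have "cmp (Suc ?k) (degen (Suc N) (Suc j0)) (word_face (Suc N) cs) = sus ?k (cmp ?k (degen N (Suc j0)) ?w)"
        using word_face_Suc[OF w] sus_cmp[OF B, of "degen N (Suc j0)"] sus_degen[OF jm] by (simp add: sus_def N_def)
      moreover have "act (path A Z) ?k m (cmp ?k (degen N (Suc j0)) ?w) (cst Z m (c j0 d0)) \<in> cells (path A Z) ?k"
        by (rule path.act_closed[OF vB cc[OF jm]])
      moreover have "act Z (Suc ?k) N (sus ?k (cmp ?k (degen N (Suc j0)) ?w)) (cst Z m (c j0 d0)) \<in> marked Z (Suc ?k)"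
        using cc[OF jm, of d0] vB by (simp add: path_cells N_def)
      ultimately show ?thesis using c0 j0(1,2) jm k by (intro exI[of _ j0] exI[of _ d0]) (auto simp: D_def)
    qed
  qed
  then obtain y where y: "y \<in> cells Z (Suc N)"
    "\<And>j d. j \<le> N \<Longrightarrow> (j, d) \<noteq> (i, e) \<Longrightarrow> act Z N (Suc N) (face (Suc N) (Suc j) d) y = D j d"
    "\<And>k w. w \<in> faces_where (Suc N) (critical (Suc i) e) k \<Longrightarrow> act Z k (Suc N) w y \<in> marked Z k"
    by blast
  have bc: "bid n \<in> faces_where n (critical (Suc i) e) n" for n
    by (auto simp: faces_where_def face_word_def intro!: exI[of _ "[]"])
  have ym: "y \<in> marked Z (Suc N)" using y(3)[OF bc] Z.act_id[OF y(1)] by simp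
  have bidm: "bid N \<in> marked ?V N" using bc by (simp add: comical_cube_simps)
  have y0: "act Z N (Suc N) (face (Suc N) (Suc N) False) y = a N (bid N)"
    and y1: "act Z N (Suc N) (face (Suc N) (Suc N) True) y = b N (bid N)"
    using y(2)[of N] i by (auto simp: D_def N_def)
  have yj: "act Z N (Suc N) (face (Suc N) (Suc j) d) y = cst Z m (c j d)" if "j \<le> m" "(j, d) \<noteq> (i, e)" for j d
    using y(2)[of j d] that by (simp add: D_def N_def)
  \<comment> \<open>The missing facet has to be a path as well. Its top cube is marked by the
    marking extension, since all other facets are degenerate or marked ends.\<close>
  have yim: "act Z N (Suc N) (face (Suc N) (Suc i) e) y \<in> marked Z N"
    unfolding N_def
  proof (rule comical_mark[OF com Z])
    show "y \<in> cells Z (Suc (Suc m))" "i \<le> Suc m" using y(1) i by (simp_all add: N_def)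
    show "act Z k (Suc (Suc m)) w y \<in> marked Z k" if "w \<in> faces_where (Suc (Suc m)) (critical (Suc i) e) k" for k w
      using y(3) that by (simp add: N_def)
    fix j d assume j: "j \<le> Suc m" "(j, d) \<noteq> (i, e)"
    show "act Z (Suc m) (Suc (Suc m)) (face (Suc (Suc m)) (Suc j) d) y \<in> marked Z (Suc m)"
    proof (cases "j \<le> m")
      case True
      have "cst Z m (c j d) \<in> marked Z N"
        using ccZ[OF True] Z.generator_marked[OF generator_degen c[OF True], of m] by (simp add: N_def)
      then show ?thesis using yj[OF True j(2)] by (simp add: N_def)
    next
      case False
      then have "j = N" using j by (simp add: N_def)
      then show ?thesis using y0 y1 hom_marked[OF a bidm] hom_marked[OF b bidm] by (cases d) (simp_all add: N_def)
    qed
  qed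
  have yip: "act Z N (Suc N) (face (Suc N) (Suc i) e) y \<in> cells (path A Z) m"
  proof (rule Z.path_cellI)
    show "act Z N (Suc N) (face (Suc N) (Suc i) e) y \<in> marked Z (Suc m)" using yim by (simp add: N_def)
    fix k j d assume k: "m = Suc k" "j \<le> k"
    have fN: "face (Suc N) (Suc l) d \<in> Box A N (Suc N)" if "l \<le> m" for l d
      using that by (auto simp: N_def intro!: Box_face_Suc)
    have fm: "face N (Suc l) d \<in> Box A m N" "face m (Suc l) d \<in> Box A k m" if "l \<le> k" for l d
      using that k by (auto simp: N_def intro!: Box_face_Suc)
    \<comment> \<open>Each side of the missing facet is shared with another facet of the cube, that
      is, with a constant path; thus the sides are paths.\<close>
    have "\<exists>l d' r d''. l \<le> m \<and> (l, d') \<noteq> (i, e) \<and> r \<le> k \<and>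
        cmp m (face (Suc N) (Suc i) e) (face N (Suc j) d) = cmp m (face (Suc N) (Suc l) d') (face N (Suc r) d'')"
    proof (cases "j < i")
      case True
      then obtain i' where i': "i = Suc i'" by (cases i) auto
      have "cmp m (face (Suc N) (Suc i) e) (face N (Suc j) d) = cmp m (face (Suc N) (Suc j) d) (face N (Suc i') e)"
        using face_face[of j i' m e d] True i' i k by (simp add: N_def)
      then show ?thesis using True i i' k by (intro exI[of _ j] exI[of _ d] exI[of _ i'] exI[of _ e]) auto
    next
      case False
      then have "cmp m (face (Suc N) (Suc i) e) (face N (Suc j) d) = cmp m (face (Suc N) (Suc (Suc j)) d) (face N (Suc i) e)"
        using face_face[of i j m d e] k by (simp add: N_def)
      then show ?thesis using False k by (intro exI[of _ "Suc j"] exI[of _ d] exI[of _ i] exI[of _ e]) auto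
    qed
    then obtain l d' r d'' where l: "l \<le> m" "(l, d') \<noteq> (i, e)" "r \<le> k"
        "cmp m (face (Suc N) (Suc i) e) (face N (Suc j) d) = cmp m (face (Suc N) (Suc l) d') (face N (Suc r) d'')"
      by blast
    have "act Z m N (face N (Suc j) d) (act Z N (Suc N) (face (Suc N) (Suc i) e) y) =
        act Z m N (face N (Suc r) d'') (cst Z m (c l d'))"
      using Z.act_comp[OF fN[OF i] fm(1)[OF k(2)] y(1), of e d] Z.act_comp[OF fN[OF l(1)] fm(1)[OF l(3)] y(1), of d' d''] l(4) yj[OF l(1,2)]
      by simp
    also have "\<dots> = act (path A Z) k m (face m (Suc r) d'') (cst Z m (c l d'))"
      using Z.path_act_face[OF l(3)] k by (simp add: N_def)
    also have "\<dots> \<in> cells (path A Z) k" by (rule path.act_closed[OF fm(2)[OF l(3)] cc[OF l(1)]])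
    finally show "act Z m (Suc m) (face (Suc m) (Suc j) d) (act Z N (Suc N) (face (Suc N) (Suc i) e) y) \<in> cells (path A Z) k"
      by (simp add: N_def)
  qed
  have yp: "y \<in> cells (path A Z) N"
  proof (rule Z.path_cellI[OF ym])
    fix m' j d assume m': "N = Suc m'" "j \<le> m'"
    then have "m' = m" by (simp add: N_def)
    then show "act Z N (Suc N) (face (Suc N) (Suc j) d) y \<in> cells (path A Z) m'"
      using yip yj[of j d] cc[of j d] m' by (cases "(j, d) = (i, e)") auto
  qed
  let ?K = "yoneda A N (path A Z) y"
  have Kev: "ev A Z d k (?K k \<phi>) = (if d then b else a) k \<phi>" if "\<phi> \<in> Box A k N" for d k \<phi>
  proof -
    have "ev A Z d k (?K k \<phi>) = act Z k N \<phi> (ev A Z d N y)"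
      using hom_act[OF Z.ev_hom that yp] that by (simp add: yoneda_def)
    also have "ev A Z d N y = (if d then b else a) N (bid N)" using y0 y1 yp by (simp add: ev_def)
    finally show ?thesis using aact[OF Box_id that] bact[OF Box_id that] by (simp add: compose_bid_left[OF that])
  qed
  have K: "?K \<in> hom A ?V (path A Z)"
  proof (rule yoneda_hom[OF Z.marked_cubical_set_path yp])
    fix k \<phi> assume \<phi>: "\<phi> \<in> marked ?V k"
    then have B: "\<phi> \<in> Box A k N" using faces_where_Box by (auto simp: comical_cube_simps)
    show "\<phi> \<in> Box A k N \<and> act (path A Z) k N \<phi> y \<in> marked (path A Z) k"
    proof (cases "inj_on \<phi> (cube k)")
      case False
      then show ?thesis using path.not_inj_marked[OF B _ yp] B by blast
    next
      case True
      then have "\<phi> \<in> faces_where N (critical (Suc i) e) k" using \<phi> by (auto simp: comical_cube_simps)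
      then have "k \<noteq> 0" using faces_where_critical_0[of "Suc i" N e] i by (cases k) (auto simp: N_def)
      moreover have "act Z k (Suc k) (face (Suc k) (Suc k) d) (act (path A Z) k N \<phi> y) \<in> marked Z k" for d
        using Kev[OF B, of d] hom_marked[OF a \<phi>] hom_marked[OF b \<phi>] path.act_closed[OF B yp] B
        by (simp add: ev_def yoneda_def split: if_splits)
      ultimately show ?thesis using B path.act_closed[OF B yp] by (simp add: path_marked)
    qed
  qed (simp_all add: V)
  have "?K k \<phi> = cst Z k (a k \<phi>)" if "\<phi> \<in> cells ?U k" for k \<phi>
  proof -
    have "\<phi> \<in> Box A k (Suc m) \<and> (\<exists>j d. j \<le> m \<and> (j, d) \<noteq> (i, e) \<and> in_facet k j d \<phi>)"
      using that cells_open_box[OF i, of A e k] by (simp add: N_def)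
    then obtain j d where j: "\<phi> \<in> Box A k N" "j \<le> m" "(j, d) \<noteq> (i, e)" "in_facet k j d \<phi>"
      by (auto simp: N_def)
    define \<psi> where "\<psi> = cmp k (degen N (Suc j)) \<phi>"
    have \<psi>: "\<psi> \<in> Box A k m" unfolding \<psi>_def N_def by (rule Box_comp[OF Box_degen_Suc]) (use j in \<open>auto simp: N_def\<close>)
    have eq: "\<phi> = cmp k (face N (Suc j) d) \<psi>"
      unfolding \<psi>_def N_def by (rule facet_factor[OF j(1)[unfolded N_def] j(2,4)])
    have "?K k \<phi> = act (path A Z) k m \<psi> (act (path A Z) m N (face N (Suc j) d) y)"
      using path.act_comp[OF fB[OF j(2)] \<psi> yp, of d] eq j(1) by (simp add: yoneda_def)
    also have "act (path A Z) m N (face N (Suc j) d) y = cst Z m (c j d)"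
      using Z.path_act_face[OF j(2)] yj[OF j(2,3)] by (simp add: N_def)
    also have "act (path A Z) k m \<psi> (cst Z m (c j d)) = cst Z k (a k \<phi>)"
      using hom_act[OF Z.cst_hom \<psi> c[OF j(2)]] aact[OF fB[OF j(2)] \<psi>, of d] eq by (simp add: c_def)
    finally show ?thesis .
  qed
  then show ?thesis using K Kev by (intro bexI[of _ ?K]) (auto simp: N_def)
qed

section \<open>Lifting against the inclusion of a cube into its connection completion\<close>

text \<open>Outside the boundary a morphism is a composite of degeneracies and connections only,
  each of which has a face as section.\<close>

lemma not_bdry_section:
  assumes "\<beta> \<in> Box A l m" "\<not> bdry l m \<beta>"
  obtains s where "s \<in> Box A m l" "cmp m \<beta> s = bid m"
proof -
  have "\<exists>s\<in>Box A m l. cmp m \<beta> s = bid m"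
    using assms
  proof (induction l arbitrary: \<beta> rule: less_induct)
    case (less l)
    show ?case
    proof (cases "inj_on \<beta> (cube l)")
      case True
      then show ?thesis using inj_not_bdry[OF less.prems(1) True less.prems(2)] Box_id compose_bid_left[OF Box_id] by auto
    next
      case False
      then obtain l' \<sigma> \<beta>' where *: "l = Suc l'" "generator A l' \<sigma>" "\<beta>' \<in> Box A l' m" "\<beta> = cmp l \<beta>' \<sigma>"
        using not_injE[OF less.prems(1)] by metis
      then have "\<not> bdry l' m \<beta>'" using bdry_cmp[OF generator_Box[OF *(2)]] less.prems by auto
      then obtain s where s: "s \<in> Box A m l'" "cmp m \<beta>' s = bid m" using less.IH[OF _ *(3)] *(1) by auto
      obtain t where t: "t \<in> Box A l' l" "cmp l' \<sigma> t = bid l'" using generator_section[OF *(2)] *(1) by metis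
      have "cmp m \<beta> (cmp m t s) = cmp m (cmp l' (cmp l \<beta>' \<sigma>) t) s" by (simp add: cmp_assoc[OF s(1)] *(4))
      also have "\<dots> = bid m" using s t by (simp add: cmp_assoc[OF t(1)] compose_bid_right[OF *(3)])
      finally show ?thesis using Box_comp[OF t(1) s(1)] by blast
    qed
  qed
  then show thesis using that by blast
qed

text \<open>The form in which critical faces are shown to be degenerate: two distinct points of the
  corresponding subcube with the same image under \<theta>.\<close>

lemma word_not_inj:
  assumes "face_word n cs" "length x = n" "length y = n" "x \<noteq> y" "\<theta> x = \<theta> y"
    "\<And>j d. (Suc j, d) \<in> set cs \<Longrightarrow> x ! j = d \<and> y ! j = d"
  shows "\<not> inj_on (cmp (n - length cs) \<theta> (word_face n cs)) (cube (n - length cs))"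
proof -
  obtain x' y' where x': "length x' = n - length cs" "word_face n cs x' = x"
    and y': "length y' = n - length cs" "word_face n cs y' = y"
    using word_face_surj[OF assms(1,2)] word_face_surj[OF assms(1,3)] assms(6) by metis
  show ?thesis
  proof
    assume "inj_on (cmp (n - length cs) \<theta> (word_face n cs)) (cube (n - length cs))"
    moreover have "cmp (n - length cs) \<theta> (word_face n cs) x' = cmp (n - length cs) \<theta> (word_face n cs) y'"
      using x' y' assms(5) by (simp add: cmp_apply)
    ultimately have "x' = y'" using x' y' by (simp add: inj_on_def)
    then show False using x' y' assms(4) by simp
  qed
qed

lemma face_not_inj:
  assumes "j \<le> m" "length x = Suc m" "length y = Suc m" "x \<noteq> y" "\<theta> x = \<theta> y" "x ! j = d" "y ! j = d"
  shows "\<not> inj_on (cmp m \<theta> (face (Suc m) (Suc j) d)) (cube m)"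
proof -
  have "face_word (Suc m) [(Suc j, d)]" using assms(1) by (simp add: face_word_def)
  from word_not_inj[OF this assms(2-5)] show ?thesis
    using assms(1,6,7) compose_bid_right[OF Box_face_Suc[of "Suc j" m d UNIV]] by simp
qed

lemma Box_to_0_ex: "\<exists>\<psi>. \<psi> \<in> Box A a 0"
proof (induction a)
  case 0 then show ?case using Box_id by blast
next
  case (Suc a)
  then obtain \<psi> where "\<psi> \<in> Box A a 0" by blast
  from Box_comp[OF this Box_degen_Suc[of 1 a]] show ?case by auto
qed

lemma Box_to_0:
  assumes "\<phi> \<in> Box B a 0"
  shows "\<phi> \<in> Box A a 0"
proof -
  obtain \<psi> where \<psi>: "\<psi> \<in> Box A a 0" using Box_to_0_ex by blast
  then have "\<phi> = \<psi>" by (rule Box_eqI[OF assms]) (use Box_length[OF assms] Box_length[OF \<psi>] in auto)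
  then show ?thesis using \<psi> by simp
qed

text \<open>A constant morphism into the interval is an endpoint after a projection to the point,
  and such composites exist in every cube category.\<close>

lemma Box_to_1_bdry:
  assumes "\<phi> \<in> Box B a 1" "bdry a 1 \<phi>"
  shows "\<phi> \<in> Box A a 1"
proof -
  obtain d where d: "in_facet a 0 d \<phi>" using assms(2) by (auto simp: bdry_def)
  have B: "cmp a (degen 1 1) \<phi> \<in> Box A a 0"
    using Box_to_0[OF Box_comp[OF Box_degen_Suc[of 1 0] assms(1)[simplified]]] by simp
  have "\<phi> = cmp a (face 1 1 d) (cmp a (degen 1 1) \<phi>)"
    using facet_factor[of \<phi> B a 0 0 d] assms(1) d by simp
  then show ?thesis using Box_comp[OF Box_face_Suc[of 1 0 d A] B] by simp
qed

text \<open>From dimension at most one there are only the constants and the identity, which need no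
  connections. A genuinely new morphism therefore has two inputs, so \<open>F_fill\<close> can fix
  one and still vary another.\<close>

lemma Box_to_1_nontrivial:
  assumes "\<phi> \<in> Box B a 1" "\<phi> \<notin> Box A a 1"
  shows "2 \<le> a"
proof (rule ccontr)
  assume "\<not> 2 \<le> a"
  then consider "a = 0" | "a = 1" by linarith
  then have "bdry a 1 \<phi> \<or> a = 1 \<and> \<phi> = bid 1"
  proof cases
    case 1 then show ?thesis using bdry_if_less[OF assms(1)] by simp
  next
    case 2
    show ?thesis
    proof (cases "inj_on \<phi> (cube a)")
      case True then show ?thesis using inj_not_bdry[OF assms(1)] by blast
    next
      case False
      then obtain a' \<sigma> \<phi>' where *: "a = Suc a'" "generator B a' \<sigma>" "\<phi>' \<in> Box B a' 1" "\<phi> = cmp a \<phi>' \<sigma>"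
        using not_injE[OF assms(1)] by metis
      then have "bdry a' 1 \<phi>'" using 2 bdry_if_less by simp
      then show ?thesis using bdry_cmp[OF generator_Box[OF *(2)]] * by simp
    qed
  qed
  then show False using assms Box_to_1_bdry Box_id by metis
qed

lemma Box_mono_args:
  assumes "\<phi> \<in> Box A m n"
  shows "length x = m \<Longrightarrow> length y = m \<Longrightarrow> (\<forall>i<m. x ! i \<le> y ! i) \<Longrightarrow> \<forall>i<n. \<phi> x ! i \<le> \<phi> y ! i"
  using assms unfolding Box_def mem_Collect_eq
proof (induction rule: is_box_left_induct)
  case (id m) then show ?case by (simp add: bid_apply)
next
  case (face k i n e \<psi>)
  have l: "length (\<psi> x) = n" "length (\<psi> y) = n" using face Box_length[of \<psi> A k n] by (auto simp: Box_def)
  have "\<forall>i<n. \<psi> x ! i \<le> \<psi> y ! i" using face by blast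
  then show ?case using l face by (auto simp: cmp_apply nth_face)
next
  case (degen k i n \<psi>)
  have l: "length (\<psi> x) = Suc n" "length (\<psi> y) = Suc n" using degen Box_length[of \<psi> A k "Suc n"] by (auto simp: Box_def)
  have "\<forall>i<Suc n. \<psi> x ! i \<le> \<psi> y ! i" using degen by blast
  then show ?case using l degen by (auto simp: cmp_apply nth_degen)
next
  case (conn k i n e \<psi>)
  have l: "length (\<psi> x) = Suc n" "length (\<psi> y) = Suc n" using conn Box_length[of \<psi> A k "Suc n"] by (auto simp: Box_def)
  have le: "\<psi> x ! i \<le> \<psi> y ! i" if "i < Suc n" for i using conn that by blast
  show ?case using l conn le[of i] le[of "Suc i"] le by (auto simp: cmp_apply nth_conn)
qed

text \<open>Both values occur because the morphism is not constant, and by monotonicity the extreme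
  points take the extreme values. It follows that absorbing inputs throughout give an absorbing
  output.\<close>

lemma Box_replicate:
  assumes "\<phi> \<in> Box A a 1" "\<not> bdry a 1 \<phi>"
  shows "\<phi> (replicate a d) = [d]"
proof -
  have "\<exists>x. length x = a \<and> \<phi> x ! 0 = d"
    using assms(2) unfolding bdry_def in_facet_def by (metis less_one)
  then obtain x where x: "length x = a" "\<phi> x ! 0 = d" by blast
  have "\<phi> (replicate a d) ! 0 = d"
    using Box_mono_args[OF assms(1), of x "replicate a True"] Box_mono_args[OF assms(1), of "replicate a False" x] x
    by (cases d) auto
  then show ?thesis using Box_length[OF assms(1), of "replicate a d"] by (auto simp: length_Suc_conv)
qed

text \<open>For this operation \<open>e\<close> is neutral and \<open>\<not> e\<close> is
  absorbing.\<close>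

definition opn :: "bool \<Rightarrow> bool \<Rightarrow> bool \<Rightarrow> bool" where
  "opn e s t = (if e then s \<and> t else s \<or> t)"

lemma opn_simps [simp]: "opn e (\<not> e) t = (\<not> e)" "opn e t (\<not> e) = (\<not> e)" "opn e e t = t" "opn e t e = t"
  by (auto simp: opn_def)

lemma conn_apply: "length x = Suc n \<Longrightarrow> q < n \<Longrightarrow>
  conn (Suc n) (Suc q) e x = take q x @ opn e (x ! q) (x ! Suc q) # drop (Suc (Suc q)) x"
  by (auto simp: conn_def opn_def min_def max_def)

lemma juxtapose_bid_apply: "length x = a + s \<Longrightarrow> juxtapose a s \<phi> (bid s) x = \<phi> (take a x) @ drop a x"
  by (simp add: juxtapose_def bid_def)

text \<open>The coordinates of an identity block take both values, so a constant output can only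
  come from \<phi>.\<close>

lemma bdry_juxtapose_bid:
  assumes "\<phi> \<in> Box B a p"
  shows "bdry (a + r) (p + r) (juxtapose a r \<phi> (bid r)) \<longleftrightarrow> bdry a p \<phi>"
proof
  assume "bdry (a + r) (p + r) (juxtapose a r \<phi> (bid r))"
  then obtain j d where j: "j < p + r" and f: "in_facet (a + r) j d (juxtapose a r \<phi> (bid r))"
    unfolding bdry_def by blast
  have e: "(\<phi> u @ v) ! j = d" if "length u = a" "length v = r" for u v
    using f that unfolding in_facet_def by (metis juxtapose_apply bid_apply length_append)
  show "bdry a p \<phi>"
  proof (cases "j < p")
    case True
    have "\<phi> u ! j = d" if "length u = a" for u
      using e[OF that, of "replicate r True"] Box_length[OF assms that] True by (simp add: nth_append)
    then show ?thesis using True unfolding bdry_def in_facet_def by blast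
  next
    case False
    have "(\<phi> (replicate a True) @ replicate r (\<not> d)) ! j = d" by (rule e) auto
    then show ?thesis using False j Box_length[OF assms, of "replicate a True"] by (simp add: nth_append)
  qed
next
  assume "bdry a p \<phi>"
  then obtain j d where "j < p" "in_facet a j d \<phi>" unfolding bdry_def by blast
  then have "in_facet (a + r) j d (juxtapose a r \<phi> (bid r))"
    using Box_length[OF assms] by (auto simp: in_facet_def juxtapose_bid_apply nth_append)
  then show "bdry (a + r) (p + r) (juxtapose a r \<phi> (bid r))" using \<open>j < p\<close> unfolding bdry_def by (meson trans_less_add1)
qed

text \<open>The internal hom out of the s-cube: an a-cube is a map from the product of the a-cube
  and the s-cube to \<open>Y\<close>. A family of \<open>(a + s)\<close>-cubes that is natural in
  the first \<open>a\<close> coordinates is a map into this object, which brings it within reach of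
  \<open>extension_problem\<close>.\<close>

definition shift :: "nat \<Rightarrow> 'a mcset \<Rightarrow> 'a mcset" where
  "shift s Y = \<lparr>cells = (\<lambda>a. cells Y (a + s)),
     act = (\<lambda>m n \<phi>. act Y (m + s) (n + s) (juxtapose m s \<phi> (bid s))), marked = (\<lambda>_. {})\<rparr>"

lemma shift_simps [simp]:
  "cells (shift s Y) a = cells Y (a + s)"
  "act (shift s Y) m n \<phi> = act Y (m + s) (n + s) (juxtapose m s \<phi> (bid s))"
  by (simp_all add: shift_def)

lemma juxtapose_bid_cmp:
  "\<psi> \<in> Box A k m \<Longrightarrow> cmp (k + s) (juxtapose m s \<phi> (bid s)) (juxtapose k s \<psi> (bid s)) = juxtapose k s (cmp k \<phi> \<psi>) (bid s)"
  by (simp add: juxtapose_cmp[OF _ Box_id] compose_bid_left[OF Box_id])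

lemma cubical_set_shift: "cubical_set A Y \<Longrightarrow> cubical_set A (shift s Y)"
proof -
  assume "cubical_set A Y"
  then interpret cubical_set A Y .
  show ?thesis
  proof
    show "act (shift s Y) m n \<phi> x \<in> cells (shift s Y) m" if "\<phi> \<in> Box A m n" "x \<in> cells (shift s Y) n" for \<phi> m n x
      using that act_closed[OF Box_juxtapose_bid] by simp
    show "act (shift s Y) n n (bid n) x = x" if "x \<in> cells (shift s Y) n" for n x
      using that act_id by (simp add: juxtapose_bid_bid)
    show "act (shift s Y) k n (cmp k \<phi> \<psi>) x = act (shift s Y) k m \<psi> (act (shift s Y) m n \<phi> x)"
      if "\<phi> \<in> Box A m n" "\<psi> \<in> Box A k m" "x \<in> cells (shift s Y) n" for \<phi> \<psi> k m n x
      using that act_comp[OF Box_juxtapose_bid[OF that(1)] Box_juxtapose_bid[OF that(2)]]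
        juxtapose_bid_cmp[OF that(2)] by simp
  qed
qed

lemma istar_simps [simp]:
  "cells (istar A X) = cells X" "marked (istar A X) = marked X"
  "\<phi> \<in> Box A m n \<Longrightarrow> act (istar A X) m n \<phi> = act X m n \<phi>"
  by (simp_all add: istar_def)

lemma cubical_set_istar:
  assumes "A \<subseteq> B" "cubical_set B X"
  shows "cubical_set A (istar A X)"
proof -
  interpret cubical_set B X by (rule assms(2))
  show ?thesis
    by unfold_locales (use act_closed act_id act_comp Box_mono[OF assms(1)] in \<open>simp_all add: Box_id Box_comp\<close>)
qed

lemma marked_cubical_set_istar:
  assumes "A \<subseteq> B" "marked_cubical_set B X"
  shows "marked_cubical_set A (istar A X)"
proof -
  interpret marked_cubical_set B X by (rule assms(2))
  show ?thesis
  proof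
    show "degenerate A (istar A X) n \<subseteq> marked (istar A X) n" for n
    proof
      fix x assume "x \<in> degenerate A (istar A X) n"
      then obtain m \<sigma> y where *: "n = Suc m" "generator A m \<sigma>" "y \<in> cells (istar A X) m" "x = act (istar A X) n m \<sigma> y"
        by (rule degenerateE)
      have "generator B m \<sigma>" using *(2) assms(1) by (auto simp: generator_def)
      then show "x \<in> marked (istar A X) n" using generator_marked[of m \<sigma> y] * generator_Box[OF *(2)] by simp
    qed
  qed (use act_closed act_id act_comp marked_cells marked_0 Box_mono[OF assms(1)] in \<open>simp_all add: Box_id Box_comp\<close>)
qed

text \<open>In this locale \<open>\<zeta>\<close> is a map $i^*\Box^n_B \to Z$, \<open>b\<close> a lift of its restriction to $i^* i_! \partial\Box^n_A$
  and \<open>y\<close> a lift of its restriction to $\Box^n_A$.\<close>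

locale connection_lift = Y: marked_cubical_set A Y + Z: marked_cubical_set A Z
  for A :: "bool set" and Y :: "'y mcset" and Z :: "'z mcset" +
  fixes B :: "bool set" and g :: "('y, 'z) mmap" and n :: nat
    and \<zeta> :: "nat \<Rightarrow> bmap \<Rightarrow> 'z" and b :: "nat \<Rightarrow> bmap \<Rightarrow> 'y" and y :: 'y and e :: bool
  assumes AB: "A \<subseteq> B" and e: "e \<in> B" and g: "g \<in> hom A Y Z" and fib: "comical_fibration A Y Z g"
    and \<zeta>_cells: "\<theta> \<in> Box B k n \<Longrightarrow> \<zeta> k \<theta> \<in> cells Z k"
    and \<zeta>_act: "\<theta> \<in> Box B k n \<Longrightarrow> \<beta> \<in> Box A l k \<Longrightarrow> \<zeta> l (cmp l \<theta> \<beta>) = act Z l k \<beta> (\<zeta> k \<theta>)"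
    and \<zeta>_marked: "\<theta> \<in> Box B k n \<Longrightarrow> \<not> inj_on \<theta> (cube k) \<Longrightarrow> \<zeta> k \<theta> \<in> marked Z k"
    and b_cells: "\<theta> \<in> Box B k n \<Longrightarrow> bdry k n \<theta> \<Longrightarrow> b k \<theta> \<in> cells Y k"
    and b_act: "\<theta> \<in> Box B k n \<Longrightarrow> bdry k n \<theta> \<Longrightarrow> \<beta> \<in> Box A l k \<Longrightarrow> b l (cmp l \<theta> \<beta>) = act Y l k \<beta> (b k \<theta>)"
    and b_marked: "\<theta> \<in> Box B k n \<Longrightarrow> bdry k n \<theta> \<Longrightarrow> \<not> inj_on \<theta> (cube k) \<Longrightarrow> b k \<theta> \<in> marked Y k"
    and b_g: "\<theta> \<in> Box B k n \<Longrightarrow> bdry k n \<theta> \<Longrightarrow> g k (b k \<theta>) = \<zeta> k \<theta>"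
    and y: "y \<in> cells Y n" "g n y = \<zeta> n (bid n)"
    and y_b: "\<beta> \<in> Box A k n \<Longrightarrow> bdry k n \<beta> \<Longrightarrow> act Y k n \<beta> y = b k \<beta>"
begin

text \<open>Says that \<open>z\<close> is admissible as value of the lift at \<theta>: it lies over
  \<zeta>, agrees with \<open>b\<close> wherever \<theta> enters the boundary, and is marked
  wherever \<theta> becomes degenerate in the larger category. Quantifying over all \<beta> makes
  this stable under operators.\<close>

definition good :: "nat \<Rightarrow> bmap \<Rightarrow> 'y \<Rightarrow> bool" where
  "good k \<theta> z \<longleftrightarrow> z \<in> cells Y k \<and> g k z = \<zeta> k \<theta> \<and>
     (\<forall>l. \<forall>\<beta>\<in>Box A l k. (bdry l n (cmp l \<theta> \<beta>) \<longrightarrow> act Y l k \<beta> z = b l (cmp l \<theta> \<beta>)) \<and>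
       (\<not> inj_on (cmp l \<theta> \<beta>) (cube l) \<longrightarrow> act Y l k \<beta> z \<in> marked Y l))"

lemma good_cells: "good k \<theta> z \<Longrightarrow> z \<in> cells Y k"
  by (simp add: good_def)

lemma good_g: "good k \<theta> z \<Longrightarrow> g k z = \<zeta> k \<theta>"
  by (simp add: good_def)

lemma good_bdry_act: "good k \<theta> z \<Longrightarrow> \<beta> \<in> Box A l k \<Longrightarrow> bdry l n (cmp l \<theta> \<beta>) \<Longrightarrow> act Y l k \<beta> z = b l (cmp l \<theta> \<beta>)"
  by (simp add: good_def)

lemma good_marked_act: "good k \<theta> z \<Longrightarrow> \<beta> \<in> Box A l k \<Longrightarrow> \<not> inj_on (cmp l \<theta> \<beta>) (cube l) \<Longrightarrow> act Y l k \<beta> z \<in> marked Y l"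
  by (simp add: good_def)

lemma good_bdry: "good k \<theta> z \<Longrightarrow> \<theta> \<in> Box B k n \<Longrightarrow> bdry k n \<theta> \<Longrightarrow> z = b k \<theta>"
  using good_bdry_act[OF _ Box_id, of k \<theta> z] Y.act_id good_cells compose_bid_right by metis

lemma good_marked: "good k \<theta> z \<Longrightarrow> \<theta> \<in> Box B k n \<Longrightarrow> \<not> inj_on \<theta> (cube k) \<Longrightarrow> z \<in> marked Y k"
  using good_marked_act[OF _ Box_id, of k \<theta> z] Y.act_id good_cells compose_bid_right by metis

lemma good_act:
  assumes z: "good k \<theta> z" and \<theta>: "\<theta> \<in> Box B k n" and \<beta>: "\<beta> \<in> Box A l k"
  shows "good l (cmp l \<theta> \<beta>) (act Y l k \<beta> z)"
proof -
  have zc: "z \<in> cells Y k" by (rule good_cells[OF z])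
  have comp: "act Y l' l \<beta>' (act Y l k \<beta> z) = act Y l' k (cmp l' \<beta> \<beta>') z"
    "cmp l' (cmp l \<theta> \<beta>) \<beta>' = cmp l' \<theta> (cmp l' \<beta> \<beta>')" "cmp l' \<beta> \<beta>' \<in> Box A l' k" if "\<beta>' \<in> Box A l' l" for l' \<beta>'
    using Y.act_comp[OF \<beta> that zc] cmp_assoc[OF that] Box_comp[OF \<beta> that] by simp_all
  have "g l (act Y l k \<beta> z) = \<zeta> l (cmp l \<theta> \<beta>)"
    using hom_act[OF g \<beta> zc] \<zeta>_act[OF \<theta> \<beta>] good_g[OF z] by simp
  then show ?thesis
    unfolding good_def using Y.act_closed[OF \<beta> zc] comp good_bdry_act[OF z] good_marked_act[OF z] by simp
qed

lemma good_b:
  assumes \<theta>: "\<theta> \<in> Box B k n" and bd: "bdry k n \<theta>"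
  shows "good k \<theta> (b k \<theta>)"
proof -
  have "act Y l k \<beta> (b k \<theta>) \<in> marked Y l" if \<beta>: "\<beta> \<in> Box A l k" and "\<not> inj_on (cmp l \<theta> \<beta>) (cube l)" for l \<beta>
    using b_act[OF \<theta> bd \<beta>] b_marked[OF Box_comp[OF \<theta> Box_mono[OF AB \<beta>]] bdry_cmp[OF \<beta> bd]] that by simp
  then show ?thesis
    unfolding good_def using b_cells[OF \<theta> bd] b_g[OF \<theta> bd] b_act[OF \<theta> bd] by simp
qed

lemma good_y: "good n (bid n) y"
  unfolding good_def
proof (intro conjI ballI allI impI)
  fix l \<beta> assume \<beta>: "\<beta> \<in> Box A l n"
  show "act Y l n \<beta> y = b l (cmp l (bid n) \<beta>)" if "bdry l n (cmp l (bid n) \<beta>)"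
    using that y_b[OF \<beta>] by (simp add: compose_bid_left[OF \<beta>])
  show "act Y l n \<beta> y \<in> marked Y l" if "\<not> inj_on (cmp l (bid n) \<beta>) (cube l)"
    using that Y.not_inj_marked[OF \<beta> _ y(1)] by (simp add: compose_bid_left[OF \<beta>])
qed (use y in auto)

text \<open>Box filling for admissible values. Facets need to be compared only when both lie outside
  the boundary, because on the boundary the value is forced to be that of \<open>b\<close>. By
  \<open>nb\<close> the missing facet meets no such prescription, and \<open>me\<close> supplies the
  marked facets needed to mark the missing one when it is degenerate.\<close>

lemma good_fill:
  assumes \<theta>: "\<theta> \<in> Box B (Suc m) n" and i: "i \<le> m"
    and nb: "\<not> bdry m n (cmp m \<theta> (face (Suc m) (Suc i) e'))"
    and D: "\<And>j d. j \<le> m \<Longrightarrow> (j, d) \<noteq> (i, e') \<Longrightarrow> good m (cmp m \<theta> (face (Suc m) (Suc j) d)) (D j d)"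
    and compat: "\<And>k j l d d'. m = Suc k \<Longrightarrow> j \<le> l \<Longrightarrow> l \<le> k \<Longrightarrow> (j, d) \<noteq> (i, e') \<Longrightarrow> (Suc l, d') \<noteq> (i, e') \<Longrightarrow>
      \<not> bdry m n (cmp m \<theta> (face (Suc m) (Suc j) d)) \<Longrightarrow> \<not> bdry m n (cmp m \<theta> (face (Suc m) (Suc (Suc l)) d')) \<Longrightarrow>
      act Y k m (face m (Suc j) d) (D (Suc l) d') = act Y k m (face m (Suc l) d') (D j d)"
    and crit: "\<And>cs. face_word (Suc m) cs \<Longrightarrow> critical (Suc i) e' cs \<Longrightarrow>
      \<not> inj_on (cmp (Suc m - length cs) \<theta> (word_face (Suc m) cs)) (cube (Suc m - length cs))"
    and me: "\<And>j d. \<not> inj_on (cmp m \<theta> (face (Suc m) (Suc i) e')) (cube m) \<Longrightarrow> j \<le> m \<Longrightarrow> (j, d) \<noteq> (i, e') \<Longrightarrow>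
      \<not> inj_on (cmp m \<theta> (face (Suc m) (Suc j) d)) (cube m)"
  shows "\<exists>z. good (Suc m) \<theta> z \<and> (\<forall>j d. j \<le> m \<longrightarrow> (j, d) \<noteq> (i, e') \<longrightarrow> act Y m (Suc m) (face (Suc m) (Suc j) d) z = D j d)"
proof -
  have fB: "face (Suc m) (Suc j) d \<in> Box C m (Suc m)" if "j \<le> m" for j d C using that by (auto intro!: Box_face_Suc)
  have \<theta>f: "cmp m \<theta> (face (Suc m) (Suc j) d) \<in> Box B m n" if "j \<le> m" for j d
    using Box_comp[OF \<theta> fB[OF that]] .
  have dB: "cmp l (degen (Suc m) (Suc j)) \<beta> \<in> Box A l m" if "\<beta> \<in> Box A l (Suc m)" "j \<le> m" for l j \<beta>
    using that by (auto intro!: Box_comp[OF Box_degen_Suc])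
  have fact: "cmp l (cmp m \<theta> (face (Suc m) (Suc j) d)) (cmp l (degen (Suc m) (Suc j)) \<beta>) = cmp l \<theta> \<beta>"
    if "\<beta> \<in> Box A l (Suc m)" "j \<le> m" "in_facet l j d \<beta>" for l \<beta> j d
    using facet_factor[OF that] cmp_assoc[OF dB[OF that(1,2)]] by simp
  have word: "\<not> inj_on (cmp k \<theta> w) (cube k)" "w \<in> Box A k (Suc m)"
    if w: "w \<in> faces_where (Suc m) (critical (Suc i) e') k" for k w
  proof -
    from w obtain cs where "w = word_face (Suc m) cs" "face_word (Suc m) cs" "critical (Suc i) e' cs" "k = Suc m - length cs"
      by (rule faces_whereE) blast
    then show "\<not> inj_on (cmp k \<theta> w) (cube k)" using crit by simp
  qed (rule faces_where_Box[OF w])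
  have "\<exists>z\<in>cells Y (Suc m). g (Suc m) z = \<zeta> (Suc m) \<theta> \<and>
    (\<forall>j d. j \<le> m \<longrightarrow> (j, d) \<noteq> (i, e') \<longrightarrow> act Y m (Suc m) (face (Suc m) (Suc j) d) z = D j d) \<and>
    (\<forall>k w. w \<in> faces_where (Suc m) (critical (Suc i) e') k \<longrightarrow> act Y k (Suc m) w z \<in> marked Y k)"
  proof (rule fill_open_box[OF fib Y.marked_cubical_set_axioms Z.marked_cubical_set_axioms g i \<zeta>_cells[OF \<theta>]])
    show "D j d \<in> cells Y m \<and> g m (D j d) = act Z m (Suc m) (face (Suc m) (Suc j) d) (\<zeta> (Suc m) \<theta>)"
      if "j \<le> m" "(j, d) \<noteq> (i, e')" for j d
      using good_cells[OF D[OF that]] good_g[OF D[OF that]] \<zeta>_act[OF \<theta> fB[OF that(1)]] by simp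
  next
    fix k j l d d' assume *: "m = Suc k" "j \<le> l" "l \<le> k" "(j, d) \<noteq> (i, e')" "(Suc l, d') \<noteq> (i, e')"
    have jm: "j \<le> m" "Suc l \<le> m" using * by simp_all
    have kB: "face m (Suc j) d \<in> Box A k m" "face m (Suc l) d' \<in> Box A k m" using * by (auto intro!: Box_face_Suc)
    have eq: "cmp k (cmp m \<theta> (face (Suc m) (Suc (Suc l)) d')) (face m (Suc j) d) =
        cmp k (cmp m \<theta> (face (Suc m) (Suc j) d)) (face m (Suc l) d')"
      unfolding cmp_assoc[OF kB(1)] cmp_assoc[OF kB(2)] using face_face[OF *(2,3), of d' d] * by simp
    show "act Y k m (face m (Suc j) d) (D (Suc l) d') = act Y k m (face m (Suc l) d') (D j d)"
    proof (cases "bdry m n (cmp m \<theta> (face (Suc m) (Suc j) d)) \<or> bdry m n (cmp m \<theta> (face (Suc m) (Suc (Suc l)) d'))")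
      case True
      then have "bdry k n (cmp k (cmp m \<theta> (face (Suc m) (Suc j) d)) (face m (Suc l) d'))"
        using bdry_cmp[OF kB(1)] bdry_cmp[OF kB(2)] eq by metis
      then show ?thesis
        using good_bdry_act[OF D[OF jm(1) *(4)] kB(2)] good_bdry_act[OF D[OF jm(2) *(5)] kB(1)] eq by simp
    next
      case False
      then show ?thesis using compat[OF *] by blast
    qed
  next
    show "act Z k (Suc m) w (\<zeta> (Suc m) \<theta>) \<in> marked Z k" if "w \<in> faces_where (Suc m) (critical (Suc i) e') k" for k w
      using word[OF that] \<zeta>_act[OF \<theta> word(2)[OF that]] \<zeta>_marked[OF Box_comp[OF \<theta> Box_mono[OF AB]]] by metis
  next
    fix cs assume cs: "face_word (Suc m) cs" "critical (Suc i) e' cs" "cs \<noteq> []"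
    obtain c0 d0 cs' where c0: "cs = (c0, d0) # cs'" using cs(3) by (cases cs) auto
    obtain j0 where j0: "c0 = Suc j0" "j0 \<le> m"
      using face_word_Cons[OF cs(1)[unfolded c0]] by (metis Suc_inject)
    have mem: "(Suc j0, d0) \<in> set cs" using c0 j0 by simp
    have ne: "(j0, d0) \<noteq> (i, e')" using mem cs(2) unfolding critical_def by (cases d0; cases e') auto
    have B: "word_face (Suc m) cs \<in> Box A (Suc m - length cs) (Suc m)" by (rule word_face_Box[OF cs(1)])
    show "\<exists>j d. (Suc j, d) \<in> set cs \<and> j \<le> m \<and>
        act Y (Suc m - length cs) m (cmp (Suc m - length cs) (degen (Suc m) (Suc j)) (word_face (Suc m) cs)) (D j d)
          \<in> marked Y (Suc m - length cs)"
      using good_marked_act[OF D[OF j0(2) ne] dB[OF B j0(2)]] fact[OF B j0(2) word_face_in_facet[OF cs(1) mem]] crit[OF cs(1,2)] mem j0(2)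
      by (intro exI[of _ j0] exI[of _ d0]) simp
  qed
  then obtain z where z: "z \<in> cells Y (Suc m)" "g (Suc m) z = \<zeta> (Suc m) \<theta>"
    "\<And>j d. j \<le> m \<Longrightarrow> (j, d) \<noteq> (i, e') \<Longrightarrow> act Y m (Suc m) (face (Suc m) (Suc j) d) z = D j d"
    "\<And>k w. w \<in> faces_where (Suc m) (critical (Suc i) e') k \<Longrightarrow> act Y k (Suc m) w z \<in> marked Y k"
    by blast
  have "bid (Suc m) \<in> faces_where (Suc m) (critical (Suc i) e') (Suc m)"
    by (auto simp: faces_where_def face_word_def intro!: exI[of _ "[]"])
  from z(4)[OF this] have zm: "z \<in> marked Y (Suc m)" using Y.act_id[OF z(1)] by simp
  have missing: "act Y m (Suc m) (face (Suc m) (Suc i) e') z \<in> marked Y m"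
    if ninj: "\<not> inj_on (cmp m \<theta> (face (Suc m) (Suc i) e')) (cube m)"
  proof -
    obtain k where k: "m = Suc k" using ninj inj_on_cube_0 by (cases m) auto
    show ?thesis
      unfolding k
    proof (rule mark_missing_face[OF fib Y.marked_cubical_set_axioms Z.marked_cubical_set_axioms g])
      show "i \<le> Suc k" "z \<in> cells Y (Suc (Suc k))" using i z k by simp_all
      show "act Y l (Suc (Suc k)) w z \<in> marked Y l" if "w \<in> faces_where (Suc (Suc k)) (critical (Suc i) e') l" for l w
        using z(4) that k by simp
      show "act Y (Suc k) (Suc (Suc k)) (face (Suc (Suc k)) (Suc j) d) z \<in> marked Y (Suc k)"
        if j: "j \<le> Suc k" "(j, d) \<noteq> (i, e')" for j d
        using z(3)[of j d] good_marked[OF D[of j d] \<theta>f me[OF ninj]] j k by simp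
      show "act Z (Suc k) (Suc (Suc k)) (face (Suc (Suc k)) (Suc i) e') (g (Suc (Suc k)) z) \<in> marked Z (Suc k)"
        using \<zeta>_act[OF \<theta> fB[OF i]] \<zeta>_marked[OF \<theta>f[OF i] ninj] z(2) k by simp
    qed
  qed
  have nb\<theta>: "\<not> bdry (Suc m) n \<theta>" using bdry_cmp[OF fB[OF i]] nb by blast
  have "good (Suc m) \<theta> z"
    unfolding good_def
  proof (intro conjI ballI allI)
    fix l \<beta> assume \<beta>: "\<beta> \<in> Box A l (Suc m)"
    have "(bdry l n (cmp l \<theta> \<beta>) \<longrightarrow> act Y l (Suc m) \<beta> z = b l (cmp l \<theta> \<beta>)) \<and>
       (\<not> inj_on (cmp l \<theta> \<beta>) (cube l) \<longrightarrow> act Y l (Suc m) \<beta> z \<in> marked Y l)"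
    proof (cases "\<exists>j d. j \<le> m \<and> (j, d) \<noteq> (i, e') \<and> in_facet l j d \<beta>")
      case True
      then obtain j d where j: "j \<le> m" "(j, d) \<noteq> (i, e')" "in_facet l j d \<beta>" by blast
      have "act Y l (Suc m) \<beta> z = act Y l m (cmp l (degen (Suc m) (Suc j)) \<beta>) (D j d)"
        using Y.act_comp[OF fB[OF j(1)] dB[OF \<beta> j(1)] z(1), of d] facet_factor[OF \<beta> j(1,3)] z(3)[OF j(1,2)] by simp
      then show ?thesis
        using good_bdry_act[OF D[OF j(1,2)] dB[OF \<beta> j(1)]] good_marked_act[OF D[OF j(1,2)] dB[OF \<beta> j(1)]] fact[OF \<beta> j(1,3)] by simp
    next
      \<comment> \<open>When \<beta> lies in no facet of the box, it maps onto the whole cube or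
        onto the missing facet and has a section there. A section would carry membership in the
        boundary back to \<theta> or to the missing facet, which is excluded; so only markings
        remain to be checked.\<close>
      case none: False
      show ?thesis
      proof (cases "bdry l (Suc m) \<beta>")
        case False
        obtain s where s: "s \<in> Box A (Suc m) l" "cmp (Suc m) \<beta> s = bid (Suc m)"
          using not_bdry_section[OF \<beta> False] .
        have "\<not> bdry l n (cmp l \<theta> \<beta>)"
        proof
          assume "bdry l n (cmp l \<theta> \<beta>)"
          from bdry_cmp[OF s(1) this] show False
            using nb\<theta> s(2) by (simp add: cmp_assoc[OF s(1)] compose_bid_right[OF \<theta>])
        qed
        moreover have "act Y l (Suc m) \<beta> z \<in> marked Y l"
        proof (cases "inj_on \<beta> (cube l)")
          case True
          then show ?thesis using inj_not_bdry[OF \<beta> True False] zm Y.act_id[OF z(1)] by simp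
        next
          case False
          then show ?thesis using Y.not_inj_marked[OF \<beta> False z(1)] by blast
        qed
        ultimately show ?thesis by blast
      next
        case True
        then obtain j d where "j < Suc m" "in_facet l j d \<beta>" unfolding bdry_def by blast
        moreover from this have "(j, d) = (i, e')" using none by (meson less_Suc_eq_le)
        ultimately have f: "in_facet l i e' \<beta>" by simp
        define \<beta>' where "\<beta>' = cmp l (degen (Suc m) (Suc i)) \<beta>"
        have \<beta>': "\<beta>' \<in> Box A l m" unfolding \<beta>'_def by (rule dB[OF \<beta> i])
        have eq: "\<beta> = cmp l (face (Suc m) (Suc i) e') \<beta>'" unfolding \<beta>'_def by (rule facet_factor[OF \<beta> i f])
        have nb': "\<not> bdry l m \<beta>'"
        proof
          assume "bdry l m \<beta>'"
          then obtain j d where j: "j < m" "in_facet l j d \<beta>'" unfolding bdry_def by blast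
          have "\<beta> x ! (if j < i then j else Suc j) = d" if "length x = l" for x
            using j i that Box_length[OF \<beta>' that] unfolding eq by (auto simp: in_facet_def cmp_apply nth_face)
          then have "in_facet l (if j < i then j else Suc j) d \<beta>" by (simp add: in_facet_def)
          moreover have "(if j < i then j else Suc j) \<le> m" "(if j < i then j else Suc j) \<noteq> i" using j by auto
          ultimately show False using none by blast
        qed
        have fz: "act Y m (Suc m) (face (Suc m) (Suc i) e') z \<in> cells Y m" by (rule Y.act_closed[OF fB[OF i] z(1)])
        have act\<beta>: "act Y l (Suc m) \<beta> z = act Y l m \<beta>' (act Y m (Suc m) (face (Suc m) (Suc i) e') z)"
          unfolding eq by (rule Y.act_comp[OF fB[OF i] \<beta>' z(1)])
        have \<theta>\<beta>: "cmp l \<theta> \<beta> = cmp l (cmp m \<theta> (face (Suc m) (Suc i) e')) \<beta>'"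
          unfolding eq by (simp add: cmp_assoc[OF \<beta>'])
        obtain s where s: "s \<in> Box A m l" "cmp m \<beta>' s = bid m"
          using not_bdry_section[OF \<beta>' nb'] .
        have "\<not> bdry l n (cmp l \<theta> \<beta>)"
        proof
          assume "bdry l n (cmp l \<theta> \<beta>)"
          from bdry_cmp[OF s(1) this] show False
            using nb s(2) compose_bid_right[OF \<theta>f[OF i], of e'] unfolding \<theta>\<beta> cmp_assoc[OF s(1)] by simp
        qed
        moreover have "act Y l (Suc m) \<beta> z \<in> marked Y l" if "\<not> inj_on (cmp l \<theta> \<beta>) (cube l)"
        proof (cases "inj_on \<beta>' (cube l)")
          case True
          from inj_not_bdry[OF \<beta>' True nb'] have l: "l = m" "\<beta>' = bid m" by simp_all
          then have "\<not> inj_on (cmp m \<theta> (face (Suc m) (Suc i) e')) (cube m)"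
            using that \<theta>\<beta> compose_bid_right[OF \<theta>f[OF i]] by metis
          then show ?thesis using missing act\<beta> l Y.act_id[OF fz] by simp
        next
          case False
          then show ?thesis using Y.not_inj_marked[OF \<beta>' False fz] act\<beta> by simp
        qed
        ultimately show ?thesis by blast
      qed
    qed
    then show "bdry l n (cmp l \<theta> \<beta>) \<longrightarrow> act Y l (Suc m) \<beta> z = b l (cmp l \<theta> \<beta>)"
      and "\<not> inj_on (cmp l \<theta> \<beta>) (cube l) \<longrightarrow> act Y l (Suc m) \<beta> z \<in> marked Y l" by blast+
  qed (use z in auto)
  then show ?thesis using z(3) by blast
qed

end

section \<open>A connection of the larger category applied at one output coordinate\<close>

lemma juxtapose_face: "j \<le> m \<Longrightarrow> juxtapose m s (face (Suc m) (Suc j) d) (bid s) = face (Suc (m + s)) (Suc j) d"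
  by (intro juxtapose_eqI[of _ UNIV _ _ "Suc (m + s)"]) (auto simp: face_append bid_apply intro: Box_face_Suc)

lemma face_apply: "length x = m \<Longrightarrow> j \<le> m \<Longrightarrow> face (Suc m) (Suc j) d x = take j x @ d # drop j x"
  by (simp add: face_def)

lemma word_point:
  assumes "face_word n cs"
  obtains x where "length x = n" "\<And>j d. (Suc j, d) \<in> set cs \<Longrightarrow> x ! j = d"
proof -
  let ?u = "replicate (n - length cs) True"
  have "length (word_face n cs ?u) = n" using Box_length[OF word_face_Box[OF assms, of UNIV], of ?u] by simp
  moreover have "word_face n cs ?u ! j = d" if "(Suc j, d) \<in> set cs" for j d
    using word_face_in_facet[OF assms that] by (simp add: in_facet_def)
  ultimately show thesis by (rule that)
qed

context connection_lift
begin

text \<open>The connection is applied at position \<open>q\<close> after \<phi> is extended by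
  \<open>s\<close> identity coordinates. Two cases occur: for \<phi> into dimension \<open>q\<close>
  the first two identity coordinates are joined (the cubes for \<open>G\<close>), and for \<phi>
  into dimension \<open>Suc q\<close> the last output of \<phi> is joined with the first identity
  coordinate (the cubes for \<open>F\<close>).\<close>

definition gam :: "nat \<Rightarrow> nat \<Rightarrow> nat \<Rightarrow> bmap \<Rightarrow> bmap" where
  "gam q a s \<phi> = cmp (a + s) (conn (Suc n) (Suc q) e) (juxtapose a s \<phi> (bid s))"

lemma gam_Box: "q < n \<Longrightarrow> p + s = Suc n \<Longrightarrow> \<phi> \<in> Box B a p \<Longrightarrow> gam q a s \<phi> \<in> Box B (a + s) n"
  unfolding gam_def using Box_juxtapose_bid[of \<phi> B a p s] e
  by (auto intro!: Box_comp[OF Box_conn_Suc])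

lemma gam_act: "\<psi> \<in> Box B k a \<Longrightarrow> cmp (k + s) (gam q a s \<phi>) (juxtapose k s \<psi> (bid s)) = gam q k s (cmp k \<phi> \<psi>)"
  unfolding gam_def using cmp_assoc[OF Box_juxtapose_bid] juxtapose_bid_cmp by metis

lemma gam_face:
  assumes "j \<le> m"
  shows "cmp (m + s) (gam q (Suc m) s \<phi>) (face (Suc (m + s)) (Suc j) d) = gam q m s (cmp m \<phi> (face (Suc m) (Suc j) d))"
  using gam_act[of "face (Suc m) (Suc j) d" m "Suc m" s q \<phi>] juxtapose_face[OF assms, of s d] assms
  by (simp add: Box_face_Suc)

lemma gam_apply: "q < n \<Longrightarrow> p + s = Suc n \<Longrightarrow> \<phi> \<in> Box B a p \<Longrightarrow> length x = a + s \<Longrightarrow>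
  gam q a s \<phi> x = (let w = \<phi> (take a x) @ drop a x in take q w @ opn e (w ! q) (w ! Suc q) # drop (Suc (Suc q)) w)"
  using Box_length[of \<phi> B a p "take a x"]
  by (simp add: gam_def cmp_apply juxtapose_bid_apply conn_apply Let_def)

lemma gam_apply_G:
  assumes "n = q + Suc r" "\<phi> \<in> Box B a q" "length x = Suc (Suc (a + r))"
  shows "gam q a (Suc (Suc r)) \<phi> x = \<phi> (take a x) @ opn e (x ! a) (x ! Suc a) # drop (Suc (Suc a)) x"
  using gam_apply[of q q "Suc (Suc r)" \<phi> a x] assms Box_length[OF assms(2), of "take a x"]
  by (simp add: Let_def nth_append)

lemma gam_apply_F:
  assumes "n = q + Suc r" "\<phi> \<in> Box B a (Suc q)" "length x = Suc (a + r)"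
  shows "gam q a (Suc r) \<phi> x = take q (\<phi> (take a x)) @ opn e (\<phi> (take a x) ! q) (x ! a) # drop (Suc a) x"
  using gam_apply[of q "Suc q" "Suc r" \<phi> a x] assms Box_length[OF assms(2), of "take a x"]
  by (simp add: Let_def nth_append)

text \<open>As \<open>e\<close> is neutral, either argument of the connection may be set to it. The
  same morphism thus occurs as two facets: one will carry the value already constructed, the other
  is the missing one.\<close>

lemma gam_face_G:
  assumes "n = q + Suc r" "\<phi> \<in> Box B a q" "j = a \<or> j = Suc a"
  shows "cmp (Suc (a + r)) (gam q a (Suc (Suc r)) \<phi>) (face (Suc (Suc (a + r))) (Suc j) e) = juxtapose a (Suc r) \<phi> (bid (Suc r))"
proof (rule Box_eqI[of _ B "Suc (a + r)" n _ B n])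
  show "cmp (Suc (a + r)) (gam q a (Suc (Suc r)) \<phi>) (face (Suc (Suc (a + r))) (Suc j) e) \<in> Box B (Suc (a + r)) n"
    using gam_Box[of q q "Suc (Suc r)" \<phi> a] assms by (auto intro!: Box_comp[OF _ Box_face_Suc])
  show "juxtapose a (Suc r) \<phi> (bid (Suc r)) \<in> Box B (Suc (a + r)) n"
    using Box_juxtapose_bid[OF assms(2), of "Suc r"] assms(1) by simp
  fix x :: "bool list" assume x: "length x = Suc (a + r)"
  have "length (face (Suc (Suc (a + r))) (Suc j) e x) = Suc (Suc (a + r))"
    using x assms(3) by (intro length_face) auto
  then show "cmp (Suc (a + r)) (gam q a (Suc (Suc r)) \<phi>) (face (Suc (Suc (a + r))) (Suc j) e) x = juxtapose a (Suc r) \<phi> (bid (Suc r)) x"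
    using x assms(3) gam_apply_G[OF assms(1,2)]
    by (auto simp: cmp_apply juxtapose_bid_apply face_apply nth_append Cons_nth_drop_Suc take_Suc_conv_app_nth)
qed

text \<open>The neutral value of the joined coordinate undoes the connection. This facet is the cube
  whose value is wanted, so it is the missing one.\<close>

lemma gam_face_F:
  assumes "n = q + Suc r" "\<phi> \<in> Box B a (Suc q)"
  shows "cmp (a + r) (gam q a (Suc r) \<phi>) (face (Suc (a + r)) (Suc a) e) = juxtapose a r \<phi> (bid r)"
proof (rule Box_eqI[of _ B "a + r" n _ B n])
  show "cmp (a + r) (gam q a (Suc r) \<phi>) (face (Suc (a + r)) (Suc a) e) \<in> Box B (a + r) n"
    using gam_Box[of q "Suc q" "Suc r" \<phi> a] assms by (auto intro!: Box_comp[OF _ Box_face_Suc])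
  show "juxtapose a r \<phi> (bid r) \<in> Box B (a + r) n"
    using Box_juxtapose_bid[OF assms(2), of r] assms(1) by simp
  fix x :: "bool list" assume x: "length x = a + r"
  have l: "length (face (Suc (a + r)) (Suc a) e x) = Suc (a + r)"
    using x by (intro length_face) auto
  have l2: "length (\<phi> (take a x)) = Suc q" using Box_length[OF assms(2)] x by simp
  then have "take q (\<phi> (take a x)) @ [\<phi> (take a x) ! q] = \<phi> (take a x)"
    by (metis lessI order_refl take_Suc_conv_app_nth take_all)
  then have "take q (\<phi> (take a x)) @ \<phi> (take a x) ! q # drop a x = \<phi> (take a x) @ drop a x"
    by (metis append.assoc append_Cons append_Nil)
  then show "cmp (a + r) (gam q a (Suc r) \<phi>) (face (Suc (a + r)) (Suc a) e) x = juxtapose a r \<phi> (bid r) x"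
    using x gam_apply_F[OF assms l]
    by (simp add: cmp_apply juxtapose_bid_apply face_apply nth_append)
qed

lemma gam_bdry_G:
  assumes n: "n = q + Suc r" and \<phi>: "\<phi> \<in> Box B a q"
    and j: "j \<le> Suc (a + r)" "(j, d) = (a, \<not> e) \<or> (j, d) = (Suc a, \<not> e) \<or> Suc a < j"
  shows "bdry (Suc (a + r)) n (cmp (Suc (a + r)) (gam q a (Suc (Suc r)) \<phi>) (face (Suc (Suc (a + r))) (Suc j) d))"
proof -
  \<comment> \<open>The constant output: the joined coordinate if one of its arguments is absorbing,
    otherwise the output that copies input \<open>j\<close>. Two inputs are joined into output
    \<open>q\<close>, hence the offset.\<close>
  define k where "k = (if j \<le> Suc a then q else q + j - Suc a)"
  have "cmp (Suc (a + r)) (gam q a (Suc (Suc r)) \<phi>) (face (Suc (Suc (a + r))) (Suc j) d) x ! k = d"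
    if x: "length x = Suc (a + r)" for x
  proof -
    have l: "length (face (Suc (Suc (a + r))) (Suc j) d x) = Suc (Suc (a + r))"
      using x j(1) by (intro length_face) auto
    let ?y = "face (Suc (Suc (a + r))) (Suc j) d x"
    have lw: "length (\<phi> (take a ?y)) = q" using Box_length[OF \<phi>] l by simp
    have y: "?y ! j = d" using x j(1) by (simp add: nth_face)
    show ?thesis
    proof (cases "j \<le> Suc a")
      case True
      then have "d = (\<not> e)" "j = a \<or> j = Suc a" using j by auto
      then show ?thesis using gam_apply_G[OF n \<phi> l] lw y x True by (auto simp: cmp_apply k_def nth_append opn_def)
    next
      case False
      then obtain j' where j': "j = Suc (Suc (a + j'))" by (metis add_Suc less_natE not_less)
      have "k = q + Suc j'" by (simp add: k_def j')
      then show ?thesis using gam_apply_G[OF n \<phi> l] lw y x l j(1) unfolding j'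
        by (simp add: cmp_apply nth_append)
    qed
  qed
  moreover have "k < n" using j n by (auto simp: k_def)
  ultimately show ?thesis unfolding bdry_def in_facet_def by blast
qed

lemma gam_bdry_F:
  assumes n: "n = q + Suc r" and \<phi>: "\<phi> \<in> Box B a (Suc q)"
    and j: "j \<le> a + r" "(j, d) = (a, \<not> e) \<or> a < j"
  shows "bdry (a + r) n (cmp (a + r) (gam q a (Suc r) \<phi>) (face (Suc (a + r)) (Suc j) d))"
proof -
  define k where "k = q + j - a"
  have "cmp (a + r) (gam q a (Suc r) \<phi>) (face (Suc (a + r)) (Suc j) d) x ! k = d"
    if x: "length x = a + r" for x
  proof -
    have l: "length (face (Suc (a + r)) (Suc j) d x) = Suc (a + r)"
      using x j(1) by (intro length_face) auto
    let ?y = "face (Suc (a + r)) (Suc j) d x"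
    have lw: "length (\<phi> (take a ?y)) = Suc q" using Box_length[OF \<phi>] l by simp
    have y: "?y ! j = d" using x j(1) by (simp add: nth_face)
    show ?thesis
    proof (cases "j = a")
      case True
      then show ?thesis using gam_apply_F[OF n \<phi> l] lw y x j by (auto simp: cmp_apply k_def nth_append)
    next
      case False
      then show ?thesis using gam_apply_F[OF n \<phi> l] lw y x l j
        by (auto simp: cmp_apply k_def nth_append nth_Cons')
    qed
  qed
  moreover have "k < n" using j n by (auto simp: k_def)
  ultimately show ?thesis unfolding bdry_def in_facet_def by blast
qed

lemma gam_collapse_G:
  assumes n: "n = q + Suc r" and \<phi>: "\<phi> \<in> Box B a q" and x: "length x = Suc (Suc (a + r))"
  shows "gam q a (Suc (Suc r)) \<phi> (x[a := True, Suc a := \<not> e]) = gam q a (Suc (Suc r)) \<phi> (x[a := False, Suc a := \<not> e])"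
    and "gam q a (Suc (Suc r)) \<phi> (x[a := \<not> e, Suc a := True]) = gam q a (Suc (Suc r)) \<phi> (x[a := \<not> e, Suc a := False])"
  using gam_apply_G[OF n \<phi>] x by simp_all

text \<open>An absorbing value on one side of the connection hides the other side: in the first case
  the inputs of \<phi>2 become invisible, in the second the new coordinate does.\<close>

lemma gam_collapse_F:
  assumes n: "n = q + Suc r" and \<phi>1: "\<phi>1 \<in> Box B a1 q" and \<phi>2: "\<phi>2 \<in> Box B a2 1" and x: "length x = Suc (a1 + a2 + r)"
    and \<phi>: "\<phi> = juxtapose a1 a2 \<phi>1 \<phi>2"
  shows "a1 \<le> j \<Longrightarrow> j < a1 + a2 \<Longrightarrow>
      gam q (a1 + a2) (Suc r) \<phi> (x[j := True, a1 + a2 := \<not> e]) = gam q (a1 + a2) (Suc r) \<phi> (x[j := False, a1 + a2 := \<not> e])"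
    and "\<phi>2 (take a2 (drop a1 x)) = [\<not> e] \<Longrightarrow>
      gam q (a1 + a2) (Suc r) \<phi> (x[a1 + a2 := True]) = gam q (a1 + a2) (Suc r) \<phi> (x[a1 + a2 := False])"
proof -
  have \<phi>B: "\<phi> \<in> Box B (a1 + a2) (Suc q)" using Box_juxtapose[OF \<phi>1 \<phi>2] \<phi> by simp
  have app: "\<phi> w = \<phi>1 (take a1 w) @ \<phi>2 (drop a1 w)" if "length w = a1 + a2" for w
    using that by (simp add: \<phi> juxtapose_def)
  have l1: "length (\<phi>1 (take a1 w)) = q" if "length w = a1 + a2" for w using Box_length[OF \<phi>1] that by simp
  have tk: "take q (\<phi> (take (a1 + a2) (x[j := b, a1 + a2 := c]))) = \<phi>1 (take a1 x)" if "a1 \<le> j" "j < a1 + a2" for j b c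
  proof -
    let ?w = "take (a1 + a2) (x[j := b, a1 + a2 := c])"
    have "take a1 ?w = take a1 x" using that by (simp add: take_take min_def)
    then show ?thesis using app[of ?w] l1[of ?w] x by simp
  qed
  show "gam q (a1 + a2) (Suc r) \<phi> (x[j := True, a1 + a2 := \<not> e]) = gam q (a1 + a2) (Suc r) \<phi> (x[j := False, a1 + a2 := \<not> e])"
    if "a1 \<le> j" "j < a1 + a2"
    using gam_apply_F[OF n \<phi>B, of "x[j := True, a1 + a2 := \<not> e]"] gam_apply_F[OF n \<phi>B, of "x[j := False, a1 + a2 := \<not> e]"]
      x that tk[OF that] by simp
  show "gam q (a1 + a2) (Suc r) \<phi> (x[a1 + a2 := True]) = gam q (a1 + a2) (Suc r) \<phi> (x[a1 + a2 := False])"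
    if "\<phi>2 (take a2 (drop a1 x)) = [\<not> e]"
  proof -
    have "\<phi> (take (a1 + a2) x) ! q = (\<not> e)" using app[of "take (a1 + a2) x"] l1[of "take (a1 + a2) x"] x that
      by (simp add: nth_append drop_take)
    then show ?thesis
      using gam_apply_F[OF n \<phi>B, of "x[a1 + a2 := True]"] gam_apply_F[OF n \<phi>B, of "x[a1 + a2 := False]"] x by simp
  qed
qed

text \<open>The missing facet is \<open>(a, e)\<close>, the facet \<open>(Suc a, e)\<close> is the
  value \<open>h\<close> already constructed, facets below \<open>a\<close> are given by
  \<open>d\<close>, and all others lie in the boundary. A critical word leaves coordinate
  \<open>a\<close> free and cannot set its neighbour to \<open>e\<close>, so the neighbour may be
  taken absorbing and then hides \<open>a\<close>.\<close>

lemma G_fill: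
  assumes n: "n = q + Suc r" and \<phi>: "\<phi> \<in> Box B a q" and nb: "\<not> bdry a q \<phi>"
    and h: "good (Suc (a + r)) (juxtapose a (Suc r) \<phi> (bid (Suc r))) h"
    and d: "\<And>j c. j < a \<Longrightarrow>
      good (Suc (a + r)) (cmp (Suc (a + r)) (gam q a (Suc (Suc r)) \<phi>) (face (Suc (Suc (a + r))) (Suc j) c)) (d j c) \<and>
      act Y (a + r) (Suc (a + r)) (face (Suc (a + r)) (Suc a) e) (d j c) =
        act Y (a + r) (Suc (a + r)) (face (Suc (a + r)) (Suc j) c) h"
    and compat: "\<And>j l c c'. j \<le> l \<Longrightarrow> Suc l < a \<Longrightarrow>
      act Y (a + r) (Suc (a + r)) (face (Suc (a + r)) (Suc j) c) (d (Suc l) c') =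
      act Y (a + r) (Suc (a + r)) (face (Suc (a + r)) (Suc l) c') (d j c)"
  shows "\<exists>z. good (Suc (Suc (a + r))) (gam q a (Suc (Suc r)) \<phi>) z \<and>
    act Y (Suc (a + r)) (Suc (Suc (a + r))) (face (Suc (Suc (a + r))) (Suc (Suc a)) e) z = h \<and>
    (\<forall>j c. j < a \<longrightarrow> act Y (Suc (a + r)) (Suc (Suc (a + r))) (face (Suc (Suc (a + r))) (Suc j) c) z = d j c)"
proof -
  let ?\<theta> = "gam q a (Suc (Suc r)) \<phi>" and ?m = "Suc (a + r)"
  have \<theta>: "?\<theta> \<in> Box B (Suc ?m) n" using gam_Box[of q q "Suc (Suc r)" \<phi> a] n \<phi> by simp
  have \<theta>f: "cmp ?m ?\<theta> (face (Suc ?m) (Suc j) c) \<in> Box B ?m n" if "j \<le> ?m" for j c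
    using that by (intro Box_comp[OF \<theta> Box_face_Suc]) auto
  define D where "D j c = (if j < a then d j c else if (j, c) = (Suc a, e) then h else b ?m (cmp ?m ?\<theta> (face (Suc ?m) (Suc j) c)))" for j c
  have bd: "bdry ?m n (cmp ?m ?\<theta> (face (Suc ?m) (Suc j) c))"
    if "j \<le> ?m" "\<not> j < a" "(j, c) \<noteq> (Suc a, e)" "(j, c) \<noteq> (a, e)" for j c
    by (rule gam_bdry_G[OF n \<phi> that(1)]) (use that in \<open>auto simp: not_less le_less_Suc_eq\<close>)
  have "\<exists>z. good (Suc ?m) ?\<theta> z \<and> (\<forall>j c. j \<le> ?m \<longrightarrow> (j, c) \<noteq> (a, e) \<longrightarrow> act Y ?m (Suc ?m) (face (Suc ?m) (Suc j) c) z = D j c)"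
  proof (rule good_fill[OF \<theta>])
    show "a \<le> ?m" by simp
    show "\<not> bdry ?m n (cmp ?m ?\<theta> (face (Suc ?m) (Suc a) e))"
      using gam_face_G[OF n \<phi>, of a] bdry_juxtapose_bid[OF \<phi>, of "Suc r"] nb n by simp
  next
    fix j c assume j: "j \<le> ?m" "(j, c) \<noteq> (a, e)"
    show "good ?m (cmp ?m ?\<theta> (face (Suc ?m) (Suc j) c)) (D j c)"
      using d[of j c] h gam_face_G[OF n \<phi>, of "Suc a"] good_b[OF \<theta>f[OF j(1)] bd[OF j(1) _ _ j(2)]] by (auto simp: D_def)
  next
    fix k j l c c'
    assume *: "?m = Suc k" "j \<le> l" "l \<le> k" "(j, c) \<noteq> (a, e)" "(Suc l, c') \<noteq> (a, e)"
      and nbd: "\<not> bdry ?m n (cmp ?m ?\<theta> (face (Suc ?m) (Suc j) c))" "\<not> bdry ?m n (cmp ?m ?\<theta> (face (Suc ?m) (Suc (Suc l)) c'))"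
    have k: "k = a + r" using * by simp
    have 1: "j < a \<or> (j, c) = (Suc a, e)" using bd[of j c] nbd(1) * by auto
    have 2: "Suc l < a \<or> (Suc l, c') = (Suc a, e)" using bd[of "Suc l" c'] nbd(2) * by auto
    have ja: "j < a" using 1 2 * by auto
    show "act Y k ?m (face ?m (Suc j) c) (D (Suc l) c') = act Y k ?m (face ?m (Suc l) c') (D j c)"
      using 2
    proof
      assume "Suc l < a"
      then show ?thesis using compat[OF *(2)] k ja by (simp add: D_def)
    next
      assume "(Suc l, c') = (Suc a, e)"
      then show ?thesis using d[OF ja, of c] k ja by (simp add: D_def)
    qed
  next
    fix cs assume cs: "face_word (Suc ?m) cs" "critical (Suc a) e cs"
    obtain x where x: "length x = Suc ?m" "\<And>j d. (Suc j, d) \<in> set cs \<Longrightarrow> x ! j = d"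
      by (rule word_point[OF cs(1)]) (rule that)
    \<comment> \<open>For a letter adjacent to the missing one there are no intermediate letters to
      require, so criticality excludes the value \<open>e\<close> outright.\<close>
    have t: "c = (\<not> e)" if "(Suc (Suc a), c) \<in> set cs" for c
      using cs(2) that unfolding critical_def by (cases "c = e") auto
    have s: "(Suc a, c) \<notin> set cs" for c
      using cs(2) unfolding critical_def by (cases "c = e") auto
    show "\<not> inj_on (cmp (Suc ?m - length cs) ?\<theta> (word_face (Suc ?m) cs)) (cube (Suc ?m - length cs))"
    proof (rule word_not_inj[OF cs(1)])
      show "?\<theta> (x[a := True, Suc a := \<not> e]) = ?\<theta> (x[a := False, Suc a := \<not> e])"
        using gam_collapse_G(1)[OF n \<phi>] x by simp
      have "x[a := True, Suc a := \<not> e] ! a \<noteq> x[a := False, Suc a := \<not> e] ! a" using x by simp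
      then show "x[a := True, Suc a := \<not> e] \<noteq> x[a := False, Suc a := \<not> e]" by metis
      fix j c assume j: "(Suc j, c) \<in> set cs"
      then have "j \<noteq> a" using s by blast
      then show "x[a := True, Suc a := \<not> e] ! j = c \<and> x[a := False, Suc a := \<not> e] ! j = c"
        using x j t by (cases "j = Suc a") auto
    qed (use x in auto)
  next
    fix j c assume ninj: "\<not> inj_on (cmp ?m ?\<theta> (face (Suc ?m) (Suc a) e)) (cube ?m)" and j: "j \<le> ?m" "(j, c) \<noteq> (a, e)"
    let ?x = "replicate (Suc ?m) c"
    have lx: "length ?x = Suc ?m" by simp
    \<comment> \<open>If the missing facet is degenerate, so is the other neutral facet, being the
      same morphism. On the remaining facets some pair of points collapses by absorption.\<close>
    consider "j \<noteq> a" "j \<noteq> Suc a" | "j = Suc a" "c = e" | "j = Suc a" "c = (\<not> e)" | "j = a" "c = (\<not> e)"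
      using j(2) by fastforce
    then show "\<not> inj_on (cmp ?m ?\<theta> (face (Suc ?m) (Suc j) c)) (cube ?m)"
    proof cases
      case 1
      have "?x[a := True, Suc a := \<not> e] ! a \<noteq> ?x[a := False, Suc a := \<not> e] ! a" by (simp del: replicate_Suc)
      then have ne: "?x[a := True, Suc a := \<not> e] \<noteq> ?x[a := False, Suc a := \<not> e]" by metis
      show ?thesis
        using face_not_inj[OF j(1) _ _ ne gam_collapse_G(1)[OF n \<phi> lx], of c] 1 j by (simp del: replicate_Suc)
    next
      case 2
      then show ?thesis using ninj gam_face_G[OF n \<phi>] by simp
    next
      case 3
      have "?x[a := True, Suc a := \<not> e] ! a \<noteq> ?x[a := False, Suc a := \<not> e] ! a" by (simp del: replicate_Suc)
      then have ne: "?x[a := True, Suc a := \<not> e] \<noteq> ?x[a := False, Suc a := \<not> e]" by metis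
      show ?thesis
        using face_not_inj[OF j(1) _ _ ne gam_collapse_G(1)[OF n \<phi> lx], of c] 3 j by (simp del: replicate_Suc)
    next
      case 4
      have "?x[a := \<not> e, Suc a := True] ! Suc a \<noteq> ?x[a := \<not> e, Suc a := False] ! Suc a" using j 4 by (simp del: replicate_Suc)
      then have ne: "?x[a := \<not> e, Suc a := True] \<noteq> ?x[a := \<not> e, Suc a := False]" by metis
      show ?thesis
        using face_not_inj[OF j(1) _ _ ne gam_collapse_G(2)[OF n \<phi> lx], of c] 4 j by (simp del: replicate_Suc)
    qed
  qed
  then obtain z where z: "good (Suc ?m) ?\<theta> z"
    "\<And>j c. j \<le> ?m \<Longrightarrow> (j, c) \<noteq> (a, e) \<Longrightarrow> act Y ?m (Suc ?m) (face (Suc ?m) (Suc j) c) z = D j c" by blast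
  show ?thesis
    using z(1) z(2)[of "Suc a" e] z(2) by (intro exI[of _ z]) (auto simp: D_def)
qed

text \<open>The missing facet is \<open>(a, e)\<close>; the other facets in direction
  \<open>a\<close> or later lie in the boundary. Requiring \<phi>2 outside \<open>Box A\<close>
  gives it at least two inputs: with one of them fixed, another still collapses once the joined
  coordinate is absorbing, so every facet other than the missing one is degenerate and the marking
  extension applies.\<close>

lemma F_fill:
  assumes n: "n = q + Suc r" and \<phi>1: "\<phi>1 \<in> Box B a1 q" and \<phi>2: "\<phi>2 \<in> Box B a2 1" "\<phi>2 \<notin> Box A a2 1"
    and \<phi>: "\<phi> = juxtapose a1 a2 \<phi>1 \<phi>2" and a: "a = a1 + a2" and nb: "\<not> bdry a (Suc q) \<phi>"
    and d: "\<And>j c. j < a \<Longrightarrow> good (a + r) (cmp (a + r) (gam q a (Suc r) \<phi>) (face (Suc (a + r)) (Suc j) c)) (d j c)"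
    and compat: "\<And>k j l c c'. a + r = Suc k \<Longrightarrow> j \<le> l \<Longrightarrow> Suc l < a \<Longrightarrow>
      act Y k (a + r) (face (a + r) (Suc j) c) (d (Suc l) c') =
      act Y k (a + r) (face (a + r) (Suc l) c') (d j c)"
  shows "\<exists>z. good (Suc (a + r)) (gam q a (Suc r) \<phi>) z \<and>
    (\<forall>j c. j < a \<longrightarrow> act Y (a + r) (Suc (a + r)) (face (Suc (a + r)) (Suc j) c) z = d j c)"
proof -
  let ?\<theta> = "gam q a (Suc r) \<phi>" and ?m = "a + r"
  have \<phi>B: "\<phi> \<in> Box B a (Suc q)" using Box_juxtapose[OF \<phi>1 \<phi>2(1)] \<phi> a by simp
  have \<theta>: "?\<theta> \<in> Box B (Suc ?m) n" using gam_Box[of q "Suc q" "Suc r" \<phi> a] n \<phi>B by simp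
  have \<theta>f: "cmp ?m ?\<theta> (face (Suc ?m) (Suc j) c) \<in> Box B ?m n" if "j \<le> ?m" for j c
    using that by (intro Box_comp[OF \<theta> Box_face_Suc]) auto
  have a2: "2 \<le> a2" by (rule Box_to_1_nontrivial[OF \<phi>2])
  have nb2: "\<not> bdry a2 1 \<phi>2" using Box_to_1_bdry[OF \<phi>2(1)] \<phi>2(2) by blast
  have coll: "\<not> inj_on (cmp ?m ?\<theta> (face (Suc ?m) (Suc j) c)) (cube ?m)"
    if "j \<le> ?m" "a1 \<le> i" "i < a" "i \<noteq> j" "(j, c) \<noteq> (a, e)" for i j c
  proof -
    let ?x = "replicate (Suc ?m) c"
    have "?x[i := True, a := \<not> e] ! i \<noteq> ?x[i := False, a := \<not> e] ! i" using that by (simp del: replicate_Suc)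
    then have ne: "?x[i := True, a := \<not> e] \<noteq> ?x[i := False, a := \<not> e]" by metis
    have eq: "?\<theta> (?x[i := True, a := \<not> e]) = ?\<theta> (?x[i := False, a := \<not> e])"
      using gam_collapse_F(1)[OF n \<phi>1 \<phi>2(1) _ \<phi>, of ?x i] a that by (simp del: replicate_Suc)
    have "?x[i := v, a := \<not> e] ! j = c" for v
      using that by (cases "j = a") (auto simp del: replicate_Suc)
    then show ?thesis
      using face_not_inj[OF that(1) _ _ ne eq, of c] by (simp del: replicate_Suc)
  qed
  define D where "D j c = (if j < a then d j c else b ?m (cmp ?m ?\<theta> (face (Suc ?m) (Suc j) c)))" for j c
  have bd: "bdry ?m n (cmp ?m ?\<theta> (face (Suc ?m) (Suc j) c))"
    if "j \<le> ?m" "\<not> j < a" "(j, c) \<noteq> (a, e)" for j c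
    by (rule gam_bdry_F[OF n \<phi>B that(1)]) (use that in auto)
  have "\<exists>z. good (Suc ?m) ?\<theta> z \<and> (\<forall>j c. j \<le> ?m \<longrightarrow> (j, c) \<noteq> (a, e) \<longrightarrow> act Y ?m (Suc ?m) (face (Suc ?m) (Suc j) c) z = D j c)"
  proof (rule good_fill[OF \<theta>])
    show "a \<le> ?m" by simp
    show "\<not> bdry ?m n (cmp ?m ?\<theta> (face (Suc ?m) (Suc a) e))"
      using gam_face_F[OF n \<phi>B] bdry_juxtapose_bid[OF \<phi>B, of r] nb n by simp
  next
    fix j c assume j: "j \<le> ?m" "(j, c) \<noteq> (a, e)"
    show "good ?m (cmp ?m ?\<theta> (face (Suc ?m) (Suc j) c)) (D j c)"
      using d[of j c] good_b[OF \<theta>f[OF j(1)] bd[OF j(1) _ j(2)]] by (auto simp: D_def)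
  next
    fix k j l c c'
    assume *: "?m = Suc k" "j \<le> l" "l \<le> k" "(j, c) \<noteq> (a, e)" "(Suc l, c') \<noteq> (a, e)"
      and nbd: "\<not> bdry ?m n (cmp ?m ?\<theta> (face (Suc ?m) (Suc j) c))" "\<not> bdry ?m n (cmp ?m ?\<theta> (face (Suc ?m) (Suc (Suc l)) c'))"
    have l: "Suc l < a" using bd[of "Suc l" c'] nbd(2) * by auto
    then show "act Y k ?m (face ?m (Suc j) c) (D (Suc l) c') = act Y k ?m (face ?m (Suc l) c') (D j c)"
      using compat[OF *(1,2) l] *(2) by (simp add: D_def)
  next
    fix cs assume cs: "face_word (Suc ?m) cs" "critical (Suc a) e cs"
    obtain x where x: "length x = Suc ?m" "\<And>j d. (Suc j, d) \<in> set cs \<Longrightarrow> x ! j = d"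
      by (rule word_point[OF cs(1)]) (rule that)
    have ta: "(Suc a, c) \<notin> set cs" for c
      using cs(2) unfolding critical_def by (cases "c = e") auto
    show "\<not> inj_on (cmp (Suc ?m - length cs) ?\<theta> (word_face (Suc ?m) cs)) (cube (Suc ?m - length cs))"
    \<comment> \<open>If the word leaves an input of \<phi>2 free, an absorbing joined coordinate
      hides that input. Otherwise the word fixes all inputs of \<phi>2, and criticality determines
      their values.\<close>
    proof (cases "\<exists>i. a1 \<le> i \<and> i < a \<and> (\<forall>c. (Suc i, c) \<notin> set cs)")
      case True
      then obtain i where i: "a1 \<le> i" "i < a" "\<And>c. (Suc i, c) \<notin> set cs" by blast
      show ?thesis
      proof (rule word_not_inj[OF cs(1)])
        show "?\<theta> (x[i := True, a := \<not> e]) = ?\<theta> (x[i := False, a := \<not> e])"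
          using gam_collapse_F(1)[OF n \<phi>1 \<phi>2(1) _ \<phi>, of x i] x i a by simp
        have "x[i := True, a := \<not> e] ! i \<noteq> x[i := False, a := \<not> e] ! i" using x i by simp
        then show "x[i := True, a := \<not> e] \<noteq> x[i := False, a := \<not> e]" by metis
        fix j c assume j: "(Suc j, c) \<in> set cs"
        then have "j \<noteq> a" "j \<noteq> i" using ta i(3) by blast+
        then show "x[i := True, a := \<not> e] ! j = c \<and> x[i := False, a := \<not> e] ! j = c"
          using x j by auto
      qed (use x in auto)
    next
      case False
      then have fixed: "(Suc i, x ! i) \<in> set cs" if "a1 \<le> i" "i < a" for i using x(2) that by blast
      let ?u = "take a2 (drop a1 x)"
      have lu: "length ?u = a2" using x a by simp
      have "\<phi>2 ?u = [\<not> e]"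
      proof (rule ccontr)
        assume ne: "\<phi>2 ?u \<noteq> [\<not> e]"
        have "?u \<noteq> replicate a2 (\<not> e)" using Box_replicate[OF \<phi>2(1) nb2, of "\<not> e"] ne by metis
        then obtain i where "i < a2" "?u ! i \<noteq> (\<not> e)"
          using lu by (auto simp: list_eq_iff_nth_eq)
        then have "\<exists>i. a1 \<le> i \<and> i < a \<and> x ! i = e" using x a by (intro exI[of _ "a1 + i"]) auto
        then have ex: "\<exists>i. (a1 \<le> i \<and> i < a \<and> x ! i = e)" by blast
        \<comment> \<open>At the last neutral input, all letters between it and the missing
          direction have the opposite value, which is exactly the pattern a critical word must
          avoid. Hence all inputs are absorbing, so is the output of \<phi>2, and the joined
          coordinate is hidden.\<close>
        define i0 where "i0 = (GREATEST i. a1 \<le> i \<and> i < a \<and> x ! i = e)"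
        have i0: "a1 \<le> i0" "i0 < a" "x ! i0 = e"
          using GreatestI_ex_nat[OF ex, of a] unfolding i0_def by auto
        have gr: "i \<le> i0" if "a1 \<le> i" "i < a" "x ! i = e" for i
          unfolding i0_def by (rule Greatest_le_nat[where b = a]) (use that in auto)
        have "(Suc i0, e) \<in> set cs" using fixed[OF i0(1,2)] i0(3) by simp
        moreover have "(k, \<not> e) \<in> set cs" if k: "Suc i0 < k" "k < Suc a" for k
        proof -
          obtain k' where k': "k = Suc k'" using k by (cases k) auto
          have "x ! k' \<noteq> e" using gr[of k'] k k' i0(1) by auto
          then have "x ! k' = (\<not> e)" by blast
          moreover have "(Suc k', x ! k') \<in> set cs" by (rule fixed) (use k k' i0(1) in auto)
          ultimately show ?thesis by (simp only: k')
        qed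
        moreover have "Suc i0 < Suc a" using i0(2) by simp
        ultimately show False using cs(2) unfolding critical_def by blast
      qed
      then have eq: "?\<theta> (x[a := True]) = ?\<theta> (x[a := False])"
        using gam_collapse_F(2)[OF n \<phi>1 \<phi>2(1) _ \<phi>, of x] x a by simp
      show ?thesis
      proof (rule word_not_inj[OF cs(1)])
        show "?\<theta> (x[a := True]) = ?\<theta> (x[a := False])" by (rule eq)
        have "x[a := True] ! a \<noteq> x[a := False] ! a" using x by simp
        then show "x[a := True] \<noteq> x[a := False]" by metis
        fix j c assume j: "(Suc j, c) \<in> set cs"
        then have "j \<noteq> a" using ta by blast
        then show "x[a := True] ! j = c \<and> x[a := False] ! j = c" using x j by auto
      qed (use x in auto)
    qed
  next
    fix j c assume j: "j \<le> ?m" "(j, c) \<noteq> (a, e)"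
    show "\<not> inj_on (cmp ?m ?\<theta> (face (Suc ?m) (Suc j) c)) (cube ?m)"
    proof (cases "j = a1")
      case True
      then show ?thesis using coll[OF j(1), of "Suc a1" c] j a2 a by simp
    next
      case False
      then show ?thesis using coll[OF j(1), of a1 c] j a2 a by simp
    qed
  qed
  then show ?thesis by (auto simp: D_def)
qed

end

section \<open>Insertion of a morphism between two identity blocks\<close>

lemma juxtapose_face_right:
  assumes "\<alpha> \<in> Box A m a" "i \<le> r"
  shows "cmp (m + r) (juxtapose m (Suc r) \<alpha> (bid (Suc r))) (face (Suc (m + r)) (Suc (m + i)) e) =
    cmp (m + r) (face (Suc (a + r)) (Suc (a + i)) e) (juxtapose m r \<alpha> (bid r))"
proof (rule Box_eqI)
  show "cmp (m + r) (juxtapose m (Suc r) \<alpha> (bid (Suc r))) (face (Suc (m + r)) (Suc (m + i)) e) \<in> Box A (m + r) (Suc (a + r))"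
    using Box_juxtapose_bid[OF assms(1), of "Suc r"] assms(2) by (intro Box_comp[OF _ Box_face_Suc]) auto
  show "cmp (m + r) (face (Suc (a + r)) (Suc (a + i)) e) (juxtapose m r \<alpha> (bid r)) \<in> Box A (m + r) (Suc (a + r))"
    using Box_juxtapose_bid[OF assms(1), of r] assms(2) by (intro Box_comp[OF Box_face_Suc]) auto
  fix x :: "bool list" assume "length x = m + r"
  then obtain u v where x: "x = u @ v" "length u = m" "length v = r" by (rule cube_addE)
  have l: "length (face (Suc r) (Suc i) e v) = Suc r" using x assms(2) by (intro length_face) auto
  have l2: "length (\<alpha> u) = a" using Box_length[OF assms(1)] x by simp
  show "cmp (m + r) (juxtapose m (Suc r) \<alpha> (bid (Suc r))) (face (Suc (m + r)) (Suc (m + i)) e) x =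
    cmp (m + r) (face (Suc (a + r)) (Suc (a + i)) e) (juxtapose m r \<alpha> (bid r)) x"
    using x l l2 juxtapose_apply[of u m "face (Suc r) (Suc i) e v" "Suc r" \<alpha> "bid (Suc r)"]
    by (simp add: cmp_apply juxtapose_apply bid_apply face_append_right del: add_Suc_right)
qed

text \<open>The morphism \<tau> between identity blocks of sizes \<open>a\<close> and
  \<open>s\<close>. Restricting \<open>G\<close> along it will give the values of \<open>F\<close>
  on products \<phi> \<otimes> \<tau>.\<close>

definition middle :: "nat \<Rightarrow> nat \<Rightarrow> nat \<Rightarrow> bmap \<Rightarrow> bmap" where
  "middle a b s \<tau> = juxtapose a (b + s) (bid a) (juxtapose b s \<tau> (bid s))"

lemma middle_apply: "length u = a \<Longrightarrow> length v = b \<Longrightarrow> length w = s \<Longrightarrow> middle a b s \<tau> (u @ v @ w) = u @ \<tau> v @ w"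
  by (simp add: middle_def juxtapose_apply bid_apply)

lemma middle_Box: "\<tau> \<in> Box A b 1 \<Longrightarrow> middle a b s \<tau> \<in> Box A (a + b + s) (Suc (a + s))"
  using Box_bid_juxtapose[OF Box_juxtapose_bid[of \<tau> A b 1 s], of a] by (simp add: middle_def add.assoc)

lemma middle_bid: "middle a 1 s (bid 1) = bid (Suc (a + s))"
  using juxtapose_bid_bid[of a "Suc s"] juxtapose_bid_bid[of 1 s] by (simp add: middle_def)

lemma middle_natural:
  assumes "\<alpha>1 \<in> Box A m1 a1" "\<alpha>2 \<in> Box A m2 a2" "\<tau> \<in> Box A a2 1"
  shows "cmp (m1 + m2 + s) (juxtapose m1 (Suc s) \<alpha>1 (bid (Suc s))) (middle m1 m2 s (cmp m2 \<tau> \<alpha>2)) =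
    cmp (m1 + m2 + s) (middle a1 a2 s \<tau>) (juxtapose (m1 + m2) s (juxtapose m1 m2 \<alpha>1 \<alpha>2) (bid s))"
proof (rule Box_eqI)
  have 1: "cmp m2 \<tau> \<alpha>2 \<in> Box A m2 1" by (rule Box_comp[OF assms(3,2)])
  show "cmp (m1 + m2 + s) (juxtapose m1 (Suc s) \<alpha>1 (bid (Suc s))) (middle m1 m2 s (cmp m2 \<tau> \<alpha>2)) \<in> Box A (m1 + m2 + s) (Suc (a1 + s))"
    using Box_comp[OF Box_juxtapose_bid[OF assms(1), of "Suc s"], of "middle m1 m2 s (cmp m2 \<tau> \<alpha>2)"] middle_Box[OF 1, of m1 s] by simp
  show "cmp (m1 + m2 + s) (middle a1 a2 s \<tau>) (juxtapose (m1 + m2) s (juxtapose m1 m2 \<alpha>1 \<alpha>2) (bid s)) \<in> Box A (m1 + m2 + s) (Suc (a1 + s))"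
    by (rule Box_comp[OF middle_Box[OF assms(3)] Box_juxtapose_bid[OF Box_juxtapose[OF assms(1,2)]]])
  fix x :: "bool list" assume "length x = m1 + m2 + s"
  then have "length x = m1 + (m2 + s)" by simp
  then obtain u v' where x1: "x = u @ v'" "length u = m1" "length v' = m2 + s" by (rule cube_addE)
  from x1(3) obtain v w where x2: "v' = v @ w" "length v = m2" "length w = s" by (rule cube_addE)
  have x: "x = u @ v @ w" "length u = m1" "length v = m2" "length w = s" using x1 x2 by simp_all
  have l: "length (\<alpha>1 u) = a1" "length (\<alpha>2 v) = a2" "length (\<tau> (\<alpha>2 v)) = 1"
    using Box_length[OF assms(1)] Box_length[OF assms(2)] Box_length[OF assms(3)] x by simp_all
  have "juxtapose m1 (Suc s) \<alpha>1 (bid (Suc s)) (u @ \<tau> (\<alpha>2 v) @ w) = \<alpha>1 u @ \<tau> (\<alpha>2 v) @ w"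
    using x l by (subst juxtapose_apply) (simp_all add: bid_apply)
  moreover have "juxtapose (m1 + m2) s (juxtapose m1 m2 \<alpha>1 \<alpha>2) (bid s) (u @ v @ w) = \<alpha>1 u @ \<alpha>2 v @ w"
    using juxtapose_apply[of "u @ v" "m1 + m2" w s] x by (simp add: juxtapose_apply bid_apply)
  ultimately show "cmp (m1 + m2 + s) (juxtapose m1 (Suc s) \<alpha>1 (bid (Suc s))) (middle m1 m2 s (cmp m2 \<tau> \<alpha>2)) x =
    cmp (m1 + m2 + s) (middle a1 a2 s \<tau>) (juxtapose (m1 + m2) s (juxtapose m1 m2 \<alpha>1 \<alpha>2) (bid s)) x"
    using x l by (simp add: cmp_apply middle_apply)
qed

text \<open>Two splittings of one morphism differ by \<open>c\<close> inputs next to the cut on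
  which neither factor depends. The projection \<open>p\<close> deleting them relates \<phi> and
  \<phi>', and the naturality of \<open>G\<close> absorbs it.\<close>

lemma juxtapose_middle_unique:
  assumes G: "\<And>a a' \<phi> \<alpha>. \<phi> \<in> Box B a q \<Longrightarrow> \<alpha> \<in> Box A a' a \<Longrightarrow>
      G a' (cmp a' \<phi> \<alpha>) = act Y (a' + Suc s) (a + Suc s) (juxtapose a' (Suc s) \<alpha> (bid (Suc s))) (G a \<phi>)"
    and Gc: "\<And>a \<phi>. \<phi> \<in> Box B a q \<Longrightarrow> G a \<phi> \<in> cells Y (a + Suc s)"
    and Y: "cubical_set A Y"
    and \<phi>: "\<phi> \<in> Box B a1 q" "\<phi>' \<in> Box B a1' q" and \<tau>: "\<tau> \<in> Box A a2 1" "\<tau>' \<in> Box A a2' 1"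
    and a: "a1' = a1 + c" "a2 = c + a2'"
    and eq: "juxtapose a1 a2 \<phi> \<tau> = juxtapose a1' a2' \<phi>' \<tau>'"
  shows "act Y (a1 + a2 + s) (a1 + Suc s) (middle a1 a2 s \<tau>) (G a1 \<phi>) =
    act Y (a1' + a2' + s) (a1' + Suc s) (middle a1' a2' s \<tau>') (G a1' \<phi>')"
proof -
  interpret Y: cubical_set A Y by (rule Y)
  obtain \<psi> where \<psi>: "\<psi> \<in> Box A c 0" using Box_to_0_ex by blast
  have \<psi>_apply: "\<psi> v = []" if "length v = c" for v using Box_length[OF \<psi> that] by simp
  define p where "p = juxtapose a1 c (bid a1) \<psi>"
  have p: "p \<in> Box A a1' a1" using Box_bid_juxtapose[OF \<psi>, of a1] a by (simp add: p_def)
  have p_apply: "p (u @ v) = u" if "length u = a1" "length v = c" for u v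
    using that by (simp add: p_def juxtapose_apply bid_apply \<psi>_apply)
  \<comment> \<open>Comparing the outputs of both splittings: \<phi>' ignores \<open>v\<close>,
    since its value is \<phi> \<open>u\<close>, and \<tau> ignores \<open>v\<close> as well.\<close>
  have app: "\<phi> u = \<phi>' (u @ v) \<and> \<tau> (v @ w) = \<tau>' w" if "length u = a1" "length v = c" "length w = a2'" for u v w
  proof -
    have "juxtapose a1 a2 \<phi> \<tau> (u @ (v @ w)) = \<phi> u @ \<tau> (v @ w)"
      using that a by (simp add: juxtapose_apply)
    moreover have "juxtapose a1' a2' \<phi>' \<tau>' ((u @ v) @ w) = \<phi>' (u @ v) @ \<tau>' w"
      using that a by (simp add: juxtapose_apply del: append_assoc)
    ultimately show ?thesis
      using eq Box_length[OF \<phi>(1), of u] Box_length[OF \<phi>(2), of "u @ v"] that a by simp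
  qed
  have \<phi>': "\<phi>' = cmp a1' \<phi> p"
  proof (rule Box_eqI[OF \<phi>(2)])
    show "cmp a1' \<phi> p \<in> Box UNIV a1' q" by (rule Box_comp[OF Box_mono[OF _ \<phi>(1)] Box_mono[OF _ p]]) auto
    fix x :: "bool list" assume "length x = a1'"
    then have "length x = a1 + c" using a by simp
    then obtain u v where x: "x = u @ v" "length u = a1" "length v = c" by (rule cube_addE)
    have "\<exists>w::bool list. length w = a2'" using Ex_list_of_length .
    then show "\<phi>' x = cmp a1' \<phi> p x" using app x p_apply a by (auto simp: cmp_apply)
  qed
  have m: "cmp (a1 + a2 + s) (juxtapose a1' (Suc s) p (bid (Suc s))) (middle a1' a2' s \<tau>') = middle a1 a2 s \<tau>"
  proof (rule Box_eqI)
    have "a1' + a2' + s = a1 + a2 + s" using a by simp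
    then show "cmp (a1 + a2 + s) (juxtapose a1' (Suc s) p (bid (Suc s))) (middle a1' a2' s \<tau>') \<in> Box A (a1 + a2 + s) (Suc (a1 + s))"
      using Box_comp[OF Box_juxtapose_bid[OF p, of "Suc s"], of "middle a1' a2' s \<tau>'" "a1' + a2' + s"] middle_Box[OF \<tau>(2), of a1' s] by simp
    show "middle a1 a2 s \<tau> \<in> Box A (a1 + a2 + s) (Suc (a1 + s))" by (rule middle_Box[OF \<tau>(1)])
    fix x :: "bool list" assume lx: "length x = a1 + a2 + s"
    then have "length x = a1 + (a2 + s)" by simp
    then obtain u v' where x1: "x = u @ v'" "length u = a1" "length v' = a2 + s" by (rule cube_addE)
    have "length v' = c + (a2' + s)" using x1 a by simp
    then obtain v w' where x2: "v' = v @ w'" "length v = c" "length w' = a2' + s" by (rule cube_addE)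
    from x2(3) obtain w t where x3: "w' = w @ t" "length w = a2'" "length t = s" by (rule cube_addE)
    have l: "length (\<tau>' w) = 1" using Box_length[OF \<tau>(2)] x3 by simp
    have e1: "middle a1 a2 s \<tau> x = u @ \<tau>' w @ t"
      using middle_apply[of u a1 "v @ w" a2 t s \<tau>] app[of u v w] x1 x2 x3 a by simp
    have "middle a1' a2' s \<tau>' x = (u @ v) @ \<tau>' w @ t"
      using middle_apply[of "u @ v" a1' w a2' t s \<tau>'] x1 x2 x3 a by simp
    moreover have "juxtapose a1' (Suc s) p (bid (Suc s)) ((u @ v) @ \<tau>' w @ t) = u @ \<tau>' w @ t"
      using x1 x2 x3 l a by (subst juxtapose_apply) (simp_all add: bid_apply p_apply)
    ultimately show "cmp (a1 + a2 + s) (juxtapose a1' (Suc s) p (bid (Suc s))) (middle a1' a2' s \<tau>') x = middle a1 a2 s \<tau> x"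
      using lx e1 by (simp add: cmp_apply)
  qed
  have j: "juxtapose a1' (Suc s) p (bid (Suc s)) \<in> Box A (a1' + Suc s) (a1 + Suc s)" by (rule Box_juxtapose_bid[OF p])
  have mb: "middle a1' a2' s \<tau>' \<in> Box A (a1 + a2 + s) (a1' + Suc s)"
    using middle_Box[OF \<tau>(2), of a1' s] a by (simp add: ac_simps)
  show ?thesis
    using Y.act_comp[OF j mb Gc[OF \<phi>(1)]] G[OF \<phi>(1) p] m \<phi>' a by (simp add: ac_simps)
qed

section \<open>The induction over the output coordinates\<close>

context connection_lift
begin

text \<open>At stage \<open>(r, q)\<close> the lift is constructed on the morphisms $\varphi \otimes \mathrm{id}$ into
  $[1]^n$, where \<open>\<phi>\<close> is any morphism of $\Box_B$ into $[1]^q$.  Stage \<open>(n, 0)\<close> is given by \<open>y\<close>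
  and stage \<open>(0, n)\<close> is the whole lift.  The value at $\varphi \otimes \mathrm{id}$, for \<open>\<phi>\<close> into
  $[1]^{q+1}$, is the missing face of an open box over the connection \<open>gam\<close>, filled in \<open>stage_F\<close>.
  On the products $\varphi = \varphi' \otimes \tau$ with \<open>\<tau>\<close> in $\Box_A$ the filler is prescribed by \<open>stage_G\<close>
  so that the new value at the identity is the old one.\<close>

definition stage :: "nat \<Rightarrow> nat \<Rightarrow> (nat \<Rightarrow> bmap \<Rightarrow> 'y) \<Rightarrow> bool" where
  "stage r q H \<longleftrightarrow> n = q + r \<and> (\<forall>a. \<forall>\<phi>\<in>Box B a q. good (a + r) (juxtapose a r \<phi> (bid r)) (H a \<phi>)) \<and>
     (\<forall>a m. \<forall>\<phi>\<in>Box B a q. \<forall>\<alpha>\<in>Box A m a.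
        H m (cmp m \<phi> \<alpha>) = act Y (m + r) (a + r) (juxtapose m r \<alpha> (bid r)) (H a \<phi>)) \<and>
     H q (bid q) = y"

lemma gam_bdry:
  assumes "q < n" "p + s = Suc n" "\<phi> \<in> Box B a p" "in_facet a j d \<phi>" "j < q" "q \<le> p"
  shows "bdry (a + s) n (gam q a s \<phi>)"
  unfolding bdry_def in_facet_def
proof (intro exI[of _ j] conjI exI[of _ d] allI impI)
  fix x :: "bool list" assume x: "length x = a + s"
  have "length (\<phi> (take a x)) = p" "\<phi> (take a x) ! j = d"
    using Box_length[OF assms(3)] assms(4) x by (simp_all add: in_facet_def)
  then show "gam q a s \<phi> x ! j = d"
    unfolding gam_apply[OF assms(1,2,3) x] Let_def using assms(5,6) by (simp add: nth_append)
qed (use assms in simp)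

lemma gam_good_act:
  assumes "q < n" "p + s = Suc n" "\<phi> \<in> Box B a p" "\<alpha> \<in> Box A m a" "good (a + s) (gam q a s \<phi>) z"
  shows "good (m + s) (gam q m s (cmp m \<phi> \<alpha>)) (act Y (m + s) (a + s) (juxtapose m s \<alpha> (bid s)) z)"
  using good_act[OF assms(5) gam_Box[OF assms(1,2,3)] Box_juxtapose_bid[OF assms(4)]] gam_act[OF Box_mono[OF AB assms(4)]] by simp

text \<open>Fills, for each \<phi>, the cube in which the next two identity coordinates are joined,
  with the old value as one neutral facet. Only operators of \<open>Box A\<close> act, hence the
  source \<open>istar A (boxset B q)\<close> and an extension problem with empty prescribed part;
  outside the boundary \<open>G_fill\<close> is the filling step.\<close>

lemma stage_G:
  assumes n: "n = q + Suc r" and H: "stage (Suc r) q H"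
  obtains G where "\<And>a \<phi>. \<phi> \<in> Box B a q \<Longrightarrow> good (a + Suc (Suc r)) (gam q a (Suc (Suc r)) \<phi>) (G a \<phi>)"
    and "\<And>a \<phi>. \<phi> \<in> Box B a q \<Longrightarrow> act Y (a + Suc r) (a + Suc (Suc r)) (face (Suc (Suc (a + r))) (Suc (Suc a)) e) (G a \<phi>) = H a \<phi>"
    and "\<And>a m \<phi> \<alpha>. \<phi> \<in> Box B a q \<Longrightarrow> \<alpha> \<in> Box A m a \<Longrightarrow>
      G m (cmp m \<phi> \<alpha>) = act Y (m + Suc (Suc r)) (a + Suc (Suc r)) (juxtapose m (Suc (Suc r)) \<alpha> (bid (Suc (Suc r)))) (G a \<phi>)"
proof -
  let ?s = "Suc (Suc r)"
  let ?X = "istar A (boxset B q)" and ?P = "shift ?s Y"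
  let ?R = "\<lambda>a \<phi> z. good (a + ?s) (gam q a ?s \<phi>) z \<and>
    act Y (a + Suc r) (a + ?s) (face (Suc (Suc (a + r))) (Suc (Suc a)) e) z = H a \<phi>"
  have qn: "q < n" "q + ?s = Suc n" using n by simp_all
  have Hgood: "good (a + Suc r) (juxtapose a (Suc r) \<phi> (bid (Suc r))) (H a \<phi>)" if "\<phi> \<in> Box B a q" for a \<phi>
    using H that unfolding stage_def by blast
  have Hact: "H m (cmp m \<phi> \<alpha>) = act Y (m + Suc r) (a + Suc r) (juxtapose m (Suc r) \<alpha> (bid (Suc r))) (H a \<phi>)"
    if "\<phi> \<in> Box B a q" "\<alpha> \<in> Box A m a" for a m \<phi> \<alpha>
    using H that unfolding stage_def by blast
  have fB: "face (Suc (Suc (a + r))) (Suc (Suc a)) e \<in> Box A (a + Suc r) (a + ?s)" for a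
    by (auto intro: Box_face_Suc)
  \<comment> \<open>Over the boundary the value must be that of \<open>b\<close>. Recording that its
    facets are admissible and lie in the boundary as well makes them agree with any admissible
    candidates for the facets.\<close>
  have bd: "\<exists>z\<in>cells ?P a. ?R a \<phi> z \<and> (\<forall>j c m. a = Suc m \<longrightarrow> j \<le> m \<longrightarrow>
      good (m + ?s) (cmp (m + ?s) (gam q a ?s \<phi>) (face (Suc (m + ?s)) (Suc j) c)) (act Y (m + ?s) (a + ?s) (face (Suc (m + ?s)) (Suc j) c) z) \<and>
      bdry (m + ?s) n (cmp (m + ?s) (gam q a ?s \<phi>) (face (Suc (m + ?s)) (Suc j) c)))"
    if \<phi>: "\<phi> \<in> Box B a q" and b: "bdry a q \<phi>" for a \<phi>
  proof -
    have gB: "gam q a ?s \<phi> \<in> Box B (a + ?s) n" by (rule gam_Box[OF qn \<phi>])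
    have gb: "bdry (a + ?s) n (gam q a ?s \<phi>)"
      using b gam_bdry[OF qn \<phi>] by (auto simp: bdry_def[of a])
    have good: "good (a + ?s) (gam q a ?s \<phi>) (b' (a + ?s) (gam q a ?s \<phi>))" if "b' = b" for b'
      using good_b[OF gB gb] that by simp
    have "act Y (a + Suc r) (a + ?s) (face (Suc (Suc (a + r))) (Suc (Suc a)) e) (b (a + ?s) (gam q a ?s \<phi>)) = H a \<phi>"
    proof -
      have "bdry (a + Suc r) n (juxtapose a (Suc r) \<phi> (bid (Suc r)))"
        using b bdry_juxtapose_bid[OF \<phi>, of "Suc r"] n by simp
      then have "H a \<phi> = b (a + Suc r) (juxtapose a (Suc r) \<phi> (bid (Suc r)))"
        using good_bdry[OF Hgood[OF \<phi>]] Box_juxtapose_bid[OF \<phi>, of "Suc r"] n by simp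
      then show ?thesis using b_act[OF gB gb fB] gam_face_G[OF n \<phi>, of "Suc a"] by simp
    qed
    moreover have "good (m + ?s) (cmp (m + ?s) (gam q a ?s \<phi>) (face (Suc (m + ?s)) (Suc j) c))
        (act Y (m + ?s) (a + ?s) (face (Suc (m + ?s)) (Suc j) c) (b (a + ?s) (gam q a ?s \<phi>)))"
      "bdry (m + ?s) n (cmp (m + ?s) (gam q a ?s \<phi>) (face (Suc (m + ?s)) (Suc j) c))"
      if "a = Suc m" "j \<le> m" for j c m
    proof -
      have f: "face (Suc (m + ?s)) (Suc j) c \<in> Box A (m + ?s) (a + ?s)" using that Box_face_Suc[of "Suc j" "m + ?s" c A] by simp
      show "good (m + ?s) (cmp (m + ?s) (gam q a ?s \<phi>) (face (Suc (m + ?s)) (Suc j) c))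
        (act Y (m + ?s) (a + ?s) (face (Suc (m + ?s)) (Suc j) c) (b (a + ?s) (gam q a ?s \<phi>)))"
        by (rule good_act[OF good[OF refl] gB f])
      show "bdry (m + ?s) n (cmp (m + ?s) (gam q a ?s \<phi>) (face (Suc (m + ?s)) (Suc j) c))"
        by (rule bdry_cmp[OF f gb])
    qed
    moreover have "b (a + ?s) (gam q a ?s \<phi>) \<in> cells ?P a" using good_cells[OF good[OF refl]] by simp
    ultimately show ?thesis using good[OF refl] by blast
  qed
  interpret E: extension_problem A ?X ?P "\<lambda>_. {}" "\<lambda>_ _. undefined" ?R
  proof (intro extension_problem.intro extension_problem_axioms.intro)
    show "cubical_set A ?X" by (intro cubical_set_istar[OF AB] marked_cubical_set.cubical marked_cubical_set_boxset)
    show "cubical_set A ?P" by (intro cubical_set_shift Y.cubical)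
    show "?R m (act ?X m a \<alpha> \<phi>) (act ?P m a \<alpha> z)"
      if \<alpha>: "\<alpha> \<in> Box A m a" and \<phi>0: "\<phi> \<in> cells ?X a" and z: "z \<in> cells ?P a" and R: "?R a \<phi> z" for m a \<alpha> \<phi> z
    proof -
      have \<phi>: "\<phi> \<in> Box B a q" using \<phi>0 by (simp add: boxset_simps)
      have e: "act ?X m a \<alpha> \<phi> = cmp m \<phi> \<alpha>" using \<alpha> by (simp add: boxset_simps)
      have j: "juxtapose m ?s \<alpha> (bid ?s) \<in> Box A (m + ?s) (a + ?s)" "juxtapose m (Suc r) \<alpha> (bid (Suc r)) \<in> Box A (m + Suc r) (a + Suc r)"
        by (rule Box_juxtapose_bid[OF \<alpha>])+
      have zc: "z \<in> cells Y (a + ?s)" using z by simp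
      have "act Y (m + Suc r) (m + ?s) (face (Suc (Suc (m + r))) (Suc (Suc m)) e) (act Y (m + ?s) (a + ?s) (juxtapose m ?s \<alpha> (bid ?s)) z) =
        act Y (m + Suc r) (a + Suc r) (juxtapose m (Suc r) \<alpha> (bid (Suc r))) (act Y (a + Suc r) (a + ?s) (face (Suc (Suc (a + r))) (Suc (Suc a)) e) z)"
        using Y.act_comp[OF j(1) fB zc] Y.act_comp[OF fB j(2) zc] juxtapose_face_right[OF \<alpha>, of 1 "Suc r" e] by simp
      also have "\<dots> = H m (cmp m \<phi> \<alpha>)" using R Hact[OF \<phi> \<alpha>] by simp
      finally show ?thesis using gam_good_act[OF qn \<phi> \<alpha>] R e by simp
    qed
    show "\<exists>z\<in>cells ?P 0. ?R 0 \<phi> z" if \<phi>0: "\<phi> \<in> cells ?X 0 - {}" for \<phi>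
    proof (cases "bdry 0 q \<phi>")
      case True
      have \<phi>: "\<phi> \<in> Box B 0 q" using \<phi>0 by (simp add: boxset_simps)
      show ?thesis using bd[OF \<phi> True] by blast
    next
      case False
      have \<phi>: "\<phi> \<in> Box B 0 q" using \<phi>0 by (simp add: boxset_simps)
      obtain z where z: "good (Suc (Suc (0 + r))) (gam q 0 ?s \<phi>) z"
        "act Y (Suc (0 + r)) (Suc (Suc (0 + r))) (face (Suc (Suc (0 + r))) (Suc (Suc 0)) e) z = H 0 \<phi>"
        using G_fill[OF n \<phi> False, of "H 0 \<phi>" "\<lambda>_ _. undefined"] Hgood[OF \<phi>] by auto
      then show ?thesis using good_cells[OF z(1)] by (intro bexI[of _ z]) simp_all
    qed
    fix \<phi> m and d :: "nat \<Rightarrow> bool \<Rightarrow> 'y"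
    assume \<phi>0: "\<phi> \<in> cells ?X (Suc m) - {}"
      and d: "\<And>j c. j \<le> m \<Longrightarrow> d j c \<in> cells ?P m \<and> ?R m (act ?X m (Suc m) (face (Suc m) (Suc j) c) \<phi>) (d j c)"
      and compat: "\<And>k j l c c'. m = Suc k \<Longrightarrow> j \<le> l \<Longrightarrow> l \<le> k \<Longrightarrow>
        act ?P k m (face m (Suc j) c) (d (Suc l) c') = act ?P k m (face m (Suc l) c') (d j c)"
    have \<phi>: "\<phi> \<in> Box B (Suc m) q" using \<phi>0 by (simp add: boxset_simps)
    have fP: "act ?P m (Suc m) (face (Suc m) (Suc j) c) z = act Y (m + ?s) (Suc m + ?s) (face (Suc (m + ?s)) (Suc j) c) z" if "j \<le> m" for j c z
      using juxtapose_face[OF that, of ?s c] by simp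
    have dg: "good (m + ?s) (cmp (m + ?s) (gam q (Suc m) ?s \<phi>) (face (Suc (m + ?s)) (Suc j) c)) (d j c) \<and>
      act Y (m + Suc r) (Suc (m + Suc r)) (face (Suc (Suc (m + r))) (Suc (Suc m)) e) (d j c) =
        act Y (m + Suc r) (Suc (m + Suc r)) (face (Suc (m + Suc r)) (Suc j) c) (H (Suc m) \<phi>)" if j: "j \<le> m" for j c
    proof -
      have f: "face (Suc m) (Suc j) c \<in> Box A m (Suc m)" using j by (auto intro: Box_face_Suc)
      have "act ?X m (Suc m) (face (Suc m) (Suc j) c) \<phi> = cmp m \<phi> (face (Suc m) (Suc j) c)" using f by (simp add: boxset_simps)
      then show ?thesis
        using d[OF j, of c] gam_face[OF j, of ?s q \<phi> c] Hact[OF \<phi> f] juxtapose_face[OF j, of "Suc r" c] by simp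
    qed
    have "\<exists>z\<in>cells ?P (Suc m). ?R (Suc m) \<phi> z \<and>
        (\<forall>j\<le>m. \<forall>c. act Y (m + ?s) (Suc m + ?s) (face (Suc (m + ?s)) (Suc j) c) z = d j c)"
    proof (cases "bdry (Suc m) q \<phi>")
      case True
      from bd[OF \<phi> True] obtain z where z: "z \<in> cells ?P (Suc m)" "?R (Suc m) \<phi> z"
        "\<And>j c. j \<le> m \<Longrightarrow> good (m + ?s) (cmp (m + ?s) (gam q (Suc m) ?s \<phi>) (face (Suc (m + ?s)) (Suc j) c)) (act Y (m + ?s) (Suc m + ?s) (face (Suc (m + ?s)) (Suc j) c) z) \<and>
          bdry (m + ?s) n (cmp (m + ?s) (gam q (Suc m) ?s \<phi>) (face (Suc (m + ?s)) (Suc j) c))"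
        by blast
      have "act Y (m + ?s) (Suc m + ?s) (face (Suc (m + ?s)) (Suc j) c) z = d j c" if j: "j \<le> m" for j c
      proof -
        have "cmp (m + ?s) (gam q (Suc m) ?s \<phi>) (face (Suc (m + ?s)) (Suc j) c) \<in> Box B (m + ?s) n"
          using gam_Box[OF qn \<phi>] j by (intro Box_comp[OF _ Box_face_Suc]) auto
        then show ?thesis using good_bdry z(3)[OF j, of c] dg[OF j, of c] by metis
      qed
      then show ?thesis using z(1,2) by blast
    next
      case False
      have compat': "act Y (Suc m + r) (Suc (Suc m + r)) (face (Suc (Suc m + r)) (Suc j) c) (d (Suc l) c') =
          act Y (Suc m + r) (Suc (Suc m + r)) (face (Suc (Suc m + r)) (Suc l) c') (d j c)"
        if jl: "j \<le> l" "Suc l < Suc m" for j l c c'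
      proof -
        obtain k where k: "m = Suc k" using jl by (cases m) auto
        show ?thesis using compat[OF k jl(1), of c c'] juxtapose_face[of j k ?s c] juxtapose_face[of l k ?s c'] jl k by simp
      qed
      have "\<exists>z. good (Suc (Suc (Suc m + r))) (gam q (Suc m) ?s \<phi>) z \<and>
        act Y (Suc (Suc m + r)) (Suc (Suc (Suc m + r))) (face (Suc (Suc (Suc m + r))) (Suc (Suc (Suc m))) e) z = H (Suc m) \<phi> \<and>
        (\<forall>j c. j < Suc m \<longrightarrow> act Y (Suc (Suc m + r)) (Suc (Suc (Suc m + r))) (face (Suc (Suc (Suc m + r))) (Suc j) c) z = d j c)"
        by (rule G_fill[OF n \<phi> False _ _ compat']) (use dg Hgood[OF \<phi>] in auto)
      then obtain z where z: "good (Suc (Suc (Suc m + r))) (gam q (Suc m) ?s \<phi>) z"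
        "act Y (Suc (Suc m + r)) (Suc (Suc (Suc m + r))) (face (Suc (Suc (Suc m + r))) (Suc (Suc (Suc m))) e) z = H (Suc m) \<phi>"
        "\<And>j c. j < Suc m \<Longrightarrow> act Y (Suc (Suc m + r)) (Suc (Suc (Suc m + r))) (face (Suc (Suc (Suc m + r))) (Suc j) c) z = d j c"
        by blast
      then show ?thesis using good_cells[OF z(1)] by (intro bexI[of _ z]) simp_all
    qed
    then show "\<exists>z\<in>cells ?P (Suc m). ?R (Suc m) \<phi> z \<and>
        (\<forall>j\<le>m. \<forall>c. act ?P m (Suc m) (face (Suc m) (Suc j) c) z = d j c)"
      using fP by simp
  qed simp_all
  obtain h where h: "\<And>a \<phi>. \<phi> \<in> cells ?X a \<Longrightarrow> ?R a \<phi> (h a \<phi>)"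
    "\<And>m a \<alpha> \<phi>. \<alpha> \<in> Box A m a \<Longrightarrow> \<phi> \<in> cells ?X a \<Longrightarrow> h m (act ?X m a \<alpha> \<phi>) = act ?P m a \<alpha> (h a \<phi>)"
    by (rule E.extension) blast
  show thesis
    by (rule that[of h]) (use h in \<open>simp_all add: boxset_simps\<close>)
qed

text \<open>The single morphism from each dimension into the point already lies in
  \<open>Box A\<close>, so all values at this stage are restrictions of \<open>y\<close>.\<close>

lemma stage_initial: "stage n 0 (\<lambda>a \<phi>. act Y (a + n) n (juxtapose a n \<phi> (bid n)) y)"
  unfolding stage_def
proof (intro conjI allI ballI)
  fix a \<phi> assume "\<phi> \<in> Box B a 0"
  then have \<phi>: "\<phi> \<in> Box A a 0" by (rule Box_to_0)
  have j: "juxtapose a n \<phi> (bid n) \<in> Box A (a + n) n" using Box_juxtapose_bid[OF \<phi>, of n] by simp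
  show "good (a + n) (juxtapose a n \<phi> (bid n)) (act Y (a + n) n (juxtapose a n \<phi> (bid n)) y)"
    using good_act[OF good_y Box_id j] by (simp add: compose_bid_left[OF j])
next
  fix a m \<phi> \<alpha> assume \<phi>B: "\<phi> \<in> Box B a 0" and \<alpha>: "\<alpha> \<in> Box A m a"
  have \<phi>: "\<phi> \<in> Box A a 0" by (rule Box_to_0[OF \<phi>B])
  have j: "juxtapose a n \<phi> (bid n) \<in> Box A (a + n) n" using Box_juxtapose_bid[OF \<phi>, of n] by simp
  show "act Y (m + n) n (juxtapose m n (cmp m \<phi> \<alpha>) (bid n)) y =
    act Y (m + n) (a + n) (juxtapose m n \<alpha> (bid n)) (act Y (a + n) n (juxtapose a n \<phi> (bid n)) y)"
    using Y.act_comp[OF j Box_juxtapose_bid[OF \<alpha>] y(1)] juxtapose_bid_cmp[OF \<alpha>, of n \<phi>] by simp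
next
  have "juxtapose 0 n (bid 0) (bid n) = bid n" using juxtapose_bid_bid[of 0 n] by simp
  then show "act Y (0 + n) n (juxtapose 0 n (bid 0) (bid n)) y = y" using Y.act_id[OF y(1)] by simp
qed simp

text \<open>On a product \<phi> \<otimes> \<tau> the cube to be filled for \<open>F\<close> is a
  restriction of the cube filled by \<open>G\<close>; this is what makes the prescribed values in
  \<open>stage_F\<close> admissible.\<close>

lemma gam_middle:
  assumes n: "n = q + Suc r" and \<phi>: "\<phi> \<in> Box B a1 q" and \<tau>: "\<tau> \<in> Box A a2 1"
  shows "cmp (a1 + a2 + Suc r) (gam q a1 (Suc (Suc r)) \<phi>) (middle a1 a2 (Suc r) \<tau>) = gam q (a1 + a2) (Suc r) (juxtapose a1 a2 \<phi> \<tau>)"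
proof -
  have "cmp (a1 + a2 + Suc r) (juxtapose a1 (Suc (Suc r)) \<phi> (bid (Suc (Suc r)))) (middle a1 a2 (Suc r) \<tau>) =
    juxtapose (a1 + a2) (Suc r) (juxtapose a1 a2 \<phi> \<tau>) (bid (Suc r))" (is "?l = ?r")
  proof (rule Box_eqI)
    have "middle a1 a2 (Suc r) \<tau> \<in> Box B (a1 + a2 + Suc r) (a1 + Suc (Suc r))"
      using Box_mono[OF AB middle_Box[OF \<tau>, of a1 "Suc r"]] by simp
    then show "?l \<in> Box B (a1 + a2 + Suc r) (q + Suc (Suc r))"
      by (rule Box_comp[OF Box_juxtapose_bid[OF \<phi>]])
    show "?r \<in> Box B (a1 + a2 + Suc r) (q + 1 + Suc r)"
      by (intro Box_juxtapose_bid Box_juxtapose \<phi> Box_mono[OF AB \<tau>])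
    fix x :: "bool list" assume lx: "length x = a1 + a2 + Suc r"
    then have "length x = a1 + (a2 + Suc r)" by simp
    then obtain u v' where x1: "x = u @ v'" "length u = a1" "length v' = a2 + Suc r" by (rule cube_addE)
    from x1(3) obtain v w where x2: "v' = v @ w" "length v = a2" "length w = Suc r" by (rule cube_addE)
    have l: "length (\<tau> v) = 1" using Box_length[OF \<tau>] x2 by simp
    have "middle a1 a2 (Suc r) \<tau> x = u @ \<tau> v @ w" using middle_apply[of u a1 v a2 w "Suc r"] x1 x2 by simp
    moreover have "juxtapose a1 (Suc (Suc r)) \<phi> (bid (Suc (Suc r))) (u @ \<tau> v @ w) = \<phi> u @ \<tau> v @ w"
      using x1 x2 l by (subst juxtapose_apply) (simp_all add: bid_apply)
    moreover have "?r x = \<phi> u @ \<tau> v @ w"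
      using juxtapose_apply[of "u @ v" "a1 + a2" w "Suc r" "juxtapose a1 a2 \<phi> \<tau>" "bid (Suc r)"] x1 x2
      by (simp add: juxtapose_apply bid_apply)
    ultimately show "?l x = ?r x" using lx by (simp add: cmp_apply)
  qed
  moreover have "middle a1 a2 (Suc r) \<tau> \<in> Box A (a1 + a2 + Suc r) (a1 + Suc (Suc r))"
    using middle_Box[OF \<tau>, of a1 "Suc r"] by simp
  ultimately show ?thesis
    unfolding gam_def by (simp only: cmp_assoc)
qed

text \<open>The prescribed part \<open>W\<close> consists of the products whose last factor \<tau>
  lies in \<open>Box A\<close>. There \<open>F\<close> is the restriction of \<open>G\<close> along
  \<tau>, in particular \<open>G\<close> itself at identities; elsewhere the last factor is
  genuinely new and \<open>F_fill\<close> applies.\<close>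

lemma stage_F:
  assumes n: "n = q + Suc r"
    and G_good: "\<And>a \<phi>. \<phi> \<in> Box B a q \<Longrightarrow> good (a + Suc (Suc r)) (gam q a (Suc (Suc r)) \<phi>) (G a \<phi>)"
    and G_act: "\<And>a m \<phi> \<alpha>. \<phi> \<in> Box B a q \<Longrightarrow> \<alpha> \<in> Box A m a \<Longrightarrow>
      G m (cmp m \<phi> \<alpha>) = act Y (m + Suc (Suc r)) (a + Suc (Suc r)) (juxtapose m (Suc (Suc r)) \<alpha> (bid (Suc (Suc r)))) (G a \<phi>)"
  obtains F where "\<And>a \<phi>. \<phi> \<in> Box B a (Suc q) \<Longrightarrow> good (a + Suc r) (gam q a (Suc r) \<phi>) (F a \<phi>)"
    and "\<And>a m \<phi> \<alpha>. \<phi> \<in> Box B a (Suc q) \<Longrightarrow> \<alpha> \<in> Box A m a \<Longrightarrow>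
      F m (cmp m \<phi> \<alpha>) = act Y (m + Suc r) (a + Suc r) (juxtapose m (Suc r) \<alpha> (bid (Suc r))) (F a \<phi>)"
    and "F (Suc q) (bid (Suc q)) = G q (bid q)"
proof -
  let ?s = "Suc r"
  let ?X = "istar A (boxset B (Suc q))" and ?P = "shift ?s Y"
  let ?R = "\<lambda>a \<phi> z. good (a + ?s) (gam q a ?s \<phi>) z"
  have qn: "q < n" "Suc q + ?s = Suc n" "q + Suc ?s = Suc n" using n by simp_all
  define W where "W a = {juxtapose a1 a2 \<phi> \<tau> | a1 a2 \<phi> \<tau>. a = a1 + a2 \<and> \<phi> \<in> Box B a1 q \<and> \<tau> \<in> Box A a2 1}" for a
  define k where "k a \<theta> z \<longleftrightarrow> (\<exists>a1 a2 \<phi> \<tau>. a = a1 + a2 \<and> \<phi> \<in> Box B a1 q \<and> \<tau> \<in> Box A a2 1 \<and> \<theta> = juxtapose a1 a2 \<phi> \<tau> \<and>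
    z = act Y (a1 + a2 + ?s) (a1 + Suc ?s) (middle a1 a2 ?s \<tau>) (G a1 \<phi>))" for a \<theta> z
  \<comment> \<open>The value is read off an arbitrary splitting;
    \<open>juxtapose_middle_unique\<close> makes the choice irrelevant.\<close>
  define h0 where "h0 a \<theta> = (SOME z. k a \<theta> z)" for a \<theta>
  have Gc: "G a \<phi> \<in> cells Y (a + Suc ?s)" if "\<phi> \<in> Box B a q" for a \<phi>
    by (rule good_cells[OF G_good[OF that]])
  have h0_eq: "h0 (a1 + a2) (juxtapose a1 a2 \<phi> \<tau>) = act Y (a1 + a2 + ?s) (a1 + Suc ?s) (middle a1 a2 ?s \<tau>) (G a1 \<phi>)"
    if \<phi>: "\<phi> \<in> Box B a1 q" and \<tau>: "\<tau> \<in> Box A a2 1" for a1 a2 \<phi> \<tau>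
  proof -
    have "k (a1 + a2) (juxtapose a1 a2 \<phi> \<tau>) (act Y (a1 + a2 + ?s) (a1 + Suc ?s) (middle a1 a2 ?s \<tau>) (G a1 \<phi>))"
      unfolding k_def using \<phi> \<tau> by blast
    then have "k (a1 + a2) (juxtapose a1 a2 \<phi> \<tau>) (h0 (a1 + a2) (juxtapose a1 a2 \<phi> \<tau>))"
      unfolding h0_def by (rule someI)
    then obtain b1 b2 \<phi>' \<tau>' where b: "a1 + a2 = b1 + b2" "\<phi>' \<in> Box B b1 q" "\<tau>' \<in> Box A b2 1"
      "juxtapose a1 a2 \<phi> \<tau> = juxtapose b1 b2 \<phi>' \<tau>'"
      "h0 (a1 + a2) (juxtapose a1 a2 \<phi> \<tau>) = act Y (b1 + b2 + ?s) (b1 + Suc ?s) (middle b1 b2 ?s \<tau>') (G b1 \<phi>')"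
      unfolding k_def by blast
    show ?thesis
    proof (cases "a1 \<le> b1")
      case True
      then obtain c where c: "b1 = a1 + c" by (metis le_Suc_ex)
      show ?thesis
        using juxtapose_middle_unique[OF G_act Gc Y.cubical \<phi> b(2) \<tau> b(3) c _ b(4)] b(1,5) c by (simp add: add.assoc)
    next
      case False
      then obtain c where c: "a1 = b1 + c" by (metis le_Suc_ex nat_le_linear)
      have b2: "b2 = c + a2" using b(1) c by linarith
      have "act Y (b1 + b2 + ?s) (b1 + Suc ?s) (middle b1 b2 ?s \<tau>') (G b1 \<phi>') =
          act Y (a1 + a2 + ?s) (a1 + Suc ?s) (middle a1 a2 ?s \<tau>) (G a1 \<phi>)"
        by (rule juxtapose_middle_unique[OF G_act Gc Y.cubical b(2) \<phi> b(3) \<tau> c b2 b(4)[symmetric]])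
      then show ?thesis using b(5) by (rule trans[rotated])
    qed
  qed
  have mB: "middle a1 a2 ?s \<tau> \<in> Box A (a1 + a2 + ?s) (a1 + Suc ?s)" if "\<tau> \<in> Box A a2 1" for a1 a2 \<tau>
    using middle_Box[OF that, of a1 ?s] by simp
  have gB: "gam q a1 (Suc ?s) \<phi> \<in> Box B (a1 + Suc ?s) n" if "\<phi> \<in> Box B a1 q" for a1 \<phi>
    by (rule gam_Box[OF qn(1,3) that])
  have h0_good: "good (a1 + a2 + ?s) (gam q (a1 + a2) ?s (juxtapose a1 a2 \<phi> \<tau>)) (h0 (a1 + a2) (juxtapose a1 a2 \<phi> \<tau>))"
    if \<phi>: "\<phi> \<in> Box B a1 q" and \<tau>: "\<tau> \<in> Box A a2 1" for a1 a2 \<phi> \<tau>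
    using good_act[OF G_good[OF \<phi>] gB[OF \<phi>] mB[OF \<tau>]] gam_middle[OF n \<phi> \<tau>] h0_eq[OF \<phi> \<tau>] by simp
  have WE: "\<exists>a1 a2 \<phi> \<tau>. a = a1 + a2 \<and> \<phi> \<in> Box B a1 q \<and> \<tau> \<in> Box A a2 1 \<and> \<theta> = juxtapose a1 a2 \<phi> \<tau>" if "\<theta> \<in> W a" for a \<theta>
    using that unfolding W_def by blast
  have W_act: "cmp m \<theta> \<alpha> \<in> W m \<and> h0 m (cmp m \<theta> \<alpha>) = act Y (m + ?s) (a + ?s) (juxtapose m ?s \<alpha> (bid ?s)) (h0 a \<theta>)"
    if \<alpha>: "\<alpha> \<in> Box A m a" and W: "\<theta> \<in> W a" for m a \<alpha> \<theta>
  proof -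
    obtain a1 a2 \<phi> \<tau> where \<theta>: "a = a1 + a2" "\<phi> \<in> Box B a1 q" "\<tau> \<in> Box A a2 1" "\<theta> = juxtapose a1 a2 \<phi> \<tau>"
      using WE[OF W] by blast
    obtain m1 m2 \<alpha>1 \<alpha>2 where m: "m = m1 + m2" "\<alpha>1 \<in> Box A m1 a1" "\<alpha>2 \<in> Box A m2 a2" "\<alpha> = juxtapose m1 m2 \<alpha>1 \<alpha>2"
      by (rule Box_splitE[OF \<alpha>[unfolded \<theta>(1)]])
    have c: "cmp m \<theta> \<alpha> = juxtapose m1 m2 (cmp m1 \<phi> \<alpha>1) (cmp m2 \<tau> \<alpha>2)"
      using juxtapose_cmp[OF m(2,3)] m(1,4) \<theta>(4) by simp
    have B: "cmp m1 \<phi> \<alpha>1 \<in> Box B m1 q" "cmp m2 \<tau> \<alpha>2 \<in> Box A m2 1"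
      by (rule Box_comp[OF \<theta>(2) Box_mono[OF AB m(2)]], rule Box_comp[OF \<theta>(3) m(3)])
    have j: "juxtapose m1 (Suc ?s) \<alpha>1 (bid (Suc ?s)) \<in> Box A (m1 + Suc ?s) (a1 + Suc ?s)"
      "juxtapose (m1 + m2) ?s \<alpha> (bid ?s) \<in> Box A (m1 + m2 + ?s) (a1 + a2 + ?s)"
      using Box_juxtapose_bid[OF m(2), of "Suc ?s"] Box_juxtapose_bid[OF \<alpha>, of ?s] m(1) \<theta>(1) by simp_all
    have "h0 m (cmp m \<theta> \<alpha>) = act Y (m1 + m2 + ?s) (m1 + Suc ?s) (middle m1 m2 ?s (cmp m2 \<tau> \<alpha>2)) (G m1 (cmp m1 \<phi> \<alpha>1))"
      using h0_eq[OF B] c m(1) by simp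
    also have "\<dots> = act Y (m1 + m2 + ?s) (a1 + Suc ?s) (cmp (m1 + m2 + ?s) (juxtapose m1 (Suc ?s) \<alpha>1 (bid (Suc ?s))) (middle m1 m2 ?s (cmp m2 \<tau> \<alpha>2))) (G a1 \<phi>)"
      using Y.act_comp[OF j(1) mB[OF B(2)] Gc[OF \<theta>(2)]] G_act[OF \<theta>(2) m(2)] by simp
    also have "\<dots> = act Y (m1 + m2 + ?s) (a1 + a2 + ?s) (juxtapose (m1 + m2) ?s \<alpha> (bid ?s)) (act Y (a1 + a2 + ?s) (a1 + Suc ?s) (middle a1 a2 ?s \<tau>) (G a1 \<phi>))"
      using Y.act_comp[OF mB[OF \<theta>(3)] j(2) Gc[OF \<theta>(2)]] middle_natural[OF m(2,3) \<theta>(3), of ?s] m(4) by simp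
    finally show ?thesis
      using h0_eq[OF \<theta>(2,3)] c B m(1) \<theta>(1,4) unfolding W_def by auto
  qed
  have split: "\<exists>a1 a2 \<phi>1 \<phi>2. \<phi>1 \<in> Box B a1 q \<and> \<phi>2 \<in> Box B a2 1 \<and> \<phi>2 \<notin> Box A a2 1 \<and> \<phi> = juxtapose a1 a2 \<phi>1 \<phi>2 \<and> a = a1 + a2"
    if \<phi>: "\<phi> \<in> Box B a (Suc q)" and nW: "\<phi> \<notin> W a" for a \<phi>
  proof -
    have "\<phi> \<in> Box B a (q + 1)" using \<phi> by simp
    then obtain a1 a2 \<phi>1 \<phi>2 where s: "a = a1 + a2" "\<phi>1 \<in> Box B a1 q" "\<phi>2 \<in> Box B a2 1" "\<phi> = juxtapose a1 a2 \<phi>1 \<phi>2"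
      by (rule Box_splitE)
    moreover have "\<phi>2 \<notin> Box A a2 1" using s nW unfolding W_def by blast
    ultimately show ?thesis by blast
  qed
  \<comment> \<open>Joining the last output to a new coordinate could destroy its constancy. Outside
    \<open>W\<close> the constant output is not the last one, since a constant last factor would lie
    in \<open>Box A\<close>.\<close>
  have bd: "bdry (a + ?s) n (gam q a ?s \<phi>)"
    if \<phi>: "\<phi> \<in> Box B a (Suc q)" and b: "bdry a (Suc q) \<phi>" and nW: "\<phi> \<notin> W a" for a \<phi>
  proof -
    obtain j d where j: "j < Suc q" "in_facet a j d \<phi>" using b unfolding bdry_def by blast
    have "j \<noteq> q"
    proof
      assume jq: "j = q"
      obtain a1 a2 \<phi>1 \<phi>2 where s: "\<phi>1 \<in> Box B a1 q" "\<phi>2 \<in> Box B a2 1" "\<phi>2 \<notin> Box A a2 1" "\<phi> = juxtapose a1 a2 \<phi>1 \<phi>2" "a = a1 + a2"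
        using split[OF \<phi> nW] by blast
      have "\<phi>2 v ! 0 = d" if v: "length v = a2" for v
      proof -
        obtain u :: "bool list" where u: "length u = a1" using Ex_list_of_length by blast
        have "\<phi> (u @ v) = \<phi>1 u @ \<phi>2 v" using u v s(4) by (simp add: juxtapose_apply)
        moreover have "\<phi> (u @ v) ! q = d" using j(2) jq u v s(5) by (simp add: in_facet_def)
        ultimately show ?thesis using Box_length[OF s(1) u] by (simp add: nth_append)
      qed
      then have "bdry a2 1 \<phi>2" by (auto simp: bdry_def in_facet_def)
      then show False using Box_to_1_bdry[OF s(2)] s(3) by blast
    qed
    then show ?thesis using gam_bdry[OF qn(1,2) \<phi> j(2)] j(1) by simp
  qed
  interpret E: extension_problem A ?X ?P W h0 ?R
  proof (intro extension_problem.intro extension_problem_axioms.intro)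
    show "cubical_set A ?X" by (intro cubical_set_istar[OF AB] marked_cubical_set.cubical marked_cubical_set_boxset)
    show "cubical_set A ?P" by (intro cubical_set_shift Y.cubical)
    show "W a \<subseteq> cells ?X a" for a
    proof
      fix \<theta> assume "\<theta> \<in> W a"
      then obtain a1 a2 \<phi> \<tau> where \<theta>: "a = a1 + a2" "\<phi> \<in> Box B a1 q" "\<tau> \<in> Box A a2 1" "\<theta> = juxtapose a1 a2 \<phi> \<tau>"
        using WE by blast
      show "\<theta> \<in> cells ?X a" using Box_juxtapose[OF \<theta>(2) Box_mono[OF AB \<theta>(3)]] \<theta> by simp
    qed
    show "act ?X m a \<alpha> \<theta> \<in> W m" if "\<alpha> \<in> Box A m a" "\<theta> \<in> W a" for m a \<alpha> \<theta>
      using W_act[OF that] that by simp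
    show "h0 m (act ?X m a \<alpha> \<theta>) = act ?P m a \<alpha> (h0 a \<theta>)" if "\<alpha> \<in> Box A m a" "\<theta> \<in> W a" for m a \<alpha> \<theta>
      using W_act[OF that] that by simp
    show h0R: "?R a \<theta> (h0 a \<theta>)" if W: "\<theta> \<in> W a" for a \<theta>
      using WE[OF W] h0_good by blast
    show "h0 a \<theta> \<in> cells ?P a" if "\<theta> \<in> W a" for a \<theta>
      using good_cells[OF h0R[OF that]] by simp
    show "?R m (act ?X m a \<alpha> \<phi>) (act ?P m a \<alpha> z)"
      if \<alpha>: "\<alpha> \<in> Box A m a" and \<phi>: "\<phi> \<in> cells ?X a" and R: "?R a \<phi> z" for m a \<alpha> \<phi> z
      using gam_good_act[OF qn(1,2) _ \<alpha> R] \<phi> \<alpha> by simp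
    show "\<exists>z\<in>cells ?P 0. ?R 0 \<phi> z" if \<phi>0: "\<phi> \<in> cells ?X 0 - W 0" for \<phi>
    proof -
      have \<phi>: "\<phi> \<in> Box B 0 (Suc q)" "\<phi> \<notin> W 0" using \<phi>0 by simp_all
      obtain a1 a2 \<phi>1 \<phi>2 where s: "\<phi>1 \<in> Box B a1 q" "\<phi>2 \<in> Box B a2 1" "\<phi>2 \<notin> Box A a2 1" "\<phi> = juxtapose a1 a2 \<phi>1 \<phi>2" "0 = a1 + a2"
        using split[OF \<phi>] by blast
      then show ?thesis using Box_to_1_nontrivial[OF s(2,3)] by simp
    qed
    fix \<phi> m and d :: "nat \<Rightarrow> bool \<Rightarrow> 'y"
    assume \<phi>0: "\<phi> \<in> cells ?X (Suc m) - W (Suc m)"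
      and d: "\<And>j c. j \<le> m \<Longrightarrow> d j c \<in> cells ?P m \<and> ?R m (act ?X m (Suc m) (face (Suc m) (Suc j) c) \<phi>) (d j c)"
      and compat: "\<And>k j l c c'. m = Suc k \<Longrightarrow> j \<le> l \<Longrightarrow> l \<le> k \<Longrightarrow>
        act ?P k m (face m (Suc j) c) (d (Suc l) c') = act ?P k m (face m (Suc l) c') (d j c)"
    have \<phi>: "\<phi> \<in> Box B (Suc m) (Suc q)" "\<phi> \<notin> W (Suc m)" using \<phi>0 by simp_all
    have fP: "act ?P m (Suc m) (face (Suc m) (Suc j) c) z = act Y (m + ?s) (Suc m + ?s) (face (Suc (m + ?s)) (Suc j) c) z" if "j \<le> m" for j c z
      using juxtapose_face[OF that, of ?s c] by simp
    have gB: "gam q (Suc m) ?s \<phi> \<in> Box B (Suc m + ?s) n" by (rule gam_Box[OF qn(1,2) \<phi>(1)])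
    have f: "face (Suc (m + ?s)) (Suc j) c \<in> Box A (m + ?s) (Suc m + ?s)" if "j \<le> m" for j c
      using that Box_face_Suc[of "Suc j" "m + ?s" c A] by simp
    have dg: "good (m + ?s) (cmp (m + ?s) (gam q (Suc m) ?s \<phi>) (face (Suc (m + ?s)) (Suc j) c)) (d j c)" if j: "j \<le> m" for j c
    proof -
      have "act ?X m (Suc m) (face (Suc m) (Suc j) c) \<phi> = cmp m \<phi> (face (Suc m) (Suc j) c)"
        using j by (simp add: Box_face_Suc)
      then show ?thesis using d[OF j, of c] gam_face[OF j, of ?s q \<phi> c] by simp
    qed
    have "\<exists>z. good (Suc m + ?s) (gam q (Suc m) ?s \<phi>) z \<and>
        (\<forall>j\<le>m. \<forall>c. act Y (m + ?s) (Suc m + ?s) (face (Suc (m + ?s)) (Suc j) c) z = d j c)"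
    proof (cases "bdry (Suc m) (Suc q) \<phi>")
      case True
      let ?z = "b (Suc m + ?s) (gam q (Suc m) ?s \<phi>)"
      have gb: "bdry (Suc m + ?s) n (gam q (Suc m) ?s \<phi>)" by (rule bd[OF \<phi>(1) True \<phi>(2)])
      have "act Y (m + ?s) (Suc m + ?s) (face (Suc (m + ?s)) (Suc j) c) ?z = d j c" if j: "j \<le> m" for j c
        using good_bdry[OF dg[OF j] Box_comp[OF gB Box_mono[OF AB f[OF j]]] bdry_cmp[OF f[OF j] gb]] b_act[OF gB gb f[OF j]] by simp
      then show ?thesis using good_b[OF gB gb] by blast
    next
      case False
      obtain a1 a2 \<phi>1 \<phi>2 where s: "\<phi>1 \<in> Box B a1 q" "\<phi>2 \<in> Box B a2 1" "\<phi>2 \<notin> Box A a2 1" "\<phi> = juxtapose a1 a2 \<phi>1 \<phi>2" "Suc m = a1 + a2"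
        using split[OF \<phi>] by blast
      have "\<exists>z. good (Suc (Suc m + r)) (gam q (Suc m) (Suc r) \<phi>) z \<and>
        (\<forall>j c. j < Suc m \<longrightarrow> act Y (Suc m + r) (Suc (Suc m + r)) (face (Suc (Suc m + r)) (Suc j) c) z = d j c)"
      proof (rule F_fill[OF n s False])
        show "good (Suc m + r) (cmp (Suc m + r) (gam q (Suc m) (Suc r) \<phi>) (face (Suc (Suc m + r)) (Suc j) c)) (d j c)" if "j < Suc m" for j c
          using dg[of j c] that by simp
        show "act Y k (Suc m + r) (face (Suc m + r) (Suc j) c) (d (Suc l) c') = act Y k (Suc m + r) (face (Suc m + r) (Suc l) c') (d j c)"
          if jl: "Suc m + r = Suc k" "j \<le> l" "Suc l < Suc m" for k j l c c'
        proof -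
          obtain k' where k: "m = Suc k'" using jl by (cases m) auto
          show ?thesis using compat[OF k jl(2), of c c'] juxtapose_face[of j k' ?s c] juxtapose_face[of l k' ?s c'] jl k by simp
        qed
      qed
      then show ?thesis by (simp add: less_Suc_eq_le)
    qed
    then obtain z where z: "good (Suc m + ?s) (gam q (Suc m) ?s \<phi>) z"
        "\<forall>j\<le>m. \<forall>c. act Y (m + ?s) (Suc m + ?s) (face (Suc (m + ?s)) (Suc j) c) z = d j c"
      by blast
    show "\<exists>z\<in>cells ?P (Suc m). ?R (Suc m) \<phi> z \<and>
        (\<forall>j\<le>m. \<forall>c. act ?P m (Suc m) (face (Suc m) (Suc j) c) z = d j c)"
    proof (intro bexI[of _ z] conjI allI impI)
      show "act ?P m (Suc m) (face (Suc m) (Suc j) c) z = d j c" if "j \<le> m" for j c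
        unfolding fP[OF that] using z(2) that by blast
    qed (use z(1) good_cells[OF z(1)] in simp_all)
  qed
  obtain h where h: "\<And>a \<phi>. \<phi> \<in> cells ?X a \<Longrightarrow> ?R a \<phi> (h a \<phi>)" "\<And>a \<theta>. \<theta> \<in> W a \<Longrightarrow> h a \<theta> = h0 a \<theta>"
    "\<And>m a \<alpha> \<phi>. \<alpha> \<in> Box A m a \<Longrightarrow> \<phi> \<in> cells ?X a \<Longrightarrow> h m (act ?X m a \<alpha> \<phi>) = act ?P m a \<alpha> (h a \<phi>)"
    by (rule E.extension) blast
  have "h (Suc q) (bid (Suc q)) = G q (bid q)"
  proof -
    have e: "bid (Suc q) = juxtapose q 1 (bid q) (bid 1)" using juxtapose_bid_bid[of q 1] by simp
    have "bid (Suc q) \<in> W (Suc q)" unfolding W_def e using Box_id[of q B] Box_id[of 1 A] by force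
    then have "h (Suc q) (bid (Suc q)) = h0 (q + 1) (juxtapose q 1 (bid q) (bid 1))" using h(2) e by simp
    also have "\<dots> = act Y (q + 1 + ?s) (q + Suc ?s) (middle q 1 ?s (bid 1)) (G q (bid q))" by (rule h0_eq[OF Box_id Box_id])
    also have "\<dots> = G q (bid q)" using middle_bid[of q ?s] Y.act_id[OF Gc[OF Box_id]] by simp
    finally show ?thesis .
  qed
  note bid = this
  show thesis
  proof (rule that[of h])
    show "good (a + Suc r) (gam q a (Suc r) \<phi>) (h a \<phi>)" if "\<phi> \<in> Box B a (Suc q)" for a \<phi>
      using h(1)[of \<phi> a] that by simp
    show "h m (cmp m \<phi> \<alpha>) = act Y (m + Suc r) (a + Suc r) (juxtapose m (Suc r) \<alpha> (bid (Suc r))) (h a \<phi>)"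
      if "\<phi> \<in> Box B a (Suc q)" "\<alpha> \<in> Box A m a" for a m \<phi> \<alpha>
      using h(3)[of \<alpha> m a \<phi>] that by simp
  qed (rule bid)
qed

text \<open>The new value is the facet of \<open>F\<close> at the neutral value of the joined
  coordinate. At the identity \<open>F\<close> equals \<open>G\<close>, and that facet of
  \<open>G\<close> is the old value, so \<open>y\<close> is preserved.\<close>

lemma stage_step:
  assumes H: "stage (Suc r) q H"
  shows "\<exists>H'. stage r (Suc q) H'"
proof -
  have n: "n = q + Suc r" using H unfolding stage_def by blast
  obtain G where G: "\<And>a \<phi>. \<phi> \<in> Box B a q \<Longrightarrow> good (a + Suc (Suc r)) (gam q a (Suc (Suc r)) \<phi>) (G a \<phi>)"
    "\<And>a \<phi>. \<phi> \<in> Box B a q \<Longrightarrow> act Y (a + Suc r) (a + Suc (Suc r)) (face (Suc (Suc (a + r))) (Suc (Suc a)) e) (G a \<phi>) = H a \<phi>"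
    "\<And>a m \<phi> \<alpha>. \<phi> \<in> Box B a q \<Longrightarrow> \<alpha> \<in> Box A m a \<Longrightarrow>
      G m (cmp m \<phi> \<alpha>) = act Y (m + Suc (Suc r)) (a + Suc (Suc r)) (juxtapose m (Suc (Suc r)) \<alpha> (bid (Suc (Suc r)))) (G a \<phi>)"
    by (rule stage_G[OF n H]) (rule that)
  obtain F where F: "\<And>a \<phi>. \<phi> \<in> Box B a (Suc q) \<Longrightarrow> good (a + Suc r) (gam q a (Suc r) \<phi>) (F a \<phi>)"
    "\<And>a m \<phi> \<alpha>. \<phi> \<in> Box B a (Suc q) \<Longrightarrow> \<alpha> \<in> Box A m a \<Longrightarrow>
      F m (cmp m \<phi> \<alpha>) = act Y (m + Suc r) (a + Suc r) (juxtapose m (Suc r) \<alpha> (bid (Suc r))) (F a \<phi>)"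
    "F (Suc q) (bid (Suc q)) = G q (bid q)"
    by (rule stage_F[OF n G(1) G(3)]) (assumption+, rule that)
  have qn: "q < n" "Suc q + Suc r = Suc n" using n by simp_all
  have f: "face (Suc (a + r)) (Suc a) e \<in> Box A (a + r) (a + Suc r)" for a by (auto intro: Box_face_Suc)
  have "stage r (Suc q) (\<lambda>a \<phi>. act Y (a + r) (a + Suc r) (face (Suc (a + r)) (Suc a) e) (F a \<phi>))"
    unfolding stage_def
  proof (intro conjI allI ballI)
    show "n = Suc q + r" using n by simp
    show "good (a + r) (juxtapose a r \<phi> (bid r)) (act Y (a + r) (a + Suc r) (face (Suc (a + r)) (Suc a) e) (F a \<phi>))"
      if \<phi>: "\<phi> \<in> Box B a (Suc q)" for a \<phi>
      using good_act[OF F(1)[OF \<phi>] gam_Box[OF qn \<phi>] f] gam_face_F[OF n \<phi>] by simp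
    show "act Y (m + r) (m + Suc r) (face (Suc (m + r)) (Suc m) e) (F m (cmp m \<phi> \<alpha>)) =
      act Y (m + r) (a + r) (juxtapose m r \<alpha> (bid r)) (act Y (a + r) (a + Suc r) (face (Suc (a + r)) (Suc a) e) (F a \<phi>))"
      if \<phi>: "\<phi> \<in> Box B a (Suc q)" and \<alpha>: "\<alpha> \<in> Box A m a" for a m \<phi> \<alpha>
      using Y.act_comp[OF Box_juxtapose_bid[OF \<alpha>] f good_cells[OF F(1)[OF \<phi>]]]
        Y.act_comp[OF f Box_juxtapose_bid[OF \<alpha>] good_cells[OF F(1)[OF \<phi>]]]
        F(2)[OF \<phi> \<alpha>] juxtapose_face_right[OF \<alpha>, of 0 r e] by simp
    show "act Y (Suc q + r) (Suc q + Suc r) (face (Suc (Suc q + r)) (Suc (Suc q)) e) (F (Suc q) (bid (Suc q))) = y"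
      using F(3) G(2)[OF Box_id] H by (simp add: stage_def)
  qed
  then show ?thesis by blast
qed

theorem lift_exists:
  obtains h where "\<And>k \<theta>. \<theta> \<in> Box B k n \<Longrightarrow> good k \<theta> (h k \<theta>)"
    and "\<And>k l \<theta> \<beta>. \<theta> \<in> Box B k n \<Longrightarrow> \<beta> \<in> Box A l k \<Longrightarrow> h l (cmp l \<theta> \<beta>) = act Y l k \<beta> (h k \<theta>)"
    and "h n (bid n) = y"
proof -
  have "\<exists>H. stage (n - q) q H" if "q \<le> n" for q
    using that
  proof (induction q)
    case 0 then show ?case using stage_initial by auto
  next
    case (Suc q)
    then obtain H where "stage (Suc (n - Suc q)) q H" by (auto simp: Suc_diff_Suc)
    from stage_step[OF this] show ?case .
  qed
  from this[of n] obtain H where H: "stage 0 n H" by auto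
  have j: "juxtapose a 0 \<phi> (bid 0) = \<phi>" if "\<phi> \<in> Box C a p" for a p \<phi> C
    by (rule juxtapose_eqI[of _ C _ _ p]) (use that in \<open>simp_all add: bid_apply\<close>)
  show thesis
  proof (rule that[of H])
    show "good k \<theta> (H k \<theta>)" if "\<theta> \<in> Box B k n" for k \<theta>
      using H that j[OF that] unfolding stage_def by (metis add.right_neutral)
    show "H l (cmp l \<theta> \<beta>) = act Y l k \<beta> (H k \<theta>)" if "\<theta> \<in> Box B k n" "\<beta> \<in> Box A l k" for k l \<theta> \<beta>
      using H that j[OF that(2)] unfolding stage_def by (metis add.right_neutral)
    show "H n (bid n) = y" using H unfolding stage_def by blast
  qed
qed

end

section \<open>Extending weak connection structures along monomorphisms\<close>

locale connection_extension = Y: marked_cubical_set A Y + Z: marked_cubical_set A Z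
  for A :: "bool set" and Y :: "'y mcset" and Z :: "'z mcset" +
  fixes B :: "bool set" and g :: "('y, 'z) mmap" and \<Gamma> :: "((nat \<times> 'z \<times> bmap) set, 'z) mmap"
  assumes AB: "A \<subseteq> B" and g: "g \<in> hom A Y Z" and fib: "comical_fibration A Y Z g"
    and \<Gamma>: "weak_connection_structure A B Z Z (mid Z) \<Gamma>"
begin

text \<open>The map from the n-cube with connections to \<open>Z\<close> that \<Gamma> attaches to
  the cube \<open>z\<close>, written out on representatives of the left Kan extension.\<close>

definition \<zeta> :: "nat \<Rightarrow> 'z \<Rightarrow> nat \<Rightarrow> bmap \<Rightarrow> 'z" where
  "\<zeta> n z k \<theta> = \<Gamma> k (lan_elem A B Z k (n, z, \<theta>))"

text \<open>Maps $i^* i_! X \to Y$ correspond to maps from $X$ to the cubical set with $n$-cubes the maps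
  $i^*\Box^n_B \to Y$.  Only those $n$-cubes are kept that lie over the map $i^*\Box^n_B \to Z$ which
  \<open>\<Gamma>\<close> associates to an $n$-cube of $Z$.\<close>

definition conn_lifts :: "(bmap, 'y) mmap mcset" where
  "conn_lifts = \<lparr>
     cells = (\<lambda>n. {h \<in> hom A (istar A (boxset B n)) Y. \<forall>k. \<forall>\<theta>\<in>Box B k n. g k (h k \<theta>) = \<zeta> n (g n (h n (bid n))) k \<theta>}),
     act = (\<lambda>m n \<phi> h k. \<lambda>\<psi>\<in>Box B k m. h k (cmp k \<phi> \<psi>)), marked = (\<lambda>_. {})\<rparr>"

lemma lan_cell: "z \<in> cells Z n \<Longrightarrow> \<theta> \<in> Box B k n \<Longrightarrow> lan_elem A B Z k (n, z, \<theta>) \<in> cells (ishriek A B Z) k"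
  unfolding lan_cells[OF AB Z.marked_cubical_set_axioms] by blast

lemma \<Gamma>_hom: "\<Gamma> \<in> hom A (ii A B Z) Z"
  using \<Gamma> by (simp add: weak_connection_structure_def)

lemma \<zeta>_cells: "z \<in> cells Z n \<Longrightarrow> \<theta> \<in> Box B k n \<Longrightarrow> \<zeta> n z k \<theta> \<in> cells Z k"
  unfolding \<zeta>_def using hom_cells[OF \<Gamma>_hom] lan_cell by simp

lemma \<zeta>_act:
  assumes "z \<in> cells Z n" "\<theta> \<in> Box B k n" "\<beta> \<in> Box A l k"
  shows "\<zeta> n z l (cmp l \<theta> \<beta>) = act Z l k \<beta> (\<zeta> n z k \<theta>)"
  using hom_act[OF \<Gamma>_hom assms(3), of "lan_elem A B Z k (n, z, \<theta>)"] lan_cell[OF assms(1,2)] assms(3)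
    lan_act[OF AB Z.marked_cubical_set_axioms Box_mono[OF AB assms(3)], of n z \<theta>]
  by (simp add: \<zeta>_def)

lemma \<zeta>_rel: "z \<in> cells Z n \<Longrightarrow> \<phi> \<in> Box A m n \<Longrightarrow> \<theta> \<in> Box B k m \<Longrightarrow> \<zeta> n z k (cmp k \<phi> \<theta>) = \<zeta> m (act Z m n \<phi> z) k \<theta>"
  unfolding \<zeta>_def using lan_rel_elem[OF AB Z.marked_cubical_set_axioms, of z n \<phi> m \<theta> k] by simp

lemma \<zeta>_bid: "z \<in> cells Z n \<Longrightarrow> \<zeta> n z n (bid n) = z"
  using \<Gamma> mcomp_eqD[of Z \<Gamma> "unit_map A B Z" "mid Z" "mid Z" z n]
  by (simp add: weak_connection_structure_def \<zeta>_def unit_map_def mid_apply mcomp_def compose_def mid_def fun_eq_iff)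

lemma \<zeta>_act_bid: "z \<in> cells Z n \<Longrightarrow> \<theta> \<in> Box A k n \<Longrightarrow> \<zeta> n z k \<theta> = act Z k n \<theta> z"
  using \<zeta>_act[of z n "bid n" n \<theta> k] \<zeta>_bid[of z n] by (simp add: Box_id compose_bid_left)

lemma \<zeta>_marked:
  assumes "z \<in> cells Z n" "\<theta> \<in> Box B k n" "\<not> inj_on \<theta> (cube k)"
  shows "\<zeta> n z k \<theta> \<in> marked Z k"
proof -
  interpret I: marked_cubical_set B "ishriek A B Z" by (rule ishriek_marked_cubical_set[OF AB Z.marked_cubical_set_axioms])
  have "act (ishriek A B Z) k n \<theta> (lan_elem A B Z n (n, z, bid n)) \<in> marked (ishriek A B Z) k"
    by (rule I.not_inj_marked[OF assms(2,3) lan_cell[OF assms(1) Box_id]])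
  then show ?thesis
    using hom_marked[OF \<Gamma>_hom] lan_act[OF AB Z.marked_cubical_set_axioms assms(2), of n z "bid n"]
    by (simp add: \<zeta>_def compose_bid_left[OF assms(2)])
qed

lemma conn_lifts_hom: "h \<in> cells conn_lifts n \<Longrightarrow> h \<in> hom A (istar A (boxset B n)) Y"
  and conn_lifts_g: "h \<in> cells conn_lifts n \<Longrightarrow> \<theta> \<in> Box B k n \<Longrightarrow> g k (h k \<theta>) = \<zeta> n (g n (h n (bid n))) k \<theta>"
  by (simp_all add: conn_lifts_def)

lemma conn_lifts_act: "act conn_lifts m n \<phi> h k = (\<lambda>\<psi>\<in>Box B k m. h k (cmp k \<phi> \<psi>))"
  by (simp add: conn_lifts_def)

lemma conn_liftsI:
  assumes "\<And>k \<theta>. \<theta> \<in> Box B k n \<Longrightarrow> h k \<theta> \<in> cells Y k" "\<And>k \<theta>. \<theta> \<notin> Box B k n \<Longrightarrow> h k \<theta> = undefined"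
    "\<And>k l \<theta> \<beta>. \<theta> \<in> Box B k n \<Longrightarrow> \<beta> \<in> Box A l k \<Longrightarrow> h l (cmp l \<theta> \<beta>) = act Y l k \<beta> (h k \<theta>)"
    "\<And>k \<theta>. \<theta> \<in> Box B k n \<Longrightarrow> \<not> inj_on \<theta> (cube k) \<Longrightarrow> h k \<theta> \<in> marked Y k"
    "\<And>k \<theta>. \<theta> \<in> Box B k n \<Longrightarrow> g k (h k \<theta>) = \<zeta> n (g n (h n (bid n))) k \<theta>"
  shows "h \<in> cells conn_lifts n"
proof -
  have "h \<in> hom A (istar A (boxset B n)) Y"
    by (rule homI) (use assms(1-4) in \<open>auto simp: marked_boxset\<close>)
  then show ?thesis using assms(5) by (simp add: conn_lifts_def)
qed

text \<open>Together with the next three facts this restates membership in \<open>conn_lifts\<close>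
  on cubes of \<open>Box B k n\<close>, without \<open>istar\<close>.\<close>

lemma conn_lift_cells: "h \<in> cells conn_lifts n \<Longrightarrow> \<theta> \<in> Box B k n \<Longrightarrow> h k \<theta> \<in> cells Y k"
  using hom_cells[OF conn_lifts_hom] by simp

lemma conn_lift_act: "h \<in> cells conn_lifts n \<Longrightarrow> \<theta> \<in> Box B k n \<Longrightarrow> \<beta> \<in> Box A l k \<Longrightarrow>
  h l (cmp l \<theta> \<beta>) = act Y l k \<beta> (h k \<theta>)"
  using hom_act[OF conn_lifts_hom, of h n \<beta> l k \<theta>] by simp

lemma conn_lift_marked: "h \<in> cells conn_lifts n \<Longrightarrow> \<theta> \<in> Box B k n \<Longrightarrow> \<not> inj_on \<theta> (cube k) \<Longrightarrow> h k \<theta> \<in> marked Y k"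
  using hom_marked[OF conn_lifts_hom, of h n \<theta> k] by (simp add: marked_boxset)

lemma conn_lift_bid: "h \<in> cells conn_lifts n \<Longrightarrow> \<beta> \<in> Box A k n \<Longrightarrow> h k \<beta> = act Y k n \<beta> (h n (bid n))"
  using conn_lift_act[OF _ Box_id, of h n \<beta> k] compose_bid_left[of \<beta> A k n] by simp

lemma cubical_set_conn_lifts: "cubical_set A conn_lifts"
proof
  fix \<phi> m n h assume \<phi>: "\<phi> \<in> Box A m n" and h: "h \<in> cells conn_lifts n"
  have c: "cmp k \<phi> \<theta> \<in> Box B k n" if "\<theta> \<in> Box B k m" for k \<theta>
    by (rule Box_comp[OF Box_mono[OF AB \<phi>] that])
  have gh: "g n (h n (bid n)) \<in> cells Z n" by (rule hom_cells[OF g conn_lift_cells[OF h Box_id]])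
  show "act conn_lifts m n \<phi> h \<in> cells conn_lifts m"
  proof (rule conn_liftsI)
    fix k \<theta> assume \<theta>: "\<theta> \<in> Box B k m"
    show "act conn_lifts m n \<phi> h k \<theta> \<in> cells Y k"
      using \<theta> conn_lift_cells[OF h c[OF \<theta>]] by (simp add: conn_lifts_act)
    show "act conn_lifts m n \<phi> h l (cmp l \<theta> \<beta>) = act Y l k \<beta> (act conn_lifts m n \<phi> h k \<theta>)" if \<beta>: "\<beta> \<in> Box A l k" for l \<beta>
      using \<theta> Box_comp[OF \<theta> Box_mono[OF AB \<beta>]] conn_lift_act[OF h c[OF \<theta>] \<beta>] cmp_assoc[OF \<beta>, of \<phi> \<theta>] by (simp add: conn_lifts_act)
    show "act conn_lifts m n \<phi> h k \<theta> \<in> marked Y k" if "\<not> inj_on \<theta> (cube k)"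
      using \<theta> conn_lift_marked[OF h c[OF \<theta>] not_inj_cmp[OF \<theta> that]] by (simp add: conn_lifts_act)
    have "g m (act conn_lifts m n \<phi> h m (bid m)) = act Z m n \<phi> (g n (h n (bid n)))"
      using conn_lift_bid[OF h \<phi>] hom_act[OF g \<phi> conn_lift_cells[OF h Box_id]]
      by (simp add: conn_lifts_act Box_id compose_bid_right[OF \<phi>])
    then show "g k (act conn_lifts m n \<phi> h k \<theta>) = \<zeta> m (g m (act conn_lifts m n \<phi> h m (bid m))) k \<theta>"
      using \<theta> conn_lifts_g[OF h c[OF \<theta>]] \<zeta>_rel[OF gh \<phi> \<theta>] by (simp add: conn_lifts_act)
  qed (simp add: conn_lifts_act)
next
  fix h n assume h: "h \<in> cells conn_lifts n"
  have "act conn_lifts n n (bid n) h k \<theta> = h k \<theta>" for k \<theta>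
    using hom_undefined[OF conn_lifts_hom[OF h], of \<theta> k] compose_bid_left[of \<theta> B k n]
    by (simp add: conn_lifts_act restrict_def)
  then show "act conn_lifts n n (bid n) h = h" by (intro ext)
next
  fix \<phi> m n \<psi> k h assume "\<phi> \<in> Box A m n" and \<psi>: "\<psi> \<in> Box A k m" and "h \<in> cells conn_lifts n"
  have "act conn_lifts k n (cmp k \<phi> \<psi>) h l \<theta> = act conn_lifts k m \<psi> (act conn_lifts m n \<phi> h) l \<theta>" for l \<theta>
    using cmp_assoc[of \<theta> B l k \<phi> \<psi>] Box_comp[OF Box_mono[OF AB \<psi>], of \<theta> l] by (simp add: conn_lifts_act restrict_def)
  then show "act conn_lifts k n (cmp k \<phi> \<psi>) h = act conn_lifts k m \<psi> (act conn_lifts m n \<phi> h)"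
    by (intro ext)
qed

text \<open>Combines a value at the identity with values on the boundary. The results of
  \<open>connection_lift\<close> are cut down to extensional functions, so that equality in
  \<open>conn_lifts\<close> is equality of maps.\<close>

lemma conn_lift_exists:
  assumes y: "y \<in> cells Y n"
    and b_cells: "\<And>k \<theta>. \<theta> \<in> Box B k n \<Longrightarrow> bdry k n \<theta> \<Longrightarrow> b k \<theta> \<in> cells Y k"
    and b_act: "\<And>k l \<theta> \<beta>. \<theta> \<in> Box B k n \<Longrightarrow> bdry k n \<theta> \<Longrightarrow> \<beta> \<in> Box A l k \<Longrightarrow> b l (cmp l \<theta> \<beta>) = act Y l k \<beta> (b k \<theta>)"
    and b_marked: "\<And>k \<theta>. \<theta> \<in> Box B k n \<Longrightarrow> bdry k n \<theta> \<Longrightarrow> \<not> inj_on \<theta> (cube k) \<Longrightarrow> b k \<theta> \<in> marked Y k"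
    and b_g: "\<And>k \<theta>. \<theta> \<in> Box B k n \<Longrightarrow> bdry k n \<theta> \<Longrightarrow> g k (b k \<theta>) = \<zeta> n (g n y) k \<theta>"
    and y_b: "\<And>k \<beta>. \<beta> \<in> Box A k n \<Longrightarrow> bdry k n \<beta> \<Longrightarrow> act Y k n \<beta> y = b k \<beta>"
  shows "\<exists>h\<in>cells conn_lifts n. h n (bid n) = y \<and> (\<forall>k. \<forall>\<theta>\<in>Box B k n. bdry k n \<theta> \<longrightarrow> h k \<theta> = b k \<theta>)"
proof (cases "B = {}")
  \<comment> \<open>Without any connection in \<open>B\<close> there is no kind \<open>e\<close> to
    use for \<open>connection_lift\<close>, but then \<open>A\<close> equals \<open>B\<close> and
    \<open>y\<close> determines the lift.\<close>
  case True
  then have BA: "B = A" using AB by blast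
  let ?h = "\<lambda>k. \<lambda>\<theta>\<in>Box B k n. act Y k n \<theta> y"
  have "?h \<in> cells conn_lifts n"
  proof (rule conn_liftsI)
    fix k \<theta> assume \<theta>B: "\<theta> \<in> Box B k n"
    then have \<theta>: "\<theta> \<in> Box A k n" by (simp add: BA)
    show "?h k \<theta> \<in> cells Y k" using Y.act_closed[OF \<theta> y] \<theta>B by simp
    show "?h l (cmp l \<theta> \<beta>) = act Y l k \<beta> (?h k \<theta>)" if \<beta>: "\<beta> \<in> Box A l k" for l \<beta>
      using Y.act_comp[OF \<theta> \<beta> y] \<theta> Box_comp[OF \<theta> \<beta>] BA by simp
    show "?h k \<theta> \<in> marked Y k" if "\<not> inj_on \<theta> (cube k)" using Y.not_inj_marked[OF \<theta> that y] \<theta> BA by simp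
    show "g k (?h k \<theta>) = \<zeta> n (g n (?h n (bid n))) k \<theta>"
      using \<zeta>_act_bid[OF hom_cells[OF g y] \<theta>] hom_act[OF g \<theta> y] \<theta> BA Y.act_id[OF y] by (simp add: Box_id)
  qed simp
  moreover have "?h n (bid n) = y" using Y.act_id[OF y] by (simp add: Box_id)
  moreover have "?h k \<theta> = b k \<theta>" if "\<theta> \<in> Box B k n" "bdry k n \<theta>" for k \<theta>
    using that y_b BA by simp
  ultimately show ?thesis by (intro bexI[of _ ?h] conjI allI ballI impI)
next
  case False
  then obtain e where e: "e \<in> B" by blast
  interpret L: connection_lift A Y Z B g n "\<zeta> n (g n y)" b y e
  proof (intro connection_lift.intro connection_lift_axioms.intro)
    show "marked_cubical_set A Y" "marked_cubical_set A Z"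
      by (rule Y.marked_cubical_set_axioms, rule Z.marked_cubical_set_axioms)
    have gy: "g n y \<in> cells Z n" by (rule hom_cells[OF g y])
    show "\<zeta> n (g n y) k \<theta> \<in> cells Z k" if "\<theta> \<in> Box B k n" for k \<theta> by (rule \<zeta>_cells[OF gy that])
    show "\<zeta> n (g n y) l (cmp l \<theta> \<beta>) = act Z l k \<beta> (\<zeta> n (g n y) k \<theta>)" if "\<theta> \<in> Box B k n" "\<beta> \<in> Box A l k" for k \<theta> l \<beta>
      by (rule \<zeta>_act[OF gy that])
    show "\<zeta> n (g n y) k \<theta> \<in> marked Z k" if "\<theta> \<in> Box B k n" "\<not> inj_on \<theta> (cube k)" for k \<theta>
      by (rule \<zeta>_marked[OF gy that])
    show "g n y = \<zeta> n (g n y) n (bid n)" by (simp add: \<zeta>_bid[OF gy])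
  qed (fact AB e g fib y b_cells b_act b_marked b_g y_b)+
  obtain h where h: "\<And>k \<theta>. \<theta> \<in> Box B k n \<Longrightarrow> L.good k \<theta> (h k \<theta>)"
    "\<And>k l \<theta> \<beta>. \<theta> \<in> Box B k n \<Longrightarrow> \<beta> \<in> Box A l k \<Longrightarrow> h l (cmp l \<theta> \<beta>) = act Y l k \<beta> (h k \<theta>)"
    "h n (bid n) = y"
    by (rule L.lift_exists) (rule that)
  let ?h = "\<lambda>k. \<lambda>\<theta>\<in>Box B k n. h k \<theta>"
  have "?h \<in> cells conn_lifts n"
  proof (rule conn_liftsI)
    fix k \<theta> assume \<theta>: "\<theta> \<in> Box B k n"
    show "?h k \<theta> \<in> cells Y k" using L.good_cells[OF h(1)[OF \<theta>]] \<theta> by simp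
    show "?h l (cmp l \<theta> \<beta>) = act Y l k \<beta> (?h k \<theta>)" if \<beta>: "\<beta> \<in> Box A l k" for l \<beta>
      using h(2)[OF \<theta> \<beta>] \<theta> Box_comp[OF \<theta> Box_mono[OF AB \<beta>]] by simp
    show "?h k \<theta> \<in> marked Y k" if "\<not> inj_on \<theta> (cube k)" using L.good_marked[OF h(1)[OF \<theta>] \<theta> that] \<theta> by simp
    show "g k (?h k \<theta>) = \<zeta> n (g n (?h n (bid n))) k \<theta>"
      using L.good_g[OF h(1)[OF \<theta>]] \<theta> h(3) by (simp add: Box_id)
  qed simp
  moreover have "?h n (bid n) = y" using h(3) by (simp add: Box_id)
  moreover have "?h k \<theta> = b k \<theta>" if "\<theta> \<in> Box B k n" "bdry k n \<theta>" for k \<theta>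
    using that L.good_bdry[OF h(1)] by simp
  ultimately show ?thesis by (intro bexI[of _ ?h] conjI allI ballI impI)
qed

text \<open>The filling step for the target \<open>conn_lifts\<close>: lifts given on the facets are
  glued to boundary values, which \<open>conn_lift_exists\<close> extends over the whole
  cube.\<close>

lemma conn_lift_fill:
  assumes y: "y \<in> cells Y (Suc m)"
    and d: "\<And>j c. j \<le> m \<Longrightarrow> d j c \<in> cells conn_lifts m \<and> d j c m (bid m) = act Y m (Suc m) (face (Suc m) (Suc j) c) y"
    and compat: "\<And>k j l c c'. m = Suc k \<Longrightarrow> j \<le> l \<Longrightarrow> l \<le> k \<Longrightarrow>
        act conn_lifts k m (face m (Suc j) c) (d (Suc l) c') = act conn_lifts k m (face m (Suc l) c') (d j c)"
  shows "\<exists>h\<in>cells conn_lifts (Suc m). h (Suc m) (bid (Suc m)) = y \<and>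
    (\<forall>j\<le>m. \<forall>c. act conn_lifts m (Suc m) (face (Suc m) (Suc j) c) h = d j c)"
proof -
  have glue: "d (Suc l) c' k (cmp k (face m (Suc j) c) \<psi>) = d j c k (cmp k (face m (Suc l) c') \<psi>)"
    if "m = Suc n" "j \<le> l" "l \<le> n" True True "\<psi> \<in> Box B k n" for n j l c c' k \<psi>
    using fun_cong[OF fun_cong[OF compat[OF that(1-3), of c c'], of k], of \<psi>] that(6) by (simp add: conn_lifts_act)
  obtain b where b: "\<And>k \<theta> j c. \<theta> \<in> Box B k (Suc m) \<Longrightarrow> j \<le> m \<Longrightarrow> True \<Longrightarrow> in_facet k j c \<theta> \<Longrightarrow>
    b k \<theta> = d j c k (cmp k (degen (Suc m) (Suc j)) \<theta>)"
    by (rule facet_family_map[of m "\<lambda>_ _. True" B d, OF glue]) (assumption+, rule that)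
  have bd: "\<exists>j c. j \<le> m \<and> in_facet k j c \<theta>" if "bdry k (Suc m) \<theta>" for k \<theta>
    using that by (auto simp: bdry_def less_Suc_eq_le)
  have dB: "cmp k (degen (Suc m) (Suc j)) \<theta> \<in> Box C k m" if "\<theta> \<in> Box C k (Suc m)" "j \<le> m" for k \<theta> j C
    using that by (auto intro!: Box_comp[OF Box_degen_Suc])
  have fB: "face (Suc m) (Suc j) c \<in> Box C m (Suc m)" if "j \<le> m" for j c C using that by (auto intro: Box_face_Suc)
  have "\<exists>h\<in>cells conn_lifts (Suc m). h (Suc m) (bid (Suc m)) = y \<and> (\<forall>k. \<forall>\<theta>\<in>Box B k (Suc m). bdry k (Suc m) \<theta> \<longrightarrow> h k \<theta> = b k \<theta>)"
  proof (rule conn_lift_exists[OF y])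
    fix k \<theta> assume \<theta>: "\<theta> \<in> Box B k (Suc m)" and "bdry k (Suc m) \<theta>"
    then obtain j c where j: "j \<le> m" "in_facet k j c \<theta>" using bd by blast
    have b\<theta>: "b k \<theta> = d j c k (cmp k (degen (Suc m) (Suc j)) \<theta>)" by (rule b[OF \<theta> j(1) TrueI j(2)])
    have dc: "d j c \<in> cells conn_lifts m" "d j c m (bid m) = act Y m (Suc m) (face (Suc m) (Suc j) c) y" using d[OF j(1)] by simp_all
    show "b k \<theta> \<in> cells Y k" using b\<theta> conn_lift_cells[OF dc(1) dB[OF \<theta> j(1)]] by simp
    show "b l (cmp l \<theta> \<beta>) = act Y l k \<beta> (b k \<theta>)" if \<beta>: "\<beta> \<in> Box A l k" for l \<beta>
      using b[OF Box_comp[OF \<theta> Box_mono[OF AB \<beta>]] j(1) TrueI in_facet_cmp[OF \<beta> j(2)]]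
        conn_lift_act[OF dc(1) dB[OF \<theta> j(1)] \<beta>] b\<theta> cmp_assoc[OF \<beta>] by simp
    show "b k \<theta> \<in> marked Y k" if "\<not> inj_on \<theta> (cube k)"
      using b\<theta> conn_lift_marked[OF dc(1) dB[OF \<theta> j(1)] not_inj_cmp[OF \<theta> that]] by simp
    have "g k (b k \<theta>) = \<zeta> m (act Z m (Suc m) (face (Suc m) (Suc j) c) (g (Suc m) y)) k (cmp k (degen (Suc m) (Suc j)) \<theta>)"
      using b\<theta> conn_lifts_g[OF dc(1) dB[OF \<theta> j(1)]] dc(2) hom_act[OF g fB[OF j(1)] y] by simp
    also have "\<dots> = \<zeta> (Suc m) (g (Suc m) y) k \<theta>"
      using \<zeta>_rel[OF hom_cells[OF g y] fB[OF j(1)] dB[OF \<theta> j(1)], of c] facet_factor[OF \<theta> j] by simp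
    finally show "g k (b k \<theta>) = \<zeta> (Suc m) (g (Suc m) y) k \<theta>" .
  next
    fix k \<beta> assume \<beta>: "\<beta> \<in> Box A k (Suc m)" and "bdry k (Suc m) \<beta>"
    then obtain j c where j: "j \<le> m" "in_facet k j c \<beta>" using bd by blast
    have dc: "d j c \<in> cells conn_lifts m" "d j c m (bid m) = act Y m (Suc m) (face (Suc m) (Suc j) c) y" using d[OF j(1)] by simp_all
    show "act Y k (Suc m) \<beta> y = b k \<beta>"
      using b[OF Box_mono[OF AB \<beta>] j(1) TrueI j(2)] conn_lift_bid[OF dc(1) dB[OF \<beta> j(1)]] dc(2)
        Y.act_comp[OF fB[OF j(1)] dB[OF \<beta> j(1)] y, of c] facet_factor[OF \<beta> j] by simp
  qed
  then obtain h where h: "h \<in> cells conn_lifts (Suc m)" "h (Suc m) (bid (Suc m)) = y"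
    "\<And>k \<theta>. \<theta> \<in> Box B k (Suc m) \<Longrightarrow> bdry k (Suc m) \<theta> \<Longrightarrow> h k \<theta> = b k \<theta>" by blast
  have "act conn_lifts m (Suc m) (face (Suc m) (Suc j) c) h = d j c" if j: "j \<le> m" for j c
  proof -
    have "act conn_lifts m (Suc m) (face (Suc m) (Suc j) c) h k \<psi> = d j c k \<psi>" for k \<psi>
    proof (cases "\<psi> \<in> Box B k m")
      case True
      let ?\<theta> = "cmp k (face (Suc m) (Suc j) c) \<psi>"
      have \<theta>: "?\<theta> \<in> Box B k (Suc m)" by (rule Box_comp[OF fB[OF j] True])
      have f: "in_facet k j c ?\<theta>" by (rule in_facet_face[OF True j])
      then have "bdry k (Suc m) ?\<theta>" using j by (auto simp: bdry_def less_Suc_eq_le)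
      then have "h k ?\<theta> = d j c k (cmp k (degen (Suc m) (Suc j)) ?\<theta>)" using h(3)[OF \<theta>] b[OF \<theta> j TrueI f] by simp
      also have "cmp k (degen (Suc m) (Suc j)) ?\<theta> = \<psi>"
        using cmp_assoc[OF True, of "degen (Suc m) (Suc j)" "face (Suc m) (Suc j) c"] degen_face[OF j] compose_bid_left[OF True] by simp
      finally show ?thesis using True by (simp add: conn_lifts_act)
    next
      case False
      then show ?thesis using d[OF j, of c] hom_undefined[OF conn_lifts_hom, of "d j c" m \<psi> k] by (simp add: conn_lifts_act)
    qed
    then show ?thesis by (intro ext)
  qed
  then show ?thesis using h(1,2) by blast
qed

end

lemma ishriek_map_elem:
  assumes AB: "A \<subseteq> B" and X: "marked_cubical_set A X" and Y: "marked_cubical_set A Y" and f: "f \<in> hom A X Y"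
    and x: "x \<in> cells X m" and \<theta>: "\<theta> \<in> Box B n m"
  shows "ishriek_map A B X Y f n (lan_elem A B X n (m, x, \<theta>)) = lan_elem A B Y n (m, f m x, \<theta>)"
proof -
  let ?I = "ishriek A B X" and ?F = "ishriek_map A B X Y f"
  note nat = ishriek_map_hom_natural[OF AB X Y f]
  have c: "lan_elem A B X m (m, x, bid m) \<in> cells ?I m"
    unfolding lan_cells[OF AB X] using x Box_id by blast
  have "?F m (lan_elem A B X m (m, x, bid m)) = lan_elem A B Y m (m, f m x, bid m)"
    using mcomp_eqD[OF nat(2) x] hom_cells[OF f x] x by (simp add: unit_map_def)
  then show ?thesis
    using hom_act[OF nat(1) \<theta> c] lan_act[OF AB X \<theta>, of m x "bid m"] lan_act[OF AB Y \<theta>, of m "f m x" "bid m"]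
    by (simp add: compose_bid_left[OF \<theta>])
qed

lemma hom_ii_eqI:
  assumes AB: "A \<subseteq> B" and X: "marked_cubical_set A X" and "p \<in> hom A (ii A B X) Y" "q \<in> hom A (ii A B X) Y'"
    and "\<And>m n x \<theta>. x \<in> cells X m \<Longrightarrow> \<theta> \<in> Box B n m \<Longrightarrow>
      p n (lan_elem A B X n (m, x, \<theta>)) = q n (lan_elem A B X n (m, x, \<theta>))"
  shows "p = q"
proof (rule hom_eqI[OF assms(3,4)])
  fix n c assume "c \<in> cells (ii A B X) n"
  then obtain m x \<theta> where "c = lan_elem A B X n (m, x, \<theta>)" "x \<in> cells X m" "\<theta> \<in> Box B n m"
    unfolding istar_simps lan_cells[OF AB X] by blast
  then show "p n c = q n c" using assms(5) by simp
qed

lemma hom_istar: "A \<subseteq> B \<Longrightarrow> f \<in> hom B X Y \<Longrightarrow> f \<in> hom A (istar A X) (istar A Y)"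
  unfolding hom_def by (auto simp: Box_mono)

lemma marked_cubical_set_ii: "A \<subseteq> B \<Longrightarrow> marked_cubical_set A X \<Longrightarrow> marked_cubical_set A (ii A B X)"
  by (rule marked_cubical_set_istar[OF _ ishriek_marked_cubical_set])

context connection_extension
begin

text \<open>By adjunction a structure on \<open>f\<close> over \<Gamma> amounts to a lift of
  \<open>f\<close> through evaluation at the identity, from \<open>conn_lifts\<close> to
  \<open>Y\<close>. On the image of \<open>j\<close> the lift is the transpose of \<Gamma>0; the
  compatibility hypothesis says exactly that this transpose takes values in
  \<open>conn_lifts\<close>.\<close>

theorem extend_weak_connection_structure:
  fixes W :: "'w mcset" and X :: "'x mcset"
  assumes W: "marked_cubical_set A W" and X: "marked_cubical_set A X"
    and j: "j \<in> hom A W X" and inj: "\<And>n. inj_on (j n) (cells W n)" and f: "f \<in> hom A X Y"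
    and \<Gamma>0: "weak_connection_structure A B W Y (mcomp W f j) \<Gamma>0"
    and eq: "mcomp (ii A B W) g \<Gamma>0 = mcomp (ii A B W) \<Gamma> (ishriek_map A B W Z (mcomp W g (mcomp W f j)))"
  shows "\<exists>\<Gamma>'. weak_connection_structure A B X Y f \<Gamma>' \<and>
    mcomp (ii A B W) \<Gamma>' (ishriek_map A B W X j) = \<Gamma>0 \<and>
    mcomp (ii A B X) g \<Gamma>' = mcomp (ii A B X) \<Gamma> (ishriek_map A B X Z (mcomp X g f))"
proof -
  interpret W: marked_cubical_set A W by (rule W)
  interpret X: marked_cubical_set A X by (rule X)
  have \<Gamma>0h: "\<Gamma>0 \<in> hom A (ii A B W) Y" using \<Gamma>0 by (simp add: weak_connection_structure_def)
  have fj: "mcomp W f j \<in> hom A W Y" and gfj: "mcomp W g (mcomp W f j) \<in> hom A W Z" and gf: "mcomp X g f \<in> hom A X Z"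
    using mcomp_hom[OF W j f] mcomp_hom[OF W _ g] mcomp_hom[OF X f g] by blast+
  have lanW: "lan_elem A B W k (n, w, \<theta>) \<in> cells (ishriek A B W) k" if "w \<in> cells W n" "\<theta> \<in> Box B k n" for k n w \<theta>
    unfolding lan_cells[OF AB W] using that by blast
  have lanX: "lan_elem A B X k (n, w, \<theta>) \<in> cells (ishriek A B X) k" if "w \<in> cells X n" "\<theta> \<in> Box B k n" for k n w \<theta>
    unfolding lan_cells[OF AB X] using that by blast
  have \<Gamma>0_bid: "\<Gamma>0 n (lan_elem A B W n (n, w, bid n)) = f n (j n w)" if "w \<in> cells W n" for n w
    using \<Gamma>0 that mcomp_apply[OF that, of \<Gamma>0 "unit_map A B W"] mcomp_apply[OF that, of f j]
    by (simp add: weak_connection_structure_def unit_map_def)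
  have \<Gamma>0_g: "g k (\<Gamma>0 k (lan_elem A B W k (n, w, \<theta>))) = \<zeta> n (g n (f n (j n w))) k \<theta>"
    if w: "w \<in> cells W n" and \<theta>: "\<theta> \<in> Box B k n" for k n w \<theta>
    using mcomp_eqD[OF eq, of "lan_elem A B W k (n, w, \<theta>)" k] lanW[OF w \<theta>]
      ishriek_map_elem[OF AB W Z.marked_cubical_set_axioms gfj w \<theta>] w by (simp add: \<zeta>_def mcomp_apply)
  have \<Gamma>0_act: "\<Gamma>0 l (lan_elem A B W l (n, w, cmp l \<theta> \<beta>)) = act Y l k \<beta> (\<Gamma>0 k (lan_elem A B W k (n, w, \<theta>)))"
    if w: "w \<in> cells W n" and \<theta>: "\<theta> \<in> Box B k n" and \<beta>: "\<beta> \<in> Box A l k" for k l n w \<theta> \<beta>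
    using hom_act[OF \<Gamma>0h \<beta>, of "lan_elem A B W k (n, w, \<theta>)"] lanW[OF w \<theta>] \<beta>
      lan_act[OF AB W Box_mono[OF AB \<beta>], of n w \<theta>] by simp
  define h1 where "h1 n w k = (\<lambda>\<theta>\<in>Box B k n. \<Gamma>0 k (lan_elem A B W k (n, w, \<theta>)))" for n w k
  define h0 where "h0 n x = h1 n (inv_into (cells W n) (j n) x)" for n x
  have h0: "h0 n (j n w) = h1 n w" if "w \<in> cells W n" for n w
    using inv_into_f_f[OF inj that] by (simp add: h0_def)
  have h1_cell: "h1 n w \<in> cells conn_lifts n" if w: "w \<in> cells W n" for n w
  proof (rule conn_liftsI)
    fix k \<theta> assume \<theta>: "\<theta> \<in> Box B k n"
    show "h1 n w k \<theta> \<in> cells Y k" using hom_cells[OF \<Gamma>0h] lanW[OF w \<theta>] \<theta> by (simp add: h1_def)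
    show "h1 n w l (cmp l \<theta> \<beta>) = act Y l k \<beta> (h1 n w k \<theta>)" if \<beta>: "\<beta> \<in> Box A l k" for l \<beta>
      using \<Gamma>0_act[OF w \<theta> \<beta>] \<theta> Box_comp[OF \<theta> Box_mono[OF AB \<beta>]] by (simp add: h1_def)
    show "h1 n w k \<theta> \<in> marked Y k" if ni: "\<not> inj_on \<theta> (cube k)"
    proof -
      interpret I: marked_cubical_set B "ishriek A B W" by (rule ishriek_marked_cubical_set[OF AB W])
      have "lan_elem A B W k (n, w, \<theta>) \<in> marked (ishriek A B W) k"
        using I.not_inj_marked[OF \<theta> ni lanW[OF w Box_id]] lan_act[OF AB W \<theta>, of n w "bid n"] compose_bid_left[OF \<theta>] by simp
      then show ?thesis using hom_marked[OF \<Gamma>0h] \<theta> by (simp add: h1_def)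
    qed
    show "g k (h1 n w k \<theta>) = \<zeta> n (g n (h1 n w n (bid n))) k \<theta>"
      using \<Gamma>0_g[OF w \<theta>] \<Gamma>0_bid[OF w] \<theta> by (simp add: h1_def Box_id)
  qed (simp add: h1_def)
  have h1_act: "h1 m (act W m n \<phi> w) = act conn_lifts m n \<phi> (h1 n w)" if \<phi>: "\<phi> \<in> Box A m n" and w: "w \<in> cells W n" for m n \<phi> w
  proof (intro ext)
    fix k \<theta> show "h1 m (act W m n \<phi> w) k \<theta> = act conn_lifts m n \<phi> (h1 n w) k \<theta>"
      using lan_rel_elem[OF AB W w \<phi>, of \<theta> k] Box_comp[OF Box_mono[OF AB \<phi>], of \<theta> k]
      by (simp add: h1_def conn_lifts_act restrict_def)
  qed
  let ?R = "\<lambda>n x h. h n (bid n) = f n x"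
  interpret E: extension_problem A X conn_lifts "\<lambda>n. j n ` cells W n" h0 ?R
  proof (intro extension_problem.intro extension_problem_axioms.intro)
    show "cubical_set A X" by (rule X.cubical)
    show "cubical_set A conn_lifts" by (rule cubical_set_conn_lifts)
    show "j n ` cells W n \<subseteq> cells X n" for n using hom_cells[OF j] by blast
    show "act X m n \<phi> x \<in> j m ` cells W m" if \<phi>: "\<phi> \<in> Box A m n" and x: "x \<in> j n ` cells W n" for m n \<phi> x
      using x hom_act[OF j \<phi>, symmetric] W.act_closed[OF \<phi>] by auto
    show "h0 n x \<in> cells conn_lifts n" if "x \<in> j n ` cells W n" for n x using that h0 h1_cell by auto
    show "h0 m (act X m n \<phi> x) = act conn_lifts m n \<phi> (h0 n x)" if \<phi>: "\<phi> \<in> Box A m n" and x: "x \<in> j n ` cells W n" for m n \<phi> x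
      using x hom_act[OF j \<phi>, symmetric] W.act_closed[OF \<phi>] h0 h1_act[OF \<phi>] by auto
    show "h0 n x n (bid n) = f n x" if "x \<in> j n ` cells W n" for n x
      using that h0 \<Gamma>0_bid by (auto simp: h1_def Box_id)
    show "act conn_lifts m n \<phi> h m (bid m) = f m (act X m n \<phi> x)"
      if \<phi>: "\<phi> \<in> Box A m n" and x: "x \<in> cells X n" and h: "h \<in> cells conn_lifts n" and R: "h n (bid n) = f n x" for m n \<phi> x h
      using conn_lift_bid[OF h \<phi>] R hom_act[OF f \<phi> x] compose_bid_right[OF \<phi>] by (simp add: conn_lifts_act Box_id)
    show "\<exists>h\<in>cells conn_lifts 0. h 0 (bid 0) = f 0 x" if x: "x \<in> cells X 0 - j 0 ` cells W 0" for x
    proof -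
      have y: "f 0 x \<in> cells Y 0" using hom_cells[OF f] x by blast
      have "\<not> bdry k 0 \<theta>" for k \<theta> by (simp add: bdry_def)
      then show ?thesis using conn_lift_exists[OF y, of "\<lambda>_ _. undefined"] by blast
    qed
    fix x m d
    assume x: "x \<in> cells X (Suc m) - j (Suc m) ` cells W (Suc m)"
      and d: "\<And>i e. i \<le> m \<Longrightarrow> d i e \<in> cells conn_lifts m \<and> ?R m (act X m (Suc m) (face (Suc m) (Suc i) e) x) (d i e)"
      and c: "\<And>k i l e e'. m = Suc k \<Longrightarrow> i \<le> l \<Longrightarrow> l \<le> k \<Longrightarrow>
        act conn_lifts k m (face m (Suc i) e) (d (Suc l) e') = act conn_lifts k m (face m (Suc l) e') (d i e)"
    show "\<exists>h\<in>cells conn_lifts (Suc m). h (Suc m) (bid (Suc m)) = f (Suc m) x \<and>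
        (\<forall>i\<le>m. \<forall>e. act conn_lifts m (Suc m) (face (Suc m) (Suc i) e) h = d i e)"
    proof (rule conn_lift_fill)
      show "f (Suc m) x \<in> cells Y (Suc m)" using hom_cells[OF f] x by blast
      show "d i e \<in> cells conn_lifts m \<and> d i e m (bid m) = act Y m (Suc m) (face (Suc m) (Suc i) e) (f (Suc m) x)"
        if i: "i \<le> m" for i e
        using d[OF i, of e] hom_act[OF f Box_face_Suc[of "Suc i" m e A], of x] x i by simp
    qed (rule c)
  qed
  obtain h where h: "\<And>n x. x \<in> cells X n \<Longrightarrow> h n x \<in> cells conn_lifts n" "\<And>n x. x \<in> cells X n \<Longrightarrow> h n x n (bid n) = f n x"
    "\<And>n x. x \<in> j n ` cells W n \<Longrightarrow> h n x = h0 n x"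
    "\<And>m n \<phi> x. \<phi> \<in> Box A m n \<Longrightarrow> x \<in> cells X n \<Longrightarrow> h m (act X m n \<phi> x) = act conn_lifts m n \<phi> (h n x)"
    by (rule E.extension) (rule that)
  define \<Gamma>' where "\<Gamma>' n = (\<lambda>c\<in>cells (ishriek A B X) n. the_elem ((\<lambda>(m, x, \<theta>). h m x n \<theta>) ` c))" for n
  have \<Gamma>': "\<Gamma>' n (lan_elem A B X n (m, x, \<theta>)) = h m x n \<theta>" if x: "x \<in> cells X m" and \<theta>: "\<theta> \<in> Box B n m" for n m x \<theta>
  proof -
    let ?F = "\<lambda>(m, x, \<theta>). h m x n \<theta>"
    have "?F u = ?F v" if r: "lan_rel A B X n u v" for u v
    proof -
      from r obtain m l \<psi> \<phi> x where *: "x \<in> cells X m" "\<psi> \<in> Box A l m" "\<phi> \<in> Box B n l"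
        "u = (m, x, cmp n \<psi> \<phi>)" "v = (l, act X l m \<psi> x, \<phi>)"
        unfolding lan_rel_def by blast
      then show ?thesis using h(4)[OF *(2,1)] by (simp add: conn_lifts_act)
    qed
    then have "the_elem (?F ` eqclass (lan_rel A B X n) (m, x, \<theta>)) = ?F (m, x, \<theta>)" by (rule the_elem_eqclass)
    then show ?thesis using lanX[OF x \<theta>] by (simp add: \<Gamma>'_def lan_elem_def)
  qed
  have lanE: "\<exists>m x \<theta>. c = lan_elem A B X n (m, x, \<theta>) \<and> x \<in> cells X m \<and> \<theta> \<in> Box B n m" if "c \<in> cells (ishriek A B X) n" for n c
    using that unfolding lan_cells[OF AB X] by blast
  have \<Gamma>'_hom: "\<Gamma>' \<in> hom A (ii A B X) Y"
  proof (rule homI)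
    show "\<Gamma>' n c \<in> cells Y n" if "c \<in> cells (ii A B X) n" for n c
      using lanE[of c n] that \<Gamma>' conn_lift_cells[OF h(1)] by auto
    show "\<Gamma>' n c = undefined" if "c \<notin> cells (ii A B X) n" for n c using that by (simp add: \<Gamma>'_def)
    show "\<Gamma>' m (act (ii A B X) m n \<beta> c) = act Y m n \<beta> (\<Gamma>' n c)" if \<beta>: "\<beta> \<in> Box A m n" and c: "c \<in> cells (ii A B X) n" for m n \<beta> c
    proof -
      obtain l x \<theta> where l: "c = lan_elem A B X n (l, x, \<theta>)" "x \<in> cells X l" "\<theta> \<in> Box B n l"
        using lanE c by fastforce
      show ?thesis
        using lan_act[OF AB X Box_mono[OF AB \<beta>], of l x \<theta>] \<Gamma>'[OF l(2,3)] \<Gamma>'[OF l(2) Box_comp[OF l(3) Box_mono[OF AB \<beta>]]]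
          conn_lift_act[OF h(1)[OF l(2)] l(3) \<beta>] l(1) \<beta> by simp
    qed
    \<comment> \<open>The object \<open>conn_lifts\<close> ignores the marked cubes of
      \<open>X\<close>. They cause no trouble: their images under the unit go to values of
      \<open>f\<close>, and every other marked cube is degenerate over \<open>B\<close>, where maps
      out of the marked representable give marked values.\<close>
    show "\<Gamma>' n c \<in> marked Y n" if c: "c \<in> marked (ii A B X) n" for n c
    proof -
      have "c \<in> {lan_elem A B X n (n, x, bid n) | x. x \<in> marked X n} \<union> degenerate B (ishriek A B X) n"
        using c lan_marked[OF AB X] by simp
      then show ?thesis
      proof
        assume "c \<in> {lan_elem A B X n (n, x, bid n) | x. x \<in> marked X n}"
        then obtain x where x: "c = lan_elem A B X n (n, x, bid n)" "x \<in> marked X n" by blast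
        then have "x \<in> cells X n" using X.marked_cells by blast
        then show ?thesis using \<Gamma>'[OF _ Box_id] h(2) hom_marked[OF f x(2)] x(1) by simp
      next
        assume "c \<in> degenerate B (ishriek A B X) n"
        then obtain k \<sigma> c' where s: "n = Suc k" "generator B k \<sigma>" "c' \<in> cells (ishriek A B X) k" "c = act (ishriek A B X) n k \<sigma> c'"
          by (rule degenerateE)
        obtain l x \<theta> where l: "c' = lan_elem A B X k (l, x, \<theta>)" "x \<in> cells X l" "\<theta> \<in> Box B k l"
          using lanE[OF s(3)] by blast
        have \<sigma>: "\<sigma> \<in> Box B n k" using generator_Box[OF s(2)] s(1) by simp
        have ni: "\<not> inj_on (cmp n \<theta> \<sigma>) (cube n)" using not_inj_cmp[OF \<sigma>] generator_not_inj[OF s(2)] s(1) by blast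
        have "c = lan_elem A B X n (l, x, cmp n \<theta> \<sigma>)" using s(4) l(1) lan_act[OF AB X \<sigma>] by simp
        then show ?thesis
          using \<Gamma>'[OF l(2) Box_comp[OF l(3) \<sigma>]] conn_lift_marked[OF h(1)[OF l(2)] Box_comp[OF l(3) \<sigma>] ni] by simp
      qed
    qed
  qed
  have "mcomp X \<Gamma>' (unit_map A B X) = f"
  proof (intro ext)
    fix n x show "mcomp X \<Gamma>' (unit_map A B X) n x = f n x"
      using \<Gamma>'[OF _ Box_id, of x n] h(2)[of x n] hom_undefined[OF f, of x n]
      by (cases "x \<in> cells X n") (simp_all add: mcomp_def compose_def unit_map_def)
  qed
  then have 1: "weak_connection_structure A B X Y f \<Gamma>'" using \<Gamma>'_hom by (simp add: weak_connection_structure_def)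
  have iX: "marked_cubical_set A (ii A B X)" and iW: "marked_cubical_set A (ii A B W)"
    by (rule marked_cubical_set_ii[OF AB X], rule marked_cubical_set_ii[OF AB W])
  have ij: "ishriek_map A B W X j \<in> hom A (ii A B W) (ii A B X)"
    by (rule hom_istar[OF AB ishriek_map_hom_natural(1)[OF AB W X j]])
  have igf: "ishriek_map A B X Z (mcomp X g f) \<in> hom A (ii A B X) (ii A B Z)"
    by (rule hom_istar[OF AB ishriek_map_hom_natural(1)[OF AB X Z.marked_cubical_set_axioms gf]])
  have 2: "mcomp (ii A B W) \<Gamma>' (ishriek_map A B W X j) = \<Gamma>0"
  proof (rule hom_ii_eqI[OF AB W mcomp_hom[OF iW ij \<Gamma>'_hom] \<Gamma>0h])
    fix m n w \<theta> assume w: "w \<in> cells W m" and \<theta>: "\<theta> \<in> Box B n m"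
    show "mcomp (ii A B W) \<Gamma>' (ishriek_map A B W X j) n (lan_elem A B W n (m, w, \<theta>)) = \<Gamma>0 n (lan_elem A B W n (m, w, \<theta>))"
      using lanW[OF w \<theta>] ishriek_map_elem[OF AB W X j w \<theta>] \<Gamma>'[OF hom_cells[OF j w] \<theta>] h(3) h0[OF w] w \<theta>
      by (simp add: mcomp_apply h1_def)
  qed
  have 3: "mcomp (ii A B X) g \<Gamma>' = mcomp (ii A B X) \<Gamma> (ishriek_map A B X Z (mcomp X g f))"
  proof (rule hom_ii_eqI[OF AB X mcomp_hom[OF iX \<Gamma>'_hom g] mcomp_hom[OF iX igf \<Gamma>_hom]])
    fix m n x \<theta> assume x: "x \<in> cells X m" and \<theta>: "\<theta> \<in> Box B n m"
    show "mcomp (ii A B X) g \<Gamma>' n (lan_elem A B X n (m, x, \<theta>)) =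
      mcomp (ii A B X) \<Gamma> (ishriek_map A B X Z (mcomp X g f)) n (lan_elem A B X n (m, x, \<theta>))"
      using lanX[OF x \<theta>] \<Gamma>'[OF x \<theta>] ishriek_map_elem[OF AB X Z.marked_cubical_set_axioms gf x \<theta>]
        conn_lifts_g[OF h(1)[OF x] \<theta>] h(2)[OF x] x by (simp add: mcomp_apply \<zeta>_def)
  qed
  show ?thesis using 1 2 3 by blast
qed

end

section \<open>Marked cubical sets on a given type of cubes\<close>

lemma marked_cubical_set_mark:
  assumes "marked_cubical_set A X" "\<And>n. S n \<subseteq> cells X n" "S 0 = {}"
  shows "marked_cubical_set A (mark X S)"
proof -
  interpret marked_cubical_set A X by (rule assms(1))
  show ?thesis
    by unfold_locales (use act_closed act_id act_comp marked_cells[THEN subsetD] marked_0 marked_degenerate[THEN subsetD] assms in \<open>auto\<close>)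
qed

lemma marked_cubical_set_subcomplex:
  assumes X: "marked_cubical_set A X" and S: "\<And>n. S n \<subseteq> cells X n"
  shows "marked_cubical_set A (subcomplex A X S)"
    and "mid (subcomplex A X S) \<in> hom A (subcomplex A X S) X"
    and "cells (subcomplex A X S) n \<subseteq> cells X n"
proof -
  interpret marked_cubical_set A X by (rule X)
  let ?U = "subcomplex A X S"
  have simps: "cells ?U k = {act X k m \<phi> s | m \<phi> s. s \<in> S m \<and> \<phi> \<in> Box A k m}" "act ?U = act X"
    "marked ?U k = marked X k \<inter> cells ?U k" for k
    by (simp_all add: subcomplex_def Let_def)
  have sub: "x \<in> cells X k" if "x \<in> cells ?U k" for x k
    using that S[THEN subsetD] act_closed by (auto simp: simps(1))
  then show "cells ?U n \<subseteq> cells X n" by blast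
  have closed: "act X m n \<phi> x \<in> cells ?U m" if \<phi>: "\<phi> \<in> Box A m n" and x: "x \<in> cells ?U n" for m n \<phi> x
  proof -
    obtain l \<psi> s where s: "s \<in> S l" "\<psi> \<in> Box A n l" "x = act X n l \<psi> s" using x by (auto simp: simps(1))
    then have "act X m n \<phi> x = act X m l (cmp m \<psi> \<phi>) s" using act_comp[OF s(2) \<phi>] S[THEN subsetD] by auto
    then show ?thesis using s(1) Box_comp[OF s(2) \<phi>] by (auto simp: simps(1))
  qed
  show U: "marked_cubical_set A ?U"
  proof
    show "degenerate A ?U n \<subseteq> marked ?U n" for n
    proof
      fix x assume "x \<in> degenerate A ?U n"
      then obtain m \<sigma> y where *: "n = Suc m" "generator A m \<sigma>" "y \<in> cells ?U m" "x = act ?U n m \<sigma> y"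
        by (rule degenerateE)
      then show "x \<in> marked ?U n"
        using generator_marked[OF *(2) sub[OF *(3)]] closed[OF generator_Box[OF *(2)] *(3)] by (simp add: simps(2,3))
    qed
  qed (use closed sub act_id act_comp marked_0 in \<open>auto simp: simps(2,3)\<close>)
  interpret U: marked_cubical_set A ?U by (rule U)
  show "mid ?U \<in> hom A ?U X"
  proof (rule homI)
    show "mid ?U m (act ?U m n \<phi> x) = act X m n \<phi> (mid ?U n x)" if "\<phi> \<in> Box A m n" "x \<in> cells ?U n" for m n \<phi> x
      using that U.act_closed[OF that] by (simp add: mid_apply simps(2))
    show "mid ?U n x \<in> marked X n" if "x \<in> marked ?U n" for n x
      using that by (simp add: mid_apply simps(3))
  qed (use sub in \<open>auto simp: mid_def\<close>)
qed

lemma mid_hom_entire: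
  assumes "marked_cubical_set A X" "cells Y = cells X" "act Y = act X" "\<And>n. marked X n \<subseteq> marked Y n"
  shows "mid X \<in> hom A X Y"
proof -
  interpret marked_cubical_set A X by (rule assms(1))
  show ?thesis
    using assms(2-4) marked_cells act_closed by (intro homI) (auto simp: mid_def)
qed

lemma mid_hom: "marked_cubical_set A X \<Longrightarrow> mid X \<in> hom A X X"
  by (rule mid_hom_entire) auto

context
  fixes A :: "bool set" and n i :: nat and e :: bool
  assumes i: "1 \<le> i" "i \<le> n"
begin

lemma marked_cubical_set_comical_cube: "marked_cubical_set A (comical_cube A n i e)"
  unfolding comical_cube_def
  by (rule marked_cubical_set_mark[OF marked_cubical_set_boxset])
    (use faces_where_Box faces_where_critical_0[OF i] in auto)

lemma open_box_inclusion:
  "marked_cubical_set A (open_box A n i e)"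
  "mid (open_box A n i e) \<in> hom A (open_box A n i e) (comical_cube A n i e)"
  "cells (open_box A n i e) k \<subseteq> cells (comical_cube A n i e) k"
proof -
  let ?S = "faces_where n (\<lambda>cs. cs \<noteq> [] \<and> cs \<noteq> [(i, e)])"
  have "?S k \<subseteq> cells (comical_cube A n i e) k" for k
    using faces_where_Box by (auto simp: comical_cube_simps)
  from marked_cubical_set_subcomplex[OF marked_cubical_set_comical_cube this]
  show "marked_cubical_set A (open_box A n i e)"
    "mid (open_box A n i e) \<in> hom A (open_box A n i e) (comical_cube A n i e)"
    "cells (open_box A n i e) k \<subseteq> cells (comical_cube A n i e) k"
    unfolding open_box_def by blast+
qed

lemma comical_marking_extension:
  assumes n: "2 \<le> n"
  shows "marked_cubical_set A (comical_cube' A n i e)"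
    and "marked_cubical_set A (tau (n - 2) (comical_cube A n i e))"
    and "mid (comical_cube' A n i e) \<in> hom A (comical_cube' A n i e) (tau (n - 2) (comical_cube A n i e))"
proof -
  let ?S = "faces_where n (\<lambda>cs. length cs = 1 \<and> cs \<noteq> [(i, e)])"
  have S: "n - 2 < k \<and> 0 < k \<and> w \<in> Box A k n" if w: "w \<in> ?S k" for w k
  proof -
    have "k + 1 = n" using w by (auto simp: faces_where_def)
    then show ?thesis using n faces_where_Box[OF w] by simp
  qed
  show 1: "marked_cubical_set A (comical_cube' A n i e)"
    unfolding comical_cube'_def
    by (rule marked_cubical_set_mark[OF marked_cubical_set_comical_cube])
      (use S in \<open>auto simp: comical_cube_simps\<close>)
  show "marked_cubical_set A (tau (n - 2) (comical_cube A n i e))"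
    unfolding tau_def by (rule marked_cubical_set_mark[OF marked_cubical_set_comical_cube]) auto
  show "mid (comical_cube' A n i e) \<in> hom A (comical_cube' A n i e) (tau (n - 2) (comical_cube A n i e))"
  proof (rule mid_hom_entire[OF 1])
    show "marked (comical_cube' A n i e) k \<subseteq> marked (tau (n - 2) (comical_cube A n i e)) k" for k
      using S by (auto simp: comical_cube'_def tau_def comical_cube_simps(1))
  qed (simp_all add: comical_cube'_def tau_def fun_eq_iff)
qed

end

text \<open>An isomorphic copy on another type of cubes. The injection may depend on the dimension,
  so each dimension needs room only for itself.\<close>

definition transport :: "(nat \<Rightarrow> 'a \<Rightarrow> 'b) \<Rightarrow> 'a mcset \<Rightarrow> 'b mcset" where
  "transport \<iota> X = \<lparr>cells = (\<lambda>n. \<iota> n ` cells X n),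
     act = (\<lambda>m n \<phi> y. \<iota> m (act X m n \<phi> (inv_into (cells X n) (\<iota> n) y))), marked = (\<lambda>n. \<iota> n ` marked X n)\<rparr>"

definition transport_map :: "(nat \<Rightarrow> 'a \<Rightarrow> 'b) \<Rightarrow> 'a mcset \<Rightarrow> ('a, 'b) mmap" where
  "transport_map \<iota> X n = (\<lambda>x\<in>cells X n. \<iota> n x)"

definition transport_inv :: "(nat \<Rightarrow> 'a \<Rightarrow> 'b) \<Rightarrow> 'a mcset \<Rightarrow> ('b, 'a) mmap" where
  "transport_inv \<iota> X n = (\<lambda>y\<in>\<iota> n ` cells X n. inv_into (cells X n) (\<iota> n) y)"

context
  fixes A :: "bool set" and X :: "'a mcset" and \<iota> :: "nat \<Rightarrow> 'a \<Rightarrow> 'b"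
  assumes X: "marked_cubical_set A X" and inj: "\<And>n. inj_on (\<iota> n) (cells X n)"
begin

interpretation marked_cubical_set A X by (rule X)

lemma transport_simps:
  "cells (transport \<iota> X) n = \<iota> n ` cells X n" "marked (transport \<iota> X) n = \<iota> n ` marked X n"
  "x \<in> cells X n \<Longrightarrow> act (transport \<iota> X) m n \<phi> (\<iota> n x) = \<iota> m (act X m n \<phi> x)"
  using inv_into_f_f[OF inj] by (simp_all add: transport_def)

lemma transport_map_apply: "x \<in> cells X n \<Longrightarrow> transport_map \<iota> X n x = \<iota> n x"
  and transport_inv_apply: "x \<in> cells X n \<Longrightarrow> transport_inv \<iota> X n (\<iota> n x) = x"
  using inv_into_f_f[OF inj] by (simp_all add: transport_map_def transport_inv_def)

lemma marked_cubical_set_transport: "marked_cubical_set A (transport \<iota> X)"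
proof
  show "degenerate A (transport \<iota> X) n \<subseteq> marked (transport \<iota> X) n" for n
  proof
    fix x assume "x \<in> degenerate A (transport \<iota> X) n"
    then obtain m \<sigma> y where *: "n = Suc m" "generator A m \<sigma>" "y \<in> cells (transport \<iota> X) m" "x = act (transport \<iota> X) n m \<sigma> y"
      by (rule degenerateE)
    then obtain y' where "y = \<iota> m y'" "y' \<in> cells X m" by (auto simp: transport_simps)
    then show "x \<in> marked (transport \<iota> X) n"
      using generator_marked[OF *(2), of y'] * by (simp add: transport_simps)
  qed
qed (use act_closed act_id act_comp marked_0 marked_cells[THEN subsetD] in \<open>auto simp: transport_simps\<close>)

lemma transport_map_hom: "transport_map \<iota> X \<in> hom A X (transport \<iota> X)"
  by (rule homI) (use act_closed marked_cells[THEN subsetD] in \<open>auto simp: transport_simps transport_map_def\<close>)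

lemma transport_inv_hom: "transport_inv \<iota> X \<in> hom A (transport \<iota> X) X"
  by (rule homI) (use act_closed marked_cells[THEN subsetD] in \<open>auto simp: transport_simps transport_inv_apply, auto simp: transport_inv_def\<close>)

lemma transport_map_inv:
  "mcomp (transport \<iota> X) (transport_map \<iota> X) (transport_inv \<iota> X) = mid (transport \<iota> X)"
  "mcomp X (transport_inv \<iota> X) (transport_map \<iota> X) = mid X"
  by (auto simp: fun_eq_iff mcomp_def compose_def mid_def transport_simps transport_map_apply transport_inv_apply)

end

lemma finite_Box: "finite (Box A m n)"
proof -
  have "finite (cube m)" for m using finite_lists_length_eq[of "UNIV :: bool set" m] by (simp add: cube_def)
  then have "finite (cube m \<rightarrow>\<^sub>E cube n)" by (intro finite_PiE)
  then show ?thesis by (rule rev_finite_subset) (use Box_ext in blast)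
qed

lemma finite_inj_on_infinite:
  assumes "finite S" "infinite (UNIV :: 'u set)"
  shows "\<exists>f :: 'a \<Rightarrow> 'u. inj_on f S"
proof -
  obtain T :: "'u set" where "finite T" "card T = card S"
    using infinite_arbitrarily_large[OF assms(2), of "card S"] by blast
  then obtain f where "bij_betw f S T" using finite_same_card_bij[OF assms(1), of T] by metis
  then show ?thesis using bij_betw_imp_inj_on by blast
qed

lemma pairing_exists:
  assumes "infinite (UNIV :: 'u set)"
  shows "\<exists>pair :: 'u \<times> 'u \<Rightarrow> 'u. inj pair"
proof -
  obtain f where "bij_betw f ((UNIV :: 'u set) \<times> (UNIV :: 'u set)) (UNIV :: 'u set)"
    using card_of_Times_same_infinite[OF assms] unfolding card_of_ordIso[symmetric] by blast
  then show ?thesis using bij_betw_imp_inj_on by fastforce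
qed

definition pullback :: "'a mcset \<Rightarrow> 'b mcset \<Rightarrow> ('a, 'c) mmap \<Rightarrow> ('b, 'c) mmap \<Rightarrow> ('a \<times> 'b) mcset" where
  "pullback P R p r = \<lparr>cells = (\<lambda>n. {(x, y). x \<in> cells P n \<and> y \<in> cells R n \<and> p n x = r n y}),
     act = (\<lambda>m n \<phi> (x, y). (act P m n \<phi> x, act R m n \<phi> y)),
     marked = (\<lambda>n. {(x, y). x \<in> marked P n \<and> y \<in> marked R n \<and> p n x = r n y})\<rparr>"

lemma pullback_simps:
  "c \<in> cells (pullback P R p r) n \<longleftrightarrow> fst c \<in> cells P n \<and> snd c \<in> cells R n \<and> p n (fst c) = r n (snd c)"
  "act (pullback P R p r) m n \<phi> c = (act P m n \<phi> (fst c), act R m n \<phi> (snd c))"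
  "c \<in> marked (pullback P R p r) n \<longleftrightarrow> fst c \<in> marked P n \<and> snd c \<in> marked R n \<and> p n (fst c) = r n (snd c)"
  by (cases c; simp add: pullback_def)+

lemma marked_cubical_set_pullback:
  assumes P: "marked_cubical_set A P" and R: "marked_cubical_set A R" and p: "p \<in> hom A P Q" and r: "r \<in> hom A R Q"
  shows "marked_cubical_set A (pullback P R p r)"
proof -
  interpret P: marked_cubical_set A P by (rule P)
  interpret R: marked_cubical_set A R by (rule R)
  let ?M = "pullback P R p r"
  have closed: "act ?M m n \<phi> c \<in> cells ?M m" if \<phi>: "\<phi> \<in> Box A m n" and c: "c \<in> cells ?M n" for m n \<phi> c
    using c P.act_closed[OF \<phi>] R.act_closed[OF \<phi>] hom_act[OF p \<phi>] hom_act[OF r \<phi>] by (simp add: pullback_simps)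
  show ?thesis
  proof
    show "degenerate A ?M n \<subseteq> marked ?M n" for n
    proof
      fix x assume "x \<in> degenerate A ?M n"
      then obtain m \<sigma> y where *: "n = Suc m" "generator A m \<sigma>" "y \<in> cells ?M m" "x = act ?M n m \<sigma> y"
        by (rule degenerateE)
      then show "x \<in> marked ?M n"
        using closed[OF generator_Box[OF *(2)] *(3)] P.generator_marked[OF *(2)] R.generator_marked[OF *(2)]
        by (simp add: pullback_simps)
    qed
    show "marked ?M n \<subseteq> cells ?M n" for n using P.marked_cells[THEN subsetD] R.marked_cells[THEN subsetD] by (auto simp: pullback_simps)
    show "marked ?M 0 = {}" using P.marked_0 by (simp add: pullback_def)
    show "act ?M n n (bid n) c = c" if "c \<in> cells ?M n" for n c
      using that P.act_id R.act_id by (simp add: pullback_simps)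
    show "act ?M k n (cmp k \<phi> \<psi>) c = act ?M k m \<psi> (act ?M m n \<phi> c)"
      if "\<phi> \<in> Box A m n" "\<psi> \<in> Box A k m" "c \<in> cells ?M n" for \<phi> \<psi> k m n c
      using that P.act_comp[OF that(1,2)] R.act_comp[OF that(1,2)] by (simp add: pullback_simps)
  qed (rule closed)
qed

section \<open>Composites of maps and invariance of lifting properties\<close>

lemma mcomp_mid_left: "f \<in> hom A X Y \<Longrightarrow> mcomp X (mid Y) f = f"
  and mcomp_mid_right: "f \<in> hom A X Y \<Longrightarrow> mcomp X f (mid X) = f"
  using hom_cells[of f A X Y] hom_undefined[of f A X Y]
  by (auto simp: fun_eq_iff mcomp_def compose_def mid_def)

lemma mcomp_assoc: "f \<in> hom A X Y \<Longrightarrow> mcomp X h (mcomp X g f) = mcomp X (mcomp Y h g) f"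
  using hom_cells[of f A X Y] by (auto simp: fun_eq_iff mcomp_def compose_def)

text \<open>Left maps are closed under retracts. In \<open>rlp_transport\<close> it is applied in
  both directions to mutually inverse maps, so that lifting does not depend on the type of
  cubes.\<close>

lemma rlp_retract:
  assumes U: "marked_cubical_set A U" and V: "marked_cubical_set A V"
    and U': "marked_cubical_set A U'" and V': "marked_cubical_set A V'"
    and h: "s \<in> hom A U U'" "r \<in> hom A U' U" "s' \<in> hom A V V'" "r' \<in> hom A V' V" "u \<in> hom A U V" "u' \<in> hom A U' V'"
      "p \<in> hom A P Q"
    and rs: "mcomp U r s = mid U" "mcomp V r' s' = mid V"
    and sq: "mcomp U u' s = mcomp U s' u" "mcomp U' u r = mcomp U' r' u'"
    and rlp: "rlp A U' V' u' P Q p"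
  shows "rlp A U V u P Q p"
  unfolding rlp_def
proof (intro ballI impI)
  fix a b assume a: "a \<in> hom A U P" and b: "b \<in> hom A V Q" and ab: "mcomp U p a = mcomp U b u"
  have "mcomp U' p (mcomp U' a r) = mcomp U' (mcomp V' b r') u'"
    using ab sq(2) mcomp_assoc[OF h(2), of p a] mcomp_assoc[OF h(2), of b u] mcomp_assoc[OF h(6), of b r'] by simp
  then obtain l where l: "l \<in> hom A V' P" "mcomp U' l u' = mcomp U' a r" "mcomp V' p l = mcomp V' b r'"
    using rlp mcomp_hom[OF U' h(2) a] mcomp_hom[OF V' h(4) b] unfolding rlp_def by blast
  have "mcomp U (mcomp V l s') u = mcomp U (mcomp U' l u') s"
    using mcomp_assoc[OF h(5), of l s'] mcomp_assoc[OF h(1), of l u'] sq(1) by simp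
  also have "\<dots> = a" using l(2) mcomp_assoc[OF h(1), of a r] rs(1) mcomp_mid_right[OF a] by simp
  finally have 1: "mcomp U (mcomp V l s') u = a" .
  have "mcomp V p (mcomp V l s') = mcomp V (mcomp V' b r') s'"
    using mcomp_assoc[OF h(3), of p l] l(3) by simp
  also have "\<dots> = b" using mcomp_assoc[OF h(3), of b r'] rs(2) mcomp_mid_right[OF b] by simp
  finally show "\<exists>h\<in>hom A V P. mcomp U h u = a \<and> mcomp V p h = b"
    using 1 mcomp_hom[OF V h(3) l(1)] by blast
qed

lemma rlp_transport:
  assumes U: "marked_cubical_set A U" and V: "marked_cubical_set A V" and u: "u \<in> hom A U V" and p: "p \<in> hom A P Q"
    and \<iota>: "\<And>n. inj_on (\<iota> n) (cells U n)" and \<kappa>: "\<And>n. inj_on (\<kappa> n) (cells V n)"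
  defines "u' \<equiv> mcomp (transport \<iota> U) (mcomp U (transport_map \<kappa> V) u) (transport_inv \<iota> U)"
  shows "u' \<in> hom A (transport \<iota> U) (transport \<kappa> V)"
    and "rlp A (transport \<iota> U) (transport \<kappa> V) u' P Q p \<longleftrightarrow> rlp A U V u P Q p"
proof -
  let ?U = "transport \<iota> U" and ?V = "transport \<kappa> V"
  have U': "marked_cubical_set A ?U" and V': "marked_cubical_set A ?V"
    by (rule marked_cubical_set_transport[OF U \<iota>], rule marked_cubical_set_transport[OF V \<kappa>])
  note mU = transport_map_hom[OF U \<iota>] transport_inv_hom[OF U \<iota>]
  note mV = transport_map_hom[OF V \<kappa>] transport_inv_hom[OF V \<kappa>]
  note cU = transport_map_inv[OF U \<iota>] and cV = transport_map_inv[OF V \<kappa>]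
  have ku: "mcomp U (transport_map \<kappa> V) u \<in> hom A U ?V" by (rule mcomp_hom[OF U u mV(1)])
  then show u': "u' \<in> hom A ?U ?V" unfolding u'_def by (rule mcomp_hom[OF U' mU(2)])
  have 1: "mcomp U u' (transport_map \<iota> U) = mcomp U (transport_map \<kappa> V) u"
    unfolding u'_def using mcomp_assoc[OF mU(1), of "mcomp U (transport_map \<kappa> V) u" "transport_inv \<iota> U"] cU(2) mcomp_mid_right[OF ku] by simp
  have 2: "mcomp ?U u (transport_inv \<iota> U) = mcomp ?U (transport_inv \<kappa> V) u'"
  proof -
    have "mcomp ?U (transport_inv \<kappa> V) u' = mcomp ?U (mcomp U (transport_inv \<kappa> V) (mcomp U (transport_map \<kappa> V) u)) (transport_inv \<iota> U)"
      unfolding u'_def by (rule mcomp_assoc[OF mU(2)])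
    also have "mcomp U (transport_inv \<kappa> V) (mcomp U (transport_map \<kappa> V) u) = u"
      using mcomp_assoc[OF u, of "transport_inv \<kappa> V" "transport_map \<kappa> V"] cV(2) mcomp_mid_left[OF u] by simp
    finally show ?thesis by simp
  qed
  show "rlp A ?U ?V u' P Q p \<longleftrightarrow> rlp A U V u P Q p"
    using rlp_retract[OF U V U' V' mU mV u u' p cU(2) cV(2) 1 2]
      rlp_retract[OF U' V' U V mU(2,1) mV(2,1) u' u p cU(1) cV(1) 2 1] by blast
qed

section \<open>The comical generators are trivial cofibrations\<close>

context model_structure
begin

lemma Fib_props: "Fib P Q p \<Longrightarrow> marked_cubical_set A P" "Fib P Q p \<Longrightarrow> marked_cubical_set A Q" "Fib P Q p \<Longrightarrow> p \<in> hom A P Q"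
  using Fib_hom by blast+

lemma WE_props: "WE P Q p \<Longrightarrow> marked_cubical_set A P" "WE P Q p \<Longrightarrow> marked_cubical_set A Q" "WE P Q p \<Longrightarrow> p \<in> hom A P Q"
  using WE_hom by blast+

text \<open>The retract argument: lifting \<open>p\<close> against the first factor, with an
  identity on top, exhibits \<open>p\<close> as a retract of the second factor. With either
  factorization axiom it turns a lifting property into membership in a class.\<close>

lemma retract_of_factor:
  assumes P: "marked_cubical_set A P" and Q: "marked_cubical_set A Q" and p: "p \<in> hom A P Q"
    and i: "i \<in> hom A P E" and p': "p' \<in> hom A E Q" and eq: "mcomp P p' i = p" and rlp: "rlp A P E i P Q p"
  shows "retract A P Q p E Q p'"
proof -
  have "mcomp P p (mid P) = mcomp P p' i" using eq mcomp_mid_right[OF p] by simp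
  then obtain r where r: "r \<in> hom A E P" "mcomp P r i = mid P" "mcomp E p r = p'"
    using rlp mid_hom[OF P] p' unfolding rlp_def by blast
  show ?thesis
    unfolding retract_def
  proof (intro bexI conjI)
    show "mcomp P r i = mid P" by (rule r(2))
    show "mcomp Q (mid Q) (mid Q) = mid Q" by (rule mcomp_mid_left[OF mid_hom[OF Q]])
    show "mcomp P p' i = mcomp P (mid Q) p" using eq mcomp_mid_left[OF p] by simp
    show "mcomp E p r = mcomp E (mid Q) p'" using r(3) mcomp_mid_left[OF p'] by simp
  qed (use i r(1) mid_hom[OF Q] in auto)
qed

lemma Fib_if_rlp:
  assumes P: "marked_cubical_set A P" and Q: "marked_cubical_set A Q" and p: "p \<in> hom A P Q"
    and rlp: "\<And>U V u. Cof U V u \<Longrightarrow> WE U V u \<Longrightarrow> rlp A U V u P Q p"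
  shows "Fib P Q p"
proof -
  obtain E i p' where i: "Cof P E i" "WE P E i" "Fib E Q p'" "mcomp P p' i = p"
    using factor_Fib[OF P Q p] by blast
  have "retract A P Q p E Q p'"
    by (rule retract_of_factor[OF P Q p WE_props(3)[OF i(2)] Fib_props(3)[OF i(3)] i(4) rlp[OF i(1,2)]])
  from retracts[OF P Q p this] show ?thesis using i(3) by blast
qed

lemma WE_if_rlp:
  assumes P: "marked_cubical_set A P" and Q: "marked_cubical_set A Q" and p: "p \<in> hom A P Q"
    and rlp: "\<And>U V u. Cof U V u \<Longrightarrow> rlp A U V u P Q p"
  shows "WE P Q p"
proof -
  obtain E i p' where i: "Cof P E i" "Fib E Q p'" "WE E Q p'" "mcomp P p' i = p"
    using factor_trivial_Fib[OF P Q p] by blast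
  have "i \<in> hom A P E" using Cof_hom[OF i(1)] by blast
  then have "retract A P Q p E Q p'"
    by (rule retract_of_factor[OF P Q p _ Fib_props(3)[OF i(2)] i(4) rlp[OF i(1)]])
  from retracts[OF P Q p this] show ?thesis using i(3) by blast
qed

lemma WE_mid: "marked_cubical_set A P \<Longrightarrow> WE P P (mid P)"
proof -
  assume P: "marked_cubical_set A P"
  obtain E i where i: "WE P E i" using factor_Fib[OF P P mid_hom[OF P]] by blast
  show ?thesis
    using two_of_three[OF P P WE_props(2)[OF i] mid_hom[OF P] WE_props(3)[OF i]] i mcomp_mid_right[OF WE_props(3)[OF i]] by simp
qed

lemma Fib_comp:
  assumes p: "Fib P Q p" and q: "Fib Q R q"
  shows "Fib P R (mcomp P q p)"
proof (rule Fib_if_rlp)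
  show "mcomp P q p \<in> hom A P R" by (rule mcomp_hom[OF Fib_props(1,3)[OF p] Fib_props(3)[OF q]])
  fix U V u assume u: "Cof U V u" "WE U V u"
  show "rlp A U V u P R (mcomp P q p)"
    unfolding rlp_def
  proof (intro ballI impI)
    fix a b assume a: "a \<in> hom A U P" and b: "b \<in> hom A V R" and ab: "mcomp U (mcomp P q p) a = mcomp U b u"
    have U: "marked_cubical_set A U" by (rule WE_props(1)[OF u(2)])
    have "mcomp U q (mcomp U p a) = mcomp U b u" using ab mcomp_assoc[OF a, of q p] by simp
    then obtain l where l: "l \<in> hom A V Q" "mcomp U l u = mcomp U p a" "mcomp V q l = b"
      using lift_Fib[OF u q] mcomp_hom[OF U a Fib_props(3)[OF p]] b unfolding rlp_def by blast
    then obtain k where k: "k \<in> hom A V P" "mcomp U k u = a" "mcomp V p k = l"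
      using lift_Fib[OF u p] a unfolding rlp_def by metis
    moreover have "mcomp V (mcomp P q p) k = b" using l(3) k(3) mcomp_assoc[OF k(1), of q p] by simp
    ultimately show "\<exists>h\<in>hom A V P. mcomp U h u = a \<and> mcomp V (mcomp P q p) h = b" by blast
  qed
qed (use Fib_props[OF p] Fib_props[OF q] in auto)

lemma fibrant_if_Fib:
  assumes p: "Fib P Q p" and Q: "fibrant A Fib Q"
  shows "fibrant A Fib P"
  using Fib_comp[OF p] Q unfolding fibrant_def by blast

lemma terminal_exists: "\<exists>T. terminal A T"
proof
  let ?T = "\<lparr>cells = \<lambda>n. {undefined}, act = \<lambda>m n \<phi> x. undefined, marked = \<lambda>n. if n = 0 then {} else {undefined}\<rparr>"
  show "terminal A ?T"
    unfolding terminal_def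
  proof (intro conjI allI impI)
    show "marked_cubical_set A ?T"
      by unfold_locales (auto simp: degenerate_def)
    fix X assume X: "marked_cubical_set A X"
    interpret marked_cubical_set A X by (rule X)
    let ?f = "\<lambda>n. \<lambda>x\<in>cells X n. undefined"
    have "?f \<in> hom A X ?T"
    proof (rule homI)
      show "?f n x \<in> marked ?T n" if "x \<in> marked X n" for n x
        using that marked_0 marked_cells by (cases "n = 0") auto
    qed auto
    moreover have "f = ?f" if f: "f \<in> hom A X ?T" for f
      by (rule hom_eqI[OF f calculation]) (use hom_cells[OF f] in auto)
    ultimately show "\<exists>!f. f \<in> hom A X ?T" by blast
  qed
qed

text \<open>Factor the composite of \<open>u\<close> with a fibrant replacement \<open>k\<close> of its target as \<open>p \<circ> i\<close>; a lift \<open>s\<close>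
  of \<open>k\<close> along \<open>p\<close> satisfies \<open>s \<circ> p \<circ> i = i\<close>, so \<open>s \<circ> p\<close> is a weak equivalence, and \<open>p\<close> is a
  retract of it.\<close>

lemma WE_if_llp:
  assumes u: "marked_cubical_set A U" "marked_cubical_set A V" "u \<in> hom A U V"
    and llp: "\<And>P Q p. Fib P Q p \<Longrightarrow> fibrant A Fib P \<Longrightarrow> fibrant A Fib Q \<Longrightarrow> rlp A U V u P Q p"
  shows "WE U V u"
proof -
  obtain T :: "'u mcset" where T: "terminal A T" using terminal_exists by blast
  then have T': "marked_cubical_set A T" unfolding terminal_def by blast
  have "\<exists>!t. t \<in> hom A V T" using T u(2) by (simp add: terminal_def)
  then obtain t where t: "t \<in> hom A V T" by (elim ex1E)
  obtain V' k t' where k: "Cof V V' k" "WE V V' k" "Fib V' T t'"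
    using factor_Fib[OF u(2) T' t] by blast
  have fV: "fibrant A Fib V'" using k(3) T unfolding fibrant_def by blast
  note V' = WE_props(2)[OF k(2)] and kh = WE_props(3)[OF k(2)]
  have ku: "mcomp U k u \<in> hom A U V'" by (rule mcomp_hom[OF u(1,3) kh])
  obtain U' i p where i: "Cof U U' i" "WE U U' i" "Fib U' V' p" "mcomp U p i = mcomp U k u"
    using factor_Fib[OF u(1) V' ku] by blast
  note U' = WE_props(2)[OF i(2)] and ih = WE_props(3)[OF i(2)] and ph = Fib_props(3)[OF i(3)]
  obtain s0 where s0: "s0 \<in> hom A V U'" "mcomp U s0 u = i" "mcomp V p s0 = k"
    using llp[OF i(3) fibrant_if_Fib[OF i(3) fV] fV] ih kh i(4) unfolding rlp_def by blast
  have "mcomp V p s0 = mcomp V (mid V') k" using s0(3) mcomp_mid_left[OF kh] by simp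
  then obtain s where s: "s \<in> hom A V' U'" "mcomp V s k = s0" "mcomp V' p s = mid V'"
    using lift_Fib[OF k(1,2) i(3)] s0(1) mid_hom[OF V'] unfolding rlp_def by blast
  let ?e = "mcomp U' s p"
  have e: "?e \<in> hom A U' U'" by (rule mcomp_hom[OF U' ph s(1)])
  have "mcomp U ?e i = mcomp U s (mcomp U p i)" using mcomp_assoc[OF ih, of s p] by simp
  also have "\<dots> = mcomp U (mcomp V s k) u" using i(4) mcomp_assoc[OF u(3), of s k] by simp
  finally have "mcomp U ?e i = i" using s(2) s0(2) by simp
  then have WEe: "WE U' U' ?e" using two_of_three[OF u(1) U' U' ih e] i(2) by simp
  have pe: "mcomp U' p ?e = p"
    using mcomp_assoc[OF ph, of p s] s(3) mcomp_mid_left[OF ph] by simp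
  have "retract A U' V' p U' U' ?e"
    unfolding retract_def
  proof (intro bexI conjI)
    show "mcomp U' (mid U') (mid U') = mid U'" by (rule mcomp_mid_left[OF mid_hom[OF U']])
    show "mcomp V' p s = mid V'" by (rule s(3))
    show "mcomp U' ?e (mid U') = mcomp U' s p" by (rule mcomp_mid_right[OF e])
    show "mcomp U' p (mid U') = mcomp U' p ?e" using pe mcomp_mid_right[OF ph] by simp
  qed (use s(1) ph mid_hom[OF U'] in auto)
  from retracts[OF U' V' ph this] have "WE U' V' p" using WEe by blast
  then have "WE U V' (mcomp U k u)"
    using two_of_three[OF u(1) U' V' ih ph] i(2,4) by simp
  then show ?thesis using two_of_three[OF u(1,2) V' u(3) kh] k(2) by blast
qed

end

section \<open>Monomorphisms and injectivity\<close>

lemma monic_if_inj: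
  assumes X: "marked_cubical_set A X" and f: "f \<in> hom A X Y" and inj: "\<And>n. inj_on (f n) (cells X n)"
  shows "monic A X Y f"
  unfolding monic_def
proof (intro conjI allI impI ballI f)
  fix V a b assume "marked_cubical_set A V" and a: "a \<in> hom A V X" and b: "b \<in> hom A V X" and eq: "mcomp V f a = mcomp V f b"
  show "a = b"
    by (rule hom_eqI[OF a b], rule inj_onD[OF inj mcomp_eqD[OF eq]]) (use hom_cells[OF a] hom_cells[OF b] in auto)
qed

text \<open>Two cubes with the same image are two maps out of a representable that \<open>f\<close>
  equalizes. Since \<open>monic\<close> only tests objects with cubes in \<open>'u\<close>, the
  representable, finite in each dimension, is first copied into that infinite type.\<close>

lemma inj_if_monic:
  fixes X Y :: "'u mcset"
  assumes inf: "infinite (UNIV :: 'u set)" and X: "marked_cubical_set A X" and m: "monic A X Y f"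
  shows "inj_on (f n) (cells X n)"
proof (rule inj_onI)
  fix x y assume x: "x \<in> cells X n" and y: "y \<in> cells X n" and eq: "f n x = f n y"
  interpret X: marked_cubical_set A X by (rule X)
  let ?B = "boxset A n"
  have f: "f \<in> hom A X Y" using m by (simp add: monic_def)
  have "\<exists>\<iota> :: bmap \<Rightarrow> 'u. inj_on \<iota> (Box A k n)" for k by (rule finite_inj_on_infinite[OF finite_Box inf])
  then obtain \<iota> :: "nat \<Rightarrow> bmap \<Rightarrow> 'u" where \<iota>: "\<And>k. inj_on (\<iota> k) (cells ?B k)" by (metis boxset_simps(1))
  let ?V = "transport \<iota> ?B" and ?r = "transport_inv \<iota> ?B"
  note B = marked_cubical_set_boxset[of A n]
  note V = marked_cubical_set_transport[OF B \<iota>] and r = transport_inv_hom[OF B \<iota>]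
  have yh: "yoneda A n X z \<in> hom A ?B X" if "z \<in> cells X n" for z
    using X.not_inj_marked that by (intro yoneda_hom[OF X that]) (auto simp: marked_boxset)
  let ?a = "\<lambda>z. mcomp ?V (yoneda A n X z) ?r"
  have ah: "?a z \<in> hom A ?V X" if "z \<in> cells X n" for z by (rule mcomp_hom[OF V r yh[OF that]])
  have ev: "?a z k (\<iota> k \<phi>) = act X k n \<phi> z" if "\<phi> \<in> Box A k n" for z k \<phi>
    using that by (simp add: mcomp_apply transport_simps[OF B \<iota>] transport_inv_apply[OF B \<iota>] yoneda_def)
  have "mcomp ?V f (?a x) = mcomp ?V f (?a y)"
  proof (rule mcomp_eqI)
    fix k c assume "c \<in> cells ?V k"
    then obtain \<phi> where "c = \<iota> k \<phi>" "\<phi> \<in> Box A k n" by (auto simp: transport_simps[OF B \<iota>])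
    then show "f k (?a x k c) = f k (?a y k c)"
      using ev hom_act[OF f _ x] hom_act[OF f _ y] eq by simp
  qed
  then have "?a x = ?a y" using m ah[OF x] ah[OF y] V unfolding monic_def by blast
  then have "?a x n (\<iota> n (bid n)) = ?a y n (\<iota> n (bid n))" by simp
  then show "x = y" using ev[OF Box_id] X.act_id x y by simp
qed

lemma rlp_obj_lift:
  assumes "rlp_obj A U V u X" "marked_cubical_set A V" "a \<in> hom A U X"
  obtains h where "h \<in> hom A V X" "mcomp U h u = a"
proof -
  have "mcomp U (\<lambda>n. \<lambda>x\<in>cells X n. ()) a = mcomp U (\<lambda>n. \<lambda>x\<in>cells V n. ()) u" by (intro ext) simp
  then have "\<exists>h\<in>hom A V X. mcomp U h u = a"
    using assms(1,3) hom_point[OF assms(2)] unfolding rlp_obj_def rlp_def by blast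
  then show thesis using that by blast
qed

definition pairing :: "'d mcset \<Rightarrow> ('d, 'a) mmap \<Rightarrow> ('d, 'b) mmap \<Rightarrow> ('d, 'a \<times> 'b) mmap" where
  "pairing D a b n = (\<lambda>x\<in>cells D n. (a n x, b n x))"

lemma pairing_hom:
  assumes D: "marked_cubical_set A D" and a: "a \<in> hom A D P" and b: "b \<in> hom A D R"
    and eq: "\<And>n x. x \<in> cells D n \<Longrightarrow> p n (a n x) = r n (b n x)"
  shows "pairing D a b \<in> hom A D (pullback P R p r)"
proof (rule homI)
  interpret marked_cubical_set A D by (rule D)
  fix m n \<phi> x assume \<phi>: "\<phi> \<in> Box A m n" and x: "x \<in> cells D n"
  then show "pairing D a b m (act D m n \<phi> x) = act (pullback P R p r) m n \<phi> (pairing D a b n x)"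
    using act_closed[OF \<phi> x] hom_act[OF a \<phi> x] hom_act[OF b \<phi> x] by (simp add: pairing_def pullback_simps)
next
  fix n x assume x: "x \<in> marked D n"
  then have "x \<in> cells D n" using marked_cubical_set.marked_cells[OF D] by blast
  then show "pairing D a b n x \<in> marked (pullback P R p r) n"
    using x hom_marked[OF a] hom_marked[OF b] eq by (simp add: pairing_def pullback_simps)
qed (use hom_cells[OF a] hom_cells[OF b] eq in \<open>auto simp: pairing_def pullback_simps\<close>)

lemma projection_hom:
  assumes "marked_cubical_set A P" "marked_cubical_set A R" "p \<in> hom A P Q" "r \<in> hom A R Q"
  shows "(\<lambda>n. \<lambda>c\<in>cells (pullback P R p r) n. fst c) \<in> hom A (pullback P R p r) P"
    and "(\<lambda>n. \<lambda>c\<in>cells (pullback P R p r) n. snd c) \<in> hom A (pullback P R p r) R"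
proof -
  interpret marked_cubical_set A "pullback P R p r" by (rule marked_cubical_set_pullback[OF assms])
  show "(\<lambda>n. \<lambda>c\<in>cells (pullback P R p r) n. fst c) \<in> hom A (pullback P R p r) P"
    and "(\<lambda>n. \<lambda>c\<in>cells (pullback P R p r) n. snd c) \<in> hom A (pullback P R p r) R"
    using act_closed marked_cells[THEN subsetD] by (intro homI; force simp: pullback_simps)+
qed

context comical_model_structure
begin

context
  assumes inf: "infinite (UNIV :: 'u set)"
begin

lemma Cof_if_inj:
  "marked_cubical_set A U \<Longrightarrow> marked_cubical_set A V \<Longrightarrow> u \<in> hom A U V \<Longrightarrow> (\<And>n. inj_on (u n) (cells U n)) \<Longrightarrow> Cof U V u"
  using Cof_iff_monic monic_if_inj by blast

lemma Cof_inj: "Cof U V u \<Longrightarrow> inj_on (u n) (cells U n)"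
  using Cof_hom[of U V u] Cof_iff_monic[of U V u] inj_if_monic[OF inf] by blast

lemma comical_if_fibrant: "marked_cubical_set A X \<Longrightarrow> fibrant A Fib X \<Longrightarrow> comical A X"
  using fibrant_iff by (simp add: comical_fibrant_def)

text \<open>The mapping path space $P \times_Q Q^I$ of \<open>p\<close> retracts onto \<open>P\<close> over the evaluation at the other end:
  the constant paths embed \<open>P\<close> into it, and this is a trivial cofibration since the projection
  to \<open>P\<close> is a trivial fibration.\<close>

lemma path_retraction:
  assumes p: "Fib P Q p" and Q: "comical A Q"
  obtains l where "l \<in> hom A (pullback P (path A Q) p (ev A Q False)) P"
    "\<And>n x. x \<in> cells P n \<Longrightarrow> l n (x, cst Q n (p n x)) = x"
    "\<And>n c. c \<in> cells (pullback P (path A Q) p (ev A Q False)) n \<Longrightarrow> p n (l n c) = ev A Q True n (snd c)"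
proof -
  note P = Fib_props(1)[OF p] and Qm = Fib_props(2)[OF p] and ph = Fib_props(3)[OF p]
  interpret P: marked_cubical_set A P by (rule P)
  interpret Q: marked_cubical_set A Q by (rule Qm)
  note R = Q.marked_cubical_set_path and ev = Q.ev_hom
  let ?N = "pullback P (path A Q) p (ev A Q False)"
  let ?fst = "\<lambda>n. \<lambda>c\<in>cells ?N n. fst c" and ?snd = "\<lambda>n. \<lambda>c\<in>cells ?N n. snd c"
  note N = marked_cubical_set_pullback[OF P R ph ev] and pr = projection_hom[OF P R ph ev]
  \<comment> \<open>The mapping path space consists of pairs; coding them in \<open>'u\<close> makes
    it an object of the category that carries the model structure.\<close>
  obtain pair :: "'u \<times> 'u \<Rightarrow> 'u" where "inj pair" using pairing_exists[OF inf] by blast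
  then have inj: "inj_on pair (cells ?N n)" for n by (rule inj_on_subset) simp
  let ?M = "transport (\<lambda>_. pair) ?N" and ?\<tau> = "transport_map (\<lambda>_. pair) ?N" and ?\<sigma> = "transport_inv (\<lambda>_. pair) ?N"
  note M = marked_cubical_set_transport[OF N inj] and \<tau> = transport_map_hom[OF N inj] and \<sigma> = transport_inv_hom[OF N inj]
  note app = transport_map_apply[OF N inj] transport_inv_apply[OF N inj]
  have \<sigma>_cell: "?\<sigma> n c \<in> cells ?N n" and \<tau>\<sigma>: "?\<tau> n (?\<sigma> n c) = c" if "c \<in> cells ?M n" for n c
    using that app by (auto simp: transport_simps[OF N inj])
  have \<sigma>\<tau>: "?\<sigma> n (?\<tau> n c) = c" and \<tau>_cell: "?\<tau> n c \<in> cells ?M n" if "c \<in> cells ?N n" for n c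
    using that app by (auto simp: transport_simps[OF N inj])
  let ?\<rho> = "mcomp ?M ?fst ?\<sigma>" and ?\<epsilon> = "mcomp ?M (ev A Q True) (mcomp ?M ?snd ?\<sigma>)"
  have \<rho>: "?\<rho> \<in> hom A ?M P" by (rule mcomp_hom[OF M \<sigma> pr(1)])
  have \<epsilon>: "?\<epsilon> \<in> hom A ?M Q" by (rule mcomp_hom[OF M mcomp_hom[OF M \<sigma> pr(2)] ev])
  have \<rho>_app: "?\<rho> n c = fst (?\<sigma> n c)" "?\<epsilon> n c = ev A Q True n (snd (?\<sigma> n c))" if "c \<in> cells ?M n" for n c
    using that \<sigma>_cell by (simp_all add: mcomp_apply)
  \<comment> \<open>The projection is a pullback of \<open>ev A Q False\<close>, so the lifts of
    \<open>path_ev_rlp\<close> give lifts for it against every cofibration.\<close>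
  have "WE ?M P ?\<rho>"
  proof (rule WE_if_rlp[OF M P \<rho>])
    fix C D u assume u: "Cof C D u"
    have C: "marked_cubical_set A C" and D: "marked_cubical_set A D" and uh: "u \<in> hom A C D" using Cof_hom[OF u] by blast+
    show "rlp A C D u ?M P ?\<rho>"
      unfolding rlp_def
    proof (intro ballI impI)
      fix a b assume a: "a \<in> hom A C ?M" and b: "b \<in> hom A D P" and ab: "mcomp C ?\<rho> a = mcomp C b u"
      have ab': "fst (?\<sigma> n (a n x)) = b n (u n x)" if "x \<in> cells C n" for n x
        using mcomp_eqD[OF ab that] \<rho>_app(1)[OF hom_cells[OF a that]] by simp
      let ?a2 = "mcomp C (mcomp ?M ?snd ?\<sigma>) a"
      have a2: "?a2 \<in> hom A C (path A Q)" by (rule mcomp_hom[OF C a mcomp_hom[OF M \<sigma> pr(2)]])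
      have a2_app: "?a2 n x = snd (?\<sigma> n (a n x))" if "x \<in> cells C n" for n x
        using that hom_cells[OF a that] \<sigma>_cell by (simp add: mcomp_apply)
      have "mcomp C (ev A Q False) ?a2 = mcomp C (mcomp D p b) u"
      proof (rule mcomp_eqI)
        fix n x assume x: "x \<in> cells C n"
        show "ev A Q False n (?a2 n x) = mcomp D p b n (u n x)"
          using \<sigma>_cell[OF hom_cells[OF a x]] a2_app[OF x] ab'[OF x] hom_cells[OF uh x]
          by (simp add: mcomp_apply pullback_simps)
      qed
      then obtain \<kappa> where \<kappa>: "\<kappa> \<in> hom A D (path A Q)" "mcomp C \<kappa> u = ?a2" "mcomp D (ev A Q False) \<kappa> = mcomp D p b"
        using path_ev_rlp[OF Qm Q C D uh Cof_inj[OF u]] a2 mcomp_hom[OF D b ph] unfolding rlp_def by blast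
      have pk: "pairing D b \<kappa> \<in> hom A D ?N"
        by (rule pairing_hom[OF D b \<kappa>(1)]) (use mcomp_eqD[OF \<kappa>(3)] in simp)
      let ?h = "mcomp D ?\<tau> (pairing D b \<kappa>)"
      have h: "?h \<in> hom A D ?M" by (rule mcomp_hom[OF D pk \<tau>])
      have h_app: "?h n x = ?\<tau> n (b n x, \<kappa> n x)" "(b n x, \<kappa> n x) \<in> cells ?N n" if "x \<in> cells D n" for n x
        using that hom_cells[OF pk that] by (simp_all add: mcomp_apply pairing_def)
      have "mcomp C ?h u = a"
      proof (rule hom_eqI[OF mcomp_hom[OF C uh h] a])
        fix n x assume x: "x \<in> cells C n"
        have "\<kappa> n (u n x) = snd (?\<sigma> n (a n x))"
          using fun_cong[OF fun_cong[OF \<kappa>(2)], of n x] x a2_app[OF x] by (simp add: mcomp_apply)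
        then have "(b n (u n x), \<kappa> n (u n x)) = ?\<sigma> n (a n x)" using ab'[OF x] by (simp add: prod_eq_iff)
        then show "mcomp C ?h u n x = a n x"
          using h_app(1)[OF hom_cells[OF uh x]] \<tau>\<sigma>[OF hom_cells[OF a x]] x by (simp add: mcomp_apply)
      qed
      moreover have "mcomp D ?\<rho> ?h = b"
      proof (rule hom_eqI[OF mcomp_hom[OF D h \<rho>] b])
        fix n x assume x: "x \<in> cells D n"
        show "mcomp D ?\<rho> ?h n x = b n x"
          using h_app[OF x] \<rho>_app(1)[OF \<tau>_cell] \<sigma>\<tau> x mcomp_apply[OF x, of ?\<rho> ?h] by simp
      qed
      ultimately show "\<exists>h\<in>hom A D ?M. mcomp C h u = a \<and> mcomp D ?\<rho> h = b" using h by blast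
    qed
  qed
  note WE\<rho> = this
  have cp: "mcomp P (cst Q) p \<in> hom A P (path A Q)" by (rule mcomp_hom[OF P ph Q.cst_hom])
  have ev_cst: "ev A Q e n (cst Q n y) = y" if "y \<in> cells Q n" for e n y
    using fun_cong[OF fun_cong[OF Q.ev_cst[of e]], of n y] that by (simp add: mcomp_apply mid_apply)
  have d: "pairing P (mid P) (mcomp P (cst Q) p) \<in> hom A P ?N"
    by (rule pairing_hom[OF P mid_hom[OF P] cp]) (simp add: mid_apply mcomp_apply ev_cst hom_cells[OF ph])
  let ?\<iota> = "mcomp P ?\<tau> (pairing P (mid P) (mcomp P (cst Q) p))"
  have \<iota>: "?\<iota> \<in> hom A P ?M" by (rule mcomp_hom[OF P d \<tau>])
  have \<iota>_app: "?\<iota> n x = ?\<tau> n (x, cst Q n (p n x))" "(x, cst Q n (p n x)) \<in> cells ?N n" if "x \<in> cells P n" for n x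
    using that hom_cells[OF d that] by (simp_all add: mcomp_apply mid_apply pairing_def)
  have "mcomp P ?\<rho> ?\<iota> = mid P"
  proof (rule hom_eqI[OF mcomp_hom[OF P \<iota> \<rho>] mid_hom[OF P]])
    fix n x assume x: "x \<in> cells P n"
    show "mcomp P ?\<rho> ?\<iota> n x = mid P n x"
      using \<iota>_app[OF x] \<rho>_app(1)[OF \<tau>_cell] \<sigma>\<tau> x mcomp_apply[OF x, of ?\<rho> ?\<iota>] by (simp add: mid_apply)
  qed
  then have "WE P ?M ?\<iota>" using two_of_three[OF P M P \<iota> \<rho>] WE\<rho> WE_mid[OF P] by simp
  moreover have "Cof P ?M ?\<iota>"
  proof (rule Cof_if_inj[OF P M \<iota>])
    show "inj_on (?\<iota> n) (cells P n)" for n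
    proof (rule inj_onI)
      fix x y assume "x \<in> cells P n" "y \<in> cells P n" "?\<iota> n x = ?\<iota> n y"
      then show "x = y" using \<iota>_app \<sigma>\<tau> by (metis Pair_inject)
    qed
  qed
  moreover have "mcomp P p (mid P) = mcomp P ?\<epsilon> ?\<iota>"
  proof (rule mcomp_eqI)
    fix n x assume x: "x \<in> cells P n"
    show "p n (mid P n x) = ?\<epsilon> n (?\<iota> n x)"
      using \<iota>_app[OF x] \<rho>_app(2)[OF \<tau>_cell] \<sigma>\<tau> ev_cst[OF hom_cells[OF ph x]] x by (simp add: mid_apply)
  qed
  \<comment> \<open>The square has the identity of \<open>P\<close> on top and evaluation at the far
    end below. Its diagonal transports a cube of \<open>P\<close> along a path starting at its
    image, and constant paths do nothing.\<close>
  ultimately obtain l where l: "l \<in> hom A ?M P" "mcomp P l ?\<iota> = mid P" "mcomp ?M p l = ?\<epsilon>"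
    using lift_Fib[OF _ _ p] mid_hom[OF P] \<epsilon> unfolding rlp_def by blast
  show thesis
  proof (rule that)
    show "mcomp ?N l ?\<tau> \<in> hom A ?N P" by (rule mcomp_hom[OF N \<tau> l(1)])
    show "mcomp ?N l ?\<tau> n (x, cst Q n (p n x)) = x" if x: "x \<in> cells P n" for n x
      using fun_cong[OF fun_cong[OF l(2)], of n x] x \<iota>_app[OF x] by (simp add: mcomp_apply[OF x] mcomp_apply[OF \<iota>_app(2)[OF x]] mid_apply)
    show "p n (mcomp ?N l ?\<tau> n c) = ev A Q True n (snd c)" if c: "c \<in> cells ?N n" for n c
      using fun_cong[OF fun_cong[OF l(3)], of n "?\<tau> n c"] \<rho>_app(2)[OF \<tau>_cell[OF c]] \<sigma>\<tau>[OF c]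
      by (simp add: mcomp_apply[OF c] mcomp_apply[OF \<tau>_cell[OF c]])
  qed
qed

text \<open>The filler \<open>h\<close> in \<open>P\<close> lies over \<open>b\<close> only on the
  open box. The homotopy \<open>K\<close> leads from the image of \<open>h\<close> to
  \<open>b\<close> and is constant on the box, so transporting \<open>h\<close> along
  \<open>K\<close> corrects it without disturbing the prescribed values.\<close>

lemma open_box_rlp:
  assumes p: "Fib P Q p" and f: "fibrant A Fib P" "fibrant A Fib Q" and i: "1 \<le> i" "i \<le> n"
  shows "rlp A (open_box A n i e) (comical_cube A n i e) (mid (open_box A n i e)) P Q p"
  unfolding rlp_def
proof (intro ballI impI)
  note P = Fib_props(1)[OF p] and Qm = Fib_props(2)[OF p] and ph = Fib_props(3)[OF p]
  note comP = comical_if_fibrant[OF P f(1)] and comQ = comical_if_fibrant[OF Qm f(2)]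
  obtain m i' where m: "n = Suc m" "i = Suc i'" "i' \<le> m" using i by (cases n; cases i) auto
  let ?U = "open_box A n i e" and ?V = "comical_cube A n i e"
  note V = marked_cubical_set_comical_cube[OF i, of A e] and U = open_box_inclusion[OF i, of A e]
  fix a b assume a: "a \<in> hom A ?U P" and b: "b \<in> hom A ?V Q" and ab: "mcomp ?U p a = mcomp ?U b (mid ?U)"
  have "rlp_obj A ?U ?V (mid ?U) P" using comP i unfolding comical_def by blast
  from this V a obtain h where h: "h \<in> hom A ?V P" "mcomp ?U h (mid ?U) = a" by (rule rlp_obj_lift)
  have hU: "h k x = a k x" "p k (a k x) = b k x" "x \<in> cells ?V k" if "x \<in> cells ?U k" for k x
    using fun_cong[OF fun_cong[OF h(2)], of k x] mcomp_eqD[OF ab that] U(3)[of k] that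
    by (auto simp: mcomp_apply mid_apply)
  have ph': "mcomp ?V p h \<in> hom A ?V Q" by (rule mcomp_hom[OF V h(1) ph])
  have pha: "mcomp ?V p h k x = p k (h k x)" if "x \<in> cells ?V k" for k x using that by (rule mcomp_apply)
  have "mcomp ?V p h k x = b k x" if "x \<in> cells ?U k" for k x
    using hU[OF that] pha by simp
  from open_box_homotopy[OF Qm comQ m(3) ph'[unfolded m] b[unfolded m] this[unfolded m]]
  obtain K where K: "K \<in> hom A ?V (path A Q)"
    "\<And>k x. x \<in> Box A k n \<Longrightarrow> ev A Q False k (K k x) = mcomp ?V p h k x \<and> ev A Q True k (K k x) = b k x"
    "\<And>k x. x \<in> cells ?U k \<Longrightarrow> K k x = cst Q k (mcomp ?V p h k x)"
    unfolding m by blast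
  have Vc: "cells ?V k = Box A k n" for k by (simp add: comical_cube_simps)
  let ?N = "pullback P (path A Q) p (ev A Q False)"
  have pk: "pairing ?V h K \<in> hom A ?V ?N"
    by (rule pairing_hom[OF V h(1) K(1)]) (use K(2) pha in \<open>simp add: Vc\<close>)
  obtain l where l: "l \<in> hom A ?N P" "\<And>n x. x \<in> cells P n \<Longrightarrow> l n (x, cst Q n (p n x)) = x"
    "\<And>n c. c \<in> cells ?N n \<Longrightarrow> p n (l n c) = ev A Q True n (snd c)"
    using path_retraction[OF p comQ] by blast
  let ?L = "mcomp ?V l (pairing ?V h K)"
  have L: "?L \<in> hom A ?V P" by (rule mcomp_hom[OF V pk l(1)])
  have L_app: "?L k x = l k (h k x, K k x)" if "x \<in> cells ?V k" for k x using that by (simp add: mcomp_apply pairing_def)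
  have "mcomp ?U ?L (mid ?U) = a"
  proof (rule hom_eqI[OF mcomp_hom[OF U(1,2) L] a])
    fix k x assume x: "x \<in> cells ?U k"
    show "mcomp ?U ?L (mid ?U) k x = a k x"
      using L_app[OF hU(3)[OF x]] K(3)[OF x] hU[OF x] pha[OF hU(3)[OF x]] l(2)[OF hom_cells[OF a x]] x
      by (simp add: mcomp_apply[of x ?U] mid_apply)
  qed
  moreover have "mcomp ?V p ?L = b"
  proof (rule hom_eqI[OF mcomp_hom[OF V L ph] b])
    fix k x assume x: "x \<in> cells ?V k"
    show "mcomp ?V p ?L k x = b k x"
      using l(3)[OF hom_cells[OF pk x]] K(2)[of x k] L_app[OF x] x by (simp add: mcomp_apply[OF x, of p] pairing_def Vc)
  qed
  ultimately show "\<exists>h\<in>hom A ?V P. mcomp ?U h (mid ?U) = a \<and> mcomp ?V p h = b" using L by blast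
qed

lemma comical_marking_extension_rlp:
  assumes p: "Fib P Q p" and f: "fibrant A Fib P" and i: "1 \<le> i" "i \<le> n" "2 \<le> n"
  shows "rlp A (comical_cube' A n i e) (tau (n - 2) (comical_cube A n i e)) (mid (comical_cube' A n i e)) P Q p"
  unfolding rlp_def
proof (intro ballI impI)
  let ?U = "comical_cube' A n i e" and ?V = "tau (n - 2) (comical_cube A n i e)"
  note UV = comical_marking_extension[OF i, of A e]
  fix a b assume a: "a \<in> hom A ?U P" and b: "b \<in> hom A ?V Q" and ab: "mcomp ?U p a = mcomp ?U b (mid ?U)"
  have "rlp_obj A ?U ?V (mid ?U) P" using comical_if_fibrant[OF Fib_props(1)[OF p] f] i unfolding comical_def by blast
  from this UV(2) a obtain h where h: "h \<in> hom A ?V P" "mcomp ?U h (mid ?U) = a" by (rule rlp_obj_lift)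
  have c: "cells ?U k = cells ?V k" for k by (simp add: comical_cube'_def tau_def)
  have "mcomp ?V p h = b"
  proof (rule hom_eqI[OF mcomp_hom[OF UV(2) h(1) Fib_props(3)[OF p]] b])
    fix k x assume x: "x \<in> cells ?V k"
    show "mcomp ?V p h k x = b k x"
      using fun_cong[OF fun_cong[OF h(2)], of k x] mcomp_eqD[OF ab, of x k] x c by (simp add: mcomp_apply mid_apply)
  qed
  with h show "\<exists>h\<in>hom A ?V P. mcomp ?U h (mid ?U) = a \<and> mcomp ?V p h = b" by blast
qed

text \<open>The model structure cannot speak about \<open>U\<close> and \<open>V\<close>, whose
  cubes are of type \<open>bmap\<close>. Finiteness in each dimension gives copies on
  \<open>'u\<close>; there the map is a trivial cofibration by \<open>WE_if_llp\<close>, and lifting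
  is carried back.\<close>

lemma rlp_if_llp_fibrant:
  fixes U V :: "bmap mcset"
  assumes U: "marked_cubical_set A U" and V: "marked_cubical_set A V" and u: "u \<in> hom A U V"
    and fin: "\<And>k. finite (cells U k)" "\<And>k. finite (cells V k)" and inj: "\<And>k. inj_on (u k) (cells U k)"
    and llp: "\<And>P Q p. Fib P Q p \<Longrightarrow> fibrant A Fib P \<Longrightarrow> fibrant A Fib Q \<Longrightarrow> rlp A U V u P Q p"
    and p: "Fib P Q p"
  shows "rlp A U V u P Q p"
proof -
  obtain \<iota> \<kappa> :: "nat \<Rightarrow> bmap \<Rightarrow> 'u" where \<iota>: "\<And>k. inj_on (\<iota> k) (cells U k)" and \<kappa>: "\<And>k. inj_on (\<kappa> k) (cells V k)"
    using finite_inj_on_infinite[OF fin(1) inf] finite_inj_on_infinite[OF fin(2) inf] by metis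
  let ?U = "transport \<iota> U" and ?V = "transport \<kappa> V"
  let ?u = "mcomp ?U (mcomp U (transport_map \<kappa> V) u) (transport_inv \<iota> U)"
  note U' = marked_cubical_set_transport[OF U \<iota>] and V' = marked_cubical_set_transport[OF V \<kappa>]
  note tr = rlp_transport[OF U V u Fib_props(3) \<iota> \<kappa>]
  have uh: "?u \<in> hom A ?U ?V" by (rule tr(1)[OF p])
  have app: "?u k (\<iota> k x) = \<kappa> k (u k x)" if "x \<in> cells U k" for k x
    using that hom_cells[OF u that]
    by (simp add: mcomp_apply transport_simps[OF U \<iota>] transport_inv_apply[OF U \<iota>] transport_map_apply[OF V \<kappa>])
  have "inj_on (?u k) (cells ?U k)" for k
  proof (rule inj_onI)
    fix x y assume "x \<in> cells ?U k" "y \<in> cells ?U k" "?u k x = ?u k y"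
    then obtain x' y' where *: "x = \<iota> k x'" "y = \<iota> k y'" "x' \<in> cells U k" "y' \<in> cells U k" "\<kappa> k (u k x') = \<kappa> k (u k y')"
      using app by (auto simp: transport_simps[OF U \<iota>])
    then have "u k x' = u k y'" using inj_onD[OF \<kappa>] hom_cells[OF u] by blast
    then show "x = y" using inj_onD[OF inj] * by blast
  qed
  then have "Cof ?U ?V ?u" by (rule Cof_if_inj[OF U' V' uh])
  moreover have "WE ?U ?V ?u"
  proof (rule WE_if_llp[OF U' V' uh])
    fix P Q p assume *: "Fib P Q p" "fibrant A Fib P" "fibrant A Fib Q"
    show "rlp A ?U ?V ?u P Q p" using tr(2)[OF *(1)] llp[OF *] by blast
  qed
  ultimately show ?thesis using lift_Fib[OF _ _ p] tr(2)[OF p] by blast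
qed

theorem comical_fibration_if_Fib:
  assumes p: "Fib P Q p"
  shows "comical_fibration A P Q p"
  unfolding comical_fibration_def
proof (intro conjI allI impI)
  have mid: "inj_on (mid X k) (cells X k)" for X :: "bmap mcset" and k by (auto simp: inj_on_def mid_def)
  fix n i :: nat and e assume i: "1 \<le> i \<and> i \<le> n"
  then have i': "1 \<le> i" "i \<le> n" by simp_all
  have fV: "finite (cells (comical_cube A n i e) k)" for k using finite_Box by (simp add: comical_cube_simps)
  note U = open_box_inclusion[OF i', of A e]
  show "rlp A (open_box A n i e) (comical_cube A n i e) (mid (open_box A n i e)) P Q p"
    by (rule rlp_if_llp_fibrant[OF U(1) marked_cubical_set_comical_cube[OF i'] U(2) finite_subset[OF U(3) fV] fV mid
        open_box_rlp[OF _ _ _ i'] p])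
next
  have mid: "inj_on (mid X k) (cells X k)" for X :: "bmap mcset" and k by (auto simp: inj_on_def mid_def)
  fix n i :: nat and e assume i: "2 \<le> n \<and> 1 \<le> i \<and> i \<le> n"
  then have i': "1 \<le> i" "i \<le> n" "2 \<le> n" by simp_all
  note UV = comical_marking_extension[OF i', of A e]
  have fin: "finite (cells (comical_cube' A n i e) k)" "finite (cells (tau (n - 2) (comical_cube A n i e)) k)" for k
    using finite_Box by (simp_all add: comical_cube'_def tau_def comical_cube_simps)
  show "rlp A (comical_cube' A n i e) (tau (n - 2) (comical_cube A n i e)) (mid (comical_cube' A n i e)) P Q p"
    by (rule rlp_if_llp_fibrant[OF UV fin mid comical_marking_extension_rlp[OF _ _ i'] p])
qed

end

end

theorem lemma2p31:
  fixes A B :: "bool set" and sat :: bool and triv :: "nat option"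
    and WE Cof Fib :: "'u map_class"
    and W X Y Z :: "'u mcset" and j f g :: "('u, 'u) mmap"
    and \<Gamma>\<^sub>f\<^sub>j \<Gamma>\<^sub>Z :: "((nat \<times> 'u \<times> bmap) set, 'u) mmap"
  assumes "infinite (UNIV :: 'u set)"
    and "A \<subseteq> B"
    and "comical_model_structure A sat triv WE Cof Fib"
    and "marked_cubical_set A W" and "marked_cubical_set A X"
    and "marked_cubical_set A Y" and "marked_cubical_set A Z"
    and "j \<in> hom A W X" and "f \<in> hom A X Y" and "g \<in> hom A Y Z"
    and "monic A W X j" and "Fib Y Z g"
    and "weak_connection_structure A B W Y (mcomp W f j) \<Gamma>\<^sub>f\<^sub>j"
    and "weak_connection_structure A B Z Z (mid Z) \<Gamma>\<^sub>Z"
    and "mcomp (ii A B W) g \<Gamma>\<^sub>f\<^sub>j =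
         mcomp (ii A B W) \<Gamma>\<^sub>Z (ishriek_map A B W Z (mcomp W g (mcomp W f j)))"
  shows "\<exists>\<Gamma>\<^sub>f. weak_connection_structure A B X Y f \<Gamma>\<^sub>f \<and>
           mcomp (ii A B W) \<Gamma>\<^sub>f (ishriek_map A B W X j) = \<Gamma>\<^sub>f\<^sub>j \<and>
           mcomp (ii A B X) g \<Gamma>\<^sub>f =
             mcomp (ii A B X) \<Gamma>\<^sub>Z (ishriek_map A B X Z (mcomp X g f))"
proof -
  interpret comical_model_structure A sat triv WE Cof Fib by (rule assms(3))
  interpret connection_extension A Y Z B g \<Gamma>\<^sub>Z
    by (intro connection_extension.intro connection_extension_axioms.intro assms
        comical_fibration_if_Fib[OF assms(1)])
  show ?thesis
    by (rule extend_weak_connection_structure[OF assms(4,5,8) inj_if_monic[OF assms(1,4,11)] assms(9,13,15)])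
qed

end
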